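(* Let $k, d$ be integers with $2\le k\le d$ and $2(k+1)<\frac{(d-1)^2}{4d}$. Let $F_k$ and $F_d$ denote the free groups of rank $k$ and $d$ respectively. Then the full box space $\Box_f F_d$ is not coarsely equivalent to the full box space $\Box_f F_k$.
   Context: Full box space: for a finitely generated group $G$ with a fixed finite generating set $S$, the full box space $\Box_f G$ is the metrized disjoint union $\coprod_N G/N$ over all finite index normal subgroups $N\lhd G$. Each component $G/N$ carries the word metric $d_{G/N}$ coming from the image of $S$; if $x\in G/N$ and $y\in G/N$ then $d(x,y)=d_{G/N}(x,y)$, and if $x\in G/N$, $y\in G/M$ with $N\neq M$ then $d(x,y)=\operatorname{diam}(G/N)+\operatorname{diam}(G/M)$. Coarse equivalence: for metric spaces $(X,d_X)$ and $(Y,d_Y)$, a map $f\colon X\to Y$ is a coarse equivalence if $f(X)$ is $C$-dense in $Y$ for some constant $C$ (every point of $Y$ is within distance $C$ of $f(X)$) and, for any two sequences $(x_n)_n$, $(y_n)_n$ in $X$, $d_X(x_n,y_n)\to+\infty$ if and only if $d_Y(f(x_n),f(y_n))\to+\infty$. Two spaces are coarsely equivalent if there is a coarse equivalence between them. *)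

theory Defs
  imports "HOL-Analysis.Abstract_Metric_Spaces" "HOL-Algebra.Generated_Groups"
begin

section \<open>Free groups of finite rank\<close>

text \<open>
  A letter \<open>(True, i)\<close> stands for the \<open>i\<close>-th basis element and \<open>(False, i)\<close> for its inverse.
  The free group of rank \<open>n\<close> consists of the reduced words over the letters with index below \<open>n\<close>;
  two words are multiplied by concatenating them and cancelling.
\<close>

type_synonym letter = "bool \<times> nat"

definition inv_letter :: "letter \<Rightarrow> letter" where
  "inv_letter a = (\<not> fst a, snd a)"

fun reduced :: "letter list \<Rightarrow> bool" where
  "reduced (a # b # w) \<longleftrightarrow> b \<noteq> inv_letter a \<and> reduced (b # w)"
| "reduced _ \<longleftrightarrow> True"

fun push :: "letter \<Rightarrow> letter list \<Rightarrow> letter list" where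
  "push a [] = [a]"
| "push a (b # w) = (if b = inv_letter a then w else a # b # w)"

definition free_group :: "nat \<Rightarrow> letter list monoid" where
  "free_group n =
     \<lparr>carrier = {w. reduced w \<and> snd ` set w \<subseteq> {..<n}}, mult = (\<lambda>u v. foldr push u v), one = []\<rparr>"

definition free_basis :: "nat \<Rightarrow> letter list set" where
  "free_basis n = (\<lambda>i. [(True, i)]) ` {..<n}"

lemma inv_letter_inv_letter [simp]: "inv_letter (inv_letter a) = a"
  by (simp add: inv_letter_def)

lemma snd_inv_letter [simp]: "snd (inv_letter a) = snd a"
  by (simp add: inv_letter_def)

lemma inv_letter_eq_iff [simp]: "inv_letter a = inv_letter b \<longleftrightarrow> a = b"
  by (metis inv_letter_inv_letter)

lemma inv_letter_neq [simp]: "inv_letter a \<noteq> a" "a \<noteq> inv_letter a"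
  by (auto simp: inv_letter_def prod_eq_iff)

lemma reduced_ConsD: "reduced (a # w) \<Longrightarrow> reduced w"
  by (cases w) auto

lemma reduced_push: "reduced w \<Longrightarrow> reduced (push a w)"
  by (cases w) (auto dest: reduced_ConsD)

lemma reduced_foldr_push: "reduced v \<Longrightarrow> reduced (foldr push u v)"
  by (induction u) (auto intro: reduced_push)

lemma push_eq_Cons: "reduced (a # w) \<Longrightarrow> push a w = a # w"
  by (cases w) auto

lemma push_push_inv: "reduced w \<Longrightarrow> push a (push (inv_letter a) w) = w"
  by (cases w) (auto dest: push_eq_Cons)

lemma foldr_push_Nil: "reduced w \<Longrightarrow> foldr push w [] = w"
proof (induction w)
  case (Cons a w)
  then show ?case using reduced_ConsD[of a w] push_eq_Cons[of a w] by simp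
qed simp

lemma set_push: "snd ` set (push a w) \<subseteq> insert (snd a) (snd ` set w)"
  by (cases w) auto

lemma set_foldr_push: "snd ` set (foldr push u v) \<subseteq> snd ` set u \<union> snd ` set v"
proof (induction u)
  case (Cons a u)
  then show ?case using set_push[of a "foldr push u v"] by (simp, blast)
qed simp

lemma foldr_push_push: "reduced w \<Longrightarrow> foldr push (push a u) w = push a (foldr push u w)"
proof (cases u)
  case (Cons b u')
  assume "reduced w"
  then show ?thesis
    using Cons push_push_inv[of "foldr push u' w" a] by (auto simp: reduced_foldr_push)
qed simp

lemma foldr_push_assoc:
  "reduced w \<Longrightarrow> foldr push (foldr push u v) w = foldr push u (foldr push v w)"
  by (induction u) (auto simp: foldr_push_push)

lemma foldr_push_inverse: "reduced w \<Longrightarrow> foldr push (rev (map inv_letter u)) (foldr push u w) = w"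
proof (induction u)
  case (Cons a u)
  have "push (inv_letter a) (push a (foldr push u w)) = foldr push u w"
    using push_push_inv[of "foldr push u w" "inv_letter a"] Cons.prems
    by (simp add: reduced_foldr_push)
  then show ?case using Cons by simp
qed simp

lemma group_free_group: "group (free_group n)"
proof (rule groupI)
  fix u v assume "u \<in> carrier (free_group n)" "v \<in> carrier (free_group n)"
  then show "u \<otimes>\<^bsub>free_group n\<^esub> v \<in> carrier (free_group n)"
    using subset_trans[OF set_foldr_push[of u v], of "{..<n}"]
    by (simp add: free_group_def reduced_foldr_push)
next
  fix u assume u: "u \<in> carrier (free_group n)"
  define v where "v = foldr push (rev (map inv_letter u)) []"
  have "snd ` set (rev (map inv_letter u)) = snd ` set u"
    by (simp add: image_image)
  then have "v \<in> carrier (free_group n)"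
    using u subset_trans[OF set_foldr_push[of "rev (map inv_letter u)" "[]"], of "{..<n}"]
    by (simp add: free_group_def v_def reduced_foldr_push)
  moreover have "v \<otimes>\<^bsub>free_group n\<^esub> u = \<one>\<^bsub>free_group n\<^esub>"
    using u foldr_push_inverse[of "[]" u]
    by (simp add: free_group_def v_def foldr_push_assoc foldr_push_Nil)
  ultimately show "\<exists>v\<in>carrier (free_group n). v \<otimes>\<^bsub>free_group n\<^esub> u = \<one>\<^bsub>free_group n\<^esub>" by blast
qed (auto simp: free_group_def foldr_push_assoc)

lemma free_basis_subset: "free_basis n \<subseteq> carrier (free_group n)"
  by (auto simp: free_basis_def free_group_def)

lemma inv_free_basis:
  assumes "i < n"
  shows "inv\<^bsub>free_group n\<^esub> [(True, i)] = [(False, i)]"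
  by (rule group.inv_equality[OF group_free_group])
    (use assms in \<open>auto simp: free_group_def inv_letter_def\<close>)

lemma generate_free_basis: "generate (free_group n) (free_basis n) = carrier (free_group n)"
proof
  show "generate (free_group n) (free_basis n) \<subseteq> carrier (free_group n)"
    using group.generate_incl[OF group_free_group free_basis_subset] .
  have "w \<in> generate (free_group n) (free_basis n)" if "w \<in> carrier (free_group n)" for w
    using that
  proof (induction w)
    case Nil
    then show ?case using generate.one[of "free_group n"] by (simp add: free_group_def)
  next
    case (Cons a w)
    have w: "w \<in> carrier (free_group n)" and a: "snd a < n" and red: "reduced (a # w)"
      using Cons.prems by (auto simp: free_group_def dest: reduced_ConsD)
    have b: "[(True, snd a)] \<in> free_basis n"
      using a by (auto simp: free_basis_def)
    have "[a] \<in> generate (free_group n) (free_basis n)"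
      using generate.incl[OF b, of "free_group n"] generate.inv[OF b, of "free_group n"]
        inv_free_basis[OF a] by (cases a; cases "fst a") auto
    then have "[a] \<otimes>\<^bsub>free_group n\<^esub> w \<in> generate (free_group n) (free_basis n)"
      using Cons.IH[OF w] by (rule generate.eng)
    moreover have "[a] \<otimes>\<^bsub>free_group n\<^esub> w = a # w"
      using red by (simp add: free_group_def push_eq_Cons)
    ultimately show ?case by simp
  qed
  then show "carrier (free_group n) \<subseteq> generate (free_group n) (free_basis n)" by blast
qed

lemma free_group_hom_exists:
  fixes H (structure) and g :: "nat \<Rightarrow> 'a"
  assumes "group H" and g: "\<And>i. i < n \<Longrightarrow> g i \<in> carrier H"
  shows "\<exists>h \<in> hom (free_group n) H. \<forall>i<n. h [(True, i)] = g i"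
proof -
  interpret group H by fact
  define \<phi> where "\<phi> = (\<lambda>a. if fst a then g (snd a) else inv (g (snd a)))"
  define h where "h = (\<lambda>w. foldr (\<lambda>a x. \<phi> a \<otimes> x) w \<one>)"
  have \<phi>: "\<phi> a \<in> carrier H" "\<phi> (inv_letter a) = inv (\<phi> a)" if "snd a < n" for a
    using that g by (auto simp: \<phi>_def inv_letter_def)
  have h: "h w \<in> carrier H" if "snd ` set w \<subseteq> {..<n}" for w
    using that by (induction w) (auto simp: h_def \<phi>)
  have h_Cons: "h (a # w) = \<phi> a \<otimes> h w" for a w
    by (simp add: h_def)
  have push: "h (push a w) = \<phi> a \<otimes> h w" if "snd a < n" "snd ` set w \<subseteq> {..<n}" for a w
  proof (cases w)
    case (Cons b v)
    then have "h v \<in> carrier H" using that h by auto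
    then show ?thesis
      using Cons that \<phi>[of a] by (auto simp: h_Cons m_assoc[symmetric])
  qed (simp add: h_def)
  have mult: "h (foldr push u v) = h u \<otimes> h v"
    if "snd ` set u \<subseteq> {..<n}" "snd ` set v \<subseteq> {..<n}" for u v
    using that(1)
  proof (induction u)
    case Nil
    then show ?case using h[OF that(2)] by (simp add: h_def)
  next
    case (Cons a u)
    have "snd ` set (foldr push u v) \<subseteq> {..<n}"
      using set_foldr_push[of u v] Cons.prems \<open>snd ` set v \<subseteq> {..<n}\<close>
      by (metis Un_least image_insert insert_subset list.simps(15) subset_trans)
    then have "h (foldr push (a # u) v) = \<phi> a \<otimes> h (foldr push u v)"
      using push[of a "foldr push u v"] Cons.prems by simp
    also have "\<dots> = \<phi> a \<otimes> (h u \<otimes> h v)"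
      using Cons by simp
    also have "\<dots> = h (a # u) \<otimes> h v"
      using \<phi>[of a] h[of u] h[OF that(2)] Cons.prems by (simp add: h_Cons m_assoc)
    finally show ?case .
  qed
  have "h \<in> hom (free_group n) H"
  proof (rule homI)
    fix u v assume "u \<in> carrier (free_group n)" "v \<in> carrier (free_group n)"
    then show "h (u \<otimes>\<^bsub>free_group n\<^esub> v) = h u \<otimes> h v"
      using mult[of u v] by (simp add: free_group_def)
  qed (use h in \<open>simp add: free_group_def\<close>)
  moreover have "h [(True, i)] = g i" if "i < n" for i
    using g[OF that] by (simp add: h_def \<phi>_def)
  ultimately show ?thesis by blast
qed

section \<open>Word metrics\<close>

definition words :: "('a, 'b) monoid_scheme \<Rightarrow> 'a set \<Rightarrow> 'a list set" where
  "words G S = lists (S \<union> m_inv G ` S)"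

definition word_value :: "('a, 'b) monoid_scheme \<Rightarrow> 'a list \<Rightarrow> 'a" where
  "word_value G ws = foldr (mult G) ws (one G)"

text \<open>
  The word metric is the left-invariant one, i.e. the path metric on the (right) Cayley graph.
\<close>

definition word_length :: "('a, 'b) monoid_scheme \<Rightarrow> 'a set \<Rightarrow> 'a \<Rightarrow> nat" where
  "word_length G S x = (LEAST n. \<exists>ws \<in> words G S. length ws = n \<and> word_value G ws = x)"

definition word_dist :: "('a, 'b) monoid_scheme \<Rightarrow> 'a set \<Rightarrow> 'a \<Rightarrow> 'a \<Rightarrow> real" where
  "word_dist G S x y = real (word_length G S (inv\<^bsub>G\<^esub> x \<otimes>\<^bsub>G\<^esub> y))"

lemma word_value_in_generate: "ws \<in> words G S \<Longrightarrow> word_value G ws \<in> generate G S"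
  by (induction ws)
    (auto simp: words_def word_value_def intro: generate.intros)

lemma word_dist_metric:
  fixes G (structure)
  assumes "group G" and S: "S \<subseteq> carrier G" and gen: "generate G S = carrier G"
    and x: "x \<in> carrier G" and y: "y \<in> carrier G"
  shows word_dist_commute: "word_dist G S x y = word_dist G S y x"
    and word_dist_zero: "word_dist G S x y = 0 \<longleftrightarrow> x = y"
    and word_dist_triangle:
      "\<And>z. z \<in> carrier G \<Longrightarrow> word_dist G S x z \<le> word_dist G S x y + word_dist G S y z"
proof -
  interpret group G by fact
  have words_Cons: "a # ws \<in> words G S \<longleftrightarrow> a \<in> S \<union> m_inv G ` S \<and> ws \<in> words G S" for a ws
    by (auto simp: words_def)
  have gens: "a \<in> carrier G" "inv a \<in> S \<union> m_inv G ` S" if "a \<in> S \<union> m_inv G ` S" for a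
    using that S by (auto simp: image_iff subset_iff)
  have val: "word_value G ws \<in> carrier G" if "ws \<in> words G S" for ws
    using word_value_in_generate[OF that] gen by simp
  have append: "us @ vs \<in> words G S \<and> word_value G (us @ vs) = word_value G us \<otimes> word_value G vs"
    if "us \<in> words G S" "vs \<in> words G S" for us vs
    using that(1)
  proof (induction us)
    case Nil
    then show ?case using that(2) val[OF that(2)] by (simp add: word_value_def)
  next
    case (Cons a us)
    then have "a \<in> carrier G" "us \<in> words G S" using gens words_Cons by auto
    then show ?case
      using Cons val[of us] val[OF that(2)] words_Cons by (simp add: word_value_def m_assoc)
  qed
  have single: "[a] \<in> words G S \<and> word_value G [a] = a" if "a \<in> S \<union> m_inv G ` S" for a
    using that gens(1)[OF that] by (simp add: words_def word_value_def)
  have inverse: "rev (map (m_inv G) us) \<in> words G S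
      \<and> word_value G (rev (map (m_inv G) us)) = inv (word_value G us)"
    if "us \<in> words G S" for us
    using that
  proof (induction us)
    case Nil
    then show ?case by (simp add: words_def word_value_def)
  next
    case (Cons a us)
    then have a: "a \<in> S \<union> m_inv G ` S" and us: "us \<in> words G S" using words_Cons by auto
    have "word_value G (a # us) = a \<otimes> word_value G us" by (simp add: word_value_def)
    then show ?case
      using append[of "rev (map (m_inv G) us)" "[inv a]"] single[OF gens(2)[OF a]] Cons.IH[OF us]
        gens(1)[OF a] val[OF us] by (simp add: inv_mult_group)
  qed
  have ex: "\<exists>ws \<in> words G S. word_value G ws = x" if "x \<in> generate G S" for x
    using that
  proof (induction rule: generate.induct)
    case one
    show ?case by (rule bexI[of _ "[]"]) (auto simp: words_def word_value_def)
  next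
    case (incl a)
    then show ?case using single[of a] by blast
  next
    case (inv a)
    then show ?case using single[of "inv a"] by blast
  next
    case (eng a b)
    then obtain us vs where "us \<in> words G S" "word_value G us = a"
      "vs \<in> words G S" "word_value G vs = b" by blast
    then show ?case using append[of us vs] by blast
  qed
  have geo: "\<exists>ws \<in> words G S. length ws = word_length G S x \<and> word_value G ws = x"
    if "x \<in> carrier G" for x
    unfolding word_length_def by (rule LeastI_ex) (use ex gen that in blast)
  have le: "word_length G S (word_value G ws) \<le> length ws" if "ws \<in> words G S" for ws
    unfolding word_length_def by (rule Least_le) (use that in blast)
  have mult: "word_length G S (x \<otimes> y) \<le> word_length G S x + word_length G S y"
    if xy: "x \<in> carrier G" "y \<in> carrier G" for x y
  proof -
    obtain us vs where "us \<in> words G S" "length us = word_length G S x" "word_value G us = x"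
      "vs \<in> words G S" "length vs = word_length G S y" "word_value G vs = y"
      using geo[OF xy(1)] geo[OF xy(2)] by blast
    then show ?thesis using append[of us vs] le[of "us @ vs"] by simp
  qed
  have inv_le: "word_length G S (inv x) \<le> word_length G S x" if x: "x \<in> carrier G" for x
  proof -
    obtain us where "us \<in> words G S" "length us = word_length G S x" "word_value G us = x"
      using geo[OF x] by blast
    then show ?thesis using inverse[of us] le[of "rev (map (m_inv G) us)"] by simp
  qed
  have zero: "word_length G S x = 0 \<longleftrightarrow> x = \<one>" if "x \<in> carrier G" for x
  proof
    assume "word_length G S x = 0"
    then show "x = \<one>" using geo[OF that] by (auto simp: word_value_def)
  next
    assume "x = \<one>"
    then show "word_length G S x = 0" using le[of "[]"] by (simp add: words_def word_value_def)
  qed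
  have "inv (inv x \<otimes> y) = inv y \<otimes> x" "inv (inv y \<otimes> x) = inv x \<otimes> y"
    using x y by (simp_all add: inv_mult_group)
  then show "word_dist G S x y = word_dist G S y x"
    using inv_le[of "inv x \<otimes> y"] inv_le[of "inv y \<otimes> x"] x y by (simp add: word_dist_def)
  have "inv x \<otimes> y = \<one> \<longleftrightarrow> x = y"
    using Units_l_cancel[of "inv x" y x] x y by (auto simp: l_inv Units_eq simp del: Units_l_cancel)
  then show "word_dist G S x y = 0 \<longleftrightarrow> x = y"
    using zero[of "inv x \<otimes> y"] x y by (simp add: word_dist_def)
  show "word_dist G S x z \<le> word_dist G S x y + word_dist G S y z" if z: "z \<in> carrier G" for z
  proof -
    have "y \<otimes> (inv y \<otimes> z) = z"
      using y z by (simp add: m_assoc[symmetric])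
    then have "inv x \<otimes> z = (inv x \<otimes> y) \<otimes> (inv y \<otimes> z)"
      using x y z by (simp add: m_assoc)
    then show ?thesis
      using mult[of "inv x \<otimes> y" "inv y \<otimes> z"] x y z
      by (simp add: word_dist_def flip: of_nat_add)
  qed
qed

text \<open>Only used for finite groups, where the supremum is over a bounded nonempty set.\<close>

definition word_diam :: "('a, 'b) monoid_scheme \<Rightarrow> 'a set \<Rightarrow> real" where
  "word_diam G S = (SUP (x, y) \<in> carrier G \<times> carrier G. word_dist G S x y)"

section \<open>Full box spaces\<close>

definition finite_index_normal :: "('a, 'b) monoid_scheme \<Rightarrow> 'a set set" where
  "finite_index_normal G = {N. N \<lhd> G \<and> finite (carrier (G Mod N))}"

text \<open>
  Points are pairs of a finite index normal subgroup \<open>N\<close> and an element of \<open>G Mod N\<close>.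
\<close>

definition box_space :: "('a, 'b) monoid_scheme \<Rightarrow> ('a set \<times> 'a set) set" where
  "box_space G = (SIGMA N : finite_index_normal G. carrier (G Mod N))"

definition quot_gens :: "('a, 'b) monoid_scheme \<Rightarrow> 'a set \<Rightarrow> 'a set \<Rightarrow> 'a set set" where
  "quot_gens G S N = (\<lambda>s. N #>\<^bsub>G\<^esub> s) ` S"

definition box_dist ::
  "('a, 'b) monoid_scheme \<Rightarrow> 'a set \<Rightarrow> 'a set \<times> 'a set \<Rightarrow> 'a set \<times> 'a set \<Rightarrow> real" where
  "box_dist G S = (\<lambda>(N, x) (M, y).
     if N = M then word_dist (G Mod N) (quot_gens G S N) x y
     else word_diam (G Mod N) (quot_gens G S N) + word_diam (G Mod M) (quot_gens G S M))"

text \<open>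
  The locale \<^locale>\<open>Metric_space\<close> requires symmetry and nonnegativity on the whole type, hence the
  restriction to pairs of points.
\<close>

lemma Metric_space_box_dist:
  fixes G (structure)
  assumes "group G" and S: "S \<subseteq> carrier G" and gen: "generate G S = carrier G"
  shows "Metric_space (box_space G)
    (\<lambda>p q. if p \<in> box_space G \<and> q \<in> box_space G then box_dist G S p q else 0)"
proof -
  interpret group G by fact
  let ?D = "\<lambda>N. word_diam (G Mod N) (quot_gens G S N)"
  let ?d = "\<lambda>N. word_dist (G Mod N) (quot_gens G S N)"
  have Q: "group (G Mod N)" "quot_gens G S N \<subseteq> carrier (G Mod N)"
    "generate (G Mod N) (quot_gens G S N) = carrier (G Mod N)" if "N \<in> finite_index_normal G" for N
  proof -
    interpret normal N G using that by (simp add: finite_index_normal_def)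
    have "group_hom G (G Mod N) (\<lambda>a. N #> a)"
      using r_coset_hom_Mod factorgroup_is_group is_group
      by (simp add: group_hom_def group_hom_axioms_def)
    then have "generate (G Mod N) (quot_gens G S N) = carrier (G Mod N)"
      using group_hom.generate_img[of G "G Mod N" "\<lambda>a. N #> a" S] S gen
      by (auto simp: quot_gens_def FactGroup_def RCOSETS_def)
    moreover have "quot_gens G S N \<subseteq> carrier (G Mod N)"
      using S by (auto simp: quot_gens_def FactGroup_def RCOSETS_def)
    ultimately show "group (G Mod N)" "quot_gens G S N \<subseteq> carrier (G Mod N)"
      "generate (G Mod N) (quot_gens G S N) = carrier (G Mod N)"
      using factorgroup_is_group by blast+
  qed
  note comm = word_dist_commute[OF Q] and zero = word_dist_zero[OF Q]
    and tri = word_dist_triangle[OF Q]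
  have diam: "?d N x y \<le> ?D N" if "N \<in> finite_index_normal G"
    "x \<in> carrier (G Mod N)" "y \<in> carrier (G Mod N)" for N x y
    unfolding word_diam_def
    by (rule cSUP_upper2[where x = "(x, y)"])
      (use that in \<open>auto simp: finite_index_normal_def\<close>)
  have nonneg: "0 \<le> ?d N x y" for N x y by (simp add: word_dist_def)
  have ne: "\<one>\<^bsub>G Mod N\<^esub> \<in> carrier (G Mod N)" if "N \<in> finite_index_normal G" for N
    using monoid.one_closed[OF group.is_monoid[OF Q(1)[OF that]]] .
  have D0: "0 \<le> ?D N" if "N \<in> finite_index_normal G" for N
    using diam[OF that ne[OF that] ne[OF that]] nonneg order_trans by blast
  have D_pos: "0 < ?D N + ?D M"
    if N: "N \<in> finite_index_normal G" and M': "M \<in> finite_index_normal G" and "N \<noteq> M" for N M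
  proof (rule ccontr)
    assume "\<not> 0 < ?D N + ?D M"
    then have z: "?D N = 0" "?D M = 0" using D0[OF N] D0[OF M'] by auto
    have *: "L = carrier G" if L: "L \<in> finite_index_normal G" and "?D L = 0" for L
    proof
      have nL: "L \<lhd> G" using L by (simp add: finite_index_normal_def)
      then have sub: "subgroup L G" by (rule normal_imp_subgroup)
      then show "L \<subseteq> carrier G" by (rule subgroup.subset)
      show "carrier G \<subseteq> L"
      proof
        fix x assume x: "x \<in> carrier G"
        have c: "L #> x \<in> carrier (G Mod L)" "L \<in> carrier (G Mod L)"
          using x sub ne[OF L] by (auto simp: FactGroup_def RCOSETS_def)
        then have "?d L (L #> x) L = 0" using diam[OF L c] nonneg[of L "L #> x" L] that by simp
        then have "L #> x = L" using zero[OF L L L c] by blast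
        then show "x \<in> L" using rcos_self[OF x sub] by simp
      qed
    qed
    show False using *[OF N z(1)] *[OF M' z(2)] \<open>N \<noteq> M\<close> by simp
  qed
  have box: "fst p \<in> finite_index_normal G" "snd p \<in> carrier (G Mod fst p)" if "p \<in> box_space G" for p
    using that by (auto simp: box_space_def)
  have same: "box_dist G S p q = ?d (fst p) (snd p) (snd q)" if "fst p = fst q" for p q
    using that by (auto simp: box_dist_def split: prod.splits)
  have diff: "box_dist G S p q = ?D (fst p) + ?D (fst q)" if "fst p \<noteq> fst q" for p q
    using that by (auto simp: box_dist_def split: prod.splits)
  have box_nonneg: "0 \<le> box_dist G S p q" if "p \<in> box_space G" "q \<in> box_space G" for p q
    using D0[OF box(1)[OF that(1)]] D0[OF box(1)[OF that(2)]] nonneg same[of p q] diff[of p q]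
    by (cases "fst p = fst q") auto
  have box_comm: "box_dist G S p q = box_dist G S q p"
    if "p \<in> box_space G" "q \<in> box_space G" for p q
  proof (cases "fst p = fst q")
    case True
    note P = box[OF that(1)] box[OF that(2)]
    show ?thesis
      using comm[OF P(1) P(1) P(1) P(2)] P(4) True same[of p q] same[of q p] by simp
  qed (use diff[of p q] diff[of q p] in simp)
  have box_zero: "box_dist G S p q = 0 \<longleftrightarrow> p = q"
    if "p \<in> box_space G" "q \<in> box_space G" for p q
  proof (cases "fst p = fst q")
    case True
    note P = box[OF that(1)] box[OF that(2)]
    show ?thesis
      using zero[OF P(1) P(1) P(1) P(2)] P(4) True same[of p q] by (simp add: prod_eq_iff)
  next
    case False
    then show ?thesis
      using D_pos[OF box(1)[OF that(1)] box(1)[OF that(2)]] diff[of p q] by auto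
  qed
  have box_tri: "box_dist G S p r \<le> box_dist G S p q + box_dist G S q r"
    if "p \<in> box_space G" "q \<in> box_space G" "r \<in> box_space G" for p q r
  proof -
    note P = box[OF that(1)] and Q = box[OF that(2)] and R = box[OF that(3)]
    note D = D0[OF P(1)] D0[OF Q(1)] D0[OF R(1)]
    consider "fst p = fst q" "fst q = fst r" | "fst p = fst q" "fst q \<noteq> fst r"
      | "fst p \<noteq> fst q" "fst q = fst r" | "fst p \<noteq> fst q" "fst q \<noteq> fst r" by blast
    then show ?thesis
    proof cases
      case 1
      then show ?thesis
        using tri[OF P(1) P(1) P(1) P(2)] Q(2) R(2) same by simp
    next
      case 2
      then show ?thesis using same[of p q] diff[of p r] diff[of q r] nonneg by simp
    next
      case 3
      then show ?thesis using same[of q r] diff[of p r] diff[of p q] nonneg by simp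
    next
      case 4
      show ?thesis
      proof (cases "fst p = fst r")
        case True
        have "?d (fst p) (snd p) (snd r) \<le> ?D (fst p)"
          using diam[OF P(1) P(2)] R(2) True by simp
        then show ?thesis using 4 True same[of p r] diff[of p q] diff[of q r] D by simp
      next
        case False
        then show ?thesis using 4 diff[of p r] diff[of p q] diff[of q r] D by simp
      qed
    qed
  qed
  show ?thesis
    by unfold_locales (auto simp: box_nonneg box_zero intro: box_comm box_tri)
qed

section \<open>Coarse equivalence\<close>

text \<open>As a map from \<open>X\<close> to \<open>Y\<close>, the function \<open>f\<close> matters only on \<open>X\<close>.\<close>

definition coarse_equivalence ::
  "'a set \<Rightarrow> ('a \<Rightarrow> 'a \<Rightarrow> real) \<Rightarrow> 'b set \<Rightarrow> ('b \<Rightarrow> 'b \<Rightarrow> real) \<Rightarrow> ('a \<Rightarrow> 'b) \<Rightarrow> bool" where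
  "coarse_equivalence X dX Y dY f \<longleftrightarrow>
     f \<in> X \<rightarrow> Y \<and>
     (\<exists>C. \<forall>y\<in>Y. \<exists>x\<in>X. dY (f x) y \<le> C) \<and>
     (\<forall>u v :: nat \<Rightarrow> 'a. range u \<subseteq> X \<longrightarrow> range v \<subseteq> X \<longrightarrow>
        (filterlim (\<lambda>n. dX (u n) (v n)) at_top sequentially \<longleftrightarrow>
         filterlim (\<lambda>n. dY (f (u n)) (f (v n))) at_top sequentially))"

definition coarsely_equivalent ::
  "'a set \<Rightarrow> ('a \<Rightarrow> 'a \<Rightarrow> real) \<Rightarrow> 'b set \<Rightarrow> ('b \<Rightarrow> 'b \<Rightarrow> real) \<Rightarrow> bool" where
  "coarsely_equivalent X dX Y dY \<longleftrightarrow> (\<exists>f. coarse_equivalence X dX Y dY f)"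

end

theory Submission
  imports Defs "HOL-Library.Z2" "HOL-Algebra.Group_Action" "HOL-Algebra.Sylow" "HOL-Algebra.Multiplicative_Group"
begin

text \<open>
  If \<open>N \<lhd> F\<^sub>d\<close> and \<open>M \<lhd> F\<^sub>k\<close> are such that \<open>F\<^sub>d/N\<close> and \<open>F\<^sub>k/M\<close> are matched by the coarse equivalence and
  \<open>N\<close> has no short elements, then lifting the two maps along paths identifies \<open>N\<close> with the quotient of
  \<open>M\<close> by the normal closure \<open>K\<close> of the elements of \<open>M\<close> of length at most \<open>r\<close>, where \<open>r\<close> depends only on
  the coarse equivalence. So only finitely many \<open>K\<close> occur. Two normal subgroups \<open>M\<close>, \<open>M'\<close> with the same \<open>K\<close> yield
  commensurable subgroups of \<open>F\<^sub>d\<close>, and as the number of homomorphisms to \<open>\<int>/2\<close> determines the index of a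
  finite index subgroup of \<open>F\<^sub>d\<close>, the ratio of the indices of \<open>M\<close> and \<open>N\<close> depends only on \<open>K\<close>.
  Hence, if the index of \<open>N\<close> is \<open>2\<^sup>n\<close>, then the index of \<open>M\<close> is \<open>2\<^sup>e b\<close> with \<open>b\<close> bounded and \<open>e \<le> n + O(1)\<close>.

  Writing down relators for the successive factors of a chief series shows that \<open>F\<^sub>k\<close> has at most
  \<open>2\<close> to the power \<open>(2 k + 1) n\<^sup>2 + O(n)\<close> such subgroups \<open>M\<close>. On the other hand \<open>F\<^sub>d\<close> has, for infinitely many \<open>n\<close>,
  at least \<open>2\<close> to the power \<open>(d - 4) n\<^sup>2/4\<close> normal subgroups of index \<open>2\<^sup>n\<close> without short elements: any
  subgroup between two consecutive terms of a central filtration, which comes from a Magnus embedding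
  modulo 2, is normal. The hypothesis implies \<open>d > 8 (k + 1)\<close>, so there are too few \<open>M\<close>.
\<close>

section \<open>Relative indices and normal closures\<close>

text \<open>A coarse equivalence says nothing about cardinalities, so the index of \<open>M\<close>
  cannot be read off from that of \<open>N\<close>; this obstacle forces the detour through
  \<open>K\<close>. The count of homomorphisms to Z/2 is the right invariant because it is
  intrinsic: a subgroup \<open>J\<close> between \<open>K\<close> and \<open>M\<close> gives a
  subgroup of F_d isomorphic to J/K, and the index of that subgroup in F_d is recovered from J/K
  alone, whichever embedding produced it. The absence of short elements in \<open>N\<close> makes
  the Cayley graph of F_d/N look like a tree up to a large scale, so that maps into it lift in an
  essentially unique way. Both counts have the shape 2 to the power \<open>c * n\<^sup>2\<close>, so
  everything depends on the leading constants. With \<open>n = 2 * R\<close> and the parameter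
  \<open>\<rho> = 8 * k + 6\<close>, which needs exactly \<open>\<rho> + 2 < d\<close>, the exponent
  for F_d is \<open>(8 * k + 5) * R\<^sup>2\<close>. That for F_k is
  \<open>(2 * k + 1) * (2 * R)\<^sup>2 = (8 * k + 4) * R\<^sup>2\<close> up to terms linear in
  \<open>R\<close>.\<close>

lemma (in group) inv_mult_cancel [simp]:
  "x \<in> carrier G \<Longrightarrow> y \<in> carrier G \<Longrightarrow> inv x \<otimes> (x \<otimes> y) = y"
  "x \<in> carrier G \<Longrightarrow> y \<in> carrier G \<Longrightarrow> x \<otimes> (inv x \<otimes> y) = y"
  by (simp_all flip: m_assoc)

text \<open>Stands for the index of \<open>J\<close> in \<open>H\<close> when \<open>J\<close> is a
  subgroup of \<open>H\<close>. An infinite index gives 0, so finiteness of the set of cosets is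
  carried as a separate assumption.\<close>

definition ridx :: "('a, 'b) monoid_scheme \<Rightarrow> 'a set \<Rightarrow> 'a set \<Rightarrow> nat" where
  "ridx G H J = card ((\<lambda>x. J #>\<^bsub>G\<^esub> x) ` H)"

definition normal_hull :: "('a, 'b) monoid_scheme \<Rightarrow> 'a set \<Rightarrow> 'a set" where
  "normal_hull G L = \<Inter>{H. H \<lhd> G \<and> L \<subseteq> H}"

context group
begin

lemma rcos_eq_iff:
  assumes "subgroup H G" "x \<in> carrier G" "y \<in> carrier G"
  shows "H #> x = H #> y \<longleftrightarrow> x \<otimes> inv y \<in> H"
proof
  assume eq: "H #> x = H #> y"
  then have "x \<in> H #> y" using rcos_self[OF assms(2,1)] by simp
  then show "x \<otimes> inv y \<in> H"
    using subgroup.rcos_module[OF assms(1) is_group assms(3,2)] by simp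
next
  assume "x \<otimes> inv y \<in> H"
  then have "x \<in> H #> y"
    using subgroup.rcos_module[OF assms(1) is_group assms(3,2)] by simp
  then show "H #> x = H #> y" using repr_independence[OF _ assms(3,1)] by simp
qed

lemma rcos_eq_self_iff:
  assumes "subgroup H G" "x \<in> carrier G"
  shows "H #> x = H \<longleftrightarrow> x \<in> H"
  using assms coset_join1 coset_join2 subgroup.subset by metis

text \<open>Indices are computed below by exhibiting a complete invariant \<open>f\<close> of the
  cosets, whose values are easier to count than the cosets themselves.\<close>

lemma ridx_eq_card_image:
  assumes "subgroup J G" "H \<subseteq> carrier G"
    and "\<And>x y. x \<in> H \<Longrightarrow> y \<in> H \<Longrightarrow> f x = f y \<longleftrightarrow> x \<otimes> inv y \<in> J"
  shows "ridx G H J = card (f ` H)" "finite ((\<lambda>x. J #> x) ` H) \<longleftrightarrow> finite (f ` H)"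
proof -
  have eq: "f x = f y \<longleftrightarrow> J #> x = J #> y" if "x \<in> H" "y \<in> H" for x y
    using rcos_eq_iff[OF assms(1), of x y] assms(2,3) that by blast
  define h where "h = (\<lambda>X. f (SOME x. x \<in> H \<and> J #> x = X))"
  have h: "h (J #> x) = f x" if "x \<in> H" for x
    using someI[of "\<lambda>z. z \<in> H \<and> J #> z = J #> x" x] that eq unfolding h_def by metis
  have "bij_betw h ((\<lambda>x. J #> x) ` H) (f ` H)"
    unfolding bij_betw_def
  proof
    show "inj_on h ((\<lambda>x. J #> x) ` H)"
      by (intro inj_onI) (use h eq in \<open>metis (no_types, lifting) imageE\<close>)
    show "h ` (\<lambda>x. J #> x) ` H = f ` H"
      using h by (force simp: image_image)
  qed
  then show "ridx G H J = card (f ` H)" "finite ((\<lambda>x. J #> x) ` H) \<longleftrightarrow> finite (f ` H)"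
    using bij_betw_same_card bij_betw_finite unfolding ridx_def by blast+
qed

lemma finite_cosets_supergroup:
  assumes H: "subgroup H G" and J: "subgroup J G" and "J \<subseteq> H" "L \<subseteq> carrier G"
    and fin: "finite ((\<lambda>x. J #> x) ` L)"
  shows "finite ((\<lambda>x. H #> x) ` L)"
proof (rule finite_surj[OF fin])
  show "(\<lambda>x. H #> x) ` L \<subseteq> (\<lambda>Y. H #> (SOME x. x \<in> L \<and> J #> x = Y)) ` (\<lambda>x. J #> x) ` L"
  proof (rule image_subsetI)
    fix x assume x: "x \<in> L"
    define y where "y = (SOME z. z \<in> L \<and> J #> z = J #> x)"
    have y: "y \<in> L \<and> J #> y = J #> x"
      unfolding y_def by (rule someI[of _ x]) (use x in simp)
    have c: "x \<in> carrier G" "y \<in> carrier G" using x y \<open>L \<subseteq> carrier G\<close> by auto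
    have "x \<otimes> inv y \<in> J" using rcos_eq_iff[OF J c] y by simp
    then have "H #> x = H #> y" using rcos_eq_iff[OF H c] \<open>J \<subseteq> H\<close> by auto
    then show "H #> x \<in> (\<lambda>Y. H #> (SOME x. x \<in> L \<and> J #> x = Y)) ` (\<lambda>x. J #> x) ` L"
      unfolding y_def using x by blast
  qed
qed

text \<open>The \<open>J\<close>-cosets inside one coset \<open>H #> x\<close> are the translates by
  \<open>x\<close> of those inside \<open>H\<close>, so all fibres of the map from
  \<open>J\<close>-cosets to \<open>H\<close>-cosets have the same size.\<close>

lemma ridx_tower:
  assumes L: "subgroup L G" and H: "subgroup H G" and J: "subgroup J G"
    and "J \<subseteq> H" "H \<subseteq> L" and fin: "finite ((\<lambda>x. J #> x) ` L)"
  shows "ridx G L J = ridx G L H * ridx G H J"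
proof -
  have sub: "L \<subseteq> carrier G" "H \<subseteq> carrier G" using subgroup.subset L H by blast+
  define S where "S = (\<lambda>x. J #> x) ` L"
  define P where "P = (\<lambda>X. {Y \<in> S. \<exists>x\<in>L. J #> x = Y \<and> H #> x = X})"
  have S_eq: "S = (\<Union>X\<in>(\<lambda>x. H #> x) ` L. P X)"
    unfolding S_def P_def by auto
  have wd: "H #> x = H #> y" if "x \<in> L" "y \<in> L" "J #> x = J #> y" for x y
  proof -
    have c: "x \<in> carrier G" "y \<in> carrier G" using that sub by auto
    have "x \<otimes> inv y \<in> J" using rcos_eq_iff[OF J c] that by simp
    then show ?thesis using rcos_eq_iff[OF H c] \<open>J \<subseteq> H\<close> by auto
  qed
  have disj: "P X \<inter> P X' = {}" if "X \<noteq> X'" for X X'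
  proof (rule ccontr)
    assume "P X \<inter> P X' \<noteq> {}"
    then obtain x y where "x \<in> L" "y \<in> L" "J #> x = J #> y" "H #> x = X" "H #> y = X'"
      unfolding P_def by force
    then show False using wd[of x y] that by simp
  qed
  have cardP: "card (P (H #> x)) = ridx G H J" if x: "x \<in> L" for x
  proof -
    have x': "x \<in> carrier G" using x sub by blast
    have img: "P (H #> x) = (\<lambda>Y. Y #> x) ` ((\<lambda>h. J #> h) ` H)"
    proof (intro equalityI subsetI)
      fix Y assume "Y \<in> P (H #> x)"
      then obtain y where y: "y \<in> L" "J #> y = Y" "H #> y = H #> x" unfolding P_def by auto
      then have h: "y \<otimes> inv x \<in> H" using rcos_eq_iff[OF H, of y x] x sub by blast
      have "(J #> (y \<otimes> inv x)) #> x = J #> y"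
        using y x sub subgroup.subset[OF J]
        by (simp add: coset_mult_assoc subset_iff m_assoc)
      then show "Y \<in> (\<lambda>Y. Y #> x) ` ((\<lambda>h. J #> h) ` H)" using h y by force
    next
      fix Y assume "Y \<in> (\<lambda>Y. Y #> x) ` ((\<lambda>h. J #> h) ` H)"
      then obtain h where h: "h \<in> H" "Y = (J #> h) #> x" by auto
      have hx: "h \<otimes> x \<in> L" using h x \<open>H \<subseteq> L\<close> L by (auto intro: subgroup.m_closed)
      have "Y = J #> (h \<otimes> x)"
        using h x' sub subgroup.subset[OF J] by (simp add: coset_mult_assoc subset_iff)
      moreover have "H #> (h \<otimes> x) = H #> x"
        using h x' sub rcos_eq_iff[OF H, of "h \<otimes> x" x]
        by (simp add: subset_iff m_assoc)
      ultimately show "Y \<in> P (H #> x)" using hx unfolding P_def S_def by auto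
    qed
    have "inj_on (\<lambda>Y. Y #> x) ((\<lambda>h. J #> h) ` H)"
    proof (rule inj_onI)
      fix Y Z assume "Y \<in> (\<lambda>h. J #> h) ` H" "Z \<in> (\<lambda>h. J #> h) ` H" "Y #> x = Z #> x"
      moreover from this have "Y \<subseteq> carrier G" "Z \<subseteq> carrier G"
        using sub subgroup.subset[OF J] r_coset_subset_G by blast+
      ultimately show "Y = Z" using x' by (metis coset_mult_assoc coset_mult_one inv_closed r_inv)
    qed
    then show ?thesis unfolding img ridx_def using card_image by blast
  qed
  have finS: "finite S" using fin unfolding S_def .
  have finH: "finite ((\<lambda>x. H #> x) ` L)"
    by (rule finite_cosets_supergroup[OF H J \<open>J \<subseteq> H\<close> sub(1) fin])
  have "card S = (\<Sum>X\<in>(\<lambda>x. H #> x) ` L. card (P X))"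
    unfolding S_eq
    by (rule card_UN_disjoint[OF finH])
      (use disj finS in \<open>auto simp: P_def intro: finite_subset[of _ S]\<close>)
  also have "\<dots> = (\<Sum>X\<in>(\<lambda>x. H #> x) ` L. ridx G H J)"
    by (rule sum.cong) (use cardP in auto)
  finally show ?thesis unfolding ridx_def S_def by simp
qed

lemma normal_hull_normal:
  assumes "L \<subseteq> carrier G"
  shows "normal_hull G L \<lhd> G"
proof -
  have "carrier G \<lhd> G" using normal_inv_iff subgroup_self by auto
  then have ne: "{H. H \<lhd> G \<and> L \<subseteq> H} \<noteq> {}" using assms by blast
  have "subgroup (\<Inter>{H. H \<lhd> G \<and> L \<subseteq> H}) G"
    by (rule subgroups_Inter) (use ne normal_imp_subgroup in blast)+
  then show ?thesis
    unfolding normal_hull_def normal_inv_iff using normal_inv_iff by blast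
qed

lemma normal_hull_subset: "L \<subseteq> normal_hull G L"
  unfolding normal_hull_def by blast

lemma normal_hull_least: "H \<lhd> G \<Longrightarrow> L \<subseteq> H \<Longrightarrow> normal_hull G L \<subseteq> H"
  unfolding normal_hull_def by blast

end

section \<open>Words in the free group\<close>

abbreviation letters :: "nat \<Rightarrow> letter set" where
  "letters n \<equiv> {a. snd a < n}"

lemma finite_letters: "finite (letters n)"
proof -
  have "letters n = UNIV \<times> {..<n}" by auto
  then show ?thesis by simp
qed

lemma free_group_simps:
  "carrier (free_group n) = {w. reduced w \<and> set w \<subseteq> letters n}"
  "u \<otimes>\<^bsub>free_group n\<^esub> v = foldr push u v" "\<one>\<^bsub>free_group n\<^esub> = []"
  by (auto simp: free_group_def)

lemma letter_in_carrier [simp]: "[a] \<in> carrier (free_group n) \<longleftrightarrow> snd a < n"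
  by (simp add: free_group_simps)

lemma reduced_append_iff_left: "reduced (u @ v) \<Longrightarrow> reduced u"
  by (induction u rule: reduced.induct) auto

lemma foldr_push_reduced: "reduced (u @ v) \<Longrightarrow> foldr push u v = u @ v"
proof (induction u)
  case (Cons a u)
  then show ?case using reduced_ConsD[of a "u @ v"] push_eq_Cons[of a "u @ v"] by simp
qed simp

lemma free_group_snoc:
  assumes "w @ [a] \<in> carrier (free_group n)"
  shows "w \<in> carrier (free_group n)" "snd a < n" "w \<otimes>\<^bsub>free_group n\<^esub> [a] = w @ [a]"
  using assms reduced_append_iff_left foldr_push_reduced by (auto simp: free_group_simps)

lemma free_group_Cons:
  assumes "a # w \<in> carrier (free_group n)"
  shows "w \<in> carrier (free_group n)" "snd a < n" "[a] \<otimes>\<^bsub>free_group n\<^esub> w = a # w"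
  using assms by (auto simp: free_group_simps push_eq_Cons dest: reduced_ConsD)

lemma free_group_induct_snoc [consumes 1, case_names one snoc]:
  assumes "w \<in> carrier (free_group n)" "P []"
    and "\<And>w a. w \<in> carrier (free_group n) \<Longrightarrow> snd a < n \<Longrightarrow> P w \<Longrightarrow> P (w \<otimes>\<^bsub>free_group n\<^esub> [a])"
  shows "P w"
  using assms(1)
proof (induction w rule: rev_induct)
  case (snoc a w)
  then show ?case using free_group_snoc[of w a n] assms(3)[of w a] by metis
qed (use assms(2) in simp)

lemma reduced_snoc_iff:
  "reduced (w @ [a]) \<longleftrightarrow> reduced w \<and> (w = [] \<or> last w \<noteq> inv_letter a)"
  by (induction w rule: reduced.induct) auto

lemma free_group_mult_letter:
  assumes "w \<in> carrier (free_group n)" "snd a < n"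
  shows "w \<otimes>\<^bsub>free_group n\<^esub> [a] = w @ [a] \<or>
    (\<exists>v. w = v @ [inv_letter a] \<and> w \<otimes>\<^bsub>free_group n\<^esub> [a] = v)"
proof (cases "reduced (w @ [a])")
  case True
  then show ?thesis by (simp add: free_group_simps foldr_push_reduced)
next
  case False
  then have "w \<noteq> []" "last w = inv_letter a"
    using assms by (auto simp: reduced_snoc_iff free_group_simps)
  then obtain v where v: "w = v @ [inv_letter a]" by (metis append_butlast_last_id)
  have "reduced v" using assms(1) v reduced_append_iff_left by (auto simp: free_group_simps)
  then have "foldr push w [a] = v" using v by (simp add: foldr_push_Nil)
  then show ?thesis using v by (simp add: free_group_simps)
qed

lemma length_push: "length (push a w) \<le> Suc (length w)"
  by (cases w) auto

lemma length_mult_le: "length (u \<otimes>\<^bsub>free_group n\<^esub> v) \<le> length u + length v"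
proof (induction u)
  case (Cons a u)
  then show ?case using length_push[of a "foldr push u v"] by (simp add: free_group_simps)
qed (simp add: free_group_simps)

lemma reduced_rev_inv: "reduced w \<Longrightarrow> reduced (rev (map inv_letter w))"
proof (induction w)
  case (Cons a w)
  then show ?case using reduced_ConsD[of a w]
    by (cases w) (auto simp: reduced_snoc_iff simp del: append_assoc append.simps)
qed simp

lemma inv_free_group:
  assumes "w \<in> carrier (free_group n)"
  shows "inv\<^bsub>free_group n\<^esub> w = rev (map inv_letter w)"
proof (rule group.inv_equality[OF group_free_group])
  show "rev (map inv_letter w) \<otimes>\<^bsub>free_group n\<^esub> w = \<one>\<^bsub>free_group n\<^esub>"
    using foldr_push_inverse[of "[]" w] assms by (simp add: free_group_simps foldr_push_Nil)
  show "rev (map inv_letter w) \<in> carrier (free_group n)"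
    using assms reduced_rev_inv by (auto simp: free_group_simps)
qed fact

lemma length_inv_free_group:
  "w \<in> carrier (free_group n) \<Longrightarrow> length (inv\<^bsub>free_group n\<^esub> w) = length w"
  by (simp add: inv_free_group)

lemma finite_words_length_le: "finite {w \<in> carrier (free_group n). length w \<le> r}"
  by (rule finite_subset[OF _ finite_lists_length_le[OF finite_letters, of n r]])
    (auto simp: free_group_simps)

section \<open>Homomorphisms to the group of order two\<close>

text \<open>A homomorphism to \<open>\<int>/2\<close> is encoded by the set on which it does not vanish.\<close>

definition hom2 :: "('a, 'b) monoid_scheme \<Rightarrow> 'a set \<Rightarrow> 'a set set" where
  "hom2 G J = {X. X \<subseteq> J \<and> (\<forall>a\<in>J. \<forall>b\<in>J. a \<otimes>\<^bsub>G\<^esub> b \<in> X \<longleftrightarrow> (a \<in> X) \<noteq> (b \<in> X))}"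

text \<open>The Schreier graph has the cosets as vertices and an edge \<open>(X, i)\<close> from
  \<open>X\<close> to its translate by the generator \<open>i\<close>; \<open>C\<close> is a
  function on the edges with values in Z/2. A negative letter runs backwards along the edge that
  starts at the end of the step.\<close>

definition edge_val :: "nat \<Rightarrow> (letter list set \<times> nat) set \<Rightarrow> letter list set \<Rightarrow> letter \<Rightarrow> bool" where
  "edge_val n C X a = (if fst a then (X, snd a) \<in> C else (X #>\<^bsub>free_group n\<^esub> [a], snd a) \<in> C)"

primrec path_val :: "nat \<Rightarrow> (letter list set \<times> nat) set \<Rightarrow> letter list set \<Rightarrow> letter list \<Rightarrow> bool" where
  "path_val n C X [] = False"
| "path_val n C X (a # w) = (edge_val n C X a \<noteq> path_val n C (X #>\<^bsub>free_group n\<^esub> [a]) w)"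

text \<open>If \<open>a\<close> cancels, the path crosses an edge and returns along it, and modulo 2
  the two contributions vanish. So values of paths survive reduction.\<close>

lemma path_val_push:
  assumes X: "X \<subseteq> carrier (free_group n)" and a: "snd a < n"
  shows "path_val n C X (push a w) = path_val n C X (a # w)"
proof (cases "\<exists>v. w = inv_letter a # v")
  case True
  then obtain v where v: "w = inv_letter a # v" by blast
  interpret group "free_group n" by (rule group_free_group)
  have "[a] \<otimes>\<^bsub>free_group n\<^esub> [inv_letter a] = []" by (simp add: free_group_simps)
  then have X': "X #>\<^bsub>free_group n\<^esub> [a] #>\<^bsub>free_group n\<^esub> [inv_letter a] = X"
    using X a coset_mult_assoc[of X "[a]" "[inv_letter a]"] coset_mult_one[OF X]
    by (simp add: free_group_simps(3))
  then show ?thesis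
    by (auto simp: v edge_val_def) (auto simp: inv_letter_def)
next
  case False
  then have "push a w = a # w" by (cases w) auto
  then show ?thesis by simp
qed

lemma path_val_mult:
  assumes X: "X \<subseteq> carrier (free_group n)" and u: "u \<in> carrier (free_group n)"
    and v: "v \<in> carrier (free_group n)"
  shows "path_val n C X (u \<otimes>\<^bsub>free_group n\<^esub> v)
    = (path_val n C X u \<noteq> path_val n C (X #>\<^bsub>free_group n\<^esub> u) v)"
  using X u
proof (induction u arbitrary: X)
  case Nil
  interpret group "free_group n" by (rule group_free_group)
  show ?case using coset_mult_one[OF Nil(1)] by (simp add: free_group_simps)
next
  case (Cons a u)
  interpret group "free_group n" by (rule group_free_group)
  note au = free_group_Cons[OF Cons.prems(2)]
  have a: "[a] \<in> carrier (free_group n)" using au by simp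
  have Xa: "X #>\<^bsub>free_group n\<^esub> [a] \<subseteq> carrier (free_group n)"
    using Cons.prems(1) a r_coset_subset_G by blast
  have "X #>\<^bsub>free_group n\<^esub> (a # u) = X #>\<^bsub>free_group n\<^esub> [a] #>\<^bsub>free_group n\<^esub> u"
    using coset_mult_assoc[OF Cons.prems(1) a au(1)] au(3) by simp
  moreover have "(a # u) \<otimes>\<^bsub>free_group n\<^esub> v = push a (u \<otimes>\<^bsub>free_group n\<^esub> v)"
    by (simp add: free_group_simps)
  ultimately show ?case
    using path_val_push[OF Cons.prems(1) au(2), of C "u \<otimes>\<^bsub>free_group n\<^esub> v"] Cons.IH[OF Xa au(1)]
    by auto
qed

text \<open>
  Both sides count the \<open>\<int>/2\<close>-valued functions on the edges of the Schreier graph of \<open>J\<close>: such a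
  function amounts to a homomorphism from \<open>J\<close> and a function on the vertices vanishing at \<open>J\<close>.
\<close>

theorem card_hom2_free_group:
  assumes J: "subgroup J (free_group n)"
    and fin: "finite ((\<lambda>x. J #>\<^bsub>free_group n\<^esub> x) ` carrier (free_group n))"
  defines "m \<equiv> ridx (free_group n) (carrier (free_group n)) J"
  shows "card (hom2 (free_group n) J) * 2 ^ (m - 1) = 2 ^ (m * n)"
proof -
  define F where "F = free_group n"
  interpret F: group F unfolding F_def by (rule group_free_group)
  interpret J: subgroup J F using J unfolding F_def .
  define Cs where "Cs = (\<lambda>x. J #>\<^bsub>F\<^esub> x) ` carrier F"
  have finCs: "finite Cs" and cardCs: "card Cs = m"
    using fin unfolding Cs_def m_def ridx_def F_def by simp_all
  have one: "\<one>\<^bsub>F\<^esub> = []" by (simp add: F_def free_group_simps)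
  have J_one: "J #>\<^bsub>F\<^esub> [] = J" using F.coset_mult_one[OF J.subset] one by simp
  have J_Cs: "J \<in> Cs" unfolding Cs_def using J_one F.one_closed one by (metis image_eqI)
  \<comment> \<open>The transversal takes the empty word at \<open>J\<close> itself, so that the
    loop \<open>lp J w\<close> of an element \<open>w\<close> of \<open>J\<close> is
    \<open>w\<close>.\<close>
  define T where "T = (\<lambda>X. if X = J then [] else SOME x. x \<in> carrier F \<and> J #>\<^bsub>F\<^esub> x = X)"
  have T: "T X \<in> carrier F" "J #>\<^bsub>F\<^esub> T X = X" if "X \<in> Cs" for X
  proof -
    have "\<exists>x. x \<in> carrier F \<and> J #>\<^bsub>F\<^esub> x = X" using that unfolding Cs_def by blast
    from someI_ex[OF this] show "T X \<in> carrier F" "J #>\<^bsub>F\<^esub> T X = X"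
      unfolding T_def using J_one F.one_closed one by auto
  qed
  have T_J: "T J = []" by (simp add: T_def)
  have Cs_sub: "X \<subseteq> carrier F" if "X \<in> Cs" for X
    using that F.r_coset_subset_G[OF J.subset] unfolding Cs_def by blast
  have Cs_mult: "X #>\<^bsub>F\<^esub> x \<in> Cs" if "X \<in> Cs" "x \<in> carrier F" for X x
    using that J.subset unfolding Cs_def by (auto simp: F.coset_mult_assoc)
  have assoc: "X #>\<^bsub>F\<^esub> x #>\<^bsub>F\<^esub> y = X #>\<^bsub>F\<^esub> (x \<otimes>\<^bsub>F\<^esub> y)"
    if "X \<in> Cs" "x \<in> carrier F" "y \<in> carrier F" for X x y
    using F.coset_mult_assoc Cs_sub that by blast
  have letter: "[a] \<in> carrier F" if "snd a < n" for a using that by (simp add: F_def)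
  \<comment> \<open>The Schreier loop: from \<open>J\<close> to \<open>X\<close> along the
    transversal, along \<open>w\<close>, and back. It lies in \<open>J\<close> and is multiplicative
    along paths.\<close>
  define lp where "lp = (\<lambda>X w. T X \<otimes>\<^bsub>F\<^esub> w \<otimes>\<^bsub>F\<^esub> inv\<^bsub>F\<^esub> T (X #>\<^bsub>F\<^esub> w))"
  have lp_J: "lp X w \<in> J" if X: "X \<in> Cs" and w: "w \<in> carrier F" for X w
  proof -
    have "J #>\<^bsub>F\<^esub> (T X \<otimes>\<^bsub>F\<^esub> w) = J #>\<^bsub>F\<^esub> T (X #>\<^bsub>F\<^esub> w)"
      using T[OF X] T(2)[OF Cs_mult[OF X w]] F.coset_mult_assoc[OF J.subset T(1)[OF X] w] by simp
    then show ?thesis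
      unfolding lp_def using F.rcos_eq_iff[OF J.is_subgroup] T(1)[OF X] T(1)[OF Cs_mult[OF X w]] w by simp
  qed
  have lp_mult: "lp X (v \<otimes>\<^bsub>F\<^esub> w) = lp X v \<otimes>\<^bsub>F\<^esub> lp (X #>\<^bsub>F\<^esub> v) w"
    if "X \<in> Cs" "v \<in> carrier F" "w \<in> carrier F" for X v w
    unfolding lp_def using that T Cs_mult by (simp add: F.m_assoc assoc)
  have lp_one: "lp X [] = \<one>\<^bsub>F\<^esub>" if "X \<in> Cs" for X
    unfolding lp_def using that T[OF that] F.coset_mult_one[OF Cs_sub[OF that]] one F.r_one[OF T(1)[OF that]] by simp
  define pv where "pv = (\<lambda>C. path_val n C)"
  have pv_mult: "pv C X (u \<otimes>\<^bsub>F\<^esub> v) = (pv C X u \<noteq> pv C (X #>\<^bsub>F\<^esub> u) v)"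
    if "X \<in> Cs" "u \<in> carrier F" "v \<in> carrier F" for C X u v
    using path_val_mult[of X n u v C] that Cs_sub unfolding pv_def F_def by blast
  have J_mult: "J #>\<^bsub>F\<^esub> u = J" if "u \<in> J" for u
    using that F.rcos_eq_self_iff[OF J.is_subgroup] J.mem_carrier by blast
  have hom2_one: "\<one>\<^bsub>F\<^esub> \<notin> X" if "X \<in> hom2 F J" for X
    using that J.one_closed unfolding hom2_def by fastforce
  have hom2_mult: "a \<otimes>\<^bsub>F\<^esub> b \<in> X \<longleftrightarrow> (a \<in> X) \<noteq> (b \<in> X)" if "X \<in> hom2 F J" "a \<in> J" "b \<in> J" for X a b
    using that unfolding hom2_def by blast
  define \<Phi> where "\<Phi> = (\<lambda>C. ({w \<in> J. pv C J w}, {X \<in> Cs. pv C J (T X)}))"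
  \<comment> \<open>The inverse: the value on an edge is that of its Schreier loop, corrected by the
    values at the two ends.\<close>
  define \<Psi> where "\<Psi> = (\<lambda>(\<xi>, V). {(X, i). X \<in> Cs \<and> i < n \<and>
    (lp X [(True, i)] \<in> \<xi>) \<noteq> ((X \<in> V) \<noteq> (X #>\<^bsub>F\<^esub> [(True, i)] \<in> V))})"
  have "bij_betw \<Phi> (Pow (Cs \<times> {..<n})) (hom2 F J \<times> Pow (Cs - {J}))"
  proof (rule bij_betw_byWitness[where f' = \<Psi>])
    show "\<Phi> ` Pow (Cs \<times> {..<n}) \<subseteq> hom2 F J \<times> Pow (Cs - {J})"
    proof (rule image_subsetI)
      fix C
      have "{w \<in> J. pv C J w} \<in> hom2 F J"
        unfolding hom2_def using pv_mult[OF J_Cs] J_mult J.mem_carrier by auto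
      moreover have "\<not> pv C J (T J)" unfolding T_J pv_def by simp
      ultimately show "\<Phi> C \<in> hom2 F J \<times> Pow (Cs - {J})" unfolding \<Phi>_def by auto
    qed
    show "\<Psi> ` (hom2 F J \<times> Pow (Cs - {J})) \<subseteq> Pow (Cs \<times> {..<n})"
      unfolding \<Psi>_def by auto
    show "\<forall>C\<in>Pow (Cs \<times> {..<n}). \<Psi> (\<Phi> C) = C"
    proof
      fix C assume C: "C \<in> Pow (Cs \<times> {..<n})"
      have "(lp X [(True, i)] \<in> {w \<in> J. pv C J w}) \<noteq>
          ((X \<in> {X \<in> Cs. pv C J (T X)}) \<noteq> (X #>\<^bsub>F\<^esub> [(True, i)] \<in> {X \<in> Cs. pv C J (T X)}))
          \<longleftrightarrow> (X, i) \<in> C" if X: "X \<in> Cs" and i: "i < n" for X i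
      proof -
        define a where "a = (True, i)"
        have a: "[a] \<in> carrier F" using i letter[of a] by (simp add: a_def)
        define Y where "Y = X #>\<^bsub>F\<^esub> [a]"
        have Y: "Y \<in> Cs" unfolding Y_def using Cs_mult[OF X a] .
        have "pv C J (T Y \<otimes>\<^bsub>F\<^esub> inv\<^bsub>F\<^esub> T Y) = (pv C J (T Y) \<noteq> pv C Y (inv\<^bsub>F\<^esub> T Y))"
          using pv_mult[OF J_Cs, of "T Y" "inv\<^bsub>F\<^esub> T Y" C] T[OF Y] by simp
        moreover have "T Y \<otimes>\<^bsub>F\<^esub> inv\<^bsub>F\<^esub> T Y = []" using T[OF Y] one by simp
        moreover have "pv C J [] = False" by (simp add: pv_def)
        ultimately have 1: "pv C Y (inv\<^bsub>F\<^esub> T Y) = pv C J (T Y)" by simp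
        have "pv C J (lp X [a]) = pv C J (T X \<otimes>\<^bsub>F\<^esub> ([a] \<otimes>\<^bsub>F\<^esub> inv\<^bsub>F\<^esub> T Y))"
          unfolding lp_def Y_def[symmetric] using T[OF X] T[OF Y] a by (simp add: F.m_assoc)
        also have "\<dots> = (pv C J (T X) \<noteq> (pv C X [a] \<noteq> pv C Y (inv\<^bsub>F\<^esub> T Y)))"
          using pv_mult[OF J_Cs, of "T X" "[a] \<otimes>\<^bsub>F\<^esub> inv\<^bsub>F\<^esub> T Y" C]
            pv_mult[OF X, of "[a]" "inv\<^bsub>F\<^esub> T Y" C] T[OF X] T[OF Y] a unfolding Y_def by simp
        also have "pv C X [a] = ((X, i) \<in> C)" by (simp add: pv_def edge_val_def a_def)
        finally show ?thesis
          using 1 lp_J[OF X a] X Y unfolding Y_def a_def by auto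
      qed
      then show "\<Psi> (\<Phi> C) = C" using C unfolding \<Psi>_def \<Phi>_def by auto
    qed
    show "\<forall>p\<in>hom2 F J \<times> Pow (Cs - {J}). \<Phi> (\<Psi> p) = p"
    proof
      fix p assume "p \<in> hom2 F J \<times> Pow (Cs - {J})"
      then obtain \<xi> V where p: "p = (\<xi>, V)" "\<xi> \<in> hom2 F J" "V \<subseteq> Cs - {J}" by auto
      define C where "C = \<Psi> (\<xi>, V)"
      have C: "(X, i) \<in> C \<longleftrightarrow> (lp X [(True, i)] \<in> \<xi>) \<noteq> ((X \<in> V) \<noteq> (X #>\<^bsub>F\<^esub> [(True, i)] \<in> V))"
        if "X \<in> Cs" "i < n" for X i using that unfolding C_def \<Psi>_def by simp
      have edge: "edge_val n C X a \<longleftrightarrow> (lp X [a] \<in> \<xi>) \<noteq> ((X \<in> V) \<noteq> (X #>\<^bsub>F\<^esub> [a] \<in> V))"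
        if X: "X \<in> Cs" and a: "snd a < n" for X a
      proof (cases "fst a")
        case True
        then have "a = (True, snd a)" by (simp add: prod_eq_iff)
        then show ?thesis using C[OF X a] by (simp add: edge_val_def True)
      next
        case False
        define b where "b = inv_letter a"
        have ab: "[a] \<otimes>\<^bsub>F\<^esub> [b] = []" by (simp add: F_def free_group_simps b_def)
        have b: "b = (True, snd a)" "[b] \<in> carrier F" "[a] \<in> carrier F"
          using False a letter by (auto simp: b_def inv_letter_def)
        define Y where "Y = X #>\<^bsub>F\<^esub> [a]"
        have Y: "Y \<in> Cs" unfolding Y_def using Cs_mult[OF X b(3)] .
        have YX: "Y #>\<^bsub>F\<^esub> [b] = X" unfolding Y_def using assoc[OF X b(3,2)] ab
            F.coset_mult_one[OF Cs_sub[OF X]] one by simp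
        have "lp X [a] \<otimes>\<^bsub>F\<^esub> lp Y [b] = \<one>\<^bsub>F\<^esub>"
          using lp_mult[OF X b(3,2)] lp_one[OF X] ab unfolding Y_def by simp
        then have "(lp X [a] \<in> \<xi>) = (lp Y [b] \<in> \<xi>)"
          using hom2_mult[OF p(2) lp_J[OF X b(3)] lp_J[OF Y b(2)]] hom2_one[OF p(2)] by simp
        moreover have "edge_val n C X a \<longleftrightarrow> (Y, snd a) \<in> C"
          by (simp add: edge_val_def False Y_def F_def)
        ultimately show ?thesis using C[OF Y a] YX b(1) unfolding Y_def by auto
      qed
      have path: "pv C X w \<longleftrightarrow> (lp X w \<in> \<xi>) \<noteq> ((X \<in> V) \<noteq> (X #>\<^bsub>F\<^esub> w \<in> V))"
        if "X \<in> Cs" "w \<in> carrier F" for X w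
        using that
      proof (induction w arbitrary: X)
        case Nil
        then show ?case
          using lp_one hom2_one[OF p(2)] F.coset_mult_one[OF Cs_sub] one by (simp add: pv_def)
      next
        case (Cons a w)
        note aw = free_group_Cons[of a w n, folded F_def, OF Cons.prems(2)]
        have a: "[a] \<in> carrier F" using letter[OF aw(2)] .
        define Y where "Y = X #>\<^bsub>F\<^esub> [a]"
        have Y: "Y \<in> Cs" unfolding Y_def using Cs_mult[OF Cons.prems(1) a] .
        have Yw: "Y #>\<^bsub>F\<^esub> w = X #>\<^bsub>F\<^esub> (a # w)"
          unfolding Y_def using assoc[OF Cons.prems(1) a aw(1)] aw(3) by simp
        have "lp X (a # w) = lp X [a] \<otimes>\<^bsub>F\<^esub> lp Y w"
          using lp_mult[OF Cons.prems(1) a aw(1)] aw(3) unfolding Y_def by simp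
        then have "lp X (a # w) \<in> \<xi> \<longleftrightarrow> (lp X [a] \<in> \<xi>) \<noteq> (lp Y w \<in> \<xi>)"
          using hom2_mult[OF p(2)] lp_J Cons.prems(1) a Y aw(1) by simp
        moreover have "pv C X (a # w) = (edge_val n C X a \<noteq> pv C Y w)"
          by (simp add: pv_def Y_def F_def)
        ultimately show ?case
          using edge[OF Cons.prems(1) aw(2)] Cons.IH[OF Y aw(1)] Yw unfolding Y_def by auto
      qed
      have JV: "J \<notin> V" using p(3) by blast
      have "{w \<in> J. pv C J w} = \<xi>"
      proof -
        have "pv C J w \<longleftrightarrow> w \<in> \<xi>" if w: "w \<in> J" for w
          using path[OF J_Cs, of w] J_mult[OF w] w J.mem_carrier JV one unfolding lp_def T_J
          by (simp add: T_J F.l_one[unfolded one] F.inv_one[unfolded one] F.r_one[unfolded one])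
        then show ?thesis using p(2) unfolding hom2_def by blast
      qed
      moreover have "{X \<in> Cs. pv C J (T X)} = V"
      proof -
        have "pv C J (T X) \<longleftrightarrow> X \<in> V" if X: "X \<in> Cs" for X
        proof -
          have "lp J (T X) = \<one>\<^bsub>F\<^esub>" unfolding lp_def T(2)[OF X] T_J
            using T(1)[OF X] one F.l_one by simp
          then show ?thesis using path[OF J_Cs T(1)[OF X]] T(2)[OF X] JV hom2_one[OF p(2)] by simp
        qed
        then show ?thesis using p(3) by blast
      qed
      ultimately show "\<Phi> (\<Psi> p) = p" unfolding p(1) C_def[symmetric] \<Phi>_def by simp
    qed
  qed
  then have "card (Pow (Cs \<times> {..<n})) = card (hom2 F J \<times> Pow (Cs - {J}))"
    by (rule bij_betw_same_card)
  then have "2 ^ (m * n) = card (hom2 F J) * 2 ^ (m - 1)"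
    using finCs J_Cs by (simp add: card_Pow card_cartesian_product cardCs)
  then show ?thesis unfolding F_def by simp
qed

section \<open>Lifting maps between quotients\<close>

text \<open>Lifting needs only a filtration by balls. The abstraction lets the same argument run in
  a free group and in a quotient of it, whose balls are the images of balls.\<close>

locale ball_group = group G for G (structure) +
  fixes Ba :: "nat \<Rightarrow> 'a set"
  assumes ball_carrier: "x \<in> Ba r \<Longrightarrow> x \<in> carrier G"
    and ball_one: "\<one> \<in> Ba 0"
    and ball_mult: "x \<in> Ba r \<Longrightarrow> y \<in> Ba s \<Longrightarrow> x \<otimes> y \<in> Ba (r + s)"
    and ball_inv: "x \<in> Ba r \<Longrightarrow> inv x \<in> Ba r"
    and ball_mono: "x \<in> Ba r \<Longrightarrow> r \<le> s \<Longrightarrow> x \<in> Ba s"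

definition free_ball :: "nat \<Rightarrow> nat \<Rightarrow> letter list set" where
  "free_ball n r = {w \<in> carrier (free_group n). length w \<le> r}"

lemma finite_free_ball: "finite (free_ball n r)"
  unfolding free_ball_def by (rule finite_words_length_le)

lemma ball_group_free: "ball_group (free_group n) (free_ball n)"
proof -
  interpret group "free_group n" by (rule group_free_group)
  show ?thesis
  proof
    fix x y r s assume "x \<in> free_ball n r" "y \<in> free_ball n s"
    then show "x \<otimes>\<^bsub>free_group n\<^esub> y \<in> free_ball n (r + s)"
      using length_mult_le[of n x y] by (auto simp: free_ball_def)
  qed (auto simp: free_ball_def length_inv_free_group, auto simp: free_group_simps)
qed

lemma (in ball_group) ball_group_Mod:
  assumes "K \<lhd> G"
  shows "ball_group (G Mod K) (\<lambda>r. (\<lambda>x. K #> x) ` Ba r)"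
proof -
  interpret K: normal K G by fact
  interpret Q: group "G Mod K" by (rule K.factorgroup_is_group)
  show ?thesis
  proof
    fix X r assume "X \<in> (\<lambda>x. K #> x) ` Ba r"
    then obtain x where x: "x \<in> Ba r" "X = K #> x" by auto
    have "inv\<^bsub>G Mod K\<^esub> X = K #> inv x"
      using x ball_carrier K.inv_FactGroup[of X] K.rcos_inv[of x] by (auto simp: carrier_FactGroup)
    then show "inv\<^bsub>G Mod K\<^esub> X \<in> (\<lambda>x. K #> x) ` Ba r" using x ball_inv by blast
  next
    fix X Y r s assume "X \<in> (\<lambda>x. K #> x) ` Ba r" "Y \<in> (\<lambda>x. K #> x) ` Ba s"
    then show "X \<otimes>\<^bsub>G Mod K\<^esub> Y \<in> (\<lambda>x. K #> x) ` Ba (r + s)"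
      using ball_mult ball_carrier by (auto simp: K.rcos_sum)
  next
    show "\<one>\<^bsub>G Mod K\<^esub> \<in> (\<lambda>x. K #> x) ` Ba 0"
      using ball_one K.subset by (auto intro!: image_eqI[of _ _ \<one>])
  qed (auto simp: carrier_FactGroup ball_carrier intro: ball_mono)
qed

lemma (in ball_group) steps_ball:
  assumes f: "\<And>x. x \<in> carrier (free_group n) \<Longrightarrow> f x \<in> carrier G"
    and step: "\<And>x a. x \<in> carrier (free_group n) \<Longrightarrow> snd a < n
      \<Longrightarrow> inv f x \<otimes> f (x \<otimes>\<^bsub>free_group n\<^esub> [a]) \<in> Ba A"
    and x: "x \<in> carrier (free_group n)" and "w \<in> carrier (free_group n)"
  shows "inv f x \<otimes> f (x \<otimes>\<^bsub>free_group n\<^esub> w) \<in> Ba (A * length w)"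
  using assms(4)
proof (induction w rule: rev_induct)
  case Nil
  interpret F: group "free_group n" by (rule group_free_group)
  have "x \<otimes>\<^bsub>free_group n\<^esub> [] = x"
    using F.r_one[OF x] by (simp add: free_group_simps)
  then show ?case using f x ball_one by simp
next
  case (snoc a w)
  interpret F: group "free_group n" by (rule group_free_group)
  note w = free_group_snoc[OF snoc.prems]
  let ?y = "x \<otimes>\<^bsub>free_group n\<^esub> w"
  have y: "?y \<in> carrier (free_group n)" "[a] \<in> carrier (free_group n)" using w x by simp_all
  have "x \<otimes>\<^bsub>free_group n\<^esub> (w @ [a]) = ?y \<otimes>\<^bsub>free_group n\<^esub> [a]"
    using w(1,3) x y by (simp add: F.m_assoc)
  moreover have "(inv f x \<otimes> f ?y) \<otimes> (inv f ?y \<otimes> f (?y \<otimes>\<^bsub>free_group n\<^esub> [a])) \<in> Ba (A * length w + A)"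
    using snoc.IH[OF w(1)] step[OF y(1) w(2)] by (rule ball_mult)
  moreover have "(inv f x \<otimes> f ?y) \<otimes> (inv f ?y \<otimes> f (?y \<otimes>\<^bsub>free_group n\<^esub> [a]))
      = inv f x \<otimes> f (?y \<otimes>\<^bsub>free_group n\<^esub> [a])"
    using f x y by (simp add: m_assoc)
  ultimately show ?case by (simp add: algebra_simps)
qed

text \<open>
  A discrete form of the uniqueness of lifts: two maps with short steps which agree up to short
  elements modulo \<open>M\<close> differ by a single deck transformation if \<open>M\<close> has no short elements.
\<close>

lemma (in ball_group) rigid:
  assumes M: "M \<lhd> G" and short: "M \<inter> Ba (s + t + 2 * D) \<subseteq> {\<one>}"
    and f: "\<And>x. x \<in> carrier (free_group n) \<Longrightarrow> f x \<in> carrier G"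
    and f_step: "\<And>x a. x \<in> carrier (free_group n) \<Longrightarrow> snd a < n
      \<Longrightarrow> inv f x \<otimes> f (x \<otimes>\<^bsub>free_group n\<^esub> [a]) \<in> Ba s"
    and g: "\<And>x. x \<in> carrier (free_group n) \<Longrightarrow> g x \<in> carrier G"
    and g_step: "\<And>x a. x \<in> carrier (free_group n) \<Longrightarrow> snd a < n
      \<Longrightarrow> inv g x \<otimes> g (x \<otimes>\<^bsub>free_group n\<^esub> [a]) \<in> Ba t"
    and near: "\<And>x. x \<in> carrier (free_group n) \<Longrightarrow> \<exists>h\<in>Ba D. M #> f x = M #> (g x \<otimes> h)"
  shows "\<exists>m\<in>M. \<forall>x\<in>carrier (free_group n). \<exists>h\<in>Ba D. f x = m \<otimes> g x \<otimes> h"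
proof -
  interpret M: normal M G by fact
  interpret F: group "free_group n" by (rule group_free_group)
  have near': "\<exists>m\<in>M. \<exists>h\<in>Ba D. f x = m \<otimes> g x \<otimes> h" if x: "x \<in> carrier (free_group n)" for x
  proof -
    obtain h where h: "h \<in> Ba D" "M #> f x = M #> (g x \<otimes> h)" using near[OF x] by blast
    let ?m = "f x \<otimes> inv (g x \<otimes> h)"
    have "?m \<in> M" using h x f g ball_carrier rcos_eq_iff[OF M.is_subgroup, of "f x" "g x \<otimes> h"] by simp
    moreover have "f x = ?m \<otimes> g x \<otimes> h"
      using h x f g ball_carrier[OF h(1)] by (simp add: m_assoc)
    ultimately show ?thesis using h(1) by blast
  qed
  have one: "[] \<in> carrier (free_group n)" by (simp add: free_group_simps)
  obtain m h0 where m: "m \<in> M" "h0 \<in> Ba D" "f [] = m \<otimes> g [] \<otimes> h0" using near'[OF one] by blast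
  have "\<exists>h\<in>Ba D. f x = m \<otimes> g x \<otimes> h" if "x \<in> carrier (free_group n)" for x
    using that
  proof (induction rule: free_group_induct_snoc)
    case one
    then show ?case using m by blast
  next
    case (snoc x a)
    let ?x' = "x \<otimes>\<^bsub>free_group n\<^esub> [a]"
    have x': "?x' \<in> carrier (free_group n)" using snoc by simp
    obtain h where h: "h \<in> Ba D" "f x = m \<otimes> g x \<otimes> h" using snoc by blast
    obtain m' h' where m': "m' \<in> M" "h' \<in> Ba D" "f ?x' = m' \<otimes> g ?x' \<otimes> h'" using near'[OF x'] by blast
    define e where "e = inv f x \<otimes> f ?x'"
    define e' where "e' = inv g x \<otimes> g ?x'"
    have e: "e \<in> Ba s" "e' \<in> Ba t"
      unfolding e_def e'_def using f_step g_step snoc by blast+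
    note c [simp] = f[OF snoc.hyps(1)] g[OF snoc.hyps(1)] f[OF x'] g[OF x'] ball_carrier[OF h(1)]
      ball_carrier[OF m'(2)] M.mem_carrier[OF m(1)] M.mem_carrier[OF m'(1)]
      ball_carrier[OF e(1)] ball_carrier[OF e(2)]
    have f': "f ?x' = f x \<otimes> e" and g': "g ?x' = g x \<otimes> e'" unfolding e_def e'_def by simp_all
    \<comment> \<open>Conjugation by \<open>g x\<close> keeps the discrepancy of the two deck
      transformations in \<open>M\<close> and makes it short: it is a product of one step and one
      error of each map, whence the radius \<open>s + t + 2 * D\<close>.\<close>
    define z where "z = inv (g x) \<otimes> (inv m' \<otimes> m) \<otimes> g x"
    have zM: "z \<in> M" unfolding z_def
      using M.inv_op_closed1[of "g x" "inv m' \<otimes> m"] m(1) m'(1) by simp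
    have "z \<otimes> (h \<otimes> e) = inv (g x) \<otimes> (inv m' \<otimes> (f x \<otimes> e))"
      unfolding z_def h(2) by (simp add: m_assoc)
    also have "f x \<otimes> e = m' \<otimes> (g x \<otimes> (e' \<otimes> h'))" using m'(3) f' g' by (simp add: m_assoc)
    also have "inv (g x) \<otimes> (inv m' \<otimes> (m' \<otimes> (g x \<otimes> (e' \<otimes> h')))) = e' \<otimes> h'" by simp
    finally have "z \<otimes> (h \<otimes> e) = e' \<otimes> h'" .
    moreover have "z \<in> carrier G" using zM M.mem_carrier by blast
    moreover from this have "z = (z \<otimes> (h \<otimes> e)) \<otimes> inv (h \<otimes> e)" by (simp add: m_assoc)
    ultimately have "z = (e' \<otimes> h') \<otimes> inv (h \<otimes> e)" by simp
    moreover have "(e' \<otimes> h') \<otimes> inv (h \<otimes> e) \<in> Ba ((t + D) + (D + s))"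
      using e h m' by (intro ball_mult ball_inv)
    moreover have "(t + D) + (D + s) = s + t + 2 * D" by simp
    ultimately have "z \<in> Ba (s + t + 2 * D)" by metis
    then have "z = \<one>" using zM short by blast
    moreover have "inv m' \<otimes> m = g x \<otimes> z \<otimes> inv (g x)" unfolding z_def by (simp add: m_assoc)
    ultimately have "inv m' \<otimes> m = \<one>" by simp
    then have "m' = m" using c by (metis inv_equality inv_inv inv_closed)
    then show ?case using m' by blast
  qed
  then show ?thesis using m(1) by blast
qed

text \<open>Expects the word reversed, so that the recursion removes its last letter;
  \<open>rev v\<close> is then the prefix at which the last step starts.\<close>

primrec snoc_lift :: "(letter list \<Rightarrow> letter \<Rightarrow> 'a) \<Rightarrow> ('a, 'b) monoid_scheme \<Rightarrow> 'a \<Rightarrow> letter list \<Rightarrow> 'a" where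
  "snoc_lift c G x [] = x"
| "snoc_lift c G x (a # v) = snoc_lift c G x v \<otimes>\<^bsub>G\<^esub> c (rev v) a"

text \<open>The Cayley graph of a free group is a tree, so a short step may be chosen for each edge
  pointing away from the root without any consistency condition. A letter that cancels runs through
  such an edge backwards, and inverses of short steps are short.\<close>

lemma (in ball_group) lift_exists:
  assumes M: "M \<lhd> G"
    and F: "\<And>x. x \<in> carrier (free_group n) \<Longrightarrow> F x \<in> carrier G"
    and F_step: "\<And>x a. x \<in> carrier (free_group n) \<Longrightarrow> snd a < n
      \<Longrightarrow> \<exists>c\<in>Ba A. M #> F (x \<otimes>\<^bsub>free_group n\<^esub> [a]) = M #> (F x \<otimes> c)"
  obtains f where "\<And>x. x \<in> carrier (free_group n) \<Longrightarrow> f x \<in> carrier G"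
    and "\<And>x. x \<in> carrier (free_group n) \<Longrightarrow> M #> f x = M #> F x"
    and "\<And>x a. x \<in> carrier (free_group n) \<Longrightarrow> snd a < n
      \<Longrightarrow> inv f x \<otimes> f (x \<otimes>\<^bsub>free_group n\<^esub> [a]) \<in> Ba A"
proof -
  interpret M: normal M G by fact
  define c where "c = (\<lambda>x a. SOME e. e \<in> Ba A \<and>
    M #> F (x \<otimes>\<^bsub>free_group n\<^esub> [a]) = M #> (F x \<otimes> e))"
  have c: "c x a \<in> Ba A" "M #> F (x \<otimes>\<^bsub>free_group n\<^esub> [a]) = M #> (F x \<otimes> c x a)"
    if "x \<in> carrier (free_group n)" "snd a < n" for x a
    using someI_ex[of "\<lambda>e. e \<in> Ba A \<and> M #> F (x \<otimes>\<^bsub>free_group n\<^esub> [a]) = M #> (F x \<otimes> e)"]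
      F_step[OF that] unfolding c_def by blast+
  define f where "f = (\<lambda>x. snoc_lift c G (F []) (rev x))"
  have f_Nil: "f [] = F []" and f_snoc: "f (x @ [a]) = f x \<otimes> c x a" for x a
    by (simp_all add: f_def)
  have ff: "f x \<in> carrier G \<and> M #> f x = M #> F x" if "x \<in> carrier (free_group n)" for x
    using that
  proof (induction x rule: rev_induct)
    case Nil
    then show ?case using F by (simp add: f_Nil)
  next
    case (snoc a x)
    note x = free_group_snoc[OF snoc.prems]
    have cc: "c x a \<in> carrier G" using c(1)[OF x(1,2)] ball_carrier by blast
    have "M #> (f x \<otimes> c x a) = M #> f x #> c x a"
      using snoc x cc by (intro coset_mult_assoc[symmetric] M.subset) auto
    also have "\<dots> = M #> F x #> c x a" using snoc x by simp
    also have "\<dots> = M #> (F x \<otimes> c x a)"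
      using snoc x cc M.subset F by (simp add: coset_mult_assoc)
    finally show ?case using snoc x cc c(2)[OF x(1,2)] by (simp add: f_snoc)
  qed
  have "inv f x \<otimes> f (x \<otimes>\<^bsub>free_group n\<^esub> [a]) \<in> Ba A"
    if x: "x \<in> carrier (free_group n)" and a: "snd a < n" for x a
    using free_group_mult_letter[OF x a]
  proof
    assume "x \<otimes>\<^bsub>free_group n\<^esub> [a] = x @ [a]"
    then show ?thesis using ff[OF x] c(1)[OF x a] ball_carrier by (simp add: f_snoc)
  next
    assume "\<exists>v. x = v @ [inv_letter a] \<and> x \<otimes>\<^bsub>free_group n\<^esub> [a] = v"
    then obtain v where v: "x = v @ [inv_letter a]" "x \<otimes>\<^bsub>free_group n\<^esub> [a] = v" by blast
    then have v': "v \<in> carrier (free_group n)" "snd (inv_letter a) < n"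
      using free_group_snoc[of v "inv_letter a" n] x by auto
    have e: "c v (inv_letter a) \<in> Ba A" using c(1)[OF v'] .
    have "inv f x \<otimes> f v = inv (c v (inv_letter a))"
      using ff[OF v'(1)] ball_carrier[OF e] by (simp add: v f_snoc inv_mult_group m_assoc)
    then show ?thesis using v e ball_inv by simp
  qed
  then show ?thesis using that[of f] ff by blast
qed

text \<open>
  The kernel of \<open>\<beta>\<close> is generated by the loops of the second quotient that are too short to be seen
  from the first one; \<open>\<beta>\<close> itself is induced by lifting \<open>G\<close> along words.
\<close>

theorem coarse_deck_group:
  fixes N M :: "letter list set" and F G :: "letter list \<Rightarrow> letter list" and A D d k :: nat
  defines "r \<equiv> A * A + 1 + 2 * D"
  assumes N: "N \<lhd> free_group d" and M: "M \<lhd> free_group k"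
    and F: "\<And>x. x \<in> carrier (free_group d) \<Longrightarrow> F x \<in> carrier (free_group k)"
    and G: "\<And>x. x \<in> carrier (free_group k) \<Longrightarrow> G x \<in> carrier (free_group d)"
    and F_step: "\<And>x a. x \<in> carrier (free_group d) \<Longrightarrow> snd a < d \<Longrightarrow> \<exists>c\<in>free_ball k A.
      M #>\<^bsub>free_group k\<^esub> F (x \<otimes>\<^bsub>free_group d\<^esub> [a]) = M #>\<^bsub>free_group k\<^esub> (F x \<otimes>\<^bsub>free_group k\<^esub> c)"
    and G_step: "\<And>x a. x \<in> carrier (free_group k) \<Longrightarrow> snd a < k \<Longrightarrow> \<exists>c\<in>free_ball d A.
      N #>\<^bsub>free_group d\<^esub> G (x \<otimes>\<^bsub>free_group k\<^esub> [a]) = N #>\<^bsub>free_group d\<^esub> (G x \<otimes>\<^bsub>free_group d\<^esub> c)"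
    and F_cong: "\<And>x y. x \<in> carrier (free_group d) \<Longrightarrow> y \<in> carrier (free_group d) \<Longrightarrow>
      N #>\<^bsub>free_group d\<^esub> x = N #>\<^bsub>free_group d\<^esub> y \<Longrightarrow> M #>\<^bsub>free_group k\<^esub> F x = M #>\<^bsub>free_group k\<^esub> F y"
    and G_cong: "\<And>x y. x \<in> carrier (free_group k) \<Longrightarrow> y \<in> carrier (free_group k) \<Longrightarrow>
      M #>\<^bsub>free_group k\<^esub> x = M #>\<^bsub>free_group k\<^esub> y \<Longrightarrow> N #>\<^bsub>free_group d\<^esub> G x = N #>\<^bsub>free_group d\<^esub> G y"
    and FG: "\<And>x. x \<in> carrier (free_group k) \<Longrightarrow> \<exists>h\<in>free_ball k D.
      M #>\<^bsub>free_group k\<^esub> F (G x) = M #>\<^bsub>free_group k\<^esub> (x \<otimes>\<^bsub>free_group k\<^esub> h)"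
    and GF: "\<And>x. x \<in> carrier (free_group d) \<Longrightarrow> \<exists>h\<in>free_ball d D.
      N #>\<^bsub>free_group d\<^esub> G (F x) = N #>\<^bsub>free_group d\<^esub> (x \<otimes>\<^bsub>free_group d\<^esub> h)"
    and short: "N \<inter> free_ball d (A * r + r + 2 * A) \<subseteq> {\<one>\<^bsub>free_group d\<^esub>}"
  obtains \<beta> where "\<beta> ` M = N"
    and "\<And>x y. x \<in> M \<Longrightarrow> y \<in> M \<Longrightarrow> \<beta> (x \<otimes>\<^bsub>free_group k\<^esub> y) = \<beta> x \<otimes>\<^bsub>free_group d\<^esub> \<beta> y"
    and "{x \<in> M. \<beta> x = \<one>\<^bsub>free_group d\<^esub>} = normal_hull (free_group k) (M \<inter> free_ball k r)"
proof -
  define Fd where "Fd = free_group d"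
  define Fk where "Fk = free_group k"
  interpret D: ball_group Fd "free_ball d" unfolding Fd_def by (rule ball_group_free)
  interpret K: ball_group Fk "free_ball k" unfolding Fk_def by (rule ball_group_free)
  interpret N: normal N Fd using N unfolding Fd_def .
  interpret M: normal M Fk using M unfolding Fk_def .
  note folds = Fd_def[symmetric] Fk_def[symmetric]
  have inv1 [simp]: "inv\<^bsub>Fd\<^esub> x \<otimes>\<^bsub>Fd\<^esub> (x \<otimes>\<^bsub>Fd\<^esub> [a]) = [a]" "[a] \<in> carrier Fd"
    if "x \<in> carrier Fd" "snd a < d" for x a using that unfolding Fd_def by (simp_all add: group.inv_mult_cancel group_free_group)
  have letter_k: "[a] \<in> carrier Fk" if "snd a < k" for a using that unfolding Fk_def by simp
  have one_k: "\<one>\<^bsub>Fk\<^esub> = []" and one_d: "\<one>\<^bsub>Fd\<^esub> = []" by (simp_all add: Fk_def Fd_def free_group_simps)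
  have nil_k: "[] \<in> carrier Fk" and nil_d: "[] \<in> carrier Fd" using K.one_closed D.one_closed one_k one_d by auto

  \<comment> \<open>Lifts of the two maps to the free groups\<close>
  obtain \<gamma> where \<gamma>: "\<And>x. x \<in> carrier Fk \<Longrightarrow> \<gamma> x \<in> carrier Fd"
    and \<gamma>_G: "\<And>x. x \<in> carrier Fk \<Longrightarrow> N #>\<^bsub>Fd\<^esub> \<gamma> x = N #>\<^bsub>Fd\<^esub> G x"
    and \<gamma>_step: "\<And>x a. x \<in> carrier Fk \<Longrightarrow> snd a < k \<Longrightarrow> inv\<^bsub>Fd\<^esub> \<gamma> x \<otimes>\<^bsub>Fd\<^esub> \<gamma> (x \<otimes>\<^bsub>Fk\<^esub> [a]) \<in> free_ball d A"
    using D.lift_exists[of N k G A] N.normal_axioms G G_step unfolding folds by blast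
  obtain \<phi> where \<phi>: "\<And>x. x \<in> carrier Fd \<Longrightarrow> \<phi> x \<in> carrier Fk"
    and \<phi>_F: "\<And>x. x \<in> carrier Fd \<Longrightarrow> M #>\<^bsub>Fk\<^esub> \<phi> x = M #>\<^bsub>Fk\<^esub> F x"
    and \<phi>_step: "\<And>x a. x \<in> carrier Fd \<Longrightarrow> snd a < d \<Longrightarrow> inv\<^bsub>Fk\<^esub> \<phi> x \<otimes>\<^bsub>Fk\<^esub> \<phi> (x \<otimes>\<^bsub>Fd\<^esub> [a]) \<in> free_ball k A"
    using K.lift_exists[of M d F A] M.normal_axioms F F_step unfolding folds by blast
  have free_ball_D: "x \<in> free_ball k s \<Longrightarrow> x \<in> carrier Fk \<and> length x \<le> s"
    "y \<in> free_ball d s \<Longrightarrow> y \<in> carrier Fd \<and> length y \<le> s" for x y s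
    by (auto simp: free_ball_def folds)
  have \<gamma>_steps: "inv\<^bsub>Fd\<^esub> \<gamma> x \<otimes>\<^bsub>Fd\<^esub> \<gamma> (x \<otimes>\<^bsub>Fk\<^esub> w) \<in> free_ball d (A * s)"
    if "x \<in> carrier Fk" "w \<in> free_ball k s" for x w s
    using D.steps_ball[of k \<gamma> A x w] \<gamma> \<gamma>_step that free_ball_D(1)[OF that(2)] unfolding folds
    by (meson D.ball_mono mult_le_mono2)
  have \<phi>_steps: "inv\<^bsub>Fk\<^esub> \<phi> x \<otimes>\<^bsub>Fk\<^esub> \<phi> (x \<otimes>\<^bsub>Fd\<^esub> w) \<in> free_ball k (A * s)"
    if "x \<in> carrier Fd" "w \<in> free_ball d s" for x w s
    using K.steps_ball[of d \<phi> A x w] \<phi> \<phi>_step that free_ball_D(2)[OF that(2)] unfolding folds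
    by (meson K.ball_mono mult_le_mono2)
  \<comment> \<open>The radii needed below are \<open>A + A\<close> for the action of
    \<open>M\<close>, \<open>r\<close> for surjectivity and \<open>A * r\<close> for the kernel; all
    are at most the radius in the hypothesis.\<close>
  have short': "N \<inter> free_ball d s \<subseteq> {\<one>\<^bsub>Fd\<^esub>}" if "s \<le> A * r + r + 2 * A" for s
    using short that D.ball_mono unfolding folds by blast

  \<comment> \<open>The homomorphism from \<open>M\<close> to \<open>N\<close>\<close>
  define \<beta> where "\<beta> = (\<lambda>m. \<gamma> m \<otimes>\<^bsub>Fd\<^esub> inv\<^bsub>Fd\<^esub> \<gamma> [])"
  have \<beta>: "\<beta> m \<in> N \<and> (\<forall>y\<in>carrier Fk. \<gamma> (m \<otimes>\<^bsub>Fk\<^esub> y) = \<beta> m \<otimes>\<^bsub>Fd\<^esub> \<gamma> y)" if m: "m \<in> M" for m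
  proof -
    have mk: "m \<in> carrier Fk" using m M.subset by blast
    \<comment> \<open>Rigidity for \<open>\<gamma>\<close> and its translate by \<open>m\<close>,
      with error 0: the ball of radius 0 is trivial, so the two maps differ exactly by an element of
      \<open>N\<close>.\<close>
    have "\<exists>n\<in>N. \<forall>x\<in>carrier Fk. \<exists>h\<in>free_ball d 0. \<gamma> (m \<otimes>\<^bsub>Fk\<^esub> x) = n \<otimes>\<^bsub>Fd\<^esub> \<gamma> x \<otimes>\<^bsub>Fd\<^esub> h"
      unfolding Fk_def
    proof (rule D.rigid[OF N.normal_axioms short'[of "A + A + 2 * 0"]], unfold folds)
      show "inv\<^bsub>Fd\<^esub> \<gamma> (m \<otimes>\<^bsub>Fk\<^esub> x) \<otimes>\<^bsub>Fd\<^esub> \<gamma> (m \<otimes>\<^bsub>Fk\<^esub> (x \<otimes>\<^bsub>Fk\<^esub> [a])) \<in> free_ball d A"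
        if "x \<in> carrier Fk" "snd a < k" for x a
        using \<gamma>_step[of "m \<otimes>\<^bsub>Fk\<^esub> x" a] that mk letter_k[OF that(2)] by (simp add: K.m_assoc)
      fix x assume x: "x \<in> carrier Fk"
      have "M #>\<^bsub>Fk\<^esub> (m \<otimes>\<^bsub>Fk\<^esub> x) = M #>\<^bsub>Fk\<^esub> x"
        using m mk x K.rcos_eq_iff[OF M.is_subgroup, of "m \<otimes>\<^bsub>Fk\<^esub> x" x] by (simp add: K.m_assoc)
      then have "N #>\<^bsub>Fd\<^esub> \<gamma> (m \<otimes>\<^bsub>Fk\<^esub> x) = N #>\<^bsub>Fd\<^esub> \<gamma> x"
        using G_cong[of "m \<otimes>\<^bsub>Fk\<^esub> x" x] \<gamma>_G x mk unfolding folds by simp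
      then show "\<exists>h\<in>free_ball d 0. N #>\<^bsub>Fd\<^esub> \<gamma> (m \<otimes>\<^bsub>Fk\<^esub> x) = N #>\<^bsub>Fd\<^esub> (\<gamma> x \<otimes>\<^bsub>Fd\<^esub> h)"
        using D.ball_one \<gamma>[OF x] by (intro bexI[of _ "\<one>\<^bsub>Fd\<^esub>"]) auto
    qed (use \<gamma> \<gamma>_step mk in auto)
    then obtain n where n: "n \<in> N" "\<And>x. x \<in> carrier Fk \<Longrightarrow> \<exists>h\<in>free_ball d 0. \<gamma> (m \<otimes>\<^bsub>Fk\<^esub> x) = n \<otimes>\<^bsub>Fd\<^esub> \<gamma> x \<otimes>\<^bsub>Fd\<^esub> h"
      by blast
    have n': "\<gamma> (m \<otimes>\<^bsub>Fk\<^esub> x) = n \<otimes>\<^bsub>Fd\<^esub> \<gamma> x" if "x \<in> carrier Fk" for x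
    proof -
      obtain h where "h \<in> free_ball d 0" "\<gamma> (m \<otimes>\<^bsub>Fk\<^esub> x) = n \<otimes>\<^bsub>Fd\<^esub> \<gamma> x \<otimes>\<^bsub>Fd\<^esub> h" using n(2)[OF \<open>x \<in> carrier Fk\<close>] by blast
      moreover from this have "h = \<one>\<^bsub>Fd\<^esub>" by (simp add: free_ball_def one_d)
      ultimately show ?thesis using n(1) N.mem_carrier \<gamma>[OF that] by simp
    qed
    have "\<gamma> m = n \<otimes>\<^bsub>Fd\<^esub> \<gamma> []"
      using n'[OF nil_k] K.r_one[OF mk] one_k by simp
    then have "\<beta> m = n"
      unfolding \<beta>_def using n(1) N.mem_carrier \<gamma>[OF nil_k] by (simp add: D.m_assoc)
    then show ?thesis using n n' by simp
  qed
  have \<beta>_mult: "\<beta> (x \<otimes>\<^bsub>Fk\<^esub> y) = \<beta> x \<otimes>\<^bsub>Fd\<^esub> \<beta> y" if "x \<in> M" "y \<in> M" for x y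
  proof -
    have c: "y \<in> carrier Fk" "\<beta> x \<in> carrier Fd" using that M.subset \<beta> N.mem_carrier by auto
    have "\<gamma> (x \<otimes>\<^bsub>Fk\<^esub> y) = \<beta> x \<otimes>\<^bsub>Fd\<^esub> \<gamma> y" using \<beta>[OF that(1)] c by blast
    moreover have e: "\<beta> z = \<gamma> z \<otimes>\<^bsub>Fd\<^esub> inv\<^bsub>Fd\<^esub> \<gamma> []" for z by (simp add: \<beta>_def)
    ultimately show ?thesis
      using c \<gamma>[OF c(1)] \<gamma>[OF nil_k] by (simp add: e[of "x \<otimes>\<^bsub>Fk\<^esub> y"] e[of y] D.m_assoc)
  qed

  \<comment> \<open>Surjectivity onto \<open>N\<close>\<close>
  have surj: "\<exists>m\<in>M. \<beta> m = n" if n: "n \<in> N" for n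
  proof -
    \<comment> \<open>Rigidity for the composite of the lifts and the identity, with steps
      \<open>A * A\<close> and 1 and error \<open>D\<close>; this is the origin of
      \<open>r\<close>.\<close>
    have "\<exists>n0\<in>N. \<forall>x\<in>carrier (free_group d). \<exists>h\<in>free_ball d D. \<gamma> (\<phi> x) = n0 \<otimes>\<^bsub>Fd\<^esub> x \<otimes>\<^bsub>Fd\<^esub> h"
    proof (rule D.rigid[OF N.normal_axioms short'[of "A * A + 1 + 2 * D"]], unfold folds)
      fix x and a :: letter assume x: "x \<in> carrier Fd" "snd a < d"
      have p: "\<phi> x \<in> carrier Fk" "\<phi> (x \<otimes>\<^bsub>Fd\<^esub> [a]) \<in> carrier Fk" using \<phi> x by simp_all
      show "inv\<^bsub>Fd\<^esub> \<gamma> (\<phi> x) \<otimes>\<^bsub>Fd\<^esub> \<gamma> (\<phi> (x \<otimes>\<^bsub>Fd\<^esub> [a])) \<in> free_ball d (A * A)"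
        using \<gamma>_steps[OF p(1) \<phi>_step[OF x]] p by simp
      show "inv\<^bsub>Fd\<^esub> x \<otimes>\<^bsub>Fd\<^esub> (x \<otimes>\<^bsub>Fd\<^esub> [a]) \<in> free_ball d 1"
        using x by (simp add: free_ball_def)
    next
      fix x assume x: "x \<in> carrier Fd"
      have "N #>\<^bsub>Fd\<^esub> \<gamma> (\<phi> x) = N #>\<^bsub>Fd\<^esub> G (F x)"
        using \<gamma>_G[OF \<phi>[OF x]] G_cong[of "\<phi> x" "F x"] \<phi>_F[OF x] \<phi>[OF x] F x unfolding folds by simp
      then show "\<exists>h\<in>free_ball d D. N #>\<^bsub>Fd\<^esub> \<gamma> (\<phi> x) = N #>\<^bsub>Fd\<^esub> (x \<otimes>\<^bsub>Fd\<^esub> h)"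
        using GF[of x] x unfolding folds by simp
    qed (use \<gamma> \<phi> in \<open>auto simp: r_def\<close>)
    then obtain n0 where n0: "n0 \<in> N"
      "\<And>x. x \<in> carrier Fd \<Longrightarrow> \<exists>h\<in>free_ball d D. \<gamma> (\<phi> x) = n0 \<otimes>\<^bsub>Fd\<^esub> x \<otimes>\<^bsub>Fd\<^esub> h"
      unfolding folds by blast
    \<comment> \<open>Compensates the translation by \<open>n0\<close>, since
      \<open>n0 n' = n n0\<close>.\<close>
    define n' where "n' = inv\<^bsub>Fd\<^esub> n0 \<otimes>\<^bsub>Fd\<^esub> n \<otimes>\<^bsub>Fd\<^esub> n0"
    have n': "n' \<in> N" "n' \<in> carrier Fd" "n0 \<in> carrier Fd" "n \<in> carrier Fd"
      unfolding n'_def using n n0(1) N.mem_carrier by simp_all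
    obtain h h0 where h: "h \<in> free_ball d D" "\<gamma> (\<phi> n') = n0 \<otimes>\<^bsub>Fd\<^esub> n' \<otimes>\<^bsub>Fd\<^esub> h"
      "h0 \<in> free_ball d D" "\<gamma> (\<phi> []) = n0 \<otimes>\<^bsub>Fd\<^esub> [] \<otimes>\<^bsub>Fd\<^esub> h0"
      using n0(2) n'(2) nil_d by meson
    note hc = D.ball_carrier[OF h(1)] D.ball_carrier[OF h(3)]
    define m where "m = \<phi> n' \<otimes>\<^bsub>Fk\<^esub> inv\<^bsub>Fk\<^esub> \<phi> []"
    have "N #>\<^bsub>Fd\<^esub> n' = N #>\<^bsub>Fd\<^esub> []"
      using n' D.rcos_eq_iff[OF N.is_subgroup n'(2) nil_d] one_d D.inv_one D.r_one[OF n'(2)] by simp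
    then have "M #>\<^bsub>Fk\<^esub> \<phi> n' = M #>\<^bsub>Fk\<^esub> \<phi> []"
      using F_cong[of n' "[]"] \<phi>_F n' nil_d unfolding folds by simp
    then have m: "m \<in> M"
      unfolding m_def using K.rcos_eq_iff[OF M.is_subgroup] \<phi> n'(2) nil_d by blast
    have "\<phi> n' = m \<otimes>\<^bsub>Fk\<^esub> \<phi> []" unfolding m_def using \<phi> n'(2) nil_d by (simp add: K.m_assoc)
    then have eq: "n0 \<otimes>\<^bsub>Fd\<^esub> n' \<otimes>\<^bsub>Fd\<^esub> h = \<beta> m \<otimes>\<^bsub>Fd\<^esub> (n0 \<otimes>\<^bsub>Fd\<^esub> h0)"
      using \<beta>[OF m] \<phi>[OF nil_d] h(2,4) n' one_d D.r_one[OF n'(3)] by simp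
    have \<beta>m: "\<beta> m \<in> N" "\<beta> m \<in> carrier Fd" using \<beta>[OF m] N.mem_carrier by auto
    \<comment> \<open>Measures how far \<open>\<beta> m\<close> is from \<open>n\<close>. It lies in
      \<open>N\<close> and has length at most \<open>2 * D\<close>, hence is trivial.\<close>
    define z where "z = h \<otimes>\<^bsub>Fd\<^esub> inv\<^bsub>Fd\<^esub> h0"
    have "n0 \<otimes>\<^bsub>Fd\<^esub> n' \<otimes>\<^bsub>Fd\<^esub> z = (n0 \<otimes>\<^bsub>Fd\<^esub> n' \<otimes>\<^bsub>Fd\<^esub> h) \<otimes>\<^bsub>Fd\<^esub> inv\<^bsub>Fd\<^esub> h0"
      unfolding z_def using hc n' by (simp add: D.m_assoc)
    also have "\<dots> = \<beta> m \<otimes>\<^bsub>Fd\<^esub> n0" unfolding eq using hc n' \<beta>m by (simp add: D.m_assoc)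
    finally have eq': "n0 \<otimes>\<^bsub>Fd\<^esub> n' \<otimes>\<^bsub>Fd\<^esub> z = \<beta> m \<otimes>\<^bsub>Fd\<^esub> n0" .
    have zc: "z \<in> carrier Fd" unfolding z_def using hc by simp
    have "z = inv\<^bsub>Fd\<^esub> (n0 \<otimes>\<^bsub>Fd\<^esub> n') \<otimes>\<^bsub>Fd\<^esub> (n0 \<otimes>\<^bsub>Fd\<^esub> n' \<otimes>\<^bsub>Fd\<^esub> z)" using zc n' by simp
    also have "\<dots> = inv\<^bsub>Fd\<^esub> (n0 \<otimes>\<^bsub>Fd\<^esub> n') \<otimes>\<^bsub>Fd\<^esub> (\<beta> m \<otimes>\<^bsub>Fd\<^esub> n0)" using eq' by simp
    finally have "z \<in> N" using n0(1) n'(1) \<beta>m(1) by simp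
    moreover have "z \<in> free_ball d (D + D)" unfolding z_def using h D.ball_mult D.ball_inv by blast
    ultimately have "z = \<one>\<^bsub>Fd\<^esub>" using short'[of "D + D"] by (auto simp: r_def)
    then have "n0 \<otimes>\<^bsub>Fd\<^esub> n' = \<beta> m \<otimes>\<^bsub>Fd\<^esub> n0" using eq' n' by simp
    moreover have "n0 \<otimes>\<^bsub>Fd\<^esub> n' = n \<otimes>\<^bsub>Fd\<^esub> n0" unfolding n'_def using n' by (simp add: D.m_assoc)
    ultimately have "\<beta> m = n" using \<beta>m n' by simp
    then show ?thesis using m by blast
  qed

  \<comment> \<open>The kernel of \<open>\<beta>\<close>\<close>
  define L where "L = normal_hull Fk (M \<inter> free_ball k r)"
  have L: "L \<lhd> Fk" unfolding L_def by (rule K.normal_hull_normal) (use M.subset in blast)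
  have L_sub: "M \<inter> free_ball k r \<subseteq> L" unfolding L_def by (rule K.normal_hull_subset)
  have LM: "L \<subseteq> M" unfolding L_def by (rule K.normal_hull_least) (use M.normal_axioms in auto)
  interpret L: normal L Fk by fact
  have ker1: "\<beta> m = \<one>\<^bsub>Fd\<^esub>" if "m \<in> L" for m
  proof -
    \<comment> \<open>Since \<open>\<beta>\<close> matters only on \<open>M\<close>, normality of
      its kernel in the whole free group is not immediate. The elements all of whose conjugates are
      killed do form a normal subgroup, and it remains to find the short elements of
      \<open>M\<close> in it.\<close>
    define E where "E = {m \<in> M. \<forall>g\<in>carrier Fk. \<beta> (g \<otimes>\<^bsub>Fk\<^esub> m \<otimes>\<^bsub>Fk\<^esub> inv\<^bsub>Fk\<^esub> g) = \<one>\<^bsub>Fd\<^esub>}"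
    have \<beta>1: "\<beta> \<one>\<^bsub>Fk\<^esub> = \<one>\<^bsub>Fd\<^esub>" unfolding \<beta>_def one_k using \<gamma>[OF nil_k] by simp
    have \<beta>c: "\<beta> x \<in> carrier Fd" if "x \<in> M" for x using \<beta>[OF that] N.mem_carrier by blast
    have conj: "g \<otimes>\<^bsub>Fk\<^esub> x \<otimes>\<^bsub>Fk\<^esub> inv\<^bsub>Fk\<^esub> g \<in> M" if "x \<in> M" "g \<in> carrier Fk" for x g
      using M.inv_op_closed2 that by simp
    have E_sub: "subgroup E Fk"
    proof (rule K.subgroupI)
      have "\<one>\<^bsub>Fk\<^esub> \<in> E" unfolding E_def using \<beta>1 by simp
      then show "E \<noteq> {}" by blast
    next
      fix x assume "x \<in> E"
      then have x: "x \<in> M" "\<And>g. g \<in> carrier Fk \<Longrightarrow> \<beta> (g \<otimes>\<^bsub>Fk\<^esub> x \<otimes>\<^bsub>Fk\<^esub> inv\<^bsub>Fk\<^esub> g) = \<one>\<^bsub>Fd\<^esub>" unfolding E_def by auto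
      have "\<beta> (g \<otimes>\<^bsub>Fk\<^esub> inv\<^bsub>Fk\<^esub> x \<otimes>\<^bsub>Fk\<^esub> inv\<^bsub>Fk\<^esub> g) = \<one>\<^bsub>Fd\<^esub>" if g: "g \<in> carrier Fk" for g
      proof -
        let ?u = "g \<otimes>\<^bsub>Fk\<^esub> inv\<^bsub>Fk\<^esub> x \<otimes>\<^bsub>Fk\<^esub> inv\<^bsub>Fk\<^esub> g"
        let ?v = "g \<otimes>\<^bsub>Fk\<^esub> x \<otimes>\<^bsub>Fk\<^esub> inv\<^bsub>Fk\<^esub> g"
        have "?u \<otimes>\<^bsub>Fk\<^esub> ?v = \<one>\<^bsub>Fk\<^esub>" using g x(1) M.mem_carrier by (simp add: K.m_assoc K.inv_mult_cancel)
        then show ?thesis using \<beta>_mult[of ?u ?v] conj[of "inv\<^bsub>Fk\<^esub> x" g] conj[of x g] x g \<beta>1 \<beta>c by simp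
      qed
      then show "inv\<^bsub>Fk\<^esub> x \<in> E" using x unfolding E_def by simp
    next
      fix x y assume "x \<in> E" "y \<in> E"
      then have xy: "x \<in> M" "y \<in> M" "\<And>g. g \<in> carrier Fk \<Longrightarrow> \<beta> (g \<otimes>\<^bsub>Fk\<^esub> x \<otimes>\<^bsub>Fk\<^esub> inv\<^bsub>Fk\<^esub> g) = \<one>\<^bsub>Fd\<^esub>"
        "\<And>g. g \<in> carrier Fk \<Longrightarrow> \<beta> (g \<otimes>\<^bsub>Fk\<^esub> y \<otimes>\<^bsub>Fk\<^esub> inv\<^bsub>Fk\<^esub> g) = \<one>\<^bsub>Fd\<^esub>" unfolding E_def by auto
      have "\<beta> (g \<otimes>\<^bsub>Fk\<^esub> (x \<otimes>\<^bsub>Fk\<^esub> y) \<otimes>\<^bsub>Fk\<^esub> inv\<^bsub>Fk\<^esub> g) = \<one>\<^bsub>Fd\<^esub>" if g: "g \<in> carrier Fk" for g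
      proof -
        have "g \<otimes>\<^bsub>Fk\<^esub> (x \<otimes>\<^bsub>Fk\<^esub> y) \<otimes>\<^bsub>Fk\<^esub> inv\<^bsub>Fk\<^esub> g
          = (g \<otimes>\<^bsub>Fk\<^esub> x \<otimes>\<^bsub>Fk\<^esub> inv\<^bsub>Fk\<^esub> g) \<otimes>\<^bsub>Fk\<^esub> (g \<otimes>\<^bsub>Fk\<^esub> y \<otimes>\<^bsub>Fk\<^esub> inv\<^bsub>Fk\<^esub> g)"
          using g xy(1,2) M.mem_carrier by (simp add: K.m_assoc K.inv_mult_cancel)
        then show ?thesis using \<beta>_mult[OF conj[OF xy(1) g] conj[OF xy(2) g]] xy(3,4)[OF g] by simp
      qed
      then show "x \<otimes>\<^bsub>Fk\<^esub> y \<in> E" using xy(1,2) unfolding E_def by simp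
    qed (use M.subset in \<open>auto simp: E_def\<close>)
    have "E \<lhd> Fk"
      unfolding K.normal_inv_iff
    proof (intro conjI ballI E_sub)
      fix y x assume y: "y \<in> carrier Fk" and "x \<in> E"
      then have x: "x \<in> M" "x \<in> carrier Fk" "\<And>g. g \<in> carrier Fk \<Longrightarrow> \<beta> (g \<otimes>\<^bsub>Fk\<^esub> x \<otimes>\<^bsub>Fk\<^esub> inv\<^bsub>Fk\<^esub> g) = \<one>\<^bsub>Fd\<^esub>"
        using M.subset unfolding E_def by auto
      have "\<beta> (g \<otimes>\<^bsub>Fk\<^esub> (y \<otimes>\<^bsub>Fk\<^esub> x \<otimes>\<^bsub>Fk\<^esub> inv\<^bsub>Fk\<^esub> y) \<otimes>\<^bsub>Fk\<^esub> inv\<^bsub>Fk\<^esub> g) = \<one>\<^bsub>Fd\<^esub>" if g: "g \<in> carrier Fk" for g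
        using x(3)[of "g \<otimes>\<^bsub>Fk\<^esub> y"] g y x(2) by (simp add: K.m_assoc K.inv_mult_group)
      then show "y \<otimes>\<^bsub>Fk\<^esub> x \<otimes>\<^bsub>Fk\<^esub> inv\<^bsub>Fk\<^esub> y \<in> E" using conj[OF x(1) y] unfolding E_def by simp
    qed
    moreover have "M \<inter> free_ball k r \<subseteq> E"
    proof
      fix x assume "x \<in> M \<inter> free_ball k r"
      then have x: "x \<in> M" "x \<in> free_ball k r" "x \<in> carrier Fk" using M.subset by auto
      have "\<beta> (g \<otimes>\<^bsub>Fk\<^esub> x \<otimes>\<^bsub>Fk\<^esub> inv\<^bsub>Fk\<^esub> g) = \<one>\<^bsub>Fd\<^esub>" if g: "g \<in> carrier Fk" for g
      proof -
        define m where "m = g \<otimes>\<^bsub>Fk\<^esub> x \<otimes>\<^bsub>Fk\<^esub> inv\<^bsub>Fk\<^esub> g"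
        have m: "m \<in> M" unfolding m_def using conj[OF x(1) g] .
        have "m \<otimes>\<^bsub>Fk\<^esub> g = g \<otimes>\<^bsub>Fk\<^esub> x" unfolding m_def using g x(3) by (simp add: K.m_assoc)
        then have e: "\<gamma> (g \<otimes>\<^bsub>Fk\<^esub> x) = \<beta> m \<otimes>\<^bsub>Fd\<^esub> \<gamma> g" using \<beta>[OF m] g by metis
        \<comment> \<open>The lift of the loop \<open>x\<close> read from the base point
          \<open>g\<close>: an element of \<open>N\<close> of length at most
          \<open>A * r\<close>.\<close>
        define z where "z = inv\<^bsub>Fd\<^esub> \<gamma> g \<otimes>\<^bsub>Fd\<^esub> (\<beta> m \<otimes>\<^bsub>Fd\<^esub> \<gamma> g)"
        have "z \<in> free_ball d (A * r)" unfolding z_def using \<gamma>_steps[OF g x(2)] e by simp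
        moreover have "z \<in> N" unfolding z_def
          using N.inv_op_closed1[of "\<gamma> g" "\<beta> m"] \<beta>[OF m] \<gamma>[OF g] \<beta>c[OF m] by (simp add: D.m_assoc)
        ultimately have "z = \<one>\<^bsub>Fd\<^esub>" using short'[of "A * r"] by auto
        moreover have "\<beta> m = \<gamma> g \<otimes>\<^bsub>Fd\<^esub> z \<otimes>\<^bsub>Fd\<^esub> inv\<^bsub>Fd\<^esub> \<gamma> g"
          unfolding z_def using \<beta>c[OF m] \<gamma>[OF g] by (simp add: D.m_assoc D.inv_mult_cancel)
        ultimately have "\<beta> m = \<one>\<^bsub>Fd\<^esub>" using \<gamma>[OF g] by simp
        then show ?thesis unfolding m_def .
      qed
      then show "x \<in> E" using x(1) unfolding E_def by simp
    qed
    ultimately have "L \<subseteq> E" unfolding L_def by (rule K.normal_hull_least)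
    then have "\<beta> (\<one>\<^bsub>Fk\<^esub> \<otimes>\<^bsub>Fk\<^esub> m \<otimes>\<^bsub>Fk\<^esub> inv\<^bsub>Fk\<^esub> \<one>\<^bsub>Fk\<^esub>) = \<one>\<^bsub>Fd\<^esub>"
      using that K.one_closed unfolding E_def by blast
    then show ?thesis using that LM M.mem_carrier by (simp add: subset_iff)
  qed

  have ker2: "m \<in> L" if m: "m \<in> M" "\<beta> m = \<one>\<^bsub>Fd\<^esub>" for m
  proof -
    \<comment> \<open>Modulo \<open>L\<close> the image of \<open>M\<close> has no short elements
      except the identity, so rigidity applies there to the composite in the other order.\<close>
    define Q where "Q = Fk Mod L"
    define q where "q = (\<lambda>x. L #>\<^bsub>Fk\<^esub> x)"
    interpret Q: ball_group Q "\<lambda>s. q ` free_ball k s"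
      unfolding Q_def q_def by (rule K.ball_group_Mod[OF L])
    interpret q: group_hom Fk Q q
      using L.r_coset_hom_Mod K.is_group Q.is_group unfolding Q_def q_def
      by (simp add: group_hom_def group_hom_axioms_def)
    have q_surj: "q ` carrier Fk = carrier Q" unfolding q_def Q_def by (simp add: carrier_FactGroup)
    have qM: "q ` M \<lhd> Q"
      using normal.surj_hom_normal_subgroup[OF M.normal_axioms q.group_hom_axioms q_surj] .
    have q_eq: "q x = q y \<longleftrightarrow> x \<otimes>\<^bsub>Fk\<^esub> inv\<^bsub>Fk\<^esub> y \<in> L" if "x \<in> carrier Fk" "y \<in> carrier Fk" for x y
      unfolding q_def using K.rcos_eq_iff[OF L.is_subgroup that] .
    have q_one: "q x = \<one>\<^bsub>Q\<^esub> \<longleftrightarrow> x \<in> L" if "x \<in> carrier Fk" for x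
      unfolding q_def Q_def using K.rcos_eq_self_iff[OF L.is_subgroup that] by simp
    have qshort: "q ` M \<inter> q ` free_ball k (A * A + 1 + 2 * D) \<subseteq> {\<one>\<^bsub>Q\<^esub>}"
    proof
      fix X assume "X \<in> q ` M \<inter> q ` free_ball k (A * A + 1 + 2 * D)"
      then obtain x b where x: "x \<in> M" "b \<in> free_ball k r" "X = q x" "q b = q x" by (auto simp: r_def)
      then have c: "x \<in> carrier Fk" "b \<in> carrier Fk" using M.subset K.ball_carrier by blast+
      then have "b \<otimes>\<^bsub>Fk\<^esub> inv\<^bsub>Fk\<^esub> x \<in> M" using q_eq x LM by blast
      then have "b \<otimes>\<^bsub>Fk\<^esub> inv\<^bsub>Fk\<^esub> x \<otimes>\<^bsub>Fk\<^esub> x \<in> M" using x(1) by blast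
      then have "b \<in> M" using c by (simp add: K.m_assoc)
      then have "b \<in> L" using L_sub x(2) by blast
      then show "X \<in> {\<one>\<^bsub>Q\<^esub>}" using q_one[OF c(2)] x by simp
    qed
    have "\<exists>X\<in>q ` M. \<forall>x\<in>carrier (free_group k). \<exists>H\<in>q ` free_ball k D.
        q (\<phi> (\<gamma> x)) = X \<otimes>\<^bsub>Q\<^esub> q x \<otimes>\<^bsub>Q\<^esub> H"
    proof (rule Q.rigid[OF qM qshort], unfold folds)
      fix x and a :: letter assume x: "x \<in> carrier Fk" "snd a < k"
      note xa = letter_k[OF x(2)] K.m_closed[OF x(1) letter_k[OF x(2)]]
      have p: "\<gamma> x \<in> carrier Fd" "\<gamma> (x \<otimes>\<^bsub>Fk\<^esub> [a]) \<in> carrier Fd" using \<gamma> x xa by simp_all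
      have "inv\<^bsub>Fk\<^esub> \<phi> (\<gamma> x) \<otimes>\<^bsub>Fk\<^esub> \<phi> (\<gamma> (x \<otimes>\<^bsub>Fk\<^esub> [a])) \<in> free_ball k (A * A)"
        using \<phi>_steps[OF p(1) \<gamma>_step[OF x]] p by (simp add: D.inv_mult_cancel)
      moreover have "inv\<^bsub>Q\<^esub> q (\<phi> (\<gamma> x)) \<otimes>\<^bsub>Q\<^esub> q (\<phi> (\<gamma> (x \<otimes>\<^bsub>Fk\<^esub> [a])))
          = q (inv\<^bsub>Fk\<^esub> \<phi> (\<gamma> x) \<otimes>\<^bsub>Fk\<^esub> \<phi> (\<gamma> (x \<otimes>\<^bsub>Fk\<^esub> [a])))"
        using \<phi>[OF p(1)] \<phi>[OF p(2)] by simp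
      ultimately show "inv\<^bsub>Q\<^esub> q (\<phi> (\<gamma> x)) \<otimes>\<^bsub>Q\<^esub> q (\<phi> (\<gamma> (x \<otimes>\<^bsub>Fk\<^esub> [a]))) \<in> q ` free_ball k (A * A)"
        by simp
      have "inv\<^bsub>Q\<^esub> q x \<otimes>\<^bsub>Q\<^esub> q (x \<otimes>\<^bsub>Fk\<^esub> [a]) = q [a]"
        using x xa q.hom_closed by simp
      moreover have "[a] \<in> free_ball k 1" using xa by (simp add: free_ball_def folds)
      ultimately show "inv\<^bsub>Q\<^esub> q x \<otimes>\<^bsub>Q\<^esub> q (x \<otimes>\<^bsub>Fk\<^esub> [a]) \<in> q ` free_ball k 1" by simp
    next
      fix x assume x: "x \<in> carrier Fk"
      have p: "\<phi> (\<gamma> x) \<in> carrier Fk" using \<phi> \<gamma> x by simp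
      have "M #>\<^bsub>Fk\<^esub> \<phi> (\<gamma> x) = M #>\<^bsub>Fk\<^esub> F (G x)"
        using \<phi>_F[OF \<gamma>[OF x]] F_cong[of "\<gamma> x" "G x"] \<gamma>_G[OF x] \<gamma>[OF x] G x unfolding folds by simp
      then obtain h where h: "h \<in> free_ball k D" "M #>\<^bsub>Fk\<^esub> \<phi> (\<gamma> x) = M #>\<^bsub>Fk\<^esub> (x \<otimes>\<^bsub>Fk\<^esub> h)"
        using FG[of x] x unfolding folds by auto
      have hc: "h \<in> carrier Fk" using K.ball_carrier h by blast
      then have "\<phi> (\<gamma> x) \<otimes>\<^bsub>Fk\<^esub> inv\<^bsub>Fk\<^esub> (x \<otimes>\<^bsub>Fk\<^esub> h) \<in> M"
        using K.rcos_eq_iff[OF M.is_subgroup p, of "x \<otimes>\<^bsub>Fk\<^esub> h"] h x by simp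
      then have "q (\<phi> (\<gamma> x)) \<otimes>\<^bsub>Q\<^esub> inv\<^bsub>Q\<^esub> (q x \<otimes>\<^bsub>Q\<^esub> q h) \<in> q ` M"
        using p x hc by (metis (no_types, lifting) K.inv_closed K.m_closed image_eqI q.hom_inv q.hom_mult)
      then have "q ` M #>\<^bsub>Q\<^esub> q (\<phi> (\<gamma> x)) = q ` M #>\<^bsub>Q\<^esub> (q x \<otimes>\<^bsub>Q\<^esub> q h)"
        using Q.rcos_eq_iff[OF normal_imp_subgroup[OF qM], of "q (\<phi> (\<gamma> x))" "q x \<otimes>\<^bsub>Q\<^esub> q h"] p x hc q.hom_closed by simp
      then show "\<exists>h\<in>q ` free_ball k D. q ` M #>\<^bsub>Q\<^esub> q (\<phi> (\<gamma> x)) = q ` M #>\<^bsub>Q\<^esub> (q x \<otimes>\<^bsub>Q\<^esub> h)"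
        using h(1) by blast
    qed (use \<gamma> \<phi> q.hom_closed in auto)
    then obtain X where X: "X \<in> q ` M" "\<And>x. x \<in> carrier Fk \<Longrightarrow> \<exists>H\<in>q ` free_ball k D.
        q (\<phi> (\<gamma> x)) = X \<otimes>\<^bsub>Q\<^esub> q x \<otimes>\<^bsub>Q\<^esub> H" unfolding folds by blast
    have mk: "m \<in> carrier Fk" using m M.subset by blast
    obtain h h0 where h: "h \<in> free_ball k D" "q (\<phi> (\<gamma> m)) = X \<otimes>\<^bsub>Q\<^esub> q m \<otimes>\<^bsub>Q\<^esub> q h"
      "h0 \<in> free_ball k D" "q (\<phi> (\<gamma> [])) = X \<otimes>\<^bsub>Q\<^esub> q [] \<otimes>\<^bsub>Q\<^esub> q h0"
      using X(2)[OF mk] X(2)[OF nil_k] by blast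
    have hc: "h \<in> carrier Fk" "h0 \<in> carrier Fk" "X \<in> carrier Q"
      using K.ball_carrier h X(1) M.subset q.hom_closed by blast+
    \<comment> \<open>An element of the kernel does not move the base point under
      \<open>\<gamma>\<close>, hence not under the composite either. So modulo \<open>L\<close> it
      is the inverse of \<open>h\<close> times the inverse of \<open>h0\<close>, which has length at
      most \<open>2 * D\<close>, lies in \<open>M\<close> and therefore in \<open>L\<close>.\<close>
    have "\<gamma> (m \<otimes>\<^bsub>Fk\<^esub> []) = \<gamma> []" using \<beta>[OF m(1)] m(2) nil_k \<gamma>[OF nil_k] by simp
    then have "\<gamma> m = \<gamma> []" using K.r_one[OF mk] one_k by simp
    then have "X \<otimes>\<^bsub>Q\<^esub> (q m \<otimes>\<^bsub>Q\<^esub> q h) = X \<otimes>\<^bsub>Q\<^esub> (q [] \<otimes>\<^bsub>Q\<^esub> q h0)"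
      using h(2,4) hc mk nil_k q.hom_closed by (simp add: Q.m_assoc)
    then have "q m \<otimes>\<^bsub>Q\<^esub> q h = q [] \<otimes>\<^bsub>Q\<^esub> q h0"
      using hc mk nil_k q.hom_closed by simp
    then have "q (m \<otimes>\<^bsub>Fk\<^esub> h) = q h0" using q.hom_one hc mk q.hom_closed one_k by simp
    then have "m \<otimes>\<^bsub>Fk\<^esub> (h \<otimes>\<^bsub>Fk\<^esub> inv\<^bsub>Fk\<^esub> h0) \<in> L"
      using q_eq[of "m \<otimes>\<^bsub>Fk\<^esub> h" h0] mk hc by (simp add: K.m_assoc)
    then have "inv\<^bsub>Fk\<^esub> m \<otimes>\<^bsub>Fk\<^esub> (m \<otimes>\<^bsub>Fk\<^esub> (h \<otimes>\<^bsub>Fk\<^esub> inv\<^bsub>Fk\<^esub> h0)) \<in> M" using m(1) LM by blast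
    then have "h \<otimes>\<^bsub>Fk\<^esub> inv\<^bsub>Fk\<^esub> h0 \<in> M" using mk hc by (simp add: K.inv_mult_cancel)
    moreover have "h \<otimes>\<^bsub>Fk\<^esub> inv\<^bsub>Fk\<^esub> h0 \<in> free_ball k (D + D)" using h K.ball_mult K.ball_inv by blast
    then have "h \<otimes>\<^bsub>Fk\<^esub> inv\<^bsub>Fk\<^esub> h0 \<in> free_ball k r" by (rule K.ball_mono) (simp add: r_def)
    ultimately have hL: "h \<otimes>\<^bsub>Fk\<^esub> inv\<^bsub>Fk\<^esub> h0 \<in> L" using L_sub by blast
    have "m = (m \<otimes>\<^bsub>Fk\<^esub> (h \<otimes>\<^bsub>Fk\<^esub> inv\<^bsub>Fk\<^esub> h0)) \<otimes>\<^bsub>Fk\<^esub> inv\<^bsub>Fk\<^esub> (h \<otimes>\<^bsub>Fk\<^esub> inv\<^bsub>Fk\<^esub> h0)"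
      using mk hc by (simp add: K.m_assoc)
    also have "\<dots> \<in> L" using \<open>m \<otimes>\<^bsub>Fk\<^esub> (h \<otimes>\<^bsub>Fk\<^esub> inv\<^bsub>Fk\<^esub> h0) \<in> L\<close> hL by blast
    finally show ?thesis .
  qed
  show ?thesis
  proof (rule that[of \<beta>])
    show "\<beta> ` M = N" using \<beta> surj by blast
    show "{x \<in> M. \<beta> x = \<one>\<^bsub>free_group d\<^esub>} = normal_hull (free_group k) (M \<inter> free_ball k r)"
      using ker1 ker2 LM unfolding folds L_def by blast
  qed (use \<beta>_mult in \<open>auto simp: folds\<close>)
qed

section \<open>Comparing indices through deck groups\<close>

context group
begin

lemma finite_cosets_trans:
  assumes L: "subgroup L G" and H: "subgroup H G" and J: "subgroup J G"
    and "H \<subseteq> L" and finH: "finite ((\<lambda>x. H #> x) ` L)" and finJ: "finite ((\<lambda>x. J #> x) ` H)"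
  shows "finite ((\<lambda>x. J #> x) ` L)"
proof -
  have sub: "L \<subseteq> carrier G" "H \<subseteq> carrier G" "J \<subseteq> carrier G"
    using subgroup.subset L H J by blast+
  define t where "t = (\<lambda>X. SOME x. x \<in> L \<and> H #> x = X)"
  have "(\<lambda>x. J #> x) ` L
      \<subseteq> (\<lambda>(Y, X). Y #> t X) ` ((\<lambda>x. J #> x) ` H \<times> (\<lambda>x. H #> x) ` L)"
  proof (rule image_subsetI)
    fix x assume x: "x \<in> L"
    then have "\<exists>y. y \<in> L \<and> H #> y = H #> x" by blast
    from someI_ex[OF this] have t: "t (H #> x) \<in> L" "H #> t (H #> x) = H #> x"
      unfolding t_def by auto
    let ?y = "t (H #> x)"
    have c: "x \<in> carrier G" "?y \<in> carrier G" using x t sub by auto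
    have h: "x \<otimes> inv ?y \<in> H" using rcos_eq_iff[OF H c] t by simp
    have "J #> (x \<otimes> inv ?y) #> ?y = J #> x"
      using c sub by (simp add: coset_mult_assoc m_assoc)
    then show "J #> x \<in> (\<lambda>(Y, X). Y #> t X) ` ((\<lambda>x. J #> x) ` H \<times> (\<lambda>x. H #> x) ` L)"
      using h x by (intro image_eqI[of _ _ "(J #> (x \<otimes> inv ?y), H #> x)"]) auto
  qed
  then show ?thesis using finH finJ by (meson finite_SigmaI finite_surj)
qed

lemma finite_cosets_Int:
  assumes "subgroup H G" "subgroup H' G" "finite ((\<lambda>x. H #> x) ` carrier G)"
    "finite ((\<lambda>x. H' #> x) ` carrier G)"
  shows "finite ((\<lambda>x. (H \<inter> H') #> x) ` carrier G)"
proof -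
  have "finite ((\<lambda>x. (H #> x, H' #> x)) ` carrier G)"
    by (rule finite_subset[of _ "(\<lambda>x. H #> x) ` carrier G \<times> (\<lambda>x. H' #> x) ` carrier G"])
      (use assms in auto)
  then show ?thesis
    using ridx_eq_card_image(2)[OF subgroups_Inter_pair[OF assms(1,2)], of "carrier G" "\<lambda>x. (H #> x, H' #> x)"]
      rcos_eq_iff[OF assms(1)] rcos_eq_iff[OF assms(2)] by auto
qed

lemma finite_cosets_subset:
  "finite ((\<lambda>x. J #> x) ` L) \<Longrightarrow> H \<subseteq> L \<Longrightarrow> finite ((\<lambda>x. J #> x) ` H)"
  by (meson finite_subset image_mono)

lemma ridx_pos:
  assumes "subgroup H G" "finite ((\<lambda>x. J #> x) ` H)"
  shows "0 < ridx G H J"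
  unfolding ridx_def using assms subgroup.one_closed by (fastforce simp: card_gt_0_iff)

end

text \<open>Presents \<open>N\<close> as \<open>M\<close> modulo \<open>K\<close>. The two subgroups
  keep their different ambient groups because their indices there are to be compared;
  \<open>\<beta>\<close> is meaningful only on \<open>M\<close>.\<close>

locale surj_on_subgroup = G: group G + H: group H for G (structure) and H (structure) +
  fixes M N :: "_ set" and K :: "_ set" and \<beta>
  assumes M: "subgroup M G" and N: "subgroup N H" and img: "\<beta> ` M = N"
    and mult: "\<And>x y. x \<in> M \<Longrightarrow> y \<in> M \<Longrightarrow> \<beta> (x \<otimes>\<^bsub>G\<^esub> y) = \<beta> x \<otimes>\<^bsub>H\<^esub> \<beta> y"
    and ker: "{x \<in> M. \<beta> x = \<one>\<^bsub>H\<^esub>} = K"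
begin

lemma sub: "group_hom (G\<lparr>carrier := M\<rparr>) H \<beta>"
proof -
  have "group (G\<lparr>carrier := M\<rparr>)" using G.subgroup_imp_group[OF M] .
  moreover have "\<beta> \<in> hom (G\<lparr>carrier := M\<rparr>) H"
    using mult img subgroup.mem_carrier[OF N] by (auto simp: hom_def)
  ultimately show ?thesis
    by (simp add: group_hom_def group_hom_axioms_def H.is_group)
qed

text \<open>The correspondence between subgroups of \<open>M\<close> above \<open>K\<close> and
  subgroups of \<open>N\<close> preserves indices, and homomorphisms on the image of
  \<open>J\<close> are those on \<open>J\<close> that vanish on \<open>K\<close>. The last number
  thus depends on \<open>J\<close> and \<open>K\<close> but not on \<open>\<beta>\<close>.\<close>

lemma quotient:
  assumes J: "subgroup J G" "J \<subseteq> M" "K \<subseteq> J"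
  shows "subgroup (\<beta> ` J) H" "ridx H N (\<beta> ` J) = ridx G M J"
    "finite ((\<lambda>x. \<beta> ` J #>\<^bsub>H\<^esub> x) ` N) \<longleftrightarrow> finite ((\<lambda>x. J #>\<^bsub>G\<^esub> x) ` M)"
    "card (hom2 H (\<beta> ` J)) = card {X \<in> hom2 G J. X \<inter> K = {}}"
proof -
  interpret h: group_hom "G\<lparr>carrier := M\<rparr>" H \<beta> by (rule sub)
  have JM: "subgroup J (G\<lparr>carrier := M\<rparr>)" using G.subgroup_incl[OF J(1) M J(2)] .
  show sJ: "subgroup (\<beta> ` J) H" using h.subgroup_img_is_subgroup[OF JM] .
  have \<beta>_inv: "\<beta> (inv\<^bsub>G\<^esub> x) = inv\<^bsub>H\<^esub> \<beta> x" if "x \<in> M" for x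
    using h.hom_inv[of x] that G.m_inv_consistent[OF M that] by simp
  have \<beta>c: "\<beta> x \<in> carrier H" if "x \<in> M" for x using h.hom_closed that by simp
  have \<beta>J: "\<beta> x \<in> \<beta> ` J \<longleftrightarrow> x \<in> J" if x: "x \<in> M" for x
  proof
    assume "\<beta> x \<in> \<beta> ` J"
    then obtain y where y: "y \<in> J" "\<beta> x = \<beta> y" by blast
    then have yM: "y \<in> M" "inv\<^bsub>G\<^esub> y \<in> M" using J(2) subgroup.m_inv_closed[OF M] by auto
    have "\<beta> (x \<otimes>\<^bsub>G\<^esub> inv\<^bsub>G\<^esub> y) = \<one>\<^bsub>H\<^esub>" using mult[OF x yM(2)] y \<beta>_inv[OF yM(1)] \<beta>c yM by simp
    then have "x \<otimes>\<^bsub>G\<^esub> inv\<^bsub>G\<^esub> y \<in> K" using ker x yM subgroup.m_closed[OF M] by blast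
    then have "x \<otimes>\<^bsub>G\<^esub> inv\<^bsub>G\<^esub> y \<otimes>\<^bsub>G\<^esub> y \<in> J" using J y subgroup.m_closed[OF J(1)] by blast
    then show "x \<in> J" using x yM subgroup.mem_carrier[OF M] by (simp add: G.m_assoc)
  qed blast
  have eq: "(\<beta> ` J #>\<^bsub>H\<^esub> \<beta> x = \<beta> ` J #>\<^bsub>H\<^esub> \<beta> y) \<longleftrightarrow> x \<otimes>\<^bsub>G\<^esub> inv\<^bsub>G\<^esub> y \<in> J" if "x \<in> M" "y \<in> M" for x y
    using H.rcos_eq_iff[OF sJ \<beta>c[OF that(1)] \<beta>c[OF that(2)]] \<beta>_inv[OF that(2)]
      mult[OF that(1) subgroup.m_inv_closed[OF M that(2)]] \<beta>J[of "x \<otimes>\<^bsub>G\<^esub> inv\<^bsub>G\<^esub> y"]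
      subgroup.m_closed[OF M] subgroup.m_inv_closed[OF M] that by simp
  have img': "(\<lambda>x. \<beta> ` J #>\<^bsub>H\<^esub> \<beta> x) ` M = (\<lambda>x. \<beta> ` J #>\<^bsub>H\<^esub> x) ` N"
    using img by (auto simp: image_image)
  show "ridx H N (\<beta> ` J) = ridx G M J"
    "finite ((\<lambda>x. \<beta> ` J #>\<^bsub>H\<^esub> x) ` N) \<longleftrightarrow> finite ((\<lambda>x. J #>\<^bsub>G\<^esub> x) ` M)"
    using G.ridx_eq_card_image[OF J(1) subgroup.subset[OF M], of "\<lambda>x. \<beta> ` J #>\<^bsub>H\<^esub> \<beta> x", OF eq] img'
    unfolding ridx_def by simp_all
  have mem: "\<beta> x \<in> \<beta> ` X \<longleftrightarrow> x \<in> X" if X: "X \<subseteq> J" "\<And>a b. a \<in> J \<Longrightarrow> b \<in> J \<Longrightarrow> a \<otimes>\<^bsub>G\<^esub> b \<in> X \<longleftrightarrow> (a \<in> X) \<noteq> (b \<in> X)" "X \<inter> K = {}"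
  and x: "x \<in> J" for X x
  proof
    assume "\<beta> x \<in> \<beta> ` X"
    then obtain y where y: "y \<in> X" "\<beta> x = \<beta> y" by blast
    then have y': "y \<in> J" "y \<in> M" "x \<in> M" using x X J(2) by auto
    have i: "inv\<^bsub>G\<^esub> y \<in> J" using subgroup.m_inv_closed[OF J(1) y'(1)] .
    have "\<beta> (x \<otimes>\<^bsub>G\<^esub> inv\<^bsub>G\<^esub> y) = \<one>\<^bsub>H\<^esub>" using mult[OF y'(3) subsetD[OF J(2) i]] y(2) \<beta>_inv[OF y'(2)] \<beta>c[OF y'(2)] by simp
    then have "x \<otimes>\<^bsub>G\<^esub> inv\<^bsub>G\<^esub> y \<in> K" using ker x i J(2) subgroup.m_closed[OF J(1)] by blast
    then have 1: "x \<otimes>\<^bsub>G\<^esub> inv\<^bsub>G\<^esub> y \<notin> X" using X(3) by auto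
    have "x \<otimes>\<^bsub>G\<^esub> inv\<^bsub>G\<^esub> y \<otimes>\<^bsub>G\<^esub> y = x" using y' subgroup.mem_carrier[OF M] by (simp add: G.m_assoc)
    then show "x \<in> X" using X(2)[of "x \<otimes>\<^bsub>G\<^esub> inv\<^bsub>G\<^esub> y" y] 1 x y y' i subgroup.m_closed[OF J(1)] by simp
  qed blast
  have "bij_betw (\<lambda>X. {x \<in> J. \<beta> x \<in> X}) (hom2 H (\<beta> ` J)) {X \<in> hom2 G J. X \<inter> K = {}}"
  proof (rule bij_betw_byWitness[where f' = "\<lambda>X. \<beta> ` X"])
    show "\<forall>X\<in>hom2 H (\<beta> ` J). \<beta> ` {x \<in> J. \<beta> x \<in> X} = X"
      unfolding hom2_def by auto
    show "\<forall>X\<in>{X \<in> hom2 G J. X \<inter> K = {}}. {x \<in> J. \<beta> x \<in> \<beta> ` X} = X"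
    proof
      fix X assume "X \<in> {X \<in> hom2 G J. X \<inter> K = {}}"
      then have X: "X \<subseteq> J" "\<And>a b. a \<in> J \<Longrightarrow> b \<in> J \<Longrightarrow> a \<otimes>\<^bsub>G\<^esub> b \<in> X \<longleftrightarrow> (a \<in> X) \<noteq> (b \<in> X)" "X \<inter> K = {}"
        unfolding hom2_def by auto
      have "\<beta> x \<in> \<beta> ` X \<longleftrightarrow> x \<in> X" if "x \<in> J" for x by (rule mem[OF X that])
      then show "{x \<in> J. \<beta> x \<in> \<beta> ` X} = X" using X(1) by auto
    qed
    show "(\<lambda>X. {x \<in> J. \<beta> x \<in> X}) ` hom2 H (\<beta> ` J) \<subseteq> {X \<in> hom2 G J. X \<inter> K = {}}"
    proof (rule image_subsetI)
      fix X assume "X \<in> hom2 H (\<beta> ` J)"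
      then have X: "\<And>a b. a \<in> J \<Longrightarrow> b \<in> J \<Longrightarrow> \<beta> a \<otimes>\<^bsub>H\<^esub> \<beta> b \<in> X \<longleftrightarrow> (\<beta> a \<in> X) \<noteq> (\<beta> b \<in> X)"
        unfolding hom2_def by auto
      have "\<one>\<^bsub>H\<^esub> \<notin> X" 
      proof -
        have "\<one>\<^bsub>G\<^esub> \<in> J" "\<beta> \<one>\<^bsub>G\<^esub> = \<one>\<^bsub>H\<^esub>" using subgroup.one_closed[OF J(1)] h.hom_one by auto
        then show ?thesis using X[of "\<one>\<^bsub>G\<^esub>" "\<one>\<^bsub>G\<^esub>"] by simp
      qed
      moreover have "\<beta> (a \<otimes>\<^bsub>G\<^esub> b) \<in> X \<longleftrightarrow> (\<beta> a \<in> X) \<noteq> (\<beta> b \<in> X)" if "a \<in> J" "b \<in> J" for a b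
        using X[OF that] mult[OF subsetD[OF J(2) that(1)] subsetD[OF J(2) that(2)]] by simp
      moreover have "\<beta> x = \<one>\<^bsub>H\<^esub>" if "x \<in> K" for x using that ker by blast
      moreover have "a \<otimes>\<^bsub>G\<^esub> b \<in> J" if "a \<in> J" "b \<in> J" for a b using subgroup.m_closed[OF J(1) that] .
      ultimately show "{x \<in> J. \<beta> x \<in> X} \<in> {X \<in> hom2 G J. X \<inter> K = {}}"
        unfolding hom2_def by (simp, metis (no_types, lifting) disjoint_iff mem_Collect_eq)
    qed
    show "(\<lambda>X. \<beta> ` X) ` {X \<in> hom2 G J. X \<inter> K = {}} \<subseteq> hom2 H (\<beta> ` J)"
    proof (rule image_subsetI)
      fix X assume "X \<in> {X \<in> hom2 G J. X \<inter> K = {}}"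
      then have X: "X \<subseteq> J" "\<And>a b. a \<in> J \<Longrightarrow> b \<in> J \<Longrightarrow> a \<otimes>\<^bsub>G\<^esub> b \<in> X \<longleftrightarrow> (a \<in> X) \<noteq> (b \<in> X)" "X \<inter> K = {}"
        unfolding hom2_def by auto
      have "\<beta> a \<otimes>\<^bsub>H\<^esub> \<beta> b \<in> \<beta> ` X \<longleftrightarrow> (\<beta> a \<in> \<beta> ` X) \<noteq> (\<beta> b \<in> \<beta> ` X)" if "a \<in> J" "b \<in> J" for a b
        using mem[OF X that(1)] mem[OF X that(2)] mem[OF X, of "a \<otimes>\<^bsub>G\<^esub> b"] X(2)[OF that]
          mult[OF subsetD[OF J(2) that(1)] subsetD[OF J(2) that(2)]] subgroup.m_closed[OF J(1) that] by simp
      then show "\<beta> ` X \<in> hom2 H (\<beta> ` J)" unfolding hom2_def using X(1) by auto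
    qed
  qed
  then show "card (hom2 H (\<beta> ` J)) = card {X \<in> hom2 G J. X \<inter> K = {}}"
    by (rule bij_betw_same_card)
qed

end

text \<open>The first equation says \<open>h = 2 ^ (m * (n - 1) + 1)\<close>, where the exponent is
  the rank in Schreier's index formula; it is strictly increasing in \<open>m\<close> because
  \<open>2 \<le> n\<close>.\<close>

lemma hom2_count_inj:
  fixes h m m' n :: nat
  assumes "h * 2 ^ (m - 1) = 2 ^ (m * n)" "h * 2 ^ (m' - 1) = 2 ^ (m' * n)" "2 \<le> n" "0 < m" "0 < m'"
  shows "m = m'"
proof -
  have "(2::nat) ^ (m * n + (m' - 1)) = h * 2 ^ (m - 1) * 2 ^ (m' - 1)" unfolding assms(1) by (rule power_add)
  also have "\<dots> = (h * 2 ^ (m' - 1)) * 2 ^ (m - 1)" by simp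
  also have "\<dots> = 2 ^ (m' * n + (m - 1))" unfolding assms(2) by (rule power_add[symmetric])
  finally have "m * n + (m' - 1) = m' * n + (m - 1)" by simp
  then have "int m * int n + int m' = int m' * int n + int m"
    using assms by (simp flip: of_nat_mult of_nat_add)
  then have "(int m - int m') * (int n - 1) = 0" by (simp add: algebra_simps)
  then show ?thesis using assms(3) by auto
qed

text \<open>The intersection \<open>J\<close> of \<open>M\<close> and \<open>M'\<close> contains
  \<open>K\<close>, and its images under \<open>\<beta>\<close> and \<open>\<beta>'\<close> are both
  isomorphic to J/K. They have equally many homomorphisms to Z/2, hence the same index in F_d; the
  claim follows by multiplicativity of indices on both sides.\<close>

theorem index_ratio_deck_group:
  assumes b: "surj_on_subgroup (free_group k) (free_group d) M N K \<beta>"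
    and b': "surj_on_subgroup (free_group k) (free_group d) M' N' K \<beta>'"
    and fM: "finite ((\<lambda>x. M #>\<^bsub>free_group k\<^esub> x) ` carrier (free_group k))"
    and fM': "finite ((\<lambda>x. M' #>\<^bsub>free_group k\<^esub> x) ` carrier (free_group k))"
    and fN: "finite ((\<lambda>x. N #>\<^bsub>free_group d\<^esub> x) ` carrier (free_group d))"
    and fN': "finite ((\<lambda>x. N' #>\<^bsub>free_group d\<^esub> x) ` carrier (free_group d))"
    and "2 \<le> d"
  shows "ridx (free_group k) (carrier (free_group k)) M * ridx (free_group d) (carrier (free_group d)) N'
    = ridx (free_group k) (carrier (free_group k)) M' * ridx (free_group d) (carrier (free_group d)) N"
proof -
  define Fd where "Fd = free_group d"
  define Fk where "Fk = free_group k"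
  note folds = Fd_def[symmetric] Fk_def[symmetric]
  interpret b: surj_on_subgroup Fk Fd M N K \<beta> using b unfolding folds .
  interpret b': surj_on_subgroup Fk Fd M' N' K \<beta>' using b' unfolding folds .
  define J where "J = M \<inter> M'"
  have J: "subgroup J Fk" unfolding J_def using b.G.subgroups_Inter_pair b.M b'.M by blast
  have JM: "J \<subseteq> M" "J \<subseteq> M'" "K \<subseteq> J" unfolding J_def using b.ker b'.ker by auto
  have fJ: "finite ((\<lambda>x. J #>\<^bsub>Fk\<^esub> x) ` carrier Fk)"
    unfolding J_def using b.G.finite_cosets_Int[OF b.M b'.M] fM fM' unfolding folds by blast
  have MF: "M \<subseteq> carrier Fk" "M' \<subseteq> carrier Fk" "N \<subseteq> carrier Fd" "N' \<subseteq> carrier Fd"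
    using b.M b.N b'.M b'.N subgroup.subset by blast+
  note fJM = b.G.finite_cosets_subset[OF fJ MF(1)] b.G.finite_cosets_subset[OF fJ MF(2)]
  note q = b.quotient[OF J JM(1,3)] and q' = b'.quotient[OF J JM(2,3)]
  have "\<beta> ` J \<subseteq> N" "\<beta>' ` J \<subseteq> N'" using JM b.img b'.img by auto
  note f1 = b.H.finite_cosets_trans[OF b.H.subgroup_self b.N q(1) MF(3) fN[unfolded folds] q(3)[THEN iffD2, OF fJM(1)]]
  note f2 = b.H.finite_cosets_trans[OF b.H.subgroup_self b'.N q'(1) MF(4) fN'[unfolded folds] q'(3)[THEN iffD2, OF fJM(2)]]
  define c where "c = card {X \<in> hom2 Fk J. X \<inter> K = {}}"
  let ?m = "ridx Fd (carrier Fd) (\<beta> ` J)" and ?m' = "ridx Fd (carrier Fd) (\<beta>' ` J)"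
  have "c * 2 ^ (?m - 1) = 2 ^ (?m * d)" "c * 2 ^ (?m' - 1) = 2 ^ (?m' * d)"
    using card_hom2_free_group[of "\<beta> ` J" d, unfolded folds, OF q(1) f1]
      card_hom2_free_group[of "\<beta>' ` J" d, unfolded folds, OF q'(1) f2] q(4) q'(4) unfolding c_def by simp_all
  then have "?m = ?m'"
    by (rule hom2_count_inj) (use \<open>2 \<le> d\<close> b.H.ridx_pos[OF b.H.subgroup_self] f1 f2 in auto)
  moreover have "?m = ridx Fd (carrier Fd) N * ridx Fk M J"
    using b.H.ridx_tower[OF b.H.subgroup_self b.N q(1) \<open>\<beta> ` J \<subseteq> N\<close> MF(3) f1] q(2) by simp
  moreover have "?m' = ridx Fd (carrier Fd) N' * ridx Fk M' J"
    using b.H.ridx_tower[OF b.H.subgroup_self b'.N q'(1) \<open>\<beta>' ` J \<subseteq> N'\<close> MF(4) f2] q'(2) by simp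
  ultimately have e1: "ridx Fd (carrier Fd) N * ridx Fk M J = ridx Fd (carrier Fd) N' * ridx Fk M' J" by simp
  have e2: "ridx Fk (carrier Fk) M * ridx Fk M J = ridx Fk (carrier Fk) M' * ridx Fk M' J"
    using b.G.ridx_tower[OF b.G.subgroup_self b.M J JM(1) MF(1) fJ]
      b.G.ridx_tower[OF b.G.subgroup_self b'.M J JM(2) MF(2) fJ] by simp
  have pos: "0 < ridx Fk M J" "0 < ridx Fk M' J"
    using b.G.ridx_pos[OF b.M fJM(1)] b.G.ridx_pos[OF b'.M fJM(2)] .
  have "(ridx Fk (carrier Fk) M * ridx Fd (carrier Fd) N') * (ridx Fk M J * ridx Fk M' J)
      = (ridx Fk (carrier Fk) M * ridx Fk M J) * (ridx Fd (carrier Fd) N' * ridx Fk M' J)" by simp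
  also have "\<dots> = (ridx Fk (carrier Fk) M' * ridx Fd (carrier Fd) N) * (ridx Fk M J * ridx Fk M' J)"
    unfolding e2 e1[symmetric] by simp
  finally show ?thesis unfolding folds using pos by simp
qed

section \<open>Magnus coefficients modulo two\<close>

text \<open>Coefficients are to be treated as elements of a field of characteristic 2, not rewritten
  into bit operations.\<close>

declare add_bit_eq_xor [simp del] mult_bit_eq_and [simp del]

lemma bit_add_cancel [simp]: "a + a = (0 :: bit)" "a + (a + b) = (b :: bit)"
  by (cases a; cases b; simp add: add_bit_eq_xor)+

lemma bit_add_eq_0_iff [simp]: "a + b = (0 :: bit) \<longleftrightarrow> a = b"
  by (cases a; cases b) (simp_all add: add_bit_eq_xor)

text \<open>The number of occurrences of \<open>u\<close> as a subsequence, modulo 2.\<close>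

primrec occ :: "'a list \<Rightarrow> 'a list \<Rightarrow> bit" where
  "occ [] u = (if u = [] then 1 else 0)"
| "occ (z # v) u = occ v u + (case u of [] \<Rightarrow> 0 | y # u' \<Rightarrow> if y = z then occ v u' else 0)"

lemma occ_Nil_right [simp]: "occ v [] = 1"
  by (induction v) auto

text \<open>\<open>occ v\<close> gives the coefficients of the product of the factors
  \<open>1 + z\<close> over the entries \<open>z\<close> of \<open>v\<close>, in noncommuting
  variables; this is the rule for the coefficients of a product.\<close>

lemma occ_append: "occ (v @ w) u = (\<Sum>i\<le>length u. occ v (take i u) * occ w (drop i u))"
proof (induction v arbitrary: u)
  case Nil
  have "(\<Sum>i\<le>length u. occ [] (take i u) * occ w (drop i u))
      = (\<Sum>i\<in>{0}. occ [] (take i u) * occ w (drop i u))"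
    by (rule sum.mono_neutral_right) auto
  then show ?case by simp
next
  case (Cons z v)
  show ?case
  proof (cases u)
    case (Cons y u')
    have "(\<Sum>i\<le>length u. occ (z # v) (take i u) * occ w (drop i u))
        = occ w u + (\<Sum>i\<le>length u'. (occ v (y # take i u') + (if y = z then occ v (take i u') else 0)) * occ w (drop i u'))"
      unfolding Cons by (simp add: sum.atMost_Suc_shift del: sum.atMost_Suc)
    also have "\<dots> = (occ w u + (\<Sum>i\<le>length u'. occ v (y # take i u') * occ w (drop i u')))
        + (if y = z then (\<Sum>i\<le>length u'. occ v (take i u') * occ w (drop i u')) else 0)"
      by (simp add: distrib_right sum.distrib add.assoc)
    also have "occ w u + (\<Sum>i\<le>length u'. occ v (y # take i u') * occ w (drop i u'))
        = (\<Sum>i\<le>length u. occ v (take i u) * occ w (drop i u))"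
      unfolding Cons by (simp add: sum.atMost_Suc_shift del: sum.atMost_Suc)
    finally show ?thesis using Cons.IH[of u] Cons.IH[of u'] by (simp add: \<open>u = y # u'\<close>)
  qed (simp add: Cons.IH)
qed

text \<open>The square of \<open>1 + z\<close> is 1 modulo 2 once \<open>z\<close> has square zero.
  Lists with equal neighbours are the monomials that are set to zero, hence the hypothesis on
  \<open>u\<close>.\<close>

lemma occ_cancel: "distinct_adj u \<Longrightarrow> occ (z # z # v) u = occ v u"
proof (cases u)
  case (Cons y u')
  assume "distinct_adj u"
  then show ?thesis
    using Cons by (cases u') (auto simp: add.assoc)
qed simp

lemma occ_longer: "length v < length u \<Longrightarrow> occ v u = 0"
proof (induction v arbitrary: u)
  case (Cons z v)
  then show ?case by (cases u) auto
qed auto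

lemma occ_self [simp]: "occ v v = 1"
  by (induction v) (auto simp: occ_longer)

text \<open>
  The generator \<open>x\<^sub>i\<close> is sent to \<open>(1 + s\<^sub>i) (1 + t\<^sub>i)\<close> in the algebra over the field with two
  elements in which all the variables \<open>s\<^sub>i\<close>, \<open>t\<^sub>i\<close> have square zero; the letters
  \<open>(True, i)\<close> and \<open>(False, i)\<close> stand for \<open>s\<^sub>i\<close> and \<open>t\<^sub>i\<close>. Then \<open>magnus w u\<close> is the coefficient at
  the monomial \<open>u\<close>.
\<close>

definition expand :: "letter list \<Rightarrow> letter list" where
  "expand w = concat (map (\<lambda>a. [a, inv_letter a]) w)"

definition magnus :: "letter list \<Rightarrow> letter list \<Rightarrow> bit" where
  "magnus w u = occ (expand w) u"

lemma expand_simps [simp]: "expand [] = []" "expand (a # w) = a # inv_letter a # expand w"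
  by (simp_all add: expand_def)

lemma occ_cong_Cons:
  assumes u: "distinct_adj u" and eq: "\<And>u. distinct_adj u \<Longrightarrow> occ v u = occ v' u"
  shows "occ (a # v) u = occ (a # v') u"
proof (cases u)
  case (Cons y t)
  have "distinct_adj t" using distinct_adj_ConsD u[unfolded Cons] .
  note 1 = eq[OF this] and 2 = eq[OF u[unfolded Cons]]
  show ?thesis unfolding Cons occ.simps list.case 1 2 ..
qed simp

text \<open>Each factor \<open>1 + s\<close> is its own inverse, so the inverse of
  \<open>(1 + s) (1 + t)\<close> is \<open>(1 + t) (1 + s)\<close>. A letter and its inverse cancel
  in two rounds, the inner pair before the outer one.\<close>

lemma magnus_push: "distinct_adj u \<Longrightarrow> magnus (push a w) u = magnus (a # w) u"
proof (cases "\<exists>v. w = inv_letter a # v")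
  case True
  assume u: "distinct_adj u"
  obtain v where v: "w = inv_letter a # v" using True by blast
  have "occ (inv_letter a # inv_letter a # a # expand v) u = occ (a # expand v) u" if "distinct_adj u" for u
    using occ_cancel[OF that] .
  then have "occ (a # inv_letter a # inv_letter a # a # expand v) u = occ (a # a # expand v) u"
    by (rule occ_cong_Cons[OF u])
  then show ?thesis using occ_cancel[OF u, of a "expand v"] by (simp add: v magnus_def)
next
  case False
  then have "push a w = a # w" by (cases w) auto
  then show ?thesis by simp
qed

lemma magnus_mult:
  assumes "distinct_adj u"
  shows "magnus (v \<otimes>\<^bsub>free_group n\<^esub> w) u = (\<Sum>i\<le>length u. magnus v (take i u) * magnus w (drop i u))"
proof -
  have "occ (expand (foldr push v w)) u = occ (expand v @ expand w) u" if "distinct_adj u" for u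
    using that
  proof (induction v arbitrary: u)
    case (Cons a v)
    have "occ (a # inv_letter a # expand (foldr push v w)) u = occ (a # inv_letter a # expand v @ expand w) u"
      by (intro occ_cong_Cons Cons)
    then show ?case using magnus_push[OF Cons.prems, of a "foldr push v w"] by (simp add: magnus_def)
  qed simp
  then show ?thesis using assms by (simp add: magnus_def free_group_simps occ_append)
qed

lemma magnus_Nil_right [simp]: "magnus w [] = 1"
  by (simp add: magnus_def)

lemma magnus_one: "u \<noteq> [] \<Longrightarrow> magnus [] u = 0"
  by (simp add: magnus_def)

lemma length_expand: "length (expand w) = 2 * length w"
  by (induction w) auto

text \<open>Equal neighbours in an expansion come only from a letter next to its inverse. This is
  what two variables per generator achieve: with one variable of square zero already the square of a
  generator would become trivial.\<close>

lemma distinct_adj_expand: "reduced w \<Longrightarrow> distinct_adj (expand w)"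
proof (induction w rule: reduced.induct)
  case (1 a b w)
  then show ?case by auto
qed auto

text \<open>The monomials that do not vanish.\<close>

definition monomials :: "nat \<Rightarrow> nat \<Rightarrow> letter list set" where
  "monomials d c = {u. distinct_adj u \<and> set u \<subseteq> letters d \<and> length u = c}"

lemma finite_monomials: "finite (monomials d c)"
  by (rule finite_subset[OF _ finite_lists_length_eq[OF finite_letters, of d c]])
    (auto simp: monomials_def)

lemma take_monomials: "u \<in> monomials d c \<Longrightarrow> i \<le> c \<Longrightarrow> take i u \<in> monomials d i"
  and drop_monomials: "u \<in> monomials d c \<Longrightarrow> i \<le> c \<Longrightarrow> drop i u \<in> monomials d (c - i)"
proof -
  assume u: "u \<in> monomials d c" "i \<le> c"
  then have "distinct_adj (take i u @ drop i u)" by (simp add: monomials_def)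
  then have "distinct_adj (take i u)" "distinct_adj (drop i u)" by blast+
  then show "take i u \<in> monomials d i" "drop i u \<in> monomials d (c - i)"
    using u set_take_subset[of i u] set_drop_subset[of i u] by (auto simp: monomials_def)
qed

text \<open>The elements congruent to 1 up to terms of degree at least \<open>c\<close>; degree 0 is
  left out because its coefficient is always 1. These are the terms of the central
  filtration.\<close>

definition magnus_group :: "nat \<Rightarrow> nat \<Rightarrow> letter list set" where
  "magnus_group d c = {w \<in> carrier (free_group d). \<forall>b u. 0 < b \<longrightarrow> b < c \<longrightarrow> u \<in> monomials d b \<longrightarrow> magnus w u = 0}"

lemma magnus_group_carrier: "w \<in> magnus_group d c \<Longrightarrow> w \<in> carrier (free_group d)"
  by (simp add: magnus_group_def)

lemma magnus_group_one: "magnus_group d 1 = carrier (free_group d)"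
  by (auto simp: magnus_group_def)

lemma magnus_group_Suc_subset: "magnus_group d (Suc c) \<subseteq> magnus_group d c"
  by (auto simp: magnus_group_def)

lemma magnus_group_zero:
  "v \<in> magnus_group d c \<Longrightarrow> u \<in> monomials d b \<Longrightarrow> 0 < b \<Longrightarrow> b < c \<Longrightarrow> magnus v u = 0"
  unfolding magnus_group_def by blast

text \<open>In the product rule only the two extreme cuts of \<open>u\<close> survive, because
  \<open>v\<close> has no terms in degrees strictly between 0 and \<open>b\<close>.\<close>

lemma magnus_mult_left:
  assumes v: "v \<in> magnus_group d c" and u: "u \<in> monomials d b" and b: "0 < b" "b \<le> c"
  shows "magnus (v \<otimes>\<^bsub>free_group d\<^esub> w) u = magnus v u + magnus w u"
    "magnus (w \<otimes>\<^bsub>free_group d\<^esub> v) u = magnus w u + magnus v u"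
proof -
  have u': "distinct_adj u" "length u = b" using u by (simp_all add: monomials_def)
  have "(\<Sum>i\<le>b. magnus v (take i u) * magnus w (drop i u)) = (\<Sum>i\<in>{0, b}. magnus v (take i u) * magnus w (drop i u))"
  proof (rule sum.mono_neutral_right)
    show "\<forall>i\<in>{..b} - {0, b}. magnus v (take i u) * magnus w (drop i u) = 0"
    proof
      fix i assume "i \<in> {..b} - {0, b}"
      then have "magnus v (take i u) = 0"
        using b by (intro magnus_group_zero[OF v take_monomials[OF u]]) auto
      then show "magnus v (take i u) * magnus w (drop i u) = 0" by simp
    qed
  qed auto
  then show "magnus (v \<otimes>\<^bsub>free_group d\<^esub> w) u = magnus v u + magnus w u"
    using b u' by (simp add: magnus_mult add.commute)
  have "(\<Sum>i\<le>b. magnus w (take i u) * magnus v (drop i u)) = (\<Sum>i\<in>{0, b}. magnus w (take i u) * magnus v (drop i u))"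
  proof (rule sum.mono_neutral_right)
    show "\<forall>i\<in>{..b} - {0, b}. magnus w (take i u) * magnus v (drop i u) = 0"
    proof
      fix i assume "i \<in> {..b} - {0, b}"
      then have "magnus v (drop i u) = 0"
        using b by (intro magnus_group_zero[OF v drop_monomials[OF u]]) auto
      then show "magnus w (take i u) * magnus v (drop i u) = 0" by simp
    qed
  qed auto
  then show "magnus (w \<otimes>\<^bsub>free_group d\<^esub> v) u = magnus w u + magnus v u"
    using b u' by (simp add: magnus_mult add.commute)
qed

text \<open>Works degree by degree: once the lower coefficients of \<open>z\<close> vanish, those in
  degree \<open>b\<close> are simply added to the coefficients of \<open>w\<close>, so they vanish
  as well.\<close>

lemma magnus_group_cancel:
  assumes z: "z \<in> carrier (free_group d)"
    and eq: "\<And>b u. 0 < b \<Longrightarrow> b < c \<Longrightarrow> u \<in> monomials d b \<Longrightarrow> magnus (z \<otimes>\<^bsub>free_group d\<^esub> w) u = magnus w u"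
  shows "z \<in> magnus_group d c"
proof -
  have "z \<in> magnus_group d b" if "b \<le> c" for b
    using that
  proof (induction b)
    case (Suc b)
    have "magnus z u = 0" if "u \<in> monomials d b" "0 < b" for u
      using magnus_mult_left(1)[of z d b u b w] eq[of b u] that Suc by (auto simp: add.commute)
    then show ?case using Suc unfolding magnus_group_def by (auto simp: less_Suc_eq)
  qed (use z in \<open>simp add: magnus_group_def\<close>)
  then show ?thesis by blast
qed

text \<open>Truncated expansions are a complete invariant of the cosets. This yields finite index,
  and also closure under inverses without inverting a series.\<close>

lemma magnus_eq_iff:
  assumes "x \<in> carrier (free_group d)" "y \<in> carrier (free_group d)"
  shows "(\<forall>b u. 0 < b \<longrightarrow> b < c \<longrightarrow> u \<in> monomials d b \<longrightarrow> magnus x u = magnus y u)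
    \<longleftrightarrow> x \<otimes>\<^bsub>free_group d\<^esub> inv\<^bsub>free_group d\<^esub> y \<in> magnus_group d c"
proof -
  interpret group "free_group d" by (rule group_free_group)
  let ?z = "x \<otimes>\<^bsub>free_group d\<^esub> inv\<^bsub>free_group d\<^esub> y"
  have z: "?z \<otimes>\<^bsub>free_group d\<^esub> y = x" "?z \<in> carrier (free_group d)" using assms by (simp_all add: m_assoc)
  show ?thesis
  proof
    assume "\<forall>b u. 0 < b \<longrightarrow> b < c \<longrightarrow> u \<in> monomials d b \<longrightarrow> magnus x u = magnus y u"
    then show "?z \<in> magnus_group d c" using magnus_group_cancel[OF z(2), of c y] z(1) by simp
  next
    assume zD: "?z \<in> magnus_group d c"
    have "magnus x u = magnus y u" if "0 < b" "b < c" "u \<in> monomials d b" for b u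
      using magnus_mult_left(1)[OF zD that(3,1), of y] z(1) that zD unfolding magnus_group_def by auto
    then show "\<forall>b u. 0 < b \<longrightarrow> b < c \<longrightarrow> u \<in> monomials d b \<longrightarrow> magnus x u = magnus y u" by blast
  qed
qed

lemma subgroup_magnus_group: "subgroup (magnus_group d c) (free_group d)"
proof -
  interpret group "free_group d" by (rule group_free_group)
  have one: "\<one>\<^bsub>free_group d\<^esub> \<in> magnus_group d c"
    using magnus_eq_iff[of "\<one>\<^bsub>free_group d\<^esub>" d "\<one>\<^bsub>free_group d\<^esub>" c] by simp
  show ?thesis
  proof (rule subgroupI)
    fix x assume x: "x \<in> magnus_group d c"
    have "\<one>\<^bsub>free_group d\<^esub> \<otimes>\<^bsub>free_group d\<^esub> inv\<^bsub>free_group d\<^esub> x \<in> magnus_group d c"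
      using magnus_eq_iff[of "\<one>\<^bsub>free_group d\<^esub>" d x c] x one unfolding magnus_group_def by auto
    then show "inv\<^bsub>free_group d\<^esub> x \<in> magnus_group d c" using x magnus_group_carrier by simp
  next
    fix x y assume xy: "x \<in> magnus_group d c" "y \<in> magnus_group d c"
    have "magnus (x \<otimes>\<^bsub>free_group d\<^esub> y) u = 0" if "0 < b" "b < c" "u \<in> monomials d b" for b u
      using magnus_mult_left(1)[OF xy(1) that(3,1), of y] xy that unfolding magnus_group_def by auto
    moreover have "x \<otimes>\<^bsub>free_group d\<^esub> y \<in> carrier (free_group d)"
      using xy magnus_group_carrier by simp
    ultimately show "x \<otimes>\<^bsub>free_group d\<^esub> y \<in> magnus_group d c"
      unfolding magnus_group_def by blast
  qed (use one magnus_group_carrier in auto)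
qed

text \<open>In degrees from 1 to \<open>c\<close> the coefficients of \<open>g x\<close> and of
  \<open>x g\<close> are both the sums of those of \<open>g\<close> and \<open>x\<close>. Hence each
  term of the filtration is normal, conjugation acts trivially on the graded pieces, and commutators
  descend by one degree.\<close>

lemma magnus_conj:
  assumes x: "x \<in> magnus_group d c" and g: "g \<in> carrier (free_group d)"
  shows "g \<otimes>\<^bsub>free_group d\<^esub> x \<otimes>\<^bsub>free_group d\<^esub> inv\<^bsub>free_group d\<^esub> g \<in> magnus_group d c" (is ?A)
    and "u \<in> monomials d c \<Longrightarrow> 0 < c
      \<Longrightarrow> magnus (g \<otimes>\<^bsub>free_group d\<^esub> x \<otimes>\<^bsub>free_group d\<^esub> inv\<^bsub>free_group d\<^esub> g) u = magnus x u"
    and "g \<otimes>\<^bsub>free_group d\<^esub> x \<otimes>\<^bsub>free_group d\<^esub> inv\<^bsub>free_group d\<^esub> (x \<otimes>\<^bsub>free_group d\<^esub> g) \<in> magnus_group d (Suc c)"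
proof -
  interpret group "free_group d" by (rule group_free_group)
  have xc: "x \<in> carrier (free_group d)" using x magnus_group_carrier by blast
  let ?z = "g \<otimes>\<^bsub>free_group d\<^esub> x \<otimes>\<^bsub>free_group d\<^esub> inv\<^bsub>free_group d\<^esub> g"
  have zg: "?z \<otimes>\<^bsub>free_group d\<^esub> g = g \<otimes>\<^bsub>free_group d\<^esub> x" using xc g by (simp add: m_assoc)
  have eq: "magnus (g \<otimes>\<^bsub>free_group d\<^esub> x) u = magnus g u + magnus x u"
    "magnus (x \<otimes>\<^bsub>free_group d\<^esub> g) u = magnus g u + magnus x u" if "0 < b" "b \<le> c" "u \<in> monomials d b" for b u
    using magnus_mult_left[OF x that(3,1,2), of g] by (simp_all add: add.commute)
  show A: ?A
    using magnus_eq_iff[of "g \<otimes>\<^bsub>free_group d\<^esub> x" d g c] eq(1) x xc g unfolding magnus_group_def by auto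
  show "magnus ?z u = magnus x u" if "u \<in> monomials d c" "0 < c"
    using magnus_mult_left(1)[OF A that, of g] zg eq(1)[OF that(2) _ that(1)]
    by (metis add.commute add_left_cancel order_refl)
  show "g \<otimes>\<^bsub>free_group d\<^esub> x \<otimes>\<^bsub>free_group d\<^esub> inv\<^bsub>free_group d\<^esub> (x \<otimes>\<^bsub>free_group d\<^esub> g) \<in> magnus_group d (Suc c)"
    using magnus_eq_iff[of "g \<otimes>\<^bsub>free_group d\<^esub> x" d "x \<otimes>\<^bsub>free_group d\<^esub> g" "Suc c"] eq xc g by (auto simp: less_Suc_eq_le)
qed

text \<open>The expansion of a reduced word is itself a nonvanishing monomial, of degree twice the
  length, and its coefficient is 1. A nonempty word is therefore detected in that degree at the
  latest.\<close>

lemma magnus_group_short: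
  assumes "w \<in> magnus_group d c" "2 * length w < c"
  shows "w = []"
proof (rule ccontr)
  assume "w \<noteq> []"
  have "reduced w" "set w \<subseteq> letters d" using assms(1) by (auto simp: magnus_group_def free_group_simps)
  moreover have "set (expand w) \<subseteq> letters d" using \<open>set w \<subseteq> letters d\<close> by (induction w) auto
  ultimately have "expand w \<in> monomials d (2 * length w)"
    using distinct_adj_expand by (simp add: monomials_def length_expand)
  then have "magnus w (expand w) = 0" using assms \<open>w \<noteq> []\<close> by (intro magnus_group_zero) auto
  then show False by (simp add: magnus_def)
qed

section \<open>Iterated commutators\<close>

primrec comm_word :: "nat \<Rightarrow> nat list \<Rightarrow> letter list" where
  "comm_word d [] = [(True, 0)]"
| "comm_word d (i # js) = comm_word d js \<otimes>\<^bsub>free_group d\<^esub> [(True, i)] \<otimes>\<^bsub>free_group d\<^esub>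
     inv\<^bsub>free_group d\<^esub> ([(True, i)] \<otimes>\<^bsub>free_group d\<^esub> comm_word d js)"

text \<open>
  Among the monomials of the commutator \<open>[\<dots>[x\<^sub>0, x\<^sub>i], \<dots>, x\<^sub>j]\<close> we look at one starting with \<open>s\<^sub>0\<close>,
  in which the variables \<open>s\<close> and \<open>t\<close> alternate, so that it does not vanish.
\<close>

primrec comm_monomial :: "nat list \<Rightarrow> letter list" where
  "comm_monomial [] = [(True, 0)]"
| "comm_monomial (i # js) = comm_monomial js @ [(odd (length js), i)]"

lemma length_comm_monomial [simp]: "length (comm_monomial js) = Suc (length js)"
  by (induction js) auto

lemma hd_comm_monomial [simp]: "hd (comm_monomial js) = (True, 0)" "comm_monomial js \<noteq> []"
  by (induction js) auto

lemma comm_monomial_inject: "length js = length js' \<Longrightarrow> comm_monomial js = comm_monomial js' \<longleftrightarrow> js = js'"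
  by (induction js js' rule: list_induct2) auto

lemma comm_monomial_in:
  assumes "0 < d" "set js \<subseteq> {1..<d}"
  shows "comm_monomial js \<in> monomials d (Suc (length js))"
proof -
  have "distinct_adj (comm_monomial js) \<and> fst (last (comm_monomial js)) = even (length js)"
    by (induction js) (auto simp: distinct_adj_append_iff)
  moreover have "set (comm_monomial js) \<subseteq> letters d" using assms by (induction js) auto
  ultimately show ?thesis by (simp add: monomials_def)
qed

lemma magnus_letter: "magnus [(True, i)] [y] = (if snd y = i then 1 else 0)"
  by (cases y) (auto simp: magnus_def inv_letter_def)

text \<open>The coefficients of the commutators at their monomials form an identity matrix, so the
  commutators are independent modulo the next term of the filtration. In the induction the leading
  coefficient of the commutator of \<open>g\<close> and \<open>x\<close> is the difference of those
  of \<open>g x\<close> and \<open>x g\<close>.\<close>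

lemma comm_word_props:
  assumes d: "0 < d" and "set js \<subseteq> {1..<d}"
  shows "comm_word d js \<in> magnus_group d (Suc (length js))"
    and "\<lbrakk>set js' \<subseteq> {1..<d}; length js' = length js\<rbrakk>
      \<Longrightarrow> magnus (comm_word d js) (comm_monomial js') = (if js = js' then 1 else 0)"
proof -
  interpret group "free_group d" by (rule group_free_group)
  have "comm_word d js \<in> magnus_group d (Suc (length js)) \<and>
    (\<forall>js'. set js' \<subseteq> {1..<d} \<longrightarrow> length js' = length js \<longrightarrow>
      magnus (comm_word d js) (comm_monomial js') = (if js = js' then 1 else 0))"
    using assms(2)
  proof (induction js)
    case Nil
    then show ?case using d magnus_group_one[of d] by (simp add: magnus_letter)
  next
    case (Cons i js)
    define g where "g = comm_word d js"
    define x where "x = [(True, i)]"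
    define c where "c = Suc (length js)"
    define z where "z = g \<otimes>\<^bsub>free_group d\<^esub> x \<otimes>\<^bsub>free_group d\<^esub> inv\<^bsub>free_group d\<^esub> (x \<otimes>\<^bsub>free_group d\<^esub> g)"
    have g: "g \<in> magnus_group d c" using Cons unfolding g_def c_def by simp
    have gc: "g \<in> carrier (free_group d)" "x \<in> carrier (free_group d)"
      using g magnus_group_carrier Cons.prems by (auto simp: x_def)
    have z: "z \<in> magnus_group d (Suc c)"
    proof -
      have "x \<otimes>\<^bsub>free_group d\<^esub> g \<otimes>\<^bsub>free_group d\<^esub> inv\<^bsub>free_group d\<^esub> (g \<otimes>\<^bsub>free_group d\<^esub> x) \<in> magnus_group d (Suc c)"
        using magnus_conj(3)[OF g gc(2)] .
      then have "inv\<^bsub>free_group d\<^esub> (x \<otimes>\<^bsub>free_group d\<^esub> g \<otimes>\<^bsub>free_group d\<^esub> inv\<^bsub>free_group d\<^esub> (g \<otimes>\<^bsub>free_group d\<^esub> x)) \<in> magnus_group d (Suc c)"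
        by (rule subgroup.m_inv_closed[OF subgroup_magnus_group])
      then show ?thesis unfolding z_def using gc by (simp add: inv_mult_group m_assoc)
    qed
    have zxg: "z \<otimes>\<^bsub>free_group d\<^esub> (x \<otimes>\<^bsub>free_group d\<^esub> g) = g \<otimes>\<^bsub>free_group d\<^esub> x"
      unfolding z_def using gc by (simp add: inv_mult_group m_assoc)
    have "magnus z (comm_monomial js') = (if i # js = js' then 1 else 0)"
      if js': "set js' \<subseteq> {1..<d}" "length js' = length (i # js)" for js'
    proof -
      obtain j ks where ks: "js' = j # ks" using js' by (cases js') auto
      define u where "u = comm_monomial js'"
      have lks: "length ks = length js" using js' ks by simp
      have u: "u \<in> monomials d (Suc c)" using comm_monomial_in[OF d js'(1)] js'(2) by (simp add: u_def c_def)
      have ud: "distinct_adj u" "length u = Suc c" using u by (simp_all add: monomials_def)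
      note small = magnus_group_zero[OF g]
      have s1: "magnus (g \<otimes>\<^bsub>free_group d\<^esub> x) u = magnus x u + magnus g (take c u) * magnus x (drop c u) + magnus g u"
      proof -
        have "magnus (g \<otimes>\<^bsub>free_group d\<^esub> x) u = (\<Sum>i\<le>Suc c. magnus g (take i u) * magnus x (drop i u))"
          using magnus_mult[OF ud(1)] ud(2) by simp
        \<comment> \<open>\<open>g\<close> has no terms in degrees strictly between 0 and
          \<open>c\<close>.\<close>
        also have "\<dots> = (\<Sum>i\<in>{0, c, Suc c}. magnus g (take i u) * magnus x (drop i u))"
        proof (rule sum.mono_neutral_right)
          show "\<forall>i\<in>{..Suc c} - {0, c, Suc c}. magnus g (take i u) * magnus x (drop i u) = 0"
            using small[OF take_monomials[OF u]] by (auto simp: le_Suc_eq)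
        qed auto
        finally show ?thesis using ud(2) by (simp add: c_def add.assoc)
      qed
      have s2: "magnus (x \<otimes>\<^bsub>free_group d\<^esub> g) u = magnus g u + magnus x (take 1 u) * magnus g (drop 1 u) + magnus x u"
      proof -
        have "magnus (x \<otimes>\<^bsub>free_group d\<^esub> g) u = (\<Sum>i\<le>Suc c. magnus x (take i u) * magnus g (drop i u))"
          using magnus_mult[OF ud(1)] ud(2) by simp
        also have "\<dots> = (\<Sum>i\<in>{0, 1, Suc c}. magnus x (take i u) * magnus g (drop i u))"
        proof (rule sum.mono_neutral_right)
          show "\<forall>i\<in>{..Suc c} - {0, 1, Suc c}. magnus x (take i u) * magnus g (drop i u) = 0"
            using small[OF drop_monomials[OF u]] by (auto simp: le_Suc_eq)
        qed auto
        finally show ?thesis using ud(2) by (simp add: c_def add.assoc)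
      qed
      \<comment> \<open>The monomial starts with a variable of generator 0 while \<open>x\<close> is
        a generator of positive index, so the mixed term of \<open>x g\<close> vanishes. This is why
        the indices avoid 0.\<close>
      have "take 1 u = [(True, 0)]"
        using hd_comm_monomial[of js'] unfolding u_def by (cases "comm_monomial js'") auto
      then have "magnus x (take 1 u) = 0" using Cons.prems by (simp add: x_def magnus_letter)
      then have s2': "magnus (x \<otimes>\<^bsub>free_group d\<^esub> g) u = magnus g u + magnus x u" using s2 by simp
      have "take c u = comm_monomial ks" "drop c u = [(odd (length ks), j)]"
        unfolding u_def ks by (simp_all add: c_def lks)
      then have s1': "magnus (g \<otimes>\<^bsub>free_group d\<^esub> x) u = magnus x u + (if js = ks \<and> i = j then 1 else 0) + magnus g u"
        using s1 Cons ks js' lks by (auto simp: g_def x_def magnus_letter)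
      have "magnus (g \<otimes>\<^bsub>free_group d\<^esub> x) u = magnus z u + magnus (x \<otimes>\<^bsub>free_group d\<^esub> g) u"
        using magnus_mult_left(1)[OF z u, of "x \<otimes>\<^bsub>free_group d\<^esub> g"] zxg by simp
      then have "magnus z u = magnus (g \<otimes>\<^bsub>free_group d\<^esub> x) u + magnus (x \<otimes>\<^bsub>free_group d\<^esub> g) u"
        by (simp add: add.assoc)
      then show ?thesis unfolding s1' s2' using ks by (auto simp: u_def ac_simps)
    qed
    moreover have "z = comm_word d (i # js)" unfolding z_def g_def x_def by simp
    ultimately show ?case using z unfolding c_def by simp
  qed
  then show "comm_word d js \<in> magnus_group d (Suc (length js))"
    and "\<lbrakk>set js' \<subseteq> {1..<d}; length js' = length js\<rbrakk>
      \<Longrightarrow> magnus (comm_word d js) (comm_monomial js') = (if js = js' then 1 else 0)" by blast+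
qed

section \<open>Counting normal subgroups of 2-power index\<close>

text \<open>Sets under symmetric difference are vectors over the field with two elements; a
  projection that hits every unit vector is onto.\<close>

lemma sym_diff_restrict_surj:
  fixes V :: "'a set set"
  assumes J: "finite J" and V0: "{} \<in> V"
    and sd: "\<And>A B. A \<in> V \<Longrightarrow> B \<in> V \<Longrightarrow> sym_diff A B \<in> V"
    and unit: "\<And>j. j \<in> J \<Longrightarrow> \<exists>A\<in>V. A \<inter> J = {j}"
  shows "Pow J \<subseteq> (\<lambda>A. A \<inter> J) ` V"
proof
  fix B assume "B \<in> Pow J"
  then have "finite B" "B \<subseteq> J" using J finite_subset by auto
  then show "B \<in> (\<lambda>A. A \<inter> J) ` V"
  proof (induction B)
    case empty
    then show ?case using V0 by (intro image_eqI[of _ _ "{}"]) auto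
  next
    case (insert j B)
    then obtain A C where A: "A \<in> V" "A \<inter> J = B" and C: "C \<in> V" "C \<inter> J = {j}" using unit[of j] by auto
    moreover have "sym_diff A C \<inter> J = sym_diff (A \<inter> J) (C \<inter> J)" by blast
    ultimately have "insert j B = sym_diff A C \<inter> J" using insert.hyps by auto
    then show ?case using sd[OF A(1) C(1)] by blast
  qed
qed

text \<open>A smallest set of coordinates separating the vectors of \<open>V\<close> works: dropping
  \<open>j\<close> identifies two vectors, and their difference restricts to the unit vector at
  \<open>j\<close>.\<close>

lemma exists_coordinates:
  fixes V :: "'a set set"
  assumes U: "finite U" "V \<subseteq> Pow U" and V0: "{} \<in> V"
    and sd: "\<And>A B. A \<in> V \<Longrightarrow> B \<in> V \<Longrightarrow> sym_diff A B \<in> V"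
  obtains J where "J \<subseteq> U" "bij_betw (\<lambda>A. A \<inter> J) V (Pow J)"
proof -
  define P where "P = (\<lambda>J. J \<subseteq> U \<and> inj_on (\<lambda>A. A \<inter> J) V)"
  have "P U" unfolding P_def inj_on_def using U(2) by blast
  then obtain J where J: "P J" and min: "\<And>J'. P J' \<Longrightarrow> card J \<le> card J'"
    using ex_has_least_nat[of P U card] by blast
  have JU: "J \<subseteq> U" "finite J" and inj: "inj_on (\<lambda>A. A \<inter> J) V"
    using J U finite_subset unfolding P_def by auto
  have "\<exists>A\<in>V. A \<inter> J = {j}" if j: "j \<in> J" for j
  proof -
    have "card (J - {j}) < card J" using j JU by (meson card_Diff1_less)
    then have "\<not> P (J - {j})" using min leD by blast
    then have "\<not> inj_on (\<lambda>A. A \<inter> (J - {j})) V" using JU unfolding P_def by blast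
    then obtain A B where AB: "A \<in> V" "B \<in> V" "A \<noteq> B" "A \<inter> (J - {j}) = B \<inter> (J - {j})"
      unfolding inj_on_def by blast
    then have "A \<inter> J \<noteq> B \<inter> J" using inj unfolding inj_on_def by blast
    moreover have "sym_diff A B \<inter> J = sym_diff (A \<inter> J) (B \<inter> J)" by blast
    ultimately have "sym_diff A B \<inter> J \<noteq> {}" by auto
    then have "sym_diff A B \<inter> J = {j}" using AB(4) by blast
    then show ?thesis using sd AB by blast
  qed
  then have "Pow J \<subseteq> (\<lambda>A. A \<inter> J) ` V" using sym_diff_restrict_surj[OF JU(2) V0 sd] by blast
  then have "bij_betw (\<lambda>A. A \<inter> J) V (Pow J)" using inj unfolding bij_betw_def by blast
  then show ?thesis using that JU by blast
qed

text \<open>The homogeneous part of degree \<open>c\<close>, encoded by its support so that addition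
  becomes symmetric difference.\<close>

definition symbol :: "nat \<Rightarrow> nat \<Rightarrow> letter list \<Rightarrow> letter list set" where
  "symbol d c w = {u \<in> monomials d c. magnus w u = 1}"

lemma symbol_mult:
  assumes "0 < c" "x \<in> magnus_group d c" "y \<in> magnus_group d c"
  shows "symbol d c (x \<otimes>\<^bsub>free_group d\<^esub> y) = sym_diff (symbol d c x) (symbol d c y)"
proof -
  have "magnus (x \<otimes>\<^bsub>free_group d\<^esub> y) u = magnus x u + magnus y u" if "u \<in> monomials d c" for u
    using magnus_mult_left(1)[OF assms(2) that assms(1)] by simp
  then show ?thesis unfolding symbol_def by (auto simp: add_bit_eq_xor)
qed

lemma symbol_eq_iff:
  assumes "0 < c" "x \<in> magnus_group d c" "y \<in> magnus_group d c"
  shows "symbol d c x = symbol d c y \<longleftrightarrow> x \<otimes>\<^bsub>free_group d\<^esub> inv\<^bsub>free_group d\<^esub> y \<in> magnus_group d (Suc c)"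
proof -
  have "symbol d c x = symbol d c y \<longleftrightarrow> (\<forall>u\<in>monomials d c. magnus x u = magnus y u)"
    unfolding symbol_def by (auto simp: set_eq_iff) (metis bit.exhaust zero_neq_one)
  also have "\<dots> \<longleftrightarrow> (\<forall>b u. 0 < b \<longrightarrow> b < Suc c \<longrightarrow> u \<in> monomials d b \<longrightarrow> magnus x u = magnus y u)"
    using assms magnus_group_zero[OF assms(2)] magnus_group_zero[OF assms(3)] by (auto simp: less_Suc_eq)
  finally show ?thesis using magnus_eq_iff[of x d y "Suc c"] assms magnus_group_carrier by simp
qed

lemma symbol_space:
  assumes "0 < c"
  obtains J where "J \<subseteq> monomials d c"
    "bij_betw (\<lambda>A. A \<inter> J) (symbol d c ` magnus_group d c) (Pow J)"
    "0 < d \<Longrightarrow> (d - 1) ^ (c - 1) \<le> card J"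
proof -
  define V where "V = symbol d c ` magnus_group d c"
  have one: "\<one>\<^bsub>free_group d\<^esub> \<in> magnus_group d c"
    using subgroup.one_closed[OF subgroup_magnus_group] .
  have "symbol d c \<one>\<^bsub>free_group d\<^esub> = {}"
    using assms by (auto simp: symbol_def free_group_simps monomials_def magnus_one)
  then have V0: "{} \<in> V" unfolding V_def using one by (metis image_eqI)
  have sd: "sym_diff A B \<in> V" if "A \<in> V" "B \<in> V" for A B
  proof -
    obtain x y where xy: "x \<in> magnus_group d c" "y \<in> magnus_group d c" "A = symbol d c x" "B = symbol d c y"
      using \<open>A \<in> V\<close> \<open>B \<in> V\<close> unfolding V_def by blast
    have "sym_diff A B = symbol d c (x \<otimes>\<^bsub>free_group d\<^esub> y)" using symbol_mult[OF assms] xy by simp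
    then show ?thesis unfolding V_def using subgroup.m_closed[OF subgroup_magnus_group xy(1,2)] by simp
  qed
  have "V \<subseteq> Pow (monomials d c)" unfolding V_def symbol_def by auto
  from exists_coordinates[OF finite_monomials this V0 sd]
  obtain J where J: "J \<subseteq> monomials d c" "bij_betw (\<lambda>A. A \<inter> J) V (Pow J)" .
  have finJ: "finite J" using J(1) finite_monomials finite_subset by blast
  have cardV: "card V = 2 ^ card J" using bij_betw_same_card[OF J(2)] card_Pow[OF finJ] by simp
  have finV: "finite V" using bij_betw_finite[OF J(2)] finJ by simp
  have "(d - 1) ^ (c - 1) \<le> card J" if d: "0 < d"
  proof -
    \<comment> \<open>The iterated commutators bound the dimension from below: \<open>c - 1\<close>
      indices, each with \<open>d - 1\<close> possible values.\<close>
    define Js where "Js = {js. set js \<subseteq> {1..<d} \<and> length js = c - 1}"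
    define J' where "J' = comm_monomial ` Js"
    have "inj_on comm_monomial Js" unfolding Js_def by (intro inj_onI) (simp add: comm_monomial_inject)
    then have cJ': "card J' = (d - 1) ^ (c - 1)" unfolding J'_def Js_def
      by (simp add: card_image card_lists_length_eq)
    have finJ': "finite J'" unfolding J'_def Js_def by (simp add: finite_lists_length_eq)
    have "Pow J' \<subseteq> (\<lambda>A. A \<inter> J') ` V"
    proof (rule sym_diff_restrict_surj[OF finJ' V0 sd])
      fix u assume "u \<in> J'"
      then obtain js where js: "set js \<subseteq> {1..<d}" "length js = c - 1" "u = comm_monomial js"
        unfolding J'_def Js_def by blast
      have "comm_word d js \<in> magnus_group d c" using comm_word_props(1)[OF d js(1)] js(2) assms by simp
      moreover have "symbol d c (comm_word d js) \<inter> J' = {u}"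
      proof -
        have "magnus (comm_word d js) v = (if v = u then 1 else 0)" if v: "v \<in> J'" for v
        proof -
          obtain js' where js': "set js' \<subseteq> {1..<d}" "length js' = c - 1" "v = comm_monomial js'"
            using v unfolding J'_def Js_def by blast
          then show ?thesis
            using comm_word_props(2)[OF d js(1) js'(1)] comm_monomial_inject[of js' js] js by auto
        qed
        moreover have "u \<in> monomials d c" using comm_monomial_in[OF d js(1)] js assms by simp
        ultimately show ?thesis unfolding symbol_def using \<open>u \<in> J'\<close> by (auto split: if_splits)
      qed
      ultimately show "\<exists>A\<in>V. A \<inter> J' = {u}" unfolding V_def by blast
    qed
    then have "card (Pow J') \<le> card V"
      using finV surj_card_le by (meson card_image_le card_mono finite_imageI le_trans)
    then have "(2::nat) ^ card J' \<le> 2 ^ card J" using card_Pow[OF finJ'] cardV by simp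
    then show ?thesis using cJ' by simp
  qed
  then show ?thesis using that J unfolding V_def by blast
qed

text \<open>A fixed choice of coordinates on the graded piece of degree \<open>c\<close>; its size
  is the dimension of that piece.\<close>

definition symbol_basis :: "nat \<Rightarrow> nat \<Rightarrow> letter list set" where
  "symbol_basis d c = (SOME J. J \<subseteq> monomials d c \<and>
     bij_betw (\<lambda>A. A \<inter> J) (symbol d c ` magnus_group d c) (Pow J) \<and>
     (0 < d \<longrightarrow> (d - 1) ^ (c - 1) \<le> card J))"

lemma symbol_basis:
  assumes "0 < c"
  shows "symbol_basis d c \<subseteq> monomials d c"
    "bij_betw (\<lambda>A. A \<inter> symbol_basis d c) (symbol d c ` magnus_group d c) (Pow (symbol_basis d c))"
    "0 < d \<Longrightarrow> (d - 1) ^ (c - 1) \<le> card (symbol_basis d c)"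
proof -
  have "\<exists>J. J \<subseteq> monomials d c \<and>
     bij_betw (\<lambda>A. A \<inter> J) (symbol d c ` magnus_group d c) (Pow J) \<and>
     (0 < d \<longrightarrow> (d - 1) ^ (c - 1) \<le> card J)"
    using symbol_space[OF assms, of d] by metis
  note * = someI_ex[OF this, folded symbol_basis_def]
  show "symbol_basis d c \<subseteq> monomials d c"
    "bij_betw (\<lambda>A. A \<inter> symbol_basis d c) (symbol d c ` magnus_group d c) (Pow (symbol_basis d c))"
    "0 < d \<Longrightarrow> (d - 1) ^ (c - 1) \<le> card (symbol_basis d c)"
    using * by blast+
qed

text \<open>The binary logarithm of the index of \<open>magnus_group d c\<close>, for positive
  \<open>c\<close>.\<close>

definition log_index :: "nat \<Rightarrow> nat \<Rightarrow> nat" where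
  "log_index d c = (\<Sum>b\<in>{1..<c}. card (symbol_basis d b))"

lemma finite_cosets_magnus_group:
  "finite ((\<lambda>x. magnus_group d c #>\<^bsub>free_group d\<^esub> x) ` carrier (free_group d))"
proof -
  interpret group "free_group d" by (rule group_free_group)
  define f where "f = (\<lambda>w. {u. \<exists>b. 0 < b \<and> b < c \<and> u \<in> monomials d b \<and> magnus w u = 1})"
  have "f ` carrier (free_group d) \<subseteq> Pow (\<Union>b\<in>{..<c}. monomials d b)" unfolding f_def by auto
  then have "finite (f ` carrier (free_group d))" by (rule finite_subset) (simp add: finite_monomials)
  moreover have "f x = f y \<longleftrightarrow> x \<otimes>\<^bsub>free_group d\<^esub> inv\<^bsub>free_group d\<^esub> y \<in> magnus_group d c"
    if "x \<in> carrier (free_group d)" "y \<in> carrier (free_group d)" for x y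
  proof -
    have "f x = f y \<longleftrightarrow> (\<forall>b u. 0 < b \<longrightarrow> b < c \<longrightarrow> u \<in> monomials d b \<longrightarrow> magnus x u = magnus y u)"
    proof
      assume f: "f x = f y"
      show "\<forall>b u. 0 < b \<longrightarrow> b < c \<longrightarrow> u \<in> monomials d b \<longrightarrow> magnus x u = magnus y u"
      proof (intro allI impI)
        fix b u assume bu: "0 < b" "b < c" "u \<in> monomials d b"
        have "u \<in> f w \<longleftrightarrow> magnus w u = 1" for w
          using bu unfolding f_def by (auto simp: monomials_def)
        then have "magnus x u = 1 \<longleftrightarrow> magnus y u = 1" using f by blast
        then show "magnus x u = magnus y u" by (cases "magnus x u"; cases "magnus y u") simp_all
      qed
    next
      assume eq: "\<forall>b u. 0 < b \<longrightarrow> b < c \<longrightarrow> u \<in> monomials d b \<longrightarrow> magnus x u = magnus y u"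
      show "f x = f y" unfolding f_def
        by (intro Collect_cong ex_cong1 conj_cong refl) (use eq in simp)
    qed
    then show ?thesis using magnus_eq_iff[OF that] by simp
  qed
  ultimately show ?thesis
    using ridx_eq_card_image(2)[OF subgroup_magnus_group subset_refl, of f] by blast
qed

lemma ridx_magnus_group:
  assumes "0 < c"
  shows "ridx (free_group d) (carrier (free_group d)) (magnus_group d c) = 2 ^ log_index d c"
  using assms
proof (induction c rule: nat_induct_non_zero)
  case 1
  interpret group "free_group d" by (rule group_free_group)
  have "(\<lambda>x. magnus_group d 1 #>\<^bsub>free_group d\<^esub> x) ` carrier (free_group d) = {carrier (free_group d)}"
    unfolding magnus_group_one using coset_join2[OF _ subgroup_self] one_closed by blast
  then show ?case by (simp add: ridx_def log_index_def)
next
  case (Suc c)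
  interpret group "free_group d" by (rule group_free_group)
  have sub: "magnus_group d c \<subseteq> carrier (free_group d)" using magnus_group_carrier by blast
  have finJ: "finite (symbol_basis d c)"
    using symbol_basis(1)[OF Suc.hyps] finite_monomials finite_subset by blast
  have "ridx (free_group d) (magnus_group d c) (magnus_group d (Suc c)) = card (symbol d c ` magnus_group d c)"
    by (rule ridx_eq_card_image(1)[OF subgroup_magnus_group sub]) (rule symbol_eq_iff[OF Suc.hyps])
  also have "\<dots> = 2 ^ card (symbol_basis d c)"
    using bij_betw_same_card[OF symbol_basis(2)[OF Suc.hyps]] card_Pow[OF finJ] by simp
  finally have "ridx (free_group d) (carrier (free_group d)) (magnus_group d (Suc c))
      = 2 ^ log_index d c * 2 ^ card (symbol_basis d c)"
    using ridx_tower[OF subgroup_self subgroup_magnus_group subgroup_magnus_group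
        magnus_group_Suc_subset sub finite_cosets_magnus_group] Suc.IH by simp
  moreover have "log_index d (Suc c) = log_index d c + card (symbol_basis d c)"
    using Suc.hyps unfolding log_index_def by simp
  ultimately show ?case by (simp add: power_add)
qed

lemma log_index_Suc: "0 < c \<Longrightarrow> log_index d (Suc c) = log_index d c + card (symbol_basis d c)"
  unfolding log_index_def by simp

text \<open>
  Otherwise the logarithm of the index would grow at most like \<open>(1 + \<rho>)\<^sup>c\<close>, but its increments are at
  least \<open>(d - 1)\<^bsup>c - 1\<^esup>\<close>.
\<close>

lemma large_graded_piece:
  assumes "\<rho> + 2 < d"
  shows "\<exists>c\<ge>c0. 0 < c \<and> \<rho> * log_index d c \<le> card (symbol_basis d c)"
proof (rule ccontr)
  assume contra: "\<not> ?thesis"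
  define b where "b = Suc c0"
  have less: "card (symbol_basis d c) < \<rho> * log_index d c" if "b \<le> c" for c
    using contra that unfolding b_def by (metis Suc_leD not_le zero_less_Suc less_le_trans)
  have up: "log_index d (b + n) \<le> (1 + \<rho>) ^ n * log_index d b" for n
  proof (induction n)
    case (Suc n)
    have "log_index d (b + Suc n) \<le> (1 + \<rho>) * log_index d (b + n)"
      using log_index_Suc[of "b + n" d] less[of "b + n"] by (simp add: b_def)
    also have "\<dots> \<le> (1 + \<rho>) * ((1 + \<rho>) ^ n * log_index d b)" using Suc by (rule mult_le_mono2)
    finally show ?case by (simp add: algebra_simps)
  qed simp
  define L where "L = (1 + \<rho>) * log_index d b"
  have "(d - 1) ^ n \<le> (1 + \<rho>) ^ n * L" for n
  proof -
    have "(d - 1) ^ n \<le> (d - 1) ^ (b + n - 1)"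
      by (rule power_increasing) (use assms in \<open>auto simp: b_def\<close>)
    also have "\<dots> \<le> card (symbol_basis d (b + n))"
      using symbol_basis(3)[of "b + n" d] assms by (simp add: b_def)
    also have "\<dots> \<le> log_index d (b + Suc n)" using log_index_Suc[of "b + n" d] by (simp add: b_def)
    also have "\<dots> \<le> (1 + \<rho>) ^ n * L" using up[of "Suc n"] unfolding L_def by (simp add: algebra_simps)
    finally show ?thesis .
  qed
  then have bound: "(real (d - 1) / real (1 + \<rho>)) ^ n \<le> real L" for n
    by (simp add: power_divide divide_le_eq mult.commute flip: of_nat_power of_nat_mult del: of_nat_add of_nat_Suc)
  \<comment> \<open>The growth rate \<open>d - 1\<close> of the pieces beats
    \<open>1 + \<rho>\<close> precisely because \<open>\<rho> + 2 < d\<close>.\<close>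
  have "1 < real (d - 1) / real (1 + \<rho>)" using assms by (simp add: less_divide_eq)
  then obtain n where "real L < (real (d - 1) / real (1 + \<rho>)) ^ n" using real_arch_pow by blast
  then show False using bound[of n] by simp
qed

lemma le_log_index: "2 \<le> d \<Longrightarrow> c - 1 \<le> log_index d c"
proof -
  assume d: "2 \<le> d"
  have "(\<Sum>b\<in>{1..<c}. 1) \<le> (\<Sum>b\<in>{1..<c}. card (symbol_basis d b))"
  proof (rule sum_mono)
    fix b assume "b \<in> {1..<c}"
    then have "(d - 1) ^ (b - 1) \<le> card (symbol_basis d b)" using symbol_basis(3)[of b d] d by simp
    moreover have "1 \<le> (d - 1) ^ (b - 1)" using d by simp
    ultimately show "1 \<le> card (symbol_basis d b)" by linarith
  qed
  then show ?thesis unfolding log_index_def by simp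
qed

text \<open>The forms \<open>u + \<Sum>u'. A u u' * u'\<close> on a graded piece, for \<open>u\<close> and \<open>u'\<close> in disjoint sets of coordinates.\<close>

definition graph_form :: "(letter list \<times> letter list) set \<Rightarrow> letter list set \<Rightarrow> letter list \<Rightarrow> letter list \<Rightarrow> bit" where
  "graph_form A J2 u w = magnus w u + (\<Sum>v\<in>{v \<in> J2. (u, v) \<in> A}. magnus w v)"

text \<open>The preimage of the graph of the linear map with matrix \<open>A\<close> from the
  \<open>J2\<close>-coordinates to the \<open>J1\<close>-coordinates. Graphs are only some of the
  subspaces of their codimension, but they are easy to count: one for each matrix.\<close>

definition graph_subgroup ::
  "nat \<Rightarrow> nat \<Rightarrow> letter list set \<Rightarrow> letter list set \<Rightarrow> (letter list \<times> letter list) set \<Rightarrow> letter list set" where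
  "graph_subgroup d c J1 J2 A = {w \<in> magnus_group d c. \<forall>u\<in>J1. graph_form A J2 u w = 0}"

text \<open>Normality holds since conjugation does not change the coefficients of degree
  \<open>c\<close> on \<open>magnus_group d c\<close>. The \<open>J1\<close>-coordinates can be
  prescribed freely, so the forms take all values, which gives the index.\<close>

lemma graph_subgroup_props:
  assumes c: "0 < c" and J: "symbol_basis d c = J1 \<union> J2" "J1 \<inter> J2 = {}"
  defines "N \<equiv> graph_subgroup d c J1 J2"
  shows "N A \<lhd> free_group d" "ridx (free_group d) (magnus_group d c) (N A) = 2 ^ card J1"
    "finite ((\<lambda>x. N A #>\<^bsub>free_group d\<^esub> x) ` magnus_group d c)"
    "inj_on N (Pow (J1 \<times> J2))"
proof -
  interpret group "free_group d" by (rule group_free_group)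
  have JM: "J1 \<subseteq> monomials d c" "J2 \<subseteq> monomials d c" using symbol_basis(1)[OF c, of d] J by auto
  then have fin: "finite J1" "finite J2" using finite_monomials finite_subset by blast+
  have mag: "magnus (x \<otimes>\<^bsub>free_group d\<^esub> y) u = magnus x u + magnus y u"
    if "x \<in> magnus_group d c" "y \<in> magnus_group d c" "u \<in> monomials d c" for x y u
    using magnus_mult_left(1)[OF that(1,3) c] by simp
  have form: "graph_form A J2 u (x \<otimes>\<^bsub>free_group d\<^esub> y) = graph_form A J2 u x + graph_form A J2 u y"
    if "x \<in> magnus_group d c" "y \<in> magnus_group d c" "u \<in> J1" for x y u A
  proof -
    have "(\<Sum>v\<in>{v \<in> J2. (u, v) \<in> A}. magnus (x \<otimes>\<^bsub>free_group d\<^esub> y) v)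
        = (\<Sum>v\<in>{v \<in> J2. (u, v) \<in> A}. magnus x v + magnus y v)"
      by (rule sum.cong) (use mag[OF that(1,2)] JM in auto)
    then show ?thesis using mag[OF that(1,2), of u] that(3) JM
      unfolding graph_form_def by (auto simp: sum.distrib ac_simps)
  qed
  have m_inv: "inv\<^bsub>free_group d\<^esub> x \<in> magnus_group d c" if "x \<in> magnus_group d c" for x
    using subgroup.m_inv_closed[OF subgroup_magnus_group that] .
  have m_mult: "x \<otimes>\<^bsub>free_group d\<^esub> y \<in> magnus_group d c" if "x \<in> magnus_group d c" "y \<in> magnus_group d c" for x y
    using subgroup.m_closed[OF subgroup_magnus_group that] .
  have m_one: "\<one>\<^bsub>free_group d\<^esub> \<in> magnus_group d c"
    using subgroup.one_closed[OF subgroup_magnus_group] .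
  have form_one: "graph_form A J2 u \<one>\<^bsub>free_group d\<^esub> = 0" if "u \<in> J1" for u A
    using form[OF m_one m_one that, of A] by simp
  have form_inv: "graph_form A J2 u (inv\<^bsub>free_group d\<^esub> x) = graph_form A J2 u x"
    if "x \<in> magnus_group d c" "u \<in> J1" for x u A
    using form[OF that(1) m_inv[OF that(1)] that(2), of A] form_one[OF that(2), of A] that(1) magnus_group_carrier by simp
  have N: "w \<in> N A \<longleftrightarrow> w \<in> magnus_group d c \<and> (\<forall>u\<in>J1. graph_form A J2 u w = 0)" for w A
    unfolding N_def graph_subgroup_def by simp
  have sub: "subgroup (N A) (free_group d)" for A
  proof (rule subgroupI)
    have "\<one>\<^bsub>free_group d\<^esub> \<in> N A" unfolding N using m_one form_one by simp
    then show "N A \<noteq> {}" by blast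
  qed (use N form form_inv m_mult m_inv magnus_group_carrier in auto)
  show "N A \<lhd> free_group d" for A
    unfolding normal_inv_iff
  proof (intro conjI ballI sub)
    fix g x assume g: "g \<in> carrier (free_group d)" and x: "x \<in> N A"
    then have xm: "x \<in> magnus_group d c" unfolding N by simp
    let ?z = "g \<otimes>\<^bsub>free_group d\<^esub> x \<otimes>\<^bsub>free_group d\<^esub> inv\<^bsub>free_group d\<^esub> g"
    have "magnus ?z u = magnus x u" if "u \<in> monomials d c" for u
      using magnus_conj(2)[OF xm g that c] .
    then have "graph_form A J2 u ?z = graph_form A J2 u x" if "u \<in> J1" for u
      unfolding graph_form_def using that JM by (auto intro!: arg_cong2[of _ _ _ _ "(+)"] sum.cong)
    then show "?z \<in> N A" using x magnus_conj(1)[OF xm g] unfolding N by simp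
  qed
  have dual: "\<exists>w\<in>magnus_group d c. \<forall>u\<in>J1 \<union> J2. magnus w u = (if u \<in> B then 1 else 0)" if B: "B \<subseteq> J1 \<union> J2" for B
  proof -
    have "B \<in> (\<lambda>A. A \<inter> symbol_basis d c) ` symbol d c ` magnus_group d c"
      using symbol_basis(2)[OF c, of d] B J(1) unfolding bij_betw_def by auto
    then obtain w where w: "w \<in> magnus_group d c" "symbol d c w \<inter> (J1 \<union> J2) = B" unfolding J(1) by auto
    have "magnus w u = (if u \<in> B then 1 else 0)" if u: "u \<in> J1 \<union> J2" for u
    proof -
      have "u \<in> B \<longleftrightarrow> magnus w u = 1" using w(2) u JM unfolding symbol_def by blast
      then show ?thesis by (cases "magnus w u") auto
    qed
    then show ?thesis using w(1) by blast
  qed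
  define f where "f = (\<lambda>A w. {u \<in> J1. graph_form A J2 u w = 1})"
  have f_eq: "f A x = f A y \<longleftrightarrow> x \<otimes>\<^bsub>free_group d\<^esub> inv\<^bsub>free_group d\<^esub> y \<in> N A"
    if "x \<in> magnus_group d c" "y \<in> magnus_group d c" for x y A
  proof -
    have "x \<otimes>\<^bsub>free_group d\<^esub> inv\<^bsub>free_group d\<^esub> y \<in> N A \<longleftrightarrow> (\<forall>u\<in>J1. graph_form A J2 u x = graph_form A J2 u y)"
      unfolding N using m_mult[OF that(1) m_inv[OF that(2)]] form[OF that(1) m_inv[OF that(2)]] form_inv[OF that(2)] by simp
    also have "\<dots> \<longleftrightarrow> f A x = f A y"
      unfolding f_def set_eq_iff mem_Collect_eq by (metis bit.exhaust zero_neq_one)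
    finally show ?thesis ..
  qed
  have f_img: "f A ` magnus_group d c = Pow J1" for A
  proof
    show "Pow J1 \<subseteq> f A ` magnus_group d c"
    proof
      fix B assume "B \<in> Pow J1"
      then have B: "B \<subseteq> J1" by simp
      then obtain w where w: "w \<in> magnus_group d c" "\<And>u. u \<in> J1 \<union> J2 \<Longrightarrow> magnus w u = (if u \<in> B then 1 else 0)"
        using dual[of B] by blast
      have "graph_form A J2 u w = (if u \<in> B then 1 else 0)" if "u \<in> J1" for u
      proof -
        have "(\<Sum>v\<in>{v \<in> J2. (u, v) \<in> A}. magnus w v) = 0"
          by (rule sum.neutral) (use w(2) B J(2) in auto)
        then show ?thesis unfolding graph_form_def using w(2)[of u] that by simp
      qed
      then have "f A w = B" unfolding f_def using B by (auto split: if_splits)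
      then show "B \<in> f A ` magnus_group d c" using w(1) by blast
    qed
  qed (auto simp: f_def)
  have carr: "magnus_group d c \<subseteq> carrier (free_group d)" using magnus_group_carrier by blast
  show "ridx (free_group d) (magnus_group d c) (N A) = 2 ^ card J1"
    "finite ((\<lambda>x. N A #>\<^bsub>free_group d\<^esub> x) ` magnus_group d c)"
    using ridx_eq_card_image[OF sub carr, of "f A" A, OF f_eq] fin(1) by (simp_all add: f_img card_Pow)
  have "A \<subseteq> A'" if A: "A \<subseteq> J1 \<times> J2" and eq: "N A = N A'" for A A'
  proof
    fix p assume p: "p \<in> A"
    then obtain u v where uv: "p = (u, v)" "u \<in> J1" "v \<in> J2" using A by blast
    \<comment> \<open>The point of the graph over the unit vector at \<open>v\<close>: its
      \<open>J1\<close>-coordinates are the column of \<open>A\<close> at \<open>v\<close>. It lies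
      in \<open>N A\<close>, and in \<open>N A'\<close> only if the columns agree.\<close>
    define B where "B = insert v {u \<in> J1. (u, v) \<in> A}"
    have B: "B \<subseteq> J1 \<union> J2" unfolding B_def using uv by auto
    then obtain w where w: "w \<in> magnus_group d c" "\<And>u. u \<in> J1 \<union> J2 \<Longrightarrow> magnus w u = (if u \<in> B then 1 else 0)"
      using dual[of B] by blast
    have val: "graph_form A0 J2 x w = (if (x, v) \<in> A then 1 else 0) + (if (x, v) \<in> A0 then 1 else 0)" if x: "x \<in> J1" for A0 x
    proof -
      have "(\<Sum>y\<in>{y \<in> J2. (x, y) \<in> A0}. magnus w y) = (\<Sum>y\<in>{y \<in> J2. (x, y) \<in> A0}. if y = v then 1 else 0)"
        by (rule sum.cong) (use w(2) J(2) in \<open>auto simp: B_def\<close>)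
      also have "\<dots> = (if (x, v) \<in> A0 then 1 else 0)" using fin uv by (simp add: sum.delta)
      finally show ?thesis unfolding graph_form_def using w(2)[of x] x uv J(2) by (auto simp: B_def)
    qed
    have "w \<in> N A" unfolding N using w(1) val by simp
    then have "graph_form A' J2 u w = 0" using eq uv N by blast
    then show "p \<in> A'" using val[OF uv(2), of A'] p uv by (auto split: if_splits)
  qed
  then show "inj_on N (Pow (J1 \<times> J2))" unfolding inj_on_def by (metis Pow_iff subset_antisym)
qed

text \<open>\<open>R\<close> forms are imposed on a graded piece of dimension at least
  \<open>\<rho> * R\<close> below a subgroup of index \<open>2 ^ R\<close>. In general
  \<open>j\<close> forms give index \<open>2 ^ (R + j)\<close> and an exponent of about
  \<open>j * (\<rho> * R - j)\<close>; relative to \<open>(R + j)\<^sup>2\<close> this is largest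
  for \<open>j\<close> near \<open>R\<close> when \<open>\<rho>\<close> is large.\<close>

theorem many_normal_subgroups:
  fixes \<rho> d s :: nat
  assumes "\<rho> + 2 < d" "1 \<le> \<rho>"
  obtains R \<N> where "s \<le> R" "2 ^ ((\<rho> - 1) * R * R) \<le> card \<N>" "finite \<N>"
    "\<And>N. N \<in> \<N> \<Longrightarrow> N \<lhd> free_group d"
    "\<And>N. N \<in> \<N> \<Longrightarrow> finite ((\<lambda>x. N #>\<^bsub>free_group d\<^esub> x) ` carrier (free_group d))"
    "\<And>N. N \<in> \<N> \<Longrightarrow> ridx (free_group d) (carrier (free_group d)) N = 2 ^ (2 * R)"
    "\<And>N w. N \<in> \<N> \<Longrightarrow> w \<in> N \<Longrightarrow> length w \<le> s \<Longrightarrow> w = []"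
proof -
  interpret group "free_group d" by (rule group_free_group)
  \<comment> \<open>Degree \<open>2 * s + 2\<close> excludes nonempty words of length at most
    \<open>s\<close> and also forces \<open>s \<le> R\<close>.\<close>
  obtain c where c: "2 * s + 2 \<le> c" "0 < c" "\<rho> * log_index d c \<le> card (symbol_basis d c)"
    using large_graded_piece[OF assms(1)] by blast
  define R where "R = log_index d c"
  define J where "J = symbol_basis d c"
  have finJ: "finite J" using symbol_basis(1)[OF c(2)] finite_monomials finite_subset unfolding J_def by blast
  have "R \<le> \<rho> * R" using assms(2) by simp
  then have "R \<le> card J" using c(3) unfolding R_def J_def by linarith
  then obtain J1 where J1: "J1 \<subseteq> J" "card J1 = R" using obtain_subset_with_card_n by metis
  define J2 where "J2 = J - J1"
  have J12: "symbol_basis d c = J1 \<union> J2" "J1 \<inter> J2 = {}" using J1 unfolding J2_def J_def by auto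
  have fin: "finite J1" "finite J2" using finJ J1 finite_subset unfolding J2_def by auto
  have "card J2 = card J - R" unfolding J2_def using J1 fin by (simp add: card_Diff_subset)
  then have cJ2: "(\<rho> - 1) * R \<le> card J2"
    using c(3) unfolding R_def[symmetric] J_def[symmetric] by (simp add: diff_mult_distrib)
  define N where "N = graph_subgroup d c J1 J2"
  note props = graph_subgroup_props[OF c(2) J12, folded N_def]
  have sub: "subgroup (N A) (free_group d)" for A using normal_imp_subgroup[OF props(1)] .
  have NA: "N A \<subseteq> magnus_group d c" for A unfolding N_def graph_subgroup_def by blast
  have carr: "magnus_group d c \<subseteq> carrier (free_group d)" using magnus_group_carrier by blast
  have fc: "finite ((\<lambda>x. N A #>\<^bsub>free_group d\<^esub> x) ` carrier (free_group d))" for A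
    using finite_cosets_trans[OF subgroup_self subgroup_magnus_group sub carr finite_cosets_magnus_group props(3)] .
  show ?thesis
  proof (rule that[of R "N ` Pow (J1 \<times> J2)"])
    show "s \<le> R" using le_log_index[of d c] assms c(1) unfolding R_def by linarith
    have "card (N ` Pow (J1 \<times> J2)) = 2 ^ (R * card J2)"
      using card_image[OF props(4)] fin J1 by (simp add: card_Pow card_cartesian_product)
    moreover have "(\<rho> - 1) * R * R \<le> R * card J2" using cJ2 by (simp add: mult.commute mult_le_mono)
    ultimately show "2 ^ ((\<rho> - 1) * R * R) \<le> card (N ` Pow (J1 \<times> J2))" by simp
    fix M assume "M \<in> N ` Pow (J1 \<times> J2)"
    then obtain A where A: "M = N A" by blast
    show "M \<lhd> free_group d" using props(1) A by simp
    show "finite ((\<lambda>x. M #>\<^bsub>free_group d\<^esub> x) ` carrier (free_group d))" using fc A by simp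
    show "ridx (free_group d) (carrier (free_group d)) M = 2 ^ (2 * R)"
      using ridx_tower[OF subgroup_self subgroup_magnus_group sub NA carr fc, of A] ridx_magnus_group[OF c(2), of d]
        props(2)[of A] J1 A unfolding R_def by (simp add: mult_2 power_add)
    fix w assume "w \<in> M" "length w \<le> s"
    then show "w = []" using magnus_group_short[of w d c] NA[of A] A c(1) by auto
  qed (use fin in simp)
qed

section \<open>Groups of 2-power order\<close>

text \<open>By the class equation: conjugacy classes have 2-power size, so they are even unless they
  consist of a central element. With \<open>\<one>\<close> as the only central element the order
  would be odd.\<close>

lemma (in group) two_group_center_nontrivial:
  assumes ord: "order G = 2 ^ n" and "0 < n"
  shows "\<exists>z\<in>carrier G. z \<noteq> \<one> \<and> (\<forall>x\<in>carrier G. x \<otimes> z = z \<otimes> x)"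
proof (rule ccontr)
  assume contra: "\<not> ?thesis"
  define \<phi> where "\<phi> = (\<lambda>g. \<lambda>h \<in> carrier G. g \<otimes> h \<otimes> (inv g))"
  interpret A: group_action G "carrier G" \<phi> unfolding \<phi>_def by (rule action_by_conjugation)
  have fin: "finite (carrier G)" using ord order_gt_0_iff_finite by simp
  have orb_one: "orbit G \<phi> \<one> = {\<one>}"
    unfolding orbit_def \<phi>_def by (auto intro: exI[of _ \<one>])
  have even_orb: "even (card b)" if b: "b \<in> orbits G (carrier G) \<phi>" "b \<noteq> {\<one>}" for b
  proof -
    obtain x where x: "x \<in> carrier G" "b = orbit G \<phi> x" using b unfolding orbits_def by blast
    have "card b dvd 2 ^ n"
      using A.orbit_stabilizer_theorem[OF x(1)] ord x(2) by (metis dvd_triv_left)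
    then obtain j where j: "card b = 2 ^ j" by (auto simp: divides_primepow_nat[OF two_is_prime_nat])
    have "j \<noteq> 0"
    proof
      assume "j = 0"
      then obtain y where "b = {y}" using j by (auto simp: card_1_singleton_iff)
      moreover have "x \<in> b" using A.orbit_refl[OF x(1)] x(2) by simp
      ultimately have bx: "orbit G \<phi> x = {x}" using x(2) by simp
      have "g \<otimes> x = x \<otimes> g" if g: "g \<in> carrier G" for g
      proof -
        have "\<phi> g x \<in> orbit G \<phi> x" unfolding orbit_def using g by blast
        then have "g \<otimes> x \<otimes> inv g = x" using bx x(1) by (simp add: \<phi>_def)
        then have "g \<otimes> x \<otimes> inv g \<otimes> g = x \<otimes> g" by simp
        then show ?thesis using g x(1) by (simp add: m_assoc)
      qed
      then have "x = \<one>" using contra x(1) by blast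
      then show False using b(2) x(2) orb_one by simp
    qed
    then show ?thesis using j by simp
  qed
  have finO: "finite (orbits G (carrier G) \<phi>)"
    unfolding orbits_def using fin by (simp add: setcompr_eq_image)
  have "(\<Sum>b\<in>orbits G (carrier G) \<phi>. \<Sum>a\<in>b. 1) = (\<Sum>a\<in>carrier G. 1::nat)"
    by (rule disjoint_sum[OF finO fin A.orbit_partition])
  then have "(\<Sum>b\<in>orbits G (carrier G) \<phi>. card b) = 2 ^ n" using ord by (simp add: order_def)
  moreover have "{\<one>} \<in> orbits G (carrier G) \<phi>" unfolding orbits_def using orb_one by force
  ultimately have "card {\<one>} + (\<Sum>b\<in>orbits G (carrier G) \<phi> - {{\<one>}}. card b) = 2 ^ n"
    using sum.remove[OF finO, of "{\<one>}" card] by simp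
  moreover have "even (\<Sum>b\<in>orbits G (carrier G) \<phi> - {{\<one>}}. card b)"
    by (rule dvd_sum) (use even_orb in auto)
  ultimately have "odd (2 ^ n :: nat)" by (metis card.empty card.insert empty_iff finite.emptyI even_Suc plus_1_eq_Suc One_nat_def)
  then show False using \<open>0 < n\<close> by simp
qed

text \<open>Repeated squaring of a nontrivial central element reaches the identity; the last element
  before that is the involution.\<close>

lemma (in group) two_group_central_involution:
  assumes ord: "order G = 2 ^ n" and "0 < n"
  shows "\<exists>z\<in>carrier G. z \<noteq> \<one> \<and> z \<otimes> z = \<one> \<and> (\<forall>x\<in>carrier G. x \<otimes> z = z \<otimes> x)"
proof -
  obtain z where z: "z \<in> carrier G" "z \<noteq> \<one>" "\<And>x. x \<in> carrier G \<Longrightarrow> x \<otimes> z = z \<otimes> x"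
    using two_group_center_nontrivial[OF assms] by blast
  have ex: "z [^] ((2::nat) ^ n) = \<one>" using pow_order_eq_1[OF z(1)] ord by simp
  define j where "j = (LEAST j. z [^] ((2::nat) ^ j) = \<one>)"
  have j: "z [^] ((2::nat) ^ j) = \<one>" unfolding j_def by (rule LeastI[of _ n]) (rule ex)
  have "j \<noteq> 0" using j z by (intro notI) simp
  then obtain i where i: "j = Suc i" by (cases j) auto
  define y where "y = z [^] ((2::nat) ^ i)"
  have "y \<noteq> \<one>" unfolding y_def using not_less_Least[of i "\<lambda>j. z [^] ((2::nat) ^ j) = \<one>"] i j_def by simp
  moreover have "y \<otimes> y = \<one>" unfolding y_def using j z(1) by (simp add: i nat_pow_mult mult_2)
  moreover have "x \<otimes> y = y \<otimes> x" if x: "x \<in> carrier G" for x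
  proof -
    have "x \<otimes> z [^] m = z [^] m \<otimes> x" for m :: nat
    proof (induction m)
      case (Suc m)
      have "x \<otimes> z [^] Suc m = (x \<otimes> z [^] m) \<otimes> z" using x z(1) by (simp add: m_assoc)
      also have "\<dots> = z [^] m \<otimes> (x \<otimes> z)" unfolding Suc using x z(1) by (simp add: m_assoc)
      also have "\<dots> = z [^] Suc m \<otimes> x" using z(3)[OF x] x z(1) by (simp add: m_assoc)
      finally show ?case .
    qed (use x in simp)
    then show ?thesis unfolding y_def .
  qed
  moreover have "y \<in> carrier G" unfolding y_def using z(1) by simp
  ultimately show ?thesis by blast
qed

text \<open>Products of subsequences in the given order. For commuting involutions this is the group
  they generate, but it is also meaningful in the free group, where it supplies representatives
  before any relation is imposed.\<close>

primrec subset_products :: "('a, 'b) monoid_scheme \<Rightarrow> 'a list \<Rightarrow> 'a set" where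
  "subset_products G [] = {\<one>\<^bsub>G\<^esub>}"
| "subset_products G (r # rs) = subset_products G rs \<union> (\<lambda>x. r \<otimes>\<^bsub>G\<^esub> x) ` subset_products G rs"

lemma finite_subset_products: "finite (subset_products G rs)"
  by (induction rs) auto

lemma card_subset_products_le: "card (subset_products G rs) \<le> 2 ^ length rs"
proof (induction rs)
  case (Cons r rs)
  have "card (subset_products G (r # rs)) \<le> card (subset_products G rs) + card ((\<lambda>x. r \<otimes>\<^bsub>G\<^esub> x) ` subset_products G rs)"
    by (simp add: card_Un_le)
  also have "\<dots> \<le> 2 ^ length rs + 2 ^ length rs"
    using Cons card_image_le[OF finite_subset_products, of "\<lambda>x. r \<otimes>\<^bsub>G\<^esub> x" G rs] by linarith
  finally show ?case by simp
qed simp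

context group
begin

lemma one_in_subset_products: "\<one> \<in> subset_products G rs"
  by (induction rs) auto

lemma subset_products_carrier: "set rs \<subseteq> carrier G \<Longrightarrow> subset_products G rs \<subseteq> carrier G"
  by (induction rs) auto

lemma set_subset_products: "set rs \<subseteq> carrier G \<Longrightarrow> set rs \<subseteq> subset_products G rs"
  by (induction rs) (auto intro!: image_eqI[of _ _ \<one>] one_in_subset_products)

lemma subset_products_least:
  assumes "subgroup H G" "set rs \<subseteq> H"
  shows "subset_products G rs \<subseteq> H"
  using assms(2) by (induction rs) (auto intro: subgroup.one_closed[OF assms(1)] subgroup.m_closed[OF assms(1)])

lemma subgroup_subset_products:
  assumes "set rs \<subseteq> carrier G" "\<And>x y. x \<in> set rs \<Longrightarrow> y \<in> set rs \<Longrightarrow> x \<otimes> y = y \<otimes> x"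
    and "\<And>x. x \<in> set rs \<Longrightarrow> x \<otimes> x = \<one>"
  shows "subgroup (subset_products G rs) G"
proof -
  have comm: "s \<otimes> x = x \<otimes> s" if "x \<in> subset_products G rs'" "s \<in> set rs" "set rs' \<subseteq> set rs" for x s rs'
    using that
  proof (induction rs' arbitrary: x)
    case Nil
    then show ?case using assms(1) by auto
  next
    case (Cons r rs')
    have r: "r \<in> carrier G" "s \<in> carrier G" "s \<otimes> r = r \<otimes> s" using Cons.prems assms by auto
    from Cons.prems(1) consider "x \<in> subset_products G rs'" | y where "x = r \<otimes> y" "y \<in> subset_products G rs'" by auto
    then show ?case
    proof cases
      case 2
      then have y: "y \<in> carrier G" using subset_products_carrier[of rs'] Cons.prems assms(1) by auto
      have "s \<otimes> (r \<otimes> y) = (s \<otimes> r) \<otimes> y" using r(1,2) y by (simp add: m_assoc)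
      also have "\<dots> = r \<otimes> (s \<otimes> y)" unfolding r(3) using r(1,2) y by (simp add: m_assoc)
      also have "s \<otimes> y = y \<otimes> s" using Cons.IH[OF 2(2)] Cons.prems by simp
      finally show ?thesis using 2 r y by (simp add: m_assoc)
    qed (use Cons in auto)
  qed
  \<comment> \<open>Multiplication by an entry toggles its presence in the product.\<close>
  have left: "s \<otimes> x \<in> subset_products G rs'" if "x \<in> subset_products G rs'" "s \<in> set rs'" "set rs' \<subseteq> set rs" for x s rs'
    using that
  proof (induction rs' arbitrary: x)
    case (Cons r rs')
    have r: "r \<in> carrier G" "s \<in> carrier G" "s \<otimes> r = r \<otimes> s" "r \<otimes> r = \<one>" using Cons.prems assms by auto
    from Cons.prems(1) consider "x \<in> subset_products G rs'" | y where "x = r \<otimes> y" "y \<in> subset_products G rs'" by auto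
    then show ?case
    proof cases
      case 1
      then show ?thesis using Cons by auto
    next
      case 2
      then have y: "y \<in> carrier G" using subset_products_carrier[of rs'] Cons.prems assms(1) by auto
      show ?thesis
      proof (cases "s = r")
        case True
        have "s \<otimes> x = (r \<otimes> r) \<otimes> y" unfolding 2 True using r(1,2) y by (simp add: m_assoc)
        then show ?thesis using 2 r y by simp
      next
        case False
        have "s \<otimes> x = (s \<otimes> r) \<otimes> y" unfolding 2 using r(1,2) y by (simp add: m_assoc)
        also have "\<dots> = r \<otimes> (s \<otimes> y)" unfolding r(3) using r(1,2) y by (simp add: m_assoc)
        finally show ?thesis using Cons.IH[OF 2(2)] Cons.prems False by auto
      qed
    qed
  qed simp
  have mult: "x \<otimes> y \<in> subset_products G rs" if "x \<in> subset_products G rs'" "y \<in> subset_products G rs" "set rs' \<subseteq> set rs" for x y rs'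
    using that
  proof (induction rs' arbitrary: x)
    case Nil
    then show ?case using subset_products_carrier[OF assms(1)] by auto
  next
    case (Cons r rs')
    from Cons.prems(1) consider "x \<in> subset_products G rs'" | z where "x = r \<otimes> z" "z \<in> subset_products G rs'" by auto
    then show ?case
    proof cases
      case 2
      have "z \<in> carrier G" "y \<in> carrier G" "r \<in> carrier G"
        using subset_products_carrier[of rs'] subset_products_carrier[OF assms(1)] Cons.prems assms(1) 2 by auto
      then have "x \<otimes> y = r \<otimes> (z \<otimes> y)" unfolding 2 by (simp add: m_assoc)
      then show ?thesis using left[of "z \<otimes> y" rs r] Cons.IH[OF 2(2)] Cons.prems by simp
    qed (use Cons in auto)
  qed
  have sq: "x \<otimes> x = \<one>" if "x \<in> subset_products G rs'" "set rs' \<subseteq> set rs" for x rs'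
    using that
  proof (induction rs' arbitrary: x)
    case (Cons r rs')
    from Cons.prems(1) consider "x \<in> subset_products G rs'" | z where "x = r \<otimes> z" "z \<in> subset_products G rs'" by auto
    then show ?case
    proof cases
      case 2
      have c: "z \<in> carrier G" "r \<in> carrier G" "r \<otimes> r = \<one>"
        using subset_products_carrier[of rs'] Cons.prems assms(1,3) 2 by auto
      have "x \<otimes> x = r \<otimes> (z \<otimes> r) \<otimes> z" unfolding 2 using c by (simp add: m_assoc)
      also have "z \<otimes> r = r \<otimes> z" using comm[OF 2(2)] Cons.prems by simp
      also have "r \<otimes> (r \<otimes> z) \<otimes> z = (r \<otimes> r) \<otimes> (z \<otimes> z)" using c(1,2) by (simp add: m_assoc)
      finally show ?thesis using Cons.IH[OF 2(2)] Cons.prems c by simp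
    qed (use Cons in auto)
  qed simp
  show ?thesis
  proof (rule subgroupI)
    show "subset_products G rs \<subseteq> carrier G" by (rule subset_products_carrier[OF assms(1)])
    show "subset_products G rs \<noteq> {}" using one_in_subset_products by blast
    fix x assume x: "x \<in> subset_products G rs"
    then have "inv x = x" using sq[OF x] subset_products_carrier[OF assms(1)] inv_equality by blast
    then show "inv x \<in> subset_products G rs" using x by simp
  qed (use mult in blast)
qed

text \<open>A longest list whose subset products are all distinct will do: an element of
  \<open>X\<close> outside these products translates them to a disjoint set, so it could be added to
  the list.\<close>

lemma exists_independent_list:
  assumes X: "finite X" "X \<subseteq> carrier G" "\<And>x y. x \<in> X \<Longrightarrow> y \<in> X \<Longrightarrow> x \<otimes> y = y \<otimes> x"
    "\<And>x. x \<in> X \<Longrightarrow> x \<otimes> x = \<one>"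
  obtains rs where "set rs \<subseteq> X" "X \<subseteq> subset_products G rs" "card (subset_products G rs) = 2 ^ length rs"
proof -
  define P where "P = (\<lambda>rs. set rs \<subseteq> X \<and> distinct rs \<and> card (subset_products G rs) = 2 ^ length rs)"
  have "P []" unfolding P_def by simp
  moreover have "length rs \<le> card X" if "P rs" for rs
    using that card_mono[OF X(1)] unfolding P_def by (metis distinct_card)
  ultimately obtain rs where rs: "P rs" "\<And>rs'. P rs' \<Longrightarrow> length rs' \<le> length rs"
    using ex_has_greatest_nat[of P "[]" length "Suc (card X)"] by (auto simp: less_Suc_eq_le)
  have sub: "set rs \<subseteq> X" "distinct rs" "card (subset_products G rs) = 2 ^ length rs" using rs(1) unfolding P_def by auto
  have sg: "subgroup (subset_products G rs) G"
    by (rule subgroup_subset_products) (use sub(1) X(2,3,4) in blast)+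
  have "X \<subseteq> subset_products G rs"
  proof
    fix x assume x: "x \<in> X"
    show "x \<in> subset_products G rs"
    proof (rule ccontr)
      assume nx: "x \<notin> subset_products G rs"
      have xc: "x \<in> carrier G" using x X by blast
      have c: "subset_products G rs \<subseteq> carrier G" using subgroup.subset[OF sg] .
      have disj: "subset_products G rs \<inter> (\<lambda>y. x \<otimes> y) ` subset_products G rs = {}"
      proof (rule ccontr)
        assume "subset_products G rs \<inter> (\<lambda>y. x \<otimes> y) ` subset_products G rs \<noteq> {}"
        then obtain y where y: "y \<in> subset_products G rs" "x \<otimes> y \<in> subset_products G rs" by blast
        then have "x \<otimes> y \<otimes> inv y \<in> subset_products G rs"
          using subgroup.m_closed[OF sg] subgroup.m_inv_closed[OF sg] by blast
        then show False using nx xc y c by (simp add: m_assoc subset_iff)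
      qed
      have "inj_on (\<lambda>y. x \<otimes> y) (subset_products G rs)"
        using xc c by (intro inj_onI) (simp add: subset_iff)
      then have "card (subset_products G (x # rs)) = 2 ^ length (x # rs)"
        using sub(3) card_Un_disjoint[OF finite_subset_products finite_imageI[OF finite_subset_products] disj]
        by (simp add: card_image)
      moreover have "x \<notin> set rs" using nx set_subset_products[of rs] sub X by blast
      ultimately have "P (x # rs)" unfolding P_def using sub x by simp
      then show False using rs(2)[of "x # rs"] by simp
    qed
  qed
  then show ?thesis using that sub by blast
qed

end

lemma (in group_hom) image_subset_products:
  "set rs \<subseteq> carrier G \<Longrightarrow> h ` subset_products G rs = subset_products H (map h rs)"
proof (induction rs)
  case (Cons r rs)
  then have "subset_products G rs \<subseteq> carrier G" using G.subset_products_carrier by simp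
  then have "h ` (\<lambda>x. r \<otimes> x) ` subset_products G rs = (\<lambda>x. h r \<otimes>\<^bsub>H\<^esub> x) ` h ` subset_products G rs"
    using Cons.prems by (force simp: image_image)
  then show ?case using Cons by (simp add: image_Un)
qed simp

section \<open>Relators along a chief series\<close>

lemma list_in_image:
  assumes "set xs \<subseteq> f ` A"
  obtains ys where "set ys \<subseteq> A" "xs = map f ys"
proof -
  have "\<exists>ys. set ys \<subseteq> A \<and> xs = map f ys"
    using assms
  proof (induction xs)
    case (Cons x xs)
    then obtain ys y where "set ys \<subseteq> A" "xs = map f ys" "y \<in> A" "x = f y" by auto
    then show ?case by (intro exI[of _ "y # ys"]) simp
  qed simp
  then show ?thesis using that by blast
qed

definition chief_basis :: "('a, 'b) monoid_scheme \<Rightarrow> 'a set \<Rightarrow> 'a set \<Rightarrow> 'a \<Rightarrow> 'a list \<Rightarrow> bool" where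
  "chief_basis G M' M \<rho> rs \<longleftrightarrow>
     (\<forall>x\<in>M'. \<exists>t\<in>subset_products G rs. x \<otimes>\<^bsub>G\<^esub> inv\<^bsub>G\<^esub> t \<in> M) \<and>
     (\<forall>t\<in>subset_products G rs. t \<in> M \<longrightarrow> t = \<one>\<^bsub>G\<^esub>) \<and>
     \<rho> \<otimes>\<^bsub>G\<^esub> \<rho> \<in> M \<and> (\<forall>r\<in>set rs. r \<otimes>\<^bsub>G\<^esub> \<rho> \<otimes>\<^bsub>G\<^esub> inv\<^bsub>G\<^esub> (\<rho> \<otimes>\<^bsub>G\<^esub> r) \<in> M)"

text \<open>\<open>M'\<close> is minimal inside the central elements of order at most 2 of
  \<open>K\<close> modulo \<open>M\<close>. So \<open>K\<close> acts trivially on \<open>M'\<close>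
  modulo \<open>M\<close>, and a conjugate of \<open>\<rho>\<close> depends only on the class modulo
  \<open>K\<close> of the conjugating element. Representatives from \<open>Rep\<close>, a set
  independent of \<open>M\<close>, therefore suffice for a basis.\<close>

lemma (in group) central_chief_factor:
  assumes K: "K \<lhd> G" and M: "M \<lhd> G" "M \<subseteq> K"
    and fin: "finite ((\<lambda>x. M #> x) ` carrier G)" and idx: "ridx G K M = 2 ^ n" "0 < n"
    and Rep: "finite Rep" "Rep \<subseteq> carrier G" "\<And>g. g \<in> carrier G \<Longrightarrow> \<exists>t\<in>Rep. g \<otimes> inv t \<in> K"
  obtains M' w where "M' \<lhd> G" "M \<subseteq> M'" "M' \<subseteq> K" "0 < w" "ridx G M' M = 2 ^ w"
    "\<And>\<rho>. \<rho> \<in> M' \<Longrightarrow> \<rho> \<notin> M \<Longrightarrow> \<exists>gs. set gs \<subseteq> Rep \<and> length gs = w \<and>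
      chief_basis G M' M \<rho> (map (\<lambda>g. g \<otimes> \<rho> \<otimes> inv g) gs)"
proof -
  interpret M: normal M G by fact
  interpret K: normal K G by fact
  define Q where "Q = G Mod M"
  define q where "q = (\<lambda>x. M #> x)"
  interpret Q: group Q unfolding Q_def by (rule M.factorgroup_is_group)
  interpret q: group_hom G Q q
    using M.r_coset_hom_Mod is_group Q.is_group unfolding Q_def q_def
    by (simp add: group_hom_def group_hom_axioms_def)
  have q_eq: "q x = q y \<longleftrightarrow> x \<otimes> inv y \<in> M" if "x \<in> carrier G" "y \<in> carrier G" for x y
    unfolding q_def by (rule rcos_eq_iff[OF M.is_subgroup that])
  have q_one: "q x = \<one>\<^bsub>Q\<^esub> \<longleftrightarrow> x \<in> M" if "x \<in> carrier G" for x
    unfolding q_def Q_def using rcos_eq_self_iff[OF M.is_subgroup that] by simp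
  have finq: "finite (q ` A)" if "A \<subseteq> carrier G" for A
    using finite_subset[OF image_mono[OF that] fin] unfolding q_def .
  have idx_q: "ridx G A M = card (q ` A)" for A unfolding ridx_def q_def ..

  \<comment> \<open>Central elements of order at most 2 in \<open>K\<close> modulo
    \<open>M\<close>\<close>
  define \<Omega> where "\<Omega> = {x \<in> K. q x \<otimes>\<^bsub>Q\<^esub> q x = \<one>\<^bsub>Q\<^esub> \<and> (\<forall>y\<in>K. q x \<otimes>\<^bsub>Q\<^esub> q y = q y \<otimes>\<^bsub>Q\<^esub> q x)}"
  have \<Omega>D: "x \<in> K" "x \<in> carrier G" "q x \<otimes>\<^bsub>Q\<^esub> q x = \<one>\<^bsub>Q\<^esub>" "\<And>y. y \<in> K \<Longrightarrow> q x \<otimes>\<^bsub>Q\<^esub> q y = q y \<otimes>\<^bsub>Q\<^esub> q x" if "x \<in> \<Omega>" for x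
    using that K.mem_carrier unfolding \<Omega>_def by auto
  have \<Omega>_sub: "subgroup \<Omega> G"
  proof (rule subgroupI)
    show "\<Omega> \<subseteq> carrier G" using \<Omega>D by blast
    have "\<one> \<in> \<Omega>" unfolding \<Omega>_def using K.mem_carrier by auto
    then show "\<Omega> \<noteq> {}" by blast
    fix x assume x: "x \<in> \<Omega>"
    note x' = \<Omega>D[OF x]
    have "inv\<^bsub>Q\<^esub> q x = q x" using x'(2,3) by (intro Q.inv_equality) auto
    then have "q (inv x) = q x" using x'(2) by simp
    moreover have "inv x \<in> K" using x'(1) by blast
    ultimately show "inv x \<in> \<Omega>" unfolding \<Omega>_def mem_Collect_eq using x'(3,4) by metis
    fix y assume y: "y \<in> \<Omega>"
    note y' = \<Omega>D[OF y]
    have c: "q x \<in> carrier Q" "q y \<in> carrier Q" using x'(2) y'(2) by auto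
    have "q (x \<otimes> y) \<otimes>\<^bsub>Q\<^esub> q (x \<otimes> y) = q x \<otimes>\<^bsub>Q\<^esub> (q y \<otimes>\<^bsub>Q\<^esub> q x) \<otimes>\<^bsub>Q\<^esub> q y" using c x'(2) y'(2) by (simp add: Q.m_assoc)
    also have "q y \<otimes>\<^bsub>Q\<^esub> q x = q x \<otimes>\<^bsub>Q\<^esub> q y" using x'(4)[OF y'(1)] by simp
    also have "q x \<otimes>\<^bsub>Q\<^esub> (q x \<otimes>\<^bsub>Q\<^esub> q y) \<otimes>\<^bsub>Q\<^esub> q y = (q x \<otimes>\<^bsub>Q\<^esub> q x) \<otimes>\<^bsub>Q\<^esub> (q y \<otimes>\<^bsub>Q\<^esub> q y)" using c by (simp add: Q.m_assoc)
    finally have 1: "q (x \<otimes> y) \<otimes>\<^bsub>Q\<^esub> q (x \<otimes> y) = \<one>\<^bsub>Q\<^esub>" using x'(3) y'(3) by simp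
    have "q (x \<otimes> y) \<otimes>\<^bsub>Q\<^esub> q z = q z \<otimes>\<^bsub>Q\<^esub> q (x \<otimes> y)" if z: "z \<in> K" for z
    proof -
      have zc: "q z \<in> carrier Q" using z K.mem_carrier by simp
      have "q (x \<otimes> y) \<otimes>\<^bsub>Q\<^esub> q z = q x \<otimes>\<^bsub>Q\<^esub> (q y \<otimes>\<^bsub>Q\<^esub> q z)" using c zc x'(2) y'(2) by (simp add: Q.m_assoc)
      also have "\<dots> = (q x \<otimes>\<^bsub>Q\<^esub> q z) \<otimes>\<^bsub>Q\<^esub> q y" unfolding y'(4)[OF z] using c zc by (simp add: Q.m_assoc)
      also have "\<dots> = q z \<otimes>\<^bsub>Q\<^esub> q (x \<otimes> y)" unfolding x'(4)[OF z] using c zc x'(2) y'(2) by (simp add: Q.m_assoc)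
      finally show ?thesis .
    qed
    moreover have "x \<otimes> y \<in> K" using x'(1) y'(1) by blast
    ultimately show "x \<otimes> y \<in> \<Omega>" unfolding \<Omega>_def mem_Collect_eq using 1 by blast
  qed
  have \<Omega>: "\<Omega> \<lhd> G"
    unfolding normal_inv_iff
  proof (intro conjI ballI \<Omega>_sub)
    fix g x assume g: "g \<in> carrier G" and x: "x \<in> \<Omega>"
    note x' = \<Omega>D[OF x]
    have c: "q g \<in> carrier Q" "q x \<in> carrier Q" using g x'(2) by auto
    let ?z = "g \<otimes> x \<otimes> inv g"
    have zK: "?z \<in> K" using K.inv_op_closed2 g x'(1) by simp
    have qz: "q ?z = q g \<otimes>\<^bsub>Q\<^esub> q x \<otimes>\<^bsub>Q\<^esub> inv\<^bsub>Q\<^esub> q g" using g x'(2) by simp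
    have "q ?z \<otimes>\<^bsub>Q\<^esub> q ?z = q g \<otimes>\<^bsub>Q\<^esub> (q x \<otimes>\<^bsub>Q\<^esub> q x) \<otimes>\<^bsub>Q\<^esub> inv\<^bsub>Q\<^esub> q g" unfolding qz using c by (simp add: Q.m_assoc)
    then have 1: "q ?z \<otimes>\<^bsub>Q\<^esub> q ?z = \<one>\<^bsub>Q\<^esub>" using x'(3) c by simp
    have "q ?z \<otimes>\<^bsub>Q\<^esub> q y = q y \<otimes>\<^bsub>Q\<^esub> q ?z" if y: "y \<in> K" for y
    proof -
      define v where "v = inv g \<otimes> y \<otimes> g"
      have v: "v \<in> K" "v \<in> carrier G" unfolding v_def using K.inv_op_closed1 g y K.mem_carrier by auto
      have vc: "q v \<in> carrier Q" using v by simp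
      have "y = g \<otimes> v \<otimes> inv g" unfolding v_def using g y K.mem_carrier by (simp add: m_assoc)
      then have qy: "q y = q g \<otimes>\<^bsub>Q\<^esub> q v \<otimes>\<^bsub>Q\<^esub> inv\<^bsub>Q\<^esub> q g" using g v by simp
      have "q ?z \<otimes>\<^bsub>Q\<^esub> q y = q g \<otimes>\<^bsub>Q\<^esub> (q x \<otimes>\<^bsub>Q\<^esub> q v) \<otimes>\<^bsub>Q\<^esub> inv\<^bsub>Q\<^esub> q g" unfolding qz qy using c vc by (simp add: Q.m_assoc)
      also have "\<dots> = q y \<otimes>\<^bsub>Q\<^esub> q ?z" unfolding qz qy x'(4)[OF v(1)] using c vc by (simp add: Q.m_assoc)
      finally show ?thesis .
    qed
    then show "?z \<in> \<Omega>" unfolding \<Omega>_def mem_Collect_eq using 1 zK by blast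
  qed
  have M\<Omega>: "M \<subseteq> \<Omega>"
  proof
    fix x assume x: "x \<in> M"
    then have "q x = \<one>\<^bsub>Q\<^esub>" "x \<in> K" using q_one M.mem_carrier M(2) by auto
    then show "x \<in> \<Omega>" unfolding \<Omega>_def using K.mem_carrier by simp
  qed
  have "\<exists>z\<in>\<Omega>. z \<notin> M"
  proof -
    have qK: "subgroup (q ` K) Q" using q.subgroup_img_is_subgroup[OF K.is_subgroup] .
    interpret P: group "Q\<lparr>carrier := q ` K\<rparr>" by (rule Q.subgroup_imp_group[OF qK])
    have "order (Q\<lparr>carrier := q ` K\<rparr>) = 2 ^ n" using idx(1) idx_q by (simp add: order_def)
    from P.two_group_central_involution[OF this idx(2)]
    have "\<exists>Z\<in>q ` K. Z \<noteq> \<one>\<^bsub>Q\<^esub> \<and> Z \<otimes>\<^bsub>Q\<^esub> Z = \<one>\<^bsub>Q\<^esub> \<and> (\<forall>X\<in>q ` K. X \<otimes>\<^bsub>Q\<^esub> Z = Z \<otimes>\<^bsub>Q\<^esub> X)"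
      by simp 
    then obtain Z where Z: "Z \<in> q ` K"
      "Z \<noteq> \<one>\<^bsub>Q\<^esub> \<and> Z \<otimes>\<^bsub>Q\<^esub> Z = \<one>\<^bsub>Q\<^esub> \<and> (\<forall>X\<in>q ` K. X \<otimes>\<^bsub>Q\<^esub> Z = Z \<otimes>\<^bsub>Q\<^esub> X)"
      by (rule bexE)
    from Z(1) obtain z where z: "Z = q z" "z \<in> K" by (rule imageE)
    have "q z \<otimes>\<^bsub>Q\<^esub> q y = q y \<otimes>\<^bsub>Q\<^esub> q z" if "y \<in> K" for y
      using Z(2)[unfolded z(1)] imageI[OF that, of q] by metis
    then have "z \<in> \<Omega>" unfolding \<Omega>_def mem_Collect_eq using z(2) Z(2)[unfolded z(1)] by blast
    moreover have "q z \<noteq> \<one>\<^bsub>Q\<^esub>" using Z(2)[unfolded z(1)] by blast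
    then have "z \<notin> M" using q_one[OF K.mem_carrier[OF z(2)]] by simp
    ultimately show ?thesis by blast
  qed
  then have "\<Omega> \<lhd> G \<and> M \<subseteq> \<Omega> \<and> \<Omega> \<subseteq> \<Omega> \<and> \<Omega> \<noteq> M" using \<Omega> M\<Omega> by blast

  \<comment> \<open>A minimal normal subgroup above \<open>M\<close>\<close>
  then obtain M' where M'1: "M' \<lhd> G \<and> M \<subseteq> M' \<and> M' \<subseteq> \<Omega> \<and> M' \<noteq> M"
    and M'2: "\<And>H. H \<lhd> G \<and> M \<subseteq> H \<and> H \<subseteq> \<Omega> \<and> H \<noteq> M \<Longrightarrow> ridx G M' M \<le> ridx G H M"
    using ex_has_least_nat[of "\<lambda>H. H \<lhd> G \<and> M \<subseteq> H \<and> H \<subseteq> \<Omega> \<and> H \<noteq> M" \<Omega> "\<lambda>H. ridx G H M"] by blast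
  have M': "M' \<lhd> G" "M \<subseteq> M'" "M' \<subseteq> \<Omega>" "M' \<noteq> M" using M'1 by auto
  interpret M': normal M' G by fact
  \<comment> \<open>By minimality any element outside \<open>M\<close> generates \<open>M'\<close>
    normally together with \<open>M\<close>.\<close>
  have gen: "normal_hull G (insert \<rho> M) = M'" if \<rho>: "\<rho> \<in> M'" "\<rho> \<notin> M" for \<rho>
  proof -
    let ?H = "normal_hull G (insert \<rho> M)"
    have Hn: "?H \<lhd> G" by (rule normal_hull_normal) (use \<rho>(1) M'.subset M.subset in auto)
    have MH: "M \<subseteq> ?H" "\<rho> \<in> ?H" using normal_hull_subset[of "insert \<rho> M"] by auto
    have HM': "?H \<subseteq> M'" by (rule normal_hull_least[OF M'(1)]) (use \<rho>(1) M'(2) in auto)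
    have "ridx G M' M \<le> ridx G ?H M" by (rule M'2) (use Hn MH HM' M'(3) \<rho> in auto)
    then have "q ` ?H = q ` M'"
      using card_seteq[OF finq[OF M'.subset] image_mono[OF HM']] unfolding idx_q by simp
    have "M' \<subseteq> ?H"
    proof
      fix x assume x: "x \<in> M'"
      then obtain y where y: "y \<in> ?H" "q x = q y" using \<open>q ` ?H = q ` M'\<close> by (metis image_iff)
      have c: "x \<in> carrier G" "y \<in> carrier G" using x y HM' M'.subset by auto
      have "x \<otimes> inv y \<in> ?H" using q_eq[OF c] y(2) MH(1) by blast
      then have "x \<otimes> inv y \<otimes> y \<in> ?H" using y(1) subgroup.m_closed[OF normal_imp_subgroup[OF Hn]] by blast
      then show "x \<in> ?H" using c by (simp add: m_assoc)
    qed
    then show ?thesis using HM' by blast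
  qed

  \<comment> \<open>A basis of conjugates of \<open>\<rho>\<close>\<close>
  have main: "\<exists>gs. set gs \<subseteq> Rep \<and> ridx G M' M = 2 ^ length gs \<and>
      chief_basis G M' M \<rho> (map (\<lambda>g. g \<otimes> \<rho> \<otimes> inv g) gs)"
    if \<rho>: "\<rho> \<in> M'" "\<rho> \<notin> M" for \<rho>
  proof -
    define cj where "cj = (\<lambda>g. g \<otimes> \<rho> \<otimes> inv g)"
    have \<rho>c: "\<rho> \<in> carrier G" using \<rho> M'.mem_carrier by blast
    have cj: "cj g \<in> M'" "cj g \<in> \<Omega>" "cj g \<in> carrier G" if "g \<in> carrier G" for g
      unfolding cj_def using M'.inv_op_closed2[OF that \<rho>(1)] M'(3) M'.mem_carrier by auto
    define X where "X = (\<lambda>g. q (cj g)) ` Rep"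
    have \<Omega>comm: "q x \<otimes>\<^bsub>Q\<^esub> q y = q y \<otimes>\<^bsub>Q\<^esub> q x" if "x \<in> \<Omega>" "y \<in> K" for x y using \<Omega>D(4)[OF that] .
    have X: "finite X" "X \<subseteq> carrier Q" "\<And>x y. x \<in> X \<Longrightarrow> y \<in> X \<Longrightarrow> x \<otimes>\<^bsub>Q\<^esub> y = y \<otimes>\<^bsub>Q\<^esub> x" "\<And>x. x \<in> X \<Longrightarrow> x \<otimes>\<^bsub>Q\<^esub> x = \<one>\<^bsub>Q\<^esub>"
    proof -
      show "finite X" unfolding X_def using Rep(1) by simp
      show "X \<subseteq> carrier Q" unfolding X_def using cj(3) Rep(2) by auto
      show "x \<otimes>\<^bsub>Q\<^esub> y = y \<otimes>\<^bsub>Q\<^esub> x" if xy: "x \<in> X" "y \<in> X" for x y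
      proof -
        obtain g h where gh: "g \<in> Rep" "x = q (cj g)" "h \<in> Rep" "y = q (cj h)" using xy unfolding X_def by blast
        then have "cj g \<in> \<Omega>" "cj h \<in> K" using cj(2) Rep(2) \<Omega>D(1) by blast+
        then show ?thesis using \<Omega>comm gh by simp
      qed
      show "x \<otimes>\<^bsub>Q\<^esub> x = \<one>\<^bsub>Q\<^esub>" if x: "x \<in> X" for x
      proof -
        obtain g where g: "g \<in> Rep" "x = q (cj g)" using x unfolding X_def by blast
        then have "cj g \<in> \<Omega>" using cj(2) Rep(2) by blast
        then show ?thesis using \<Omega>D(3) g by simp
      qed
    qed
    obtain xs where xs: "set xs \<subseteq> X" "X \<subseteq> subset_products Q xs" "card (subset_products Q xs) = 2 ^ length xs"
      using Q.exists_independent_list[OF X] by blast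
    obtain gs where gs: "set gs \<subseteq> Rep" "xs = map (\<lambda>g. q (cj g)) gs"
      using list_in_image[OF xs(1)[unfolded X_def]] .
    define rs where "rs = map cj gs"
    have rsc: "set rs \<subseteq> carrier G" "set rs \<subseteq> M'" unfolding rs_def using gs(1) Rep(2) cj by auto
    have q_sp: "q ` subset_products G rs = subset_products Q xs"
      using q.image_subset_products[OF rsc(1)] by (simp add: rs_def gs(2) comp_def)
    have spQ: "subgroup (subset_products Q xs) Q"
      by (rule Q.subgroup_subset_products) (use xs(1) X(2,3,4) in blast)+
    \<comment> \<open>Write \<open>g h = \<kappa> t\<close> with \<open>t\<close> in
      \<open>Rep\<close> and \<open>\<kappa>\<close> in \<open>K\<close>; conjugation by
      \<open>\<kappa>\<close> is invisible modulo \<open>M\<close>.\<close>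
    have conj_X: "q g \<otimes>\<^bsub>Q\<^esub> x \<otimes>\<^bsub>Q\<^esub> inv\<^bsub>Q\<^esub> q g \<in> X" if g: "g \<in> carrier G" and x: "x \<in> X" for g x
    proof -
      obtain h where h: "h \<in> Rep" "x = q (cj h)" using x unfolding X_def by blast
      have hc: "h \<in> carrier G" using h Rep(2) by blast
      obtain t where t: "t \<in> Rep" "g \<otimes> h \<otimes> inv t \<in> K" using Rep(3)[of "g \<otimes> h"] g hc by auto
      have tc: "t \<in> carrier G" using t Rep(2) by blast
      define \<kappa> where "\<kappa> = g \<otimes> h \<otimes> inv t"
      have \<kappa>: "\<kappa> \<in> K" "\<kappa> \<in> carrier G" unfolding \<kappa>_def using t g hc tc by auto
      have "g \<otimes> h = \<kappa> \<otimes> t" unfolding \<kappa>_def using g hc tc by (simp add: m_assoc)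
      then have "g \<otimes> cj h \<otimes> inv g = \<kappa> \<otimes> cj t \<otimes> inv \<kappa>"
      proof -
        have "g \<otimes> cj h \<otimes> inv g = (g \<otimes> h) \<otimes> \<rho> \<otimes> inv (g \<otimes> h)"
          unfolding cj_def using g hc \<rho>c by (simp add: m_assoc inv_mult_group)
        also have "\<dots> = (\<kappa> \<otimes> t) \<otimes> \<rho> \<otimes> inv (\<kappa> \<otimes> t)" using \<open>g \<otimes> h = \<kappa> \<otimes> t\<close> by simp
        also have "\<dots> = \<kappa> \<otimes> cj t \<otimes> inv \<kappa>"
          unfolding cj_def using \<kappa> tc \<rho>c by (simp add: m_assoc inv_mult_group)
        finally show ?thesis .
      qed
      then have "q (g \<otimes> cj h \<otimes> inv g) = q (\<kappa> \<otimes> cj t \<otimes> inv \<kappa>)" by simp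
      then have "q g \<otimes>\<^bsub>Q\<^esub> x \<otimes>\<^bsub>Q\<^esub> inv\<^bsub>Q\<^esub> q g = q \<kappa> \<otimes>\<^bsub>Q\<^esub> q (cj t) \<otimes>\<^bsub>Q\<^esub> inv\<^bsub>Q\<^esub> q \<kappa>"
        using g \<kappa> cj(3)[OF tc] cj(3)[OF hc] h(2) by simp
      also have "\<dots> = q (cj t) \<otimes>\<^bsub>Q\<^esub> q \<kappa> \<otimes>\<^bsub>Q\<^esub> inv\<^bsub>Q\<^esub> q \<kappa>" using \<Omega>comm[OF cj(2)[OF tc] \<kappa>(1)] by simp
      also have "\<dots> = q (cj t)" using \<kappa> cj(3)[OF tc] by (simp add: Q.m_assoc)
      finally show ?thesis unfolding X_def using t(1) by blast
    qed
    \<comment> \<open>The preimage of the span of the conjugates. It is normal and contains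
      \<open>M\<close> and \<open>\<rho>\<close>, hence all of \<open>M'\<close>.\<close>
    define W where "W = {x \<in> carrier G. q x \<in> subset_products Q xs}"
    have W_sub: "subgroup W G"
      by (rule subgroupI)
        (auto simp: W_def intro: subgroup.m_closed[OF spQ] subgroup.m_inv_closed[OF spQ]
          intro!: exI[of _ \<one>] subgroup.one_closed[OF spQ])
    have W_normal: "W \<lhd> G"
      unfolding normal_inv_iff
    proof (intro conjI ballI W_sub)
      fix g x assume g: "g \<in> carrier G" and x: "x \<in> W"
      have gc: "q g \<in> carrier Q" using g by simp
      define H where "H = {y \<in> carrier Q. q g \<otimes>\<^bsub>Q\<^esub> y \<otimes>\<^bsub>Q\<^esub> inv\<^bsub>Q\<^esub> q g \<in> subset_products Q xs}"
      have "subgroup H Q"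
      proof (rule Q.subgroupI)
        have "\<one>\<^bsub>Q\<^esub> \<in> H" unfolding H_def using gc subgroup.one_closed[OF spQ] by simp
        then show "H \<noteq> {}" by blast
        fix x assume "x \<in> H"
        then have x: "x \<in> carrier Q" "q g \<otimes>\<^bsub>Q\<^esub> x \<otimes>\<^bsub>Q\<^esub> inv\<^bsub>Q\<^esub> q g \<in> subset_products Q xs" unfolding H_def by auto
        have "inv\<^bsub>Q\<^esub> (q g \<otimes>\<^bsub>Q\<^esub> x \<otimes>\<^bsub>Q\<^esub> inv\<^bsub>Q\<^esub> q g) = q g \<otimes>\<^bsub>Q\<^esub> inv\<^bsub>Q\<^esub> x \<otimes>\<^bsub>Q\<^esub> inv\<^bsub>Q\<^esub> q g"
          using x(1) gc by (simp add: Q.inv_mult_group Q.m_assoc)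
        then show "inv\<^bsub>Q\<^esub> x \<in> H" unfolding H_def using x subgroup.m_inv_closed[OF spQ x(2)] by simp
        fix y assume "y \<in> H"
        then have y: "y \<in> carrier Q" "q g \<otimes>\<^bsub>Q\<^esub> y \<otimes>\<^bsub>Q\<^esub> inv\<^bsub>Q\<^esub> q g \<in> subset_products Q xs" unfolding H_def by auto
        have "(q g \<otimes>\<^bsub>Q\<^esub> x \<otimes>\<^bsub>Q\<^esub> inv\<^bsub>Q\<^esub> q g) \<otimes>\<^bsub>Q\<^esub> (q g \<otimes>\<^bsub>Q\<^esub> y \<otimes>\<^bsub>Q\<^esub> inv\<^bsub>Q\<^esub> q g) = q g \<otimes>\<^bsub>Q\<^esub> (x \<otimes>\<^bsub>Q\<^esub> y) \<otimes>\<^bsub>Q\<^esub> inv\<^bsub>Q\<^esub> q g"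
          using x(1) y(1) gc by (simp add: Q.m_assoc)
        then show "x \<otimes>\<^bsub>Q\<^esub> y \<in> H" unfolding H_def using x(1) y(1) subgroup.m_closed[OF spQ x(2) y(2)] by simp
      qed (auto simp: H_def)
      moreover have "set xs \<subseteq> H"
      proof
        fix y assume "y \<in> set xs"
        then have "y \<in> X" using xs(1) by blast
        then show "y \<in> H" unfolding H_def using conj_X[OF g] xs(2) X(2) by blast
      qed
      ultimately have "subset_products Q xs \<subseteq> H" by (rule Q.subset_products_least)
      then have "q x \<in> H" using x unfolding W_def by blast
      then show "g \<otimes> x \<otimes> inv g \<in> W" using x g unfolding H_def W_def by simp
    qed
    have MW: "M \<subseteq> W"
    proof
      fix x assume x: "x \<in> M"
      then have "q x = \<one>\<^bsub>Q\<^esub>" "x \<in> carrier G" using q_one M.mem_carrier by auto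
      then show "x \<in> W" unfolding W_def using subgroup.one_closed[OF spQ] by simp
    qed
    have \<rho>W: "\<rho> \<in> W"
    proof -
      obtain t where t: "t \<in> Rep" using Rep(3)[of \<one>] by auto
      then have tc: "t \<in> carrier G" using Rep(2) by blast
      have "cj t \<in> W" unfolding W_def using t cj(3)[OF tc] xs(2) unfolding X_def by blast
      then have "inv t \<otimes> cj t \<otimes> t \<in> W" using normal.inv_op_closed1[OF W_normal tc] by blast
      then show ?thesis unfolding cj_def using tc \<rho>c by (simp add: m_assoc)
    qed
    have "M' \<subseteq> W" using normal_hull_least[OF W_normal, of "insert \<rho> M"] gen[OF \<rho>] MW \<rho>W by blast
    moreover have "subset_products Q xs \<subseteq> q ` M'"
      unfolding q_sp[symmetric] using subset_products_least[OF M'.is_subgroup rsc(2)] by blast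
    ultimately have qM': "q ` M' = subset_products Q xs" unfolding W_def by blast
    have idxM': "ridx G M' M = 2 ^ length gs" unfolding idx_q qM' xs(3) by (simp add: gs(2))
    have pA: "\<exists>t\<in>subset_products G rs. x \<otimes> inv t \<in> M" if x: "x \<in> M'" for x
    proof -
      have "q x \<in> q ` subset_products G rs" unfolding q_sp qM'[symmetric] using x by blast
      then obtain t where t: "t \<in> subset_products G rs" "q x = q t" by blast
      have "t \<in> carrier G" using t subset_products_carrier[OF rsc(1)] by blast
      then show ?thesis using t q_eq x M'.mem_carrier by blast
    qed
    \<comment> \<open>At most \<open>2 ^ length rs\<close> products represent that many cosets, so
      no two of them are congruent modulo \<open>M\<close>.\<close>
    have pB: "t = \<one>" if t: "t \<in> subset_products G rs" "t \<in> M" for t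
    proof -
      have "card (subset_products G rs) \<le> 2 ^ length rs" by (rule card_subset_products_le)
      also have "\<dots> = card (q ` subset_products G rs)" unfolding q_sp xs(3) by (simp add: rs_def gs(2))
      finally have "card (q ` subset_products G rs) = card (subset_products G rs)"
        using card_image_le[OF finite_subset_products, of q G rs] by simp
      then have "inj_on q (subset_products G rs)" by (rule eq_card_imp_inj_on[OF finite_subset_products])
      moreover have "q t = q \<one>" using q_one[OF M.mem_carrier[OF t(2)]] t(2) by simp
      ultimately show ?thesis using t(1) one_in_subset_products by (rule inj_onD)
    qed
    have pC: "\<rho> \<otimes> \<rho> \<in> M"
      using q_one[of "\<rho> \<otimes> \<rho>"] \<Omega>D(3)[of \<rho>] \<rho>(1) M'(3) \<rho>c by auto
    have pD: "cj g \<otimes> \<rho> \<otimes> inv (\<rho> \<otimes> cj g) \<in> M" if g: "g \<in> set gs" for g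
    proof -
      have gc: "g \<in> carrier G" using g gs(1) Rep(2) by blast
      have "\<rho> \<in> K" using \<rho>(1) M'(3) \<Omega>D(1) by blast
      then have "q (cj g \<otimes> \<rho>) = q (\<rho> \<otimes> cj g)" using \<Omega>comm[OF cj(2)[OF gc]] \<rho>c cj(3)[OF gc] by simp
      then show ?thesis using \<rho>c cj(3)[OF gc] by (intro q_eq[THEN iffD1]) simp_all
    qed
    have rs': "map (\<lambda>g. g \<otimes> \<rho> \<otimes> inv g) gs = rs" by (simp add: rs_def cj_def)
    have "chief_basis G M' M \<rho> rs"
      unfolding chief_basis_def using pA pB pC pD by (auto simp: rs_def)
    then show ?thesis using gs(1) idxM' rs' by metis
  qed
  obtain \<rho>0 where \<rho>0: "\<rho>0 \<in> M'" "\<rho>0 \<notin> M" using M'(2,4) by blast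
  obtain gs0 :: "'a list" where gs0: "ridx G M' M = 2 ^ length gs0" using main[OF \<rho>0] by blast
  have "length gs0 \<noteq> 0"
  proof
    assume "length gs0 = 0"
    then have "card (q ` M') = 1" using gs0 unfolding idx_q by simp
    then have "q \<rho>0 = q \<one>" using \<rho>0(1) M'.one_closed by (metis card_1_singletonE imageI singletonD)
    then show False using \<rho>0 q_one M'.mem_carrier by auto
  qed
  then have w: "0 < length gs0" by simp
  have M'K: "M' \<subseteq> K" using M'(3) \<Omega>D(1) by blast
  show ?thesis
  proof (rule that[OF M'(1,2) M'K w gs0])
    fix \<rho> assume "\<rho> \<in> M'" "\<rho> \<notin> M"
    from main[OF this] show "\<exists>gs. set gs \<subseteq> Rep \<and> length gs = length gs0 \<and>
      chief_basis G M' M \<rho> (map (\<lambda>g. g \<otimes> \<rho> \<otimes> inv g) gs)"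
      unfolding gs0 by auto
  qed
qed

text \<open>\<open>ts\<close> records as which subset products the old relators \<open>L\<close> and
  the conjugates of \<open>rs\<close> by \<open>As\<close> are to be read. Once the other arguments
  are fixed, all the information is in \<open>ts\<close>.\<close>

definition relators ::
  "('a, 'b) monoid_scheme \<Rightarrow> 'a list \<Rightarrow> 'a list \<Rightarrow> 'a \<Rightarrow> 'a list \<Rightarrow> 'a list \<Rightarrow> 'a list" where
  "relators G As L \<rho> rs ts =
     map2 (\<lambda>l t. l \<otimes>\<^bsub>G\<^esub> inv\<^bsub>G\<^esub> t) (L @ concat (map (\<lambda>r. map (\<lambda>a. a \<otimes>\<^bsub>G\<^esub> r \<otimes>\<^bsub>G\<^esub> inv\<^bsub>G\<^esub> a) As) rs)) ts
     @ [\<rho> \<otimes>\<^bsub>G\<^esub> \<rho>] @ map (\<lambda>r. r \<otimes>\<^bsub>G\<^esub> \<rho> \<otimes>\<^bsub>G\<^esub> inv\<^bsub>G\<^esub> (\<rho> \<otimes>\<^bsub>G\<^esub> r)) rs"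

text \<open>Both signs are listed: a subgroup mapped into itself under conjugation by the generators
  need not be normal unless the same holds for their inverses.\<close>

definition letter_words :: "nat \<Rightarrow> letter list list" where
  "letter_words k = map (\<lambda>i. [(True, i)]) [0..<k] @ map (\<lambda>i. [(False, i)]) [0..<k]"

lemma length_letter_words: "length (letter_words k) = 2 * k"
  by (simp add: letter_words_def)

lemma letter_words_iff: "snd a < k \<Longrightarrow> [a] \<in> set (letter_words k)"
  "x \<in> set (letter_words k) \<Longrightarrow> x \<in> carrier (free_group k)"
  by (cases a; cases "fst a"; auto simp: letter_words_def) (auto simp: letter_words_def)

lemma map2_map_right: "map2 f xs (map g xs) = map (\<lambda>x. f x (g x)) xs"
  by (induction xs) auto

lemma length_concat_const: "(\<And>x. length (f x) = c) \<Longrightarrow> length (concat (map f xs)) = length xs * c"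
  by (induction xs) auto

lemma free_group_conj_closed:
  assumes "\<And>a x. snd a < k \<Longrightarrow> x \<in> A \<Longrightarrow> [a] \<otimes>\<^bsub>free_group k\<^esub> x \<otimes>\<^bsub>free_group k\<^esub> inv\<^bsub>free_group k\<^esub> [a] \<in> A"
    and "A \<subseteq> carrier (free_group k)" "g \<in> carrier (free_group k)" "x \<in> A"
  shows "g \<otimes>\<^bsub>free_group k\<^esub> x \<otimes>\<^bsub>free_group k\<^esub> inv\<^bsub>free_group k\<^esub> g \<in> A"
  using assms(3,4)
proof (induction arbitrary: x rule: free_group_induct_snoc)
  case one
  interpret group "free_group k" by (rule group_free_group)
  have "[] = \<one>\<^bsub>free_group k\<^esub>" by (simp add: free_group_simps)
  moreover have "\<one>\<^bsub>free_group k\<^esub> \<otimes>\<^bsub>free_group k\<^esub> x \<otimes>\<^bsub>free_group k\<^esub> inv\<^bsub>free_group k\<^esub> \<one>\<^bsub>free_group k\<^esub> = x"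
    using one assms(2) by (simp add: subset_iff)
  ultimately show ?case using one by simp
next
  case (snoc w a)
  interpret group "free_group k" by (rule group_free_group)
  have c: "w \<in> carrier (free_group k)" "[a] \<in> carrier (free_group k)" "x \<in> carrier (free_group k)"
    using snoc assms(2) by auto
  have "(w \<otimes>\<^bsub>free_group k\<^esub> [a]) \<otimes>\<^bsub>free_group k\<^esub> x \<otimes>\<^bsub>free_group k\<^esub> inv\<^bsub>free_group k\<^esub> (w \<otimes>\<^bsub>free_group k\<^esub> [a])
      = w \<otimes>\<^bsub>free_group k\<^esub> ([a] \<otimes>\<^bsub>free_group k\<^esub> x \<otimes>\<^bsub>free_group k\<^esub> inv\<^bsub>free_group k\<^esub> [a]) \<otimes>\<^bsub>free_group k\<^esub> inv\<^bsub>free_group k\<^esub> w"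
    using c by (simp only: m_assoc inv_mult_group m_closed inv_closed)
  then show ?case using snoc.IH[OF assms(1)[OF snoc.hyps(2) snoc.prems]] by simp
qed

text \<open>
  Modulo the relators the conjugates of \<open>\<rho>\<close> commute with each other, because \<open>\<rho>\<close> commutes with the group
  generated by \<open>rs\<close> and this group is normal; hence it consists of the products of subsets of \<open>rs\<close>.
\<close>

lemma normal_hull_relators:
  fixes k :: nat
  defines "F \<equiv> free_group k"
  assumes M: "M \<lhd> F" and M': "normal_hull F (set L) = M'" "M \<subseteq> M'" and L: "set L \<subseteq> carrier F"
    and \<rho>: "\<rho> \<in> M'" and gs: "set gs \<subseteq> carrier F"
    and rs: "rs = map (\<lambda>g. g \<otimes>\<^bsub>F\<^esub> \<rho> \<otimes>\<^bsub>F\<^esub> inv\<^bsub>F\<^esub> g) gs"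
    and basis: "chief_basis F M' M \<rho> rs"
  obtains ts where "length ts = length L + length gs * (2 * k)" "set ts \<subseteq> subset_products F rs"
    "set (relators F (letter_words k) L \<rho> rs ts) \<subseteq> carrier F"
    "normal_hull F (set (relators F (letter_words k) L \<rho> rs ts)) = M"
proof -
  have cover: "\<And>x. x \<in> M' \<Longrightarrow> \<exists>t\<in>subset_products F rs. x \<otimes>\<^bsub>F\<^esub> inv\<^bsub>F\<^esub> t \<in> M"
    and indep: "\<And>t. t \<in> subset_products F rs \<Longrightarrow> t \<in> M \<Longrightarrow> t = \<one>\<^bsub>F\<^esub>"
    and \<rho>2: "\<rho> \<otimes>\<^bsub>F\<^esub> \<rho> \<in> M"
    and comm: "\<And>r. r \<in> set rs \<Longrightarrow> r \<otimes>\<^bsub>F\<^esub> \<rho> \<otimes>\<^bsub>F\<^esub> inv\<^bsub>F\<^esub> (\<rho> \<otimes>\<^bsub>F\<^esub> r) \<in> M"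
    using basis unfolding chief_basis_def by blast+
  interpret F: group F unfolding F_def by (rule group_free_group)
  interpret M: normal M F by fact
  have M'n: "M' \<lhd> F" unfolding M'(1)[symmetric] using F.normal_hull_normal[OF L] .
  interpret M': normal M' F by fact
  have LM': "set L \<subseteq> M'" unfolding M'(1)[symmetric] by (rule F.normal_hull_subset)
  define Ls where "Ls = L @ concat (map (\<lambda>r. map (\<lambda>a. a \<otimes>\<^bsub>F\<^esub> r \<otimes>\<^bsub>F\<^esub> inv\<^bsub>F\<^esub> a) (letter_words k)) rs)"
  have rsM': "set rs \<subseteq> M'" unfolding rs using gs \<rho> M'.inv_op_closed2 by auto
  have rsc: "set rs \<subseteq> carrier F" using rsM' M'.subset by blast
  have \<rho>c: "\<rho> \<in> carrier F" using \<rho> M'.mem_carrier by blast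
  have lw: "x \<in> carrier F" if "x \<in> set (letter_words k)" for x using letter_words_iff(2)[OF that] unfolding F_def .
  have conjM': "a \<otimes>\<^bsub>F\<^esub> r \<otimes>\<^bsub>F\<^esub> inv\<^bsub>F\<^esub> a \<in> M'" if "r \<in> set rs" "a \<in> set (letter_words k)" for a r
    using M'.inv_op_closed2 lw that rsM' by blast
  have LsM': "set Ls \<subseteq> M'" unfolding Ls_def using LM' conjM' by auto
  define tt where "tt = (\<lambda>x. SOME t. t \<in> subset_products F rs \<and> x \<otimes>\<^bsub>F\<^esub> inv\<^bsub>F\<^esub> t \<in> M)"
  have tt: "tt x \<in> subset_products F rs" "x \<otimes>\<^bsub>F\<^esub> inv\<^bsub>F\<^esub> tt x \<in> M" if "x \<in> M'" for x
  proof -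
    have "\<exists>t. t \<in> subset_products F rs \<and> x \<otimes>\<^bsub>F\<^esub> inv\<^bsub>F\<^esub> t \<in> M" using cover[OF that] by blast
    from someI_ex[OF this] show "tt x \<in> subset_products F rs" "x \<otimes>\<^bsub>F\<^esub> inv\<^bsub>F\<^esub> tt x \<in> M" unfolding tt_def by auto
  qed
  define ts where "ts = map tt Ls"
  define R where "R = set (relators F (letter_words k) L \<rho> rs ts)"
  have R: "R = (\<lambda>l. l \<otimes>\<^bsub>F\<^esub> inv\<^bsub>F\<^esub> tt l) ` set Ls \<union> {\<rho> \<otimes>\<^bsub>F\<^esub> \<rho>} \<union> (\<lambda>r. r \<otimes>\<^bsub>F\<^esub> \<rho> \<otimes>\<^bsub>F\<^esub> inv\<^bsub>F\<^esub> (\<rho> \<otimes>\<^bsub>F\<^esub> r)) ` set rs"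
    unfolding R_def relators_def Ls_def[symmetric] ts_def map2_map_right by auto
  have RM: "R \<subseteq> M" unfolding R using tt(2) LsM' \<rho>2 comm by auto
  then have Rc: "R \<subseteq> carrier F" using M.subset by blast
  define N where "N = normal_hull F R"
  have Nn: "N \<lhd> F" unfolding N_def by (rule F.normal_hull_normal[OF Rc])
  have RN: "R \<subseteq> N" unfolding N_def by (rule F.normal_hull_subset)
  have NM: "N \<subseteq> M" unfolding N_def by (rule F.normal_hull_least[OF M RM])
  interpret N: normal N F by fact
  define Q where "Q = F Mod N"
  define q where "q = (\<lambda>x. N #>\<^bsub>F\<^esub> x)"
  interpret Q: group Q unfolding Q_def by (rule N.factorgroup_is_group)
  interpret q: group_hom F Q q
    using N.r_coset_hom_Mod F.is_group Q.is_group unfolding Q_def q_def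
    by (simp add: group_hom_def group_hom_axioms_def)
  have q_surj: "q ` carrier F = carrier Q" unfolding q_def Q_def by (simp add: carrier_FactGroup)
  have q_eq: "q x = q y \<longleftrightarrow> x \<otimes>\<^bsub>F\<^esub> inv\<^bsub>F\<^esub> y \<in> N" if "x \<in> carrier F" "y \<in> carrier F" for x y
    unfolding q_def by (rule F.rcos_eq_iff[OF N.is_subgroup that])
  have q_one: "q x = \<one>\<^bsub>Q\<^esub> \<longleftrightarrow> x \<in> N" if "x \<in> carrier F" for x
    unfolding q_def Q_def using F.rcos_eq_self_iff[OF N.is_subgroup that] by simp
  define S where "S = subset_products Q (map q rs)"
  have q_sp: "q ` subset_products F rs = S" unfolding S_def using q.image_subset_products[OF rsc] .
  have qrs: "set (map q rs) \<subseteq> carrier Q" using rsc by auto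
  define A where "A = generate Q (set (map q rs))"
  have A: "subgroup A Q" unfolding A_def by (rule Q.generate_is_subgroup[OF qrs])
  have Ac: "x \<in> carrier Q" if "x \<in> A" for x using subgroup.mem_carrier[OF A that] .
  have rsA: "set (map q rs) \<subseteq> A" unfolding A_def using generate.incl by (metis subsetI)
  have SA: "S \<subseteq> A" unfolding S_def by (rule Q.subset_products_least[OF A rsA])
  have q_tt: "q l = q (tt l)" if "l \<in> set Ls" for l
  proof -
    have "l \<in> M'" using that LsM' by blast
    then have "l \<in> carrier F" "tt l \<in> carrier F"
      using M'.mem_carrier tt(1) F.subset_products_carrier[OF rsc] by auto
    moreover have "l \<otimes>\<^bsub>F\<^esub> inv\<^bsub>F\<^esub> tt l \<in> N" using RN that unfolding R by blast
    ultimately show ?thesis using q_eq by blast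
  qed
  have q_Ls: "q l \<in> S" if "l \<in> set Ls" for l
    using q_tt[OF that] tt(1) LsM' that q_sp by blast
  have letter_conj: "q [a] \<otimes>\<^bsub>Q\<^esub> x \<otimes>\<^bsub>Q\<^esub> inv\<^bsub>Q\<^esub> q [a] \<in> A" if a: "snd a < k" and x: "x \<in> A" for a x
  proof -
    have ac: "[a] \<in> carrier F" using a unfolding F_def by simp
    then have qa: "q [a] \<in> carrier Q" by simp
    show ?thesis using x unfolding A_def
    proof (induction rule: generate.induct)
      case one
      then show ?case using qa generate.one by simp
    next
      case (incl h)
      then obtain r where r: "r \<in> set rs" "h = q r" by auto
      have "[a] \<otimes>\<^bsub>F\<^esub> r \<otimes>\<^bsub>F\<^esub> inv\<^bsub>F\<^esub> [a] \<in> set Ls" unfolding Ls_def using r(1) letter_words_iff(1)[OF a] by auto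
      then have "q ([a] \<otimes>\<^bsub>F\<^esub> r \<otimes>\<^bsub>F\<^esub> inv\<^bsub>F\<^esub> [a]) \<in> A" using q_Ls SA by blast
      then show ?case using r ac rsc by (simp add: A_def subset_iff)
    next
      case (inv h)
      then obtain r where r: "r \<in> set rs" "h = q r" by auto
      then have hc: "h \<in> carrier Q" using rsc by auto
      have "[a] \<otimes>\<^bsub>F\<^esub> r \<otimes>\<^bsub>F\<^esub> inv\<^bsub>F\<^esub> [a] \<in> set Ls" unfolding Ls_def using r(1) letter_words_iff(1)[OF a] by auto
      then have "q ([a] \<otimes>\<^bsub>F\<^esub> r \<otimes>\<^bsub>F\<^esub> inv\<^bsub>F\<^esub> [a]) \<in> A" using q_Ls SA by blast
      then have "q [a] \<otimes>\<^bsub>Q\<^esub> h \<otimes>\<^bsub>Q\<^esub> inv\<^bsub>Q\<^esub> q [a] \<in> A" using r ac rsc by (simp add: subset_iff)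
      then have "inv\<^bsub>Q\<^esub> (q [a] \<otimes>\<^bsub>Q\<^esub> h \<otimes>\<^bsub>Q\<^esub> inv\<^bsub>Q\<^esub> q [a]) \<in> A" by (rule subgroup.m_inv_closed[OF A])
      then show ?case using hc qa by (simp add: A_def Q.inv_mult_group Q.m_assoc)
    next
      case (eng h1 h2)
      have hc: "h1 \<in> carrier Q" "h2 \<in> carrier Q" using eng.hyps Ac unfolding A_def by auto
      have "q [a] \<otimes>\<^bsub>Q\<^esub> (h1 \<otimes>\<^bsub>Q\<^esub> h2) \<otimes>\<^bsub>Q\<^esub> inv\<^bsub>Q\<^esub> q [a]
          = (q [a] \<otimes>\<^bsub>Q\<^esub> h1 \<otimes>\<^bsub>Q\<^esub> inv\<^bsub>Q\<^esub> q [a]) \<otimes>\<^bsub>Q\<^esub> (q [a] \<otimes>\<^bsub>Q\<^esub> h2 \<otimes>\<^bsub>Q\<^esub> inv\<^bsub>Q\<^esub> q [a])"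
        using hc qa by (simp add: Q.m_assoc)
      then show ?case using generate.eng[OF eng.IH] by simp
    qed
  qed
  \<comment> \<open>The preimage of the group generated by \<open>rs\<close>. Conjugation by letters
    suffices to see that it is normal, and it turns out to contain \<open>L\<close>, hence
    \<open>M'\<close>.\<close>
  define P where "P = {x \<in> carrier F. q x \<in> A}"
  have P_conj: "g \<otimes>\<^bsub>F\<^esub> x \<otimes>\<^bsub>F\<^esub> inv\<^bsub>F\<^esub> g \<in> P" if "g \<in> carrier F" "x \<in> P" for g x
    using that unfolding F_def
  proof (intro free_group_conj_closed[of k P g x], fold F_def)
    fix a :: letter and x assume a: "snd a < k" and x: "x \<in> P"
    have "[a] \<in> carrier F" using a unfolding F_def by simp
    then show "[a] \<otimes>\<^bsub>F\<^esub> x \<otimes>\<^bsub>F\<^esub> inv\<^bsub>F\<^esub> [a] \<in> P" using letter_conj[OF a, of "q x"] x unfolding P_def by simp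
  qed (auto simp: P_def)
  have P_sub: "subgroup P F"
  proof (rule F.subgroupI)
    have "\<one>\<^bsub>F\<^esub> \<in> P" unfolding P_def using subgroup.one_closed[OF A] by simp
    then show "P \<noteq> {}" by blast
  qed (auto simp: P_def subgroup.m_inv_closed[OF A] subgroup.m_closed[OF A])
  have A_conj: "q g \<otimes>\<^bsub>Q\<^esub> x \<otimes>\<^bsub>Q\<^esub> inv\<^bsub>Q\<^esub> q g \<in> A" if g: "g \<in> carrier F" and x: "x \<in> A" for g x
  proof -
    obtain y where y: "y \<in> carrier F" "x = q y" using Ac[OF x] q_surj by (metis imageE)
    then have "y \<in> P" unfolding P_def using x by simp
    then show ?thesis using P_conj[OF g] g y unfolding P_def by simp
  qed
  have \<rho>_comm: "q \<rho> \<otimes>\<^bsub>Q\<^esub> x = x \<otimes>\<^bsub>Q\<^esub> q \<rho>" if "x \<in> A" for x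
    using that unfolding A_def
  proof (induction rule: generate.induct)
    case (incl h)
    then obtain r where r: "r \<in> set rs" "h = q r" by auto
    have rc: "r \<in> carrier F" using r rsc by blast
    have "r \<otimes>\<^bsub>F\<^esub> \<rho> \<otimes>\<^bsub>F\<^esub> inv\<^bsub>F\<^esub> (\<rho> \<otimes>\<^bsub>F\<^esub> r) \<in> N" using RN r unfolding R by blast
    then have "q (r \<otimes>\<^bsub>F\<^esub> \<rho>) = q (\<rho> \<otimes>\<^bsub>F\<^esub> r)" using rc \<rho>c by (intro q_eq[THEN iffD2]) simp_all
    then show ?case using r rc \<rho>c by simp
  next
    case (inv h)
    then obtain r where r: "r \<in> set rs" "h = q r" by auto
    have rc: "r \<in> carrier F" using r rsc by blast
    have hc: "h \<in> carrier Q" "q \<rho> \<in> carrier Q" using r rc \<rho>c by auto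
    have "r \<otimes>\<^bsub>F\<^esub> \<rho> \<otimes>\<^bsub>F\<^esub> inv\<^bsub>F\<^esub> (\<rho> \<otimes>\<^bsub>F\<^esub> r) \<in> N" using RN r unfolding R by blast
    then have "q (r \<otimes>\<^bsub>F\<^esub> \<rho>) = q (\<rho> \<otimes>\<^bsub>F\<^esub> r)" using rc \<rho>c by (intro q_eq[THEN iffD2]) simp_all
    then have e: "h \<otimes>\<^bsub>Q\<^esub> q \<rho> = q \<rho> \<otimes>\<^bsub>Q\<^esub> h" using r rc \<rho>c by simp
    have "q \<rho> \<otimes>\<^bsub>Q\<^esub> inv\<^bsub>Q\<^esub> h = inv\<^bsub>Q\<^esub> h \<otimes>\<^bsub>Q\<^esub> (h \<otimes>\<^bsub>Q\<^esub> q \<rho>) \<otimes>\<^bsub>Q\<^esub> inv\<^bsub>Q\<^esub> h" using hc by simp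
    also have "\<dots> = inv\<^bsub>Q\<^esub> h \<otimes>\<^bsub>Q\<^esub> q \<rho>" unfolding e using hc by (simp add: Q.m_assoc)
    finally show ?case .
  next
    case (eng h1 h2)
    have hc: "h1 \<in> carrier Q" "h2 \<in> carrier Q" "q \<rho> \<in> carrier Q" using eng.hyps Ac \<rho>c unfolding A_def by auto
    have "q \<rho> \<otimes>\<^bsub>Q\<^esub> (h1 \<otimes>\<^bsub>Q\<^esub> h2) = (q \<rho> \<otimes>\<^bsub>Q\<^esub> h1) \<otimes>\<^bsub>Q\<^esub> h2" using hc by (simp add: Q.m_assoc)
    also have "\<dots> = h1 \<otimes>\<^bsub>Q\<^esub> (q \<rho> \<otimes>\<^bsub>Q\<^esub> h2)" unfolding eng.IH(1) using hc by (simp add: Q.m_assoc)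
    also have "\<dots> = h1 \<otimes>\<^bsub>Q\<^esub> h2 \<otimes>\<^bsub>Q\<^esub> q \<rho>" unfolding eng.IH(2) using hc by (simp add: Q.m_assoc)
    finally show ?case .
  qed (use \<rho>c in simp)
  have rs_form: "\<exists>g\<in>carrier F. x = q g \<otimes>\<^bsub>Q\<^esub> q \<rho> \<otimes>\<^bsub>Q\<^esub> inv\<^bsub>Q\<^esub> q g" if x: "x \<in> set (map q rs)" for x
  proof -
    obtain g where g: "g \<in> set gs" "x = q (g \<otimes>\<^bsub>F\<^esub> \<rho> \<otimes>\<^bsub>F\<^esub> inv\<^bsub>F\<^esub> g)" using x unfolding rs by auto
    then have "g \<in> carrier F" using gs by blast
    then show ?thesis using g \<rho>c by (intro bexI[of _ g]) simp_all
  qed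
  have rs_comm: "x \<otimes>\<^bsub>Q\<^esub> y = y \<otimes>\<^bsub>Q\<^esub> x" if x: "x \<in> set (map q rs)" and y: "y \<in> A" for x y
  proof -
    obtain g where g: "g \<in> carrier F" "x = q g \<otimes>\<^bsub>Q\<^esub> q \<rho> \<otimes>\<^bsub>Q\<^esub> inv\<^bsub>Q\<^esub> q g" using rs_form[OF x] by blast
    define z where "z = inv\<^bsub>Q\<^esub> q g \<otimes>\<^bsub>Q\<^esub> y \<otimes>\<^bsub>Q\<^esub> q g"
    have c: "q g \<in> carrier Q" "y \<in> carrier Q" "q \<rho> \<in> carrier Q" using g y Ac \<rho>c by auto
    have "z \<in> A" using A_conj[of "inv\<^bsub>F\<^esub> g" y] g(1) y c unfolding z_def by simp
    then have e: "q \<rho> \<otimes>\<^bsub>Q\<^esub> z = z \<otimes>\<^bsub>Q\<^esub> q \<rho>" by (rule \<rho>_comm)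
    have zc: "z \<in> carrier Q" unfolding z_def using c by simp
    have yz: "y = q g \<otimes>\<^bsub>Q\<^esub> z \<otimes>\<^bsub>Q\<^esub> inv\<^bsub>Q\<^esub> q g" unfolding z_def using c by (simp add: Q.m_assoc)
    have "x \<otimes>\<^bsub>Q\<^esub> y = q g \<otimes>\<^bsub>Q\<^esub> (q \<rho> \<otimes>\<^bsub>Q\<^esub> z) \<otimes>\<^bsub>Q\<^esub> inv\<^bsub>Q\<^esub> q g" unfolding g(2) yz using c zc by (simp add: Q.m_assoc)
    also have "\<dots> = y \<otimes>\<^bsub>Q\<^esub> x" unfolding e unfolding g(2) yz using c zc by (simp add: Q.m_assoc)
    finally show ?thesis .
  qed
  have rs_sq: "x \<otimes>\<^bsub>Q\<^esub> x = \<one>\<^bsub>Q\<^esub>" if x: "x \<in> set (map q rs)" for x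
  proof -
    obtain g where g: "g \<in> carrier F" "x = q g \<otimes>\<^bsub>Q\<^esub> q \<rho> \<otimes>\<^bsub>Q\<^esub> inv\<^bsub>Q\<^esub> q g" using rs_form[OF x] by blast
    have c: "q g \<in> carrier Q" "q \<rho> \<in> carrier Q" using g \<rho>c by auto
    have "\<rho> \<otimes>\<^bsub>F\<^esub> \<rho> \<in> N" using RN unfolding R by blast
    then have e: "q \<rho> \<otimes>\<^bsub>Q\<^esub> q \<rho> = \<one>\<^bsub>Q\<^esub>" using q_one[of "\<rho> \<otimes>\<^bsub>F\<^esub> \<rho>"] \<rho>c by simp
    have "x \<otimes>\<^bsub>Q\<^esub> x = q g \<otimes>\<^bsub>Q\<^esub> (q \<rho> \<otimes>\<^bsub>Q\<^esub> q \<rho>) \<otimes>\<^bsub>Q\<^esub> inv\<^bsub>Q\<^esub> q g" unfolding g(2) using c by (simp add: Q.m_assoc)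
    then show ?thesis unfolding e using c by simp
  qed
  have S_sub: "subgroup S Q" unfolding S_def
    by (rule Q.subgroup_subset_products[OF qrs]) (use rs_comm rs_sq rsA in blast)+
  have "A \<subseteq> S" unfolding A_def
    by (rule Q.generate_subgroup_incl[OF _ S_sub]) (unfold S_def, rule Q.set_subset_products[OF qrs])
  then have AS: "A = S" using SA by blast
  have "P \<lhd> F" unfolding F.normal_inv_iff using P_sub P_conj by blast
  moreover have "set L \<subseteq> P" unfolding P_def AS using q_Ls L unfolding Ls_def by auto
  ultimately have M'P: "M' \<subseteq> P" unfolding M'(1)[symmetric] by (rule F.normal_hull_least)
  \<comment> \<open>Modulo \<open>N\<close> an element of \<open>M\<close> is a subset product; this
    product lies in \<open>M\<close> too, so by independence it is trivial.\<close>
  have "M \<subseteq> N"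
  proof
    fix x assume x: "x \<in> M"
    then have xP: "x \<in> P" using M'(2) M'P by blast
    then obtain t where t: "t \<in> subset_products F rs" "q x = q t" unfolding P_def AS q_sp[symmetric] by blast
    have tc: "t \<in> carrier F" "x \<in> carrier F" using t(1) F.subset_products_carrier[OF rsc] xP unfolding P_def by auto
    have e: "x \<otimes>\<^bsub>F\<^esub> inv\<^bsub>F\<^esub> t \<in> N" using q_eq t tc by blast
    then have "inv\<^bsub>F\<^esub> (x \<otimes>\<^bsub>F\<^esub> inv\<^bsub>F\<^esub> t) \<otimes>\<^bsub>F\<^esub> x \<in> M" using x NM by blast
    then have "t \<in> M" using tc by (simp add: F.inv_mult_group F.m_assoc)
    then have "t = \<one>\<^bsub>F\<^esub>" using indep t(1) by blast
    then show "x \<in> N" using e tc by simp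
  qed
  then have "N = M" using NM by blast
  show ?thesis
  proof (rule that[of ts])
    show "length ts = length L + length gs * (2 * k)"
      unfolding ts_def Ls_def by (simp add: length_concat_const length_letter_words rs)
    show "set ts \<subseteq> subset_products F rs" unfolding ts_def using tt(1) LsM' by auto
    show "set (relators F (letter_words k) L \<rho> rs ts) \<subseteq> carrier F" using Rc unfolding R_def .
    show "normal_hull F (set (relators F (letter_words k) L \<rho> rs ts)) = M"
      using \<open>N = M\<close> unfolding N_def R_def .
  qed
qed

section \<open>Finite index subgroups of a free group\<close>

text \<open>The Schreier generators of \<open>K\<close> have length at most \<open>2 * l + 1\<close>
  when the transversal has lengths at most \<open>l\<close>, so all elements of \<open>K\<close> up
  to this length generate.\<close>

lemma finite_normal_generators:
  assumes K: "K \<lhd> free_group k" and fin: "finite ((\<lambda>x. K #>\<^bsub>free_group k\<^esub> x) ` carrier (free_group k))"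
  obtains L where "set L \<subseteq> carrier (free_group k)" "normal_hull (free_group k) (set L) = K"
proof -
  define F where "F = free_group k"
  interpret F: group F unfolding F_def by (rule group_free_group)
  interpret K: normal K F using K unfolding F_def .
  define Cs where "Cs = (\<lambda>x. K #>\<^bsub>F\<^esub> x) ` carrier F"
  have finCs: "finite Cs" using fin unfolding Cs_def F_def .
  have one: "\<one>\<^bsub>F\<^esub> = []" by (simp add: F_def free_group_simps)
  have K1: "K #>\<^bsub>F\<^esub> [] = K" using F.coset_mult_one[OF K.subset] one by simp
  define T where "T = (\<lambda>X. if X = K then [] else SOME x. x \<in> carrier F \<and> K #>\<^bsub>F\<^esub> x = X)"
  have T: "T X \<in> carrier F" "K #>\<^bsub>F\<^esub> T X = X" if "X \<in> Cs" for X
  proof -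
    have "\<exists>x. x \<in> carrier F \<and> K #>\<^bsub>F\<^esub> x = X" using that unfolding Cs_def by blast
    from someI_ex[OF this] show "T X \<in> carrier F" "K #>\<^bsub>F\<^esub> T X = X"
      unfolding T_def using K1 F.one_closed one by auto
  qed
  define l where "l = Max (length ` T ` Cs)"
  have l: "length (T X) \<le> l" if "X \<in> Cs" for X unfolding l_def using finCs that by (intro Max_ge) auto
  define S where "S = {u \<in> K. length u \<le> 2 * l + 1}"
  have SK: "S \<subseteq> K" unfolding S_def by blast
  then have Sc: "S \<subseteq> carrier F" using K.subset by blast
  have "finite S"
    by (rule finite_subset[OF _ finite_words_length_le[of k "2 * l + 1"]]) (use Sc in \<open>auto simp: S_def F_def\<close>)
  define H where "H = normal_hull F S"
  have H: "H \<lhd> F" unfolding H_def by (rule F.normal_hull_normal[OF Sc])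
  have SH: "S \<subseteq> H" unfolding H_def by (rule F.normal_hull_subset)
  have HK: "H \<subseteq> K" unfolding H_def by (rule F.normal_hull_least) (use SK K.normal_axioms in auto)
  interpret H: normal H F by fact
  have claim: "w \<otimes>\<^bsub>F\<^esub> inv\<^bsub>F\<^esub> T (K #>\<^bsub>F\<^esub> w) \<in> H" if "w \<in> carrier (free_group k)" for w
    using that
  proof (induction w rule: free_group_induct_snoc)
    case one
    then show ?case using K1 \<open>\<one>\<^bsub>F\<^esub> = []\<close> F.inv_one H.one_closed by (simp add: T_def F.r_one[unfolded \<open>\<one>\<^bsub>F\<^esub> = []\<close>])
  next
    case (snoc w a)
    note folds = F_def[symmetric]
    have wc: "w \<in> carrier F" "[a] \<in> carrier F" using snoc by (simp_all add: F_def)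
    define t where "t = T (K #>\<^bsub>F\<^esub> w)"
    define t' where "t' = T (K #>\<^bsub>F\<^esub> (w \<otimes>\<^bsub>F\<^esub> [a]))"
    have Cs: "K #>\<^bsub>F\<^esub> w \<in> Cs" "K #>\<^bsub>F\<^esub> (w \<otimes>\<^bsub>F\<^esub> [a]) \<in> Cs" unfolding Cs_def using wc by auto
    have tc: "t \<in> carrier F" "t' \<in> carrier F" unfolding t_def t'_def using T(1) Cs by auto
    have "K #>\<^bsub>F\<^esub> (t \<otimes>\<^bsub>F\<^esub> [a]) = K #>\<^bsub>F\<^esub> t #>\<^bsub>F\<^esub> [a]" using F.coset_mult_assoc[OF K.subset tc(1) wc(2)] by simp
    also have "\<dots> = K #>\<^bsub>F\<^esub> w #>\<^bsub>F\<^esub> [a]" unfolding t_def T(2)[OF Cs(1)] ..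
    also have "\<dots> = K #>\<^bsub>F\<^esub> t'" unfolding t'_def T(2)[OF Cs(2)] using F.coset_mult_assoc[OF K.subset wc] by simp
    finally have "t \<otimes>\<^bsub>F\<^esub> [a] \<otimes>\<^bsub>F\<^esub> inv\<^bsub>F\<^esub> t' \<in> K" using F.rcos_eq_iff[OF K.is_subgroup] tc wc by simp
    moreover have "length (t \<otimes>\<^bsub>F\<^esub> [a] \<otimes>\<^bsub>F\<^esub> inv\<^bsub>F\<^esub> t') \<le> 2 * l + 1"
    proof -
      have "length (t \<otimes>\<^bsub>F\<^esub> [a] \<otimes>\<^bsub>F\<^esub> inv\<^bsub>F\<^esub> t') \<le> length (t \<otimes>\<^bsub>F\<^esub> [a]) + length (inv\<^bsub>F\<^esub> t')"
        unfolding F_def by (rule length_mult_le)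
      moreover have "length (t \<otimes>\<^bsub>F\<^esub> [a]) \<le> length t + 1" using length_mult_le[of k t "[a]"] unfolding F_def by simp
      moreover have "length (inv\<^bsub>F\<^esub> t') = length t'" using length_inv_free_group[of t' k] tc unfolding F_def by simp
      moreover have "length t \<le> l" "length t' \<le> l" unfolding t_def t'_def using l Cs by auto
      ultimately show ?thesis by linarith
    qed
    ultimately have u: "t \<otimes>\<^bsub>F\<^esub> [a] \<otimes>\<^bsub>F\<^esub> inv\<^bsub>F\<^esub> t' \<in> H" using SH unfolding S_def by blast
    have "w \<otimes>\<^bsub>F\<^esub> inv\<^bsub>F\<^esub> t \<in> H" using snoc.IH unfolding folds t_def .
    then have "(w \<otimes>\<^bsub>F\<^esub> inv\<^bsub>F\<^esub> t) \<otimes>\<^bsub>F\<^esub> (t \<otimes>\<^bsub>F\<^esub> [a] \<otimes>\<^bsub>F\<^esub> inv\<^bsub>F\<^esub> t') \<in> H" using u by blast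
    then show ?case using tc wc unfolding folds t'_def[symmetric] by (simp add: F.m_assoc)
  qed
  have "K \<subseteq> H"
  proof
    fix w assume w: "w \<in> K"
    then have "K #>\<^bsub>F\<^esub> w = K" using F.rcos_eq_self_iff[OF K.is_subgroup] K.mem_carrier by blast
    then have "w \<otimes>\<^bsub>F\<^esub> inv\<^bsub>F\<^esub> [] \<in> H" using claim[of w] w K.mem_carrier by (simp add: T_def F_def)
    then show "w \<in> H" using w K.mem_carrier F.inv_one F.r_one one by metis
  qed
  then have "H = K" using HK by blast
  obtain L where "set L = S" using finite_list[OF \<open>finite S\<close>] by blast
  then show ?thesis using that[of L] Sc \<open>H = K\<close> unfolding H_def F_def by simp
qed

text \<open>The coset graph of \<open>H\<close> is an automaton with at most \<open>m\<close> states
  that accepts exactly \<open>H\<close>, and there are only finitely many such automata.\<close>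

lemma finite_subgroups_index_le:
  "finite {H. subgroup H (free_group k) \<and> finite ((\<lambda>x. H #>\<^bsub>free_group k\<^esub> x) ` carrier (free_group k)) \<and>
     ridx (free_group k) (carrier (free_group k)) H \<le> m}"
proof -
  define F where "F = free_group k"
  interpret F: group F unfolding F_def by (rule group_free_group)
  have one: "\<one>\<^bsub>F\<^esub> = []" by (simp add: F_def free_group_simps)
  define acc where "acc = (\<lambda>(\<delta> :: nat \<times> letter \<Rightarrow> nat, s :: nat). {w \<in> carrier F. foldl (\<lambda>i a. \<delta> (i, a)) s w = s})"
  define D where "D = ({..<m} \<times> letters k) \<rightarrow>\<^sub>E {..<m}"
  have "{H. subgroup H F \<and> finite ((\<lambda>x. H #>\<^bsub>F\<^esub> x) ` carrier F) \<and> ridx F (carrier F) H \<le> m} \<subseteq> acc ` (D \<times> {..<m})"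
  proof
    fix H assume "H \<in> {H. subgroup H F \<and> finite ((\<lambda>x. H #>\<^bsub>F\<^esub> x) ` carrier F) \<and> ridx F (carrier F) H \<le> m}"
    then have H: "subgroup H F" and fin: "finite ((\<lambda>x. H #>\<^bsub>F\<^esub> x) ` carrier F)" and le: "ridx F (carrier F) H \<le> m" by auto
    have Hc: "H \<subseteq> carrier F" using subgroup.subset[OF H] .
    define Cs where "Cs = (\<lambda>x. H #>\<^bsub>F\<^esub> x) ` carrier F"
    have "card Cs \<le> card {..<m}" using le unfolding Cs_def ridx_def by simp
    then obtain h where h: "h ` Cs \<subseteq> {..<m}" "inj_on h Cs"
      using card_le_inj[of Cs "{..<m}"] fin unfolding Cs_def by auto
    \<comment> \<open>Numbers that encode no coset are never reached; they get a dummy transition so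
      that \<open>\<delta>\<close> lies in the finite set \<open>D\<close>.\<close>
    define \<delta> where "\<delta> = restrict (\<lambda>(i, a). if i \<in> h ` Cs then h (the_inv_into Cs h i #>\<^bsub>F\<^esub> [a]) else i) ({..<m} \<times> letters k)"
    have HCs: "H \<in> Cs" unfolding Cs_def using F.coset_mult_one[OF Hc] F.one_closed by force
    have Cs_mult: "X #>\<^bsub>F\<^esub> x \<in> Cs" if "X \<in> Cs" "x \<in> carrier F" for X x
      using that Hc unfolding Cs_def by (auto simp: F.coset_mult_assoc)
    have Cs_sub: "X \<subseteq> carrier F" if "X \<in> Cs" for X
      using that F.r_coset_subset_G[OF Hc] unfolding Cs_def by blast
    have hm: "h X < m" if "X \<in> Cs" for X using h that by auto
    have letter: "[a] \<in> carrier F" if "snd a < k" for a using that by (simp add: F_def)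
    have "\<delta> \<in> D" unfolding D_def \<delta>_def
    proof (rule restrict_PiE_iff[THEN iffD2], intro ballI)
      fix p assume "p \<in> {..<m} \<times> letters k"
      then obtain i a where p: "p = (i, a)" "i < m" "snd a < k" by auto
      show "(case p of (i, a) \<Rightarrow> if i \<in> h ` Cs then h (the_inv_into Cs h i #>\<^bsub>F\<^esub> [a]) else i) \<in> {..<m}"
      proof (cases "i \<in> h ` Cs")
        case True
        then have "the_inv_into Cs h i \<in> Cs" using the_inv_into_into[OF h(2) _ subset_refl] by blast
        then show ?thesis using p hm[OF Cs_mult[OF _ letter[OF p(3)]]] True by simp
      qed (use p in simp)
    qed
    moreover have "h H < m" using hm[OF HCs] .
    moreover have "foldl (\<lambda>i a. \<delta> (i, a)) (h X) w = h (X #>\<^bsub>F\<^esub> w)" if "X \<in> Cs" "w \<in> carrier F" for X w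
      using that
    proof (induction w arbitrary: X)
      case Nil
      then show ?case using F.coset_mult_one[OF Cs_sub] one by simp
    next
      case (Cons a w)
      note aw = free_group_Cons[of a w k, folded F_def, OF Cons.prems(2)]
      have "\<delta> (h X, a) = h (X #>\<^bsub>F\<^esub> [a])"
        unfolding \<delta>_def using hm[OF Cons.prems(1)] aw(2) Cons.prems(1) the_inv_into_f_f[OF h(2) Cons.prems(1)] by simp
      moreover have "X #>\<^bsub>F\<^esub> [a] #>\<^bsub>F\<^esub> w = X #>\<^bsub>F\<^esub> (a # w)"
        using F.coset_mult_assoc[OF Cs_sub[OF Cons.prems(1)] letter[OF aw(2)] aw(1)] aw(3) by simp
      ultimately show ?case using Cons.IH[OF Cs_mult[OF Cons.prems(1) letter[OF aw(2)]] aw(1)] by simp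
    qed
    then have "foldl (\<lambda>i a. \<delta> (i, a)) (h H) w = h H \<longleftrightarrow> w \<in> H" if "w \<in> carrier F" for w
      using that HCs inj_on_eq_iff[OF h(2) Cs_mult[OF HCs that] HCs] F.rcos_eq_self_iff[OF H that] by simp
    then have "acc (\<delta>, h H) = H" unfolding acc_def using Hc by auto
    ultimately show "H \<in> acc ` (D \<times> {..<m})" by (intro image_eqI[of _ _ "(\<delta>, h H)"]) auto
  qed
  moreover have "finite (acc ` (D \<times> {..<m}))"
    unfolding D_def using finite_letters by (intro finite_imageI finite_cartesian_product finite_PiE) auto
  ultimately show ?thesis unfolding F_def by (rule finite_subset)
qed

definition normal_core :: "('a, 'b) monoid_scheme \<Rightarrow> 'a set \<Rightarrow> 'a set" where
  "normal_core G H = {g \<in> carrier G. \<forall>x\<in>carrier G. x \<otimes>\<^bsub>G\<^esub> g \<otimes>\<^bsub>G\<^esub> inv\<^bsub>G\<^esub> x \<in> H}"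

context group
begin

lemma normal_core_subset: "normal_core G H \<subseteq> H"
proof
  fix g assume "g \<in> normal_core G H"
  then have g: "g \<in> carrier G" and "\<forall>x\<in>carrier G. x \<otimes> g \<otimes> inv x \<in> H" unfolding normal_core_def by blast+
  from bspec[OF this(2) one_closed] show "g \<in> H" using g by simp
qed

lemma normal_core_greatest:
  assumes "M \<lhd> G" "M \<subseteq> H"
  shows "M \<subseteq> normal_core G H"
proof
  interpret M: normal M G by fact
  fix g assume g: "g \<in> M"
  have "x \<otimes> g \<otimes> inv x \<in> H" if "x \<in> carrier G" for x
    using subsetD[OF assms(2) M.inv_op_closed2[OF that g]] .
  then show "g \<in> normal_core G H" unfolding normal_core_def using M.mem_carrier[OF g] by simp
qed

lemma normal_core_normal:
  assumes H: "subgroup H G"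
  shows "normal_core G H \<lhd> G"
proof -
  have sub: "subgroup (normal_core G H) G"
  proof (rule subgroupI)
    have "\<one> \<in> normal_core G H" unfolding normal_core_def using subgroup.one_closed[OF H] by simp
    then show "normal_core G H \<noteq> {}" by blast
    fix g assume g: "g \<in> normal_core G H"
    have "x \<otimes> inv g \<otimes> inv x \<in> H" if x: "x \<in> carrier G" for x
    proof -
      have "x \<otimes> inv g \<otimes> inv x = inv (x \<otimes> g \<otimes> inv x)"
        using g x unfolding normal_core_def by (simp add: inv_mult_group m_assoc)
      then show ?thesis using g x subgroup.m_inv_closed[OF H] unfolding normal_core_def by simp
    qed
    then show "inv g \<in> normal_core G H" using g unfolding normal_core_def by simp
    fix h assume h: "h \<in> normal_core G H"
    have "x \<otimes> (g \<otimes> h) \<otimes> inv x \<in> H" if x: "x \<in> carrier G" for x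
    proof -
      have "x \<otimes> (g \<otimes> h) \<otimes> inv x = (x \<otimes> g \<otimes> inv x) \<otimes> (x \<otimes> h \<otimes> inv x)"
        using g h x unfolding normal_core_def by (simp add: m_assoc)
      then show ?thesis using g h x subgroup.m_closed[OF H] unfolding normal_core_def by simp
    qed
    then show "g \<otimes> h \<in> normal_core G H" using g h unfolding normal_core_def by simp
  qed (auto simp: normal_core_def)
  show ?thesis
    unfolding normal_inv_iff
  proof (intro conjI ballI sub)
    fix y g assume y: "y \<in> carrier G" and g: "g \<in> normal_core G H"
    have "x \<otimes> (y \<otimes> g \<otimes> inv y) \<otimes> inv x \<in> H" if x: "x \<in> carrier G" for x
    proof -
      have "x \<otimes> (y \<otimes> g \<otimes> inv y) \<otimes> inv x = (x \<otimes> y) \<otimes> g \<otimes> inv (x \<otimes> y)"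
        using g x y unfolding normal_core_def by (simp add: m_assoc inv_mult_group)
      then show ?thesis using g x y unfolding normal_core_def by simp
    qed
    then show "y \<otimes> g \<otimes> inv y \<in> normal_core G H" using g y unfolding normal_core_def by simp
  qed
qed

text \<open>The core is the kernel of the action on the cosets of \<open>H\<close>, so its cosets
  are told apart by self-maps of a finite set.\<close>

lemma finite_cosets_normal_core:
  assumes H: "subgroup H G" and fin: "finite ((\<lambda>x. H #> x) ` carrier G)"
  shows "finite ((\<lambda>x. normal_core G H #> x) ` carrier G)"
proof -
  define Cs where "Cs = (\<lambda>x. H #> x) ` carrier G"
  define f where "f = (\<lambda>g. \<lambda>X\<in>Cs. X #> g)"
  have Hc: "H \<subseteq> carrier G" using subgroup.subset[OF H] .
  have "f ` carrier G \<subseteq> Cs \<rightarrow>\<^sub>E Cs"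
    using Hc unfolding f_def Cs_def by (auto simp: coset_mult_assoc)
  moreover have "finite (Cs \<rightarrow>\<^sub>E Cs)" using fin unfolding Cs_def by (simp add: finite_PiE)
  ultimately have "finite (f ` carrier G)" by (rule finite_subset)
  moreover have "f g = f h \<longleftrightarrow> g \<otimes> inv h \<in> normal_core G H" if gh: "g \<in> carrier G" "h \<in> carrier G" for g h
  proof -
    have "f g = f h \<longleftrightarrow> (\<forall>X\<in>Cs. X #> g = X #> h)"
      unfolding f_def by (auto simp: fun_eq_iff restrict_def)
    also have "\<dots> \<longleftrightarrow> (\<forall>x\<in>carrier G. H #> (x \<otimes> g) = H #> (x \<otimes> h))"
      unfolding Cs_def using gh Hc by (auto simp: coset_mult_assoc)
    also have "\<dots> \<longleftrightarrow> (\<forall>x\<in>carrier G. x \<otimes> (g \<otimes> inv h) \<otimes> inv x \<in> H)"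
    proof (rule ball_cong[OF refl])
      fix x assume x: "x \<in> carrier G"
      have "(x \<otimes> g) \<otimes> inv (x \<otimes> h) = x \<otimes> (g \<otimes> inv h) \<otimes> inv x"
        using gh x by (simp add: inv_mult_group m_assoc)
      then show "(H #> (x \<otimes> g) = H #> (x \<otimes> h)) = (x \<otimes> (g \<otimes> inv h) \<otimes> inv x \<in> H)"
        using rcos_eq_iff[OF H, of "x \<otimes> g" "x \<otimes> h"] gh x by simp
    qed
    also have "\<dots> \<longleftrightarrow> g \<otimes> inv h \<in> normal_core G H" unfolding normal_core_def using gh by simp
    finally show ?thesis .
  qed
  ultimately show ?thesis
    using ridx_eq_card_image(2)[OF normal_imp_subgroup[OF normal_core_normal[OF H]] subset_refl, of f] by blast
qed

text \<open>The preimage of a subgroup of order \<open>2 ^ e\<close>, which Sylow's theorem provides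
  even if \<open>b\<close> is even.\<close>

lemma exists_sylow_preimage:
  assumes M: "M \<lhd> G" and fin: "finite ((\<lambda>x. M #> x) ` carrier G)" and idx: "ridx G (carrier G) M = 2 ^ e * b"
  obtains H where "subgroup H G" "M \<subseteq> H" "ridx G (carrier G) H = b" "ridx G H M = 2 ^ e"
    "finite ((\<lambda>x. H #> x) ` carrier G)"
proof -
  interpret M: normal M G by fact
  define Q where "Q = G Mod M"
  define q where "q = (\<lambda>x. M #> x)"
  interpret Q: group Q unfolding Q_def by (rule M.factorgroup_is_group)
  interpret q: group_hom G Q q
    using M.r_coset_hom_Mod is_group Q.is_group unfolding Q_def q_def
    by (simp add: group_hom_def group_hom_axioms_def)
  have q_surj: "q ` carrier G = carrier Q" unfolding q_def Q_def by (simp add: carrier_FactGroup)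
  have finQ: "finite (carrier Q)" unfolding q_surj[symmetric] using fin unfolding q_def .
  have "order Q = 2 ^ e * b" unfolding order_def q_surj[symmetric] using idx unfolding ridx_def q_def .
  then obtain P where P: "subgroup P Q" "card P = 2 ^ e"
    using sylow_thm[OF two_is_prime_nat Q.is_group _ finQ] by blast
  define H where "H = {x \<in> carrier G. q x \<in> P}"
  have H: "subgroup H G"
  proof (rule subgroupI)
    have "\<one> \<in> H" unfolding H_def using subgroup.one_closed[OF P(1)] by simp
    then show "H \<noteq> {}" by blast
  qed (auto simp: H_def subgroup.m_inv_closed[OF P(1)] subgroup.m_closed[OF P(1)])
  have MH: "M \<subseteq> H"
  proof
    fix x assume x: "x \<in> M"
    then have "q x = \<one>\<^bsub>Q\<^esub>" unfolding q_def Q_def using rcos_eq_self_iff[OF M.is_subgroup M.mem_carrier] by simp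
    then show "x \<in> H" unfolding H_def using x M.mem_carrier subgroup.one_closed[OF P(1)] by simp
  qed
  have "q ` H = P"
  proof
    show "P \<subseteq> q ` H"
    proof
      fix X assume X: "X \<in> P"
      then have "X \<in> q ` carrier G" using subgroup.subset[OF P(1)] q_surj by auto
      then obtain x where "X = q x" "x \<in> carrier G" by (rule imageE)
      then show "X \<in> q ` H" using X unfolding H_def by (intro image_eqI[of _ _ x]) auto
    qed
  qed (auto simp: H_def)
  then have HM: "ridx G H M = 2 ^ e" unfolding ridx_def using P(2) unfolding q_def by simp
  have "2 ^ e * b = ridx G (carrier G) H * 2 ^ e"
    using ridx_tower[OF subgroup_self H M.is_subgroup MH subgroup.subset[OF H] fin] idx HM by simp
  then have b: "ridx G (carrier G) H = b" by simp
  have "finite ((\<lambda>x. H #> x) ` carrier G)"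
    by (rule finite_cosets_supergroup[OF H M.is_subgroup MH subset_refl fin])
  then show ?thesis by (rule that[OF H MH b HM])
qed

end

lemma card_UN_le_mult:
  assumes "finite I" "\<And>i. i \<in> I \<Longrightarrow> card (A i) \<le> b"
  shows "card (\<Union>i\<in>I. A i) \<le> card I * b"
  using card_UN_le[OF assms(1), of A] sum_bounded_above[of I "\<lambda>i. card (A i)" b] assms(2) by simp

text \<open>The factors on the left count the values of \<open>w\<close>, the codes of
  \<open>M'\<close>, the choices of \<open>\<rho>\<close> in such a code, of the conjugating
  elements, and of \<open>ts\<close>. The quadratic part of the exponent grows by
  \<open>(2 * k + 1) * (2 * m * w + w\<^sup>2)\<close> with \<open>m = n - w\<close>, which exceeds
  the cost \<open>(2 * k + 2) * m * w + 2 * k * w\<^sup>2\<close> of \<open>ts\<close>;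
  \<open>C\<close> absorbs the rest.\<close>

lemma relator_count_bound:
  fixes k r0 h n w :: nat
  assumes "1 \<le> k" "1 \<le> w" "w \<le> n"
  defines "C \<equiv> 2 * r0 + h + 2 * k + 3"
  shows "n * (2 ^ ((2 * k + 1) * (n - w)\<^sup>2 + C * (n - w)) * ((r0 + (2 * k + 2) * n) *
      ((2 ^ h) ^ w * (2 ^ w) ^ (r0 + (2 * k + 2) * (n - w) + w * (2 * k)))))
    \<le> 2 ^ ((2 * k + 1) * n\<^sup>2 + C * n)"
proof -
  define m where "m = n - w"
  have n: "n = m + w" using assms unfolding m_def by simp
  have sq: "n * n \<le> 2 ^ (n + 1)" for n :: nat
  proof (induction n)
    case (Suc n)
    show ?case
    proof (cases "n \<le> 2")
      case True
      then have "n = 0 \<or> n = 1 \<or> n = 2" by auto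
      then show ?thesis by auto
    next
      case False
      have "Suc n * Suc n = n * n + (2 * n + 1)" by simp
      also have "2 * n + 1 \<le> n * n"
      proof -
        have "3 * n \<le> n * n" using False by (intro mult_right_mono) auto
        then show ?thesis using False by linarith
      qed
      finally show ?thesis using Suc by simp
    qed
  qed simp
  have "r0 + (2 * k + 2) * n \<le> (r0 + 2 * k + 2) * n" using assms(2,3) by (simp add: algebra_simps)
  then have "n * (r0 + (2 * k + 2) * n) \<le> (r0 + 2 * k + 2) * (n * n)" by (metis mult.left_commute mult_le_mono2)
  also have "\<dots> \<le> 2 ^ (r0 + 2 * k + 2) * 2 ^ (n + 1)"
    using less_exp[of "r0 + 2 * k + 2"] sq[of n] by (intro mult_mono) auto
  finally have a: "n * (r0 + (2 * k + 2) * n) \<le> 2 ^ (r0 + 2 * k + 2 + (n + 1))" by (simp only: power_add)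
  define e2 where "e2 = r0 + (2 * k + 2) * m + w * (2 * k)"
  have "n * (2 ^ ((2 * k + 1) * m\<^sup>2 + C * m) * ((r0 + (2 * k + 2) * n) *
      ((2 ^ h) ^ w * (2 ^ w) ^ e2)))
    = (n * (r0 + (2 * k + 2) * n)) * 2 ^ ((2 * k + 1) * m\<^sup>2 + C * m + h * w + w * e2)"
    by (simp only: power_add power_mult[symmetric] ac_simps)
  also have "\<dots> \<le> 2 ^ (r0 + 2 * k + 2 + (n + 1)) * 2 ^ ((2 * k + 1) * m\<^sup>2 + C * m + h * w + w * e2)"
    using a by (rule mult_right_mono) simp
  also have "\<dots> = 2 ^ (r0 + 2 * k + 2 + (n + 1) + ((2 * k + 1) * m\<^sup>2 + C * m + h * w + w * e2))"
    by (simp only: power_add)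
  also have "\<dots> \<le> 2 ^ ((2 * k + 1) * n\<^sup>2 + C * n)"
  proof (rule power_increasing)
    obtain k' where k': "k = Suc k'" using assms(1) by (cases k) auto
    obtain w' where w': "w = Suc w'" using assms(2) by (cases w) auto
    show "r0 + 2 * k + 2 + (n + 1) + ((2 * k + 1) * m\<^sup>2 + C * m + h * w + w * e2)
        \<le> (2 * k + 1) * n\<^sup>2 + C * n"
      unfolding n C_def e2_def k' w' by (simp add: algebra_simps power2_eq_square)
  qed simp
  finally show ?thesis unfolding e2_def m_def .
qed

text \<open>Induction along a chief series below \<open>K\<close>: a code of \<open>M\<close>
  consists of a code of \<open>M'\<close> and the data of the relators for the factor. The length
  bound \<open>r n\<close> belongs to the induction, because every old relator costs
  \<open>w\<close> bits at a step of rank \<open>w\<close>.\<close>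

lemma relator_codes:
  fixes k :: nat
  defines "F \<equiv> free_group k"
  assumes k: "1 \<le> k" and K: "K \<lhd> F" and fin: "finite ((\<lambda>x. K #>\<^bsub>F\<^esub> x) ` carrier F)"
  shows "\<exists>C. \<forall>n. \<exists>\<C>. finite \<C> \<and> card \<C> \<le> 2 ^ ((2 * k + 1) * n\<^sup>2 + C * n) \<and>
    (\<forall>M. M \<lhd> F \<longrightarrow> M \<subseteq> K \<longrightarrow> finite ((\<lambda>x. M #>\<^bsub>F\<^esub> x) ` carrier F) \<longrightarrow> ridx F K M = 2 ^ n \<longrightarrow>
      (\<exists>L\<in>\<C>. normal_hull F (set L) = M))"
proof -
  interpret F: group F unfolding F_def by (rule group_free_group)
  interpret K: normal K F by fact
  obtain L0 where L0: "set L0 \<subseteq> carrier F" "normal_hull F (set L0) = K"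
    using finite_normal_generators[of K k] K fin unfolding F_def by blast
  define r0 where "r0 = length L0"
  define rep where "rep = (\<lambda>X. SOME x. x \<in> carrier F \<and> K #>\<^bsub>F\<^esub> x = X)"
  define Rep where "Rep = rep ` (\<lambda>x. K #>\<^bsub>F\<^esub> x) ` carrier F"
  have rep: "rep (K #>\<^bsub>F\<^esub> x) \<in> carrier F" "K #>\<^bsub>F\<^esub> rep (K #>\<^bsub>F\<^esub> x) = K #>\<^bsub>F\<^esub> x" if "x \<in> carrier F" for x
    using someI_ex[of "\<lambda>y. y \<in> carrier F \<and> K #>\<^bsub>F\<^esub> y = K #>\<^bsub>F\<^esub> x"] that unfolding rep_def by blast+
  have Rep: "finite Rep" "Rep \<subseteq> carrier F" "\<exists>t\<in>Rep. g \<otimes>\<^bsub>F\<^esub> inv\<^bsub>F\<^esub> t \<in> K" if "g \<in> carrier F" for g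
  proof -
    show "finite Rep" unfolding Rep_def using fin by simp
    show "Rep \<subseteq> carrier F" unfolding Rep_def using rep(1) by auto
    have "g \<otimes>\<^bsub>F\<^esub> inv\<^bsub>F\<^esub> rep (K #>\<^bsub>F\<^esub> g) \<in> K"
      using F.rcos_eq_iff[OF K.is_subgroup that rep(1)[OF that]] rep(2)[OF that] by simp
    then show "\<exists>t\<in>Rep. g \<otimes>\<^bsub>F\<^esub> inv\<^bsub>F\<^esub> t \<in> K" unfolding Rep_def using that by blast
  qed
  have Rep': "finite Rep" "Rep \<subseteq> carrier F" using Rep(1,2)[OF F.one_closed] .
  define h where "h = card Rep"
  define C where "C = 2 * r0 + h + 2 * k + 3"
  \<comment> \<open>A factor of rank \<open>w\<close> adds \<open>2 * k * w + 1 + w\<close>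
    relators, at most \<open>(2 * k + 2) * w\<close>.\<close>
  define r where "r = (\<lambda>n. r0 + (2 * k + 2) * n)"
  define E where "E = (\<lambda>n. (2 * k + 1) * n\<^sup>2 + C * n)"
  define good where "good = (\<lambda>n \<C>. finite \<C> \<and> card \<C> \<le> 2 ^ E n \<and> (\<forall>L\<in>\<C>. set L \<subseteq> carrier F \<and> length L \<le> r n) \<and>
    (\<forall>M. M \<lhd> F \<longrightarrow> M \<subseteq> K \<longrightarrow> finite ((\<lambda>x. M #>\<^bsub>F\<^esub> x) ` carrier F) \<longrightarrow> ridx F K M = 2 ^ n \<longrightarrow>
      (\<exists>L\<in>\<C>. normal_hull F (set L) = M)))"
  have "\<exists>\<C>. good n \<C>" for n
  proof (induction n rule: less_induct)
    case (less n)
    show ?case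
    proof (cases "n = 0")
      case True
      have "M = K" if M: "M \<lhd> F" "M \<subseteq> K" "ridx F K M = 2 ^ n" for M
      proof -
        have Ms: "subgroup M F" using normal_imp_subgroup[OF M(1)] .
        obtain X where X: "(\<lambda>x. M #>\<^bsub>F\<^esub> x) ` K = {X}"
          using M(3) True unfolding ridx_def by (auto simp: card_1_singleton_iff)
        have "x \<in> M" if x: "x \<in> K" for x
        proof -
          have "M #>\<^bsub>F\<^esub> x = X" "M #>\<^bsub>F\<^esub> \<one>\<^bsub>F\<^esub> = X" using X x K.one_closed by blast+
          then have "M #>\<^bsub>F\<^esub> x = M" using F.coset_mult_one[OF subgroup.subset[OF Ms]] by simp
          then show ?thesis using F.rcos_eq_self_iff[OF Ms] x K.mem_carrier by blast
        qed
        then show ?thesis using M(2) by blast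
      qed
      then have "good n {L0}" unfolding good_def using L0 by (auto simp: r_def r0_def)
      then show ?thesis by blast
    next
      case False
      have "\<forall>m\<in>{..<n}. \<exists>\<C>. good m \<C>" using less by blast
      then obtain CC where CC: "\<And>m. m < n \<Longrightarrow> good m (CC m)" using bchoice by (metis lessThan_iff)

      \<comment> \<open>The codes for index \<open>2 ^ n\<close>\<close>
      define cj where "cj = (\<lambda>\<rho> gs. map (\<lambda>g. g \<otimes>\<^bsub>F\<^esub> \<rho> \<otimes>\<^bsub>F\<^esub> inv\<^bsub>F\<^esub> g) gs)"
      define Gs where "Gs = (\<lambda>w. {gs. set gs \<subseteq> Rep \<and> length gs = w})"
      define Ts where "Ts = (\<lambda>w (L :: letter list list) \<rho> gs. {ts. set ts \<subseteq> subset_products F (cj \<rho> gs) \<and> length ts = length L + w * (2 * k)})"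
      define st where "st = (\<lambda>w L \<rho> gs. {L' \<in> relators F (letter_words k) L \<rho> (cj \<rho> gs) ` Ts w L \<rho> gs. set L' \<subseteq> carrier F})"
      define \<C> where "\<C> = (\<Union>w\<in>{1..n}. \<Union>L\<in>CC (n - w). \<Union>\<rho>\<in>set L. \<Union>gs\<in>Gs w. st w L \<rho> gs)"
      have finGs: "finite (Gs w)" "card (Gs w) \<le> (2 ^ h) ^ w" for w
      proof -
        show "finite (Gs w)" unfolding Gs_def by (rule finite_lists_length_eq[OF Rep'(1)])
        have "card (Gs w) = h ^ w" unfolding Gs_def h_def by (rule card_lists_length_eq[OF Rep'(1)])
        then show "card (Gs w) \<le> (2 ^ h) ^ w" using power_mono[of h "2 ^ h" w] less_exp[of h] by simp
      qed
      have finTs: "finite (Ts w L \<rho> gs)" for w L \<rho> gs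
        unfolding Ts_def by (rule finite_lists_length_eq[OF finite_subset_products])
      have st: "finite (st w L \<rho> gs)" "card (st w L \<rho> gs) \<le> (2 ^ w) ^ (r (n - w) + w * (2 * k))"
        if gs: "gs \<in> Gs w" and L: "length L \<le> r (n - w)" for w L \<rho> gs
      proof -
        have fi: "finite (relators F (letter_words k) L \<rho> (cj \<rho> gs) ` Ts w L \<rho> gs)" using finTs by simp
        then show "finite (st w L \<rho> gs)" unfolding st_def by simp
        have "card (st w L \<rho> gs) \<le> card (relators F (letter_words k) L \<rho> (cj \<rho> gs) ` Ts w L \<rho> gs)"
          unfolding st_def by (rule card_mono[OF fi]) auto
        also have "\<dots> \<le> card (Ts w L \<rho> gs)" by (rule card_image_le[OF finTs])
        also have "\<dots> = card (subset_products F (cj \<rho> gs)) ^ (length L + w * (2 * k))"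
          unfolding Ts_def by (rule card_lists_length_eq[OF finite_subset_products])
        also have "\<dots> \<le> (2 ^ w) ^ (length L + w * (2 * k))"
          using card_subset_products_le[of F "cj \<rho> gs"] gs unfolding Gs_def cj_def by (intro power_mono) auto
        also have "\<dots> \<le> (2 ^ w) ^ (r (n - w) + w * (2 * k))" using L by (intro power_increasing) auto
        finally show "card (st w L \<rho> gs) \<le> (2 ^ w) ^ (r (n - w) + w * (2 * k))" .
      qed
      have CC': "finite (CC (n - w))" "card (CC (n - w)) \<le> 2 ^ E (n - w)"
        "\<And>L. L \<in> CC (n - w) \<Longrightarrow> set L \<subseteq> carrier F \<and> length L \<le> r (n - w)"
        "\<And>M. M \<lhd> F \<Longrightarrow> M \<subseteq> K \<Longrightarrow> finite ((\<lambda>x. M #>\<^bsub>F\<^esub> x) ` carrier F) \<Longrightarrow> ridx F K M = 2 ^ (n - w) \<Longrightarrow>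
          \<exists>L\<in>CC (n - w). normal_hull F (set L) = M" if "w \<in> {1..n}" for w
        using CC[of "n - w"] that unfolding good_def by auto
      have fin\<C>: "finite \<C>"
        unfolding \<C>_def using CC' finGs st by (intro finite_UN_I finite_atLeastAtMost) auto

      \<comment> \<open>Counting the codes\<close>
      define B where "B = (\<lambda>w. 2 ^ E (n - w) * (r n * ((2 ^ h) ^ w * (2 ^ w) ^ (r (n - w) + w * (2 * k)))))"
      have cardw: "card (\<Union>L\<in>CC (n - w). \<Union>\<rho>\<in>set L. \<Union>gs\<in>Gs w. st w L \<rho> gs) \<le> B w" if w: "w \<in> {1..n}" for w
      proof -
        have 1: "card (\<Union>gs\<in>Gs w. st w L \<rho> gs) \<le> (2 ^ h) ^ w * (2 ^ w) ^ (r (n - w) + w * (2 * k))"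
          if L: "L \<in> CC (n - w)" for L \<rho>
        proof -
          have "card (\<Union>gs\<in>Gs w. st w L \<rho> gs) \<le> card (Gs w) * (2 ^ w) ^ (r (n - w) + w * (2 * k))"
            by (rule card_UN_le_mult[OF finGs(1)]) (use st(2) CC'(3)[OF w L] in blast)
          also have "\<dots> \<le> (2 ^ h) ^ w * (2 ^ w) ^ (r (n - w) + w * (2 * k))"
            using finGs(2) by (rule mult_right_mono) simp
          finally show ?thesis .
        qed
        have 2: "card (\<Union>\<rho>\<in>set L. \<Union>gs\<in>Gs w. st w L \<rho> gs)
            \<le> r n * ((2 ^ h) ^ w * (2 ^ w) ^ (r (n - w) + w * (2 * k)))" if L: "L \<in> CC (n - w)" for L
        proof -
          have "card (\<Union>\<rho>\<in>set L. \<Union>gs\<in>Gs w. st w L \<rho> gs)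
              \<le> card (set L) * ((2 ^ h) ^ w * (2 ^ w) ^ (r (n - w) + w * (2 * k)))"
            by (rule card_UN_le_mult) (use 1[OF L] in auto)
          moreover have "card (set L) \<le> r n"
            using card_length[of L] CC'(3)[OF w L] unfolding r_def by (meson diff_le_self le_trans mult_le_mono2 nat_add_left_cancel_le)
          ultimately show ?thesis by (meson le_trans mult_le_mono1)
        qed
        have "card (\<Union>L\<in>CC (n - w). \<Union>\<rho>\<in>set L. \<Union>gs\<in>Gs w. st w L \<rho> gs)
            \<le> card (CC (n - w)) * (r n * ((2 ^ h) ^ w * (2 ^ w) ^ (r (n - w) + w * (2 * k))))"
          by (rule card_UN_le_mult[OF CC'(1)[OF w]]) (rule 2)
        also have "\<dots> \<le> B w" unfolding B_def using CC'(2)[OF w] by (rule mult_right_mono) simp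
        finally show ?thesis .
      qed
      have "card \<C> \<le> (\<Sum>w\<in>{1..n}. card (\<Union>L\<in>CC (n - w). \<Union>\<rho>\<in>set L. \<Union>gs\<in>Gs w. st w L \<rho> gs))"
        unfolding \<C>_def by (rule card_UN_le) simp
      also have "\<dots> \<le> (\<Sum>w\<in>{1..n}. B w)" by (rule sum_mono) (rule cardw)
      \<comment> \<open>The factor \<open>n\<close> replaces a division: each of the
        \<open>n\<close> summands is at most \<open>2 ^ E n\<close> divided by
        \<open>n\<close>.\<close>
      finally have "n * card \<C> \<le> (\<Sum>w\<in>{1..n}. n * B w)" by (simp add: sum_distrib_left[symmetric])
      also have "\<dots> \<le> (\<Sum>w\<in>{1..n}. 2 ^ E n)"
      proof (rule sum_mono)
        fix w assume "w \<in> {1..n}"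
        then have "1 \<le> w" "w \<le> n" by simp_all
        from relator_count_bound[OF k this, of r0 h] show "n * B w \<le> 2 ^ E n"
          unfolding B_def E_def C_def r_def .
      qed
      finally have "card \<C> \<le> 2 ^ E n" using False by simp
      moreover have "set L' \<subseteq> carrier F \<and> length L' \<le> r n" if LC: "L' \<in> \<C>" for L'
      proof -
        obtain w L \<rho> gs where w: "w \<in> {1..n}" and L: "L \<in> CC (n - w)" and gs: "gs \<in> Gs w" and L': "L' \<in> st w L \<rho> gs"
          using LC unfolding \<C>_def by blast
        obtain ts where ts: "ts \<in> Ts w L \<rho> gs" "L' = relators F (letter_words k) L \<rho> (cj \<rho> gs) ts" "set L' \<subseteq> carrier F"
          using L' unfolding st_def by blast
        have "length L' \<le> length ts + 1 + length gs"
          unfolding ts(2) relators_def by (simp add: cj_def)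
        also have "\<dots> = length L + w * (2 * k) + 1 + w" using ts(1) gs unfolding Ts_def Gs_def by simp
        also have "\<dots> \<le> r (n - w) + w * (2 * k) + w + w" using CC'(3)[OF w L] w by simp
        also have "\<dots> = r n"
        proof -
          have "n = (n - w) + w" using w by simp
          then have "r n = r0 + (2 * k + 2) * ((n - w) + w)" unfolding r_def by metis
          then show ?thesis unfolding r_def by (simp add: algebra_simps)
        qed
        finally show ?thesis using ts(3) by simp
      qed

      \<comment> \<open>Every \<open>M\<close> has a code\<close>
      moreover have "\<exists>L\<in>\<C>. normal_hull F (set L) = M"
        if M: "M \<lhd> F" "M \<subseteq> K" "finite ((\<lambda>x. M #>\<^bsub>F\<^esub> x) ` carrier F)" "ridx F K M = 2 ^ n" for M
      proof -
        obtain M' w where M': "M' \<lhd> F" "M \<subseteq> M'" "M' \<subseteq> K" "0 < w" "ridx F M' M = 2 ^ w"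
          and basis: "\<And>\<rho>. \<rho> \<in> M' \<Longrightarrow> \<rho> \<notin> M \<Longrightarrow> \<exists>gs. set gs \<subseteq> Rep \<and> length gs = w \<and>
            chief_basis F M' M \<rho> (map (\<lambda>g. g \<otimes>\<^bsub>F\<^esub> \<rho> \<otimes>\<^bsub>F\<^esub> inv\<^bsub>F\<^esub> g) gs)"
          using F.central_chief_factor[OF K M(1,2,3,4) _ Rep'(1,2) Rep(3)] False by blast
        note M's = normal_imp_subgroup[OF M'(1)] and Ms = normal_imp_subgroup[OF M(1)]
        have finK: "finite ((\<lambda>x. M #>\<^bsub>F\<^esub> x) ` K)" using F.finite_cosets_subset[OF M(3) K.subset] .
        have tower: "2 ^ n = ridx F K M' * 2 ^ w"
          using F.ridx_tower[OF K.is_subgroup M's Ms M'(2,3) finK] M(4) M'(5) by simp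
        have fM': "finite ((\<lambda>x. M' #>\<^bsub>F\<^esub> x) ` carrier F)"
          using F.finite_cosets_supergroup[OF M's Ms M'(2) subset_refl M(3)] .
        have "0 < ridx F K M'" using F.ridx_pos[OF K.is_subgroup F.finite_cosets_subset[OF fM' K.subset]] .
        then have "(2::nat) ^ w \<le> 2 ^ n" unfolding tower by simp
        then have wn: "w \<le> n" by simp
        then have "(2::nat) ^ n = 2 ^ (n - w) * 2 ^ w" by (simp flip: power_add)
        then have idx': "ridx F K M' = 2 ^ (n - w)" using tower by simp
        have w: "w \<in> {1..n}" using wn M'(4) by simp
        obtain L where L: "L \<in> CC (n - w)" "normal_hull F (set L) = M'"
          using CC'(4)[OF w M'(1,3) fM' idx'] by blast
        have Lc: "set L \<subseteq> carrier F" using CC'(3)[OF w L(1)] by blast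
        have "M' \<noteq> M"
        proof
          assume "M' = M"
          moreover have "M #>\<^bsub>F\<^esub> x = M" if "x \<in> M" for x
            using F.rcos_eq_self_iff[OF Ms subgroup.mem_carrier[OF Ms that]] that by simp
          then have "(\<lambda>x. M #>\<^bsub>F\<^esub> x) ` M = {M}" using subgroup.one_closed[OF Ms] by auto
          ultimately show False using M'(4,5) one_less_power[of "2 :: nat" w] unfolding ridx_def by simp
        qed
        \<comment> \<open>\<open>L\<close> generates \<open>M'\<close> normally, so one of its
          entries lies outside \<open>M\<close>. Taking \<open>\<rho>\<close> from \<open>L\<close>
          costs only a factor linear in \<open>n\<close>, whereas an arbitrary \<open>\<rho>\<close>
          would have no a priori bound.\<close>
        then have "\<not> set L \<subseteq> M" using F.normal_hull_least[OF M(1)] L(2) M'(2) by blast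
        then obtain \<rho> where \<rho>: "\<rho> \<in> set L" "\<rho> \<notin> M" by blast
        have \<rho>M': "\<rho> \<in> M'" using \<rho>(1) F.normal_hull_subset[of "set L"] L(2) by blast
        obtain gs where gs: "set gs \<subseteq> Rep" "length gs = w" "chief_basis F M' M \<rho> (cj \<rho> gs)"
          using basis[OF \<rho>M' \<rho>(2)] unfolding cj_def by blast
        have gsc: "set gs \<subseteq> carrier F" using gs(1) Rep'(2) by blast
        obtain ts where ts: "length ts = length L + length gs * (2 * k)" "set ts \<subseteq> subset_products F (cj \<rho> gs)"
          "set (relators F (letter_words k) L \<rho> (cj \<rho> gs) ts) \<subseteq> carrier F"
          "normal_hull F (set (relators F (letter_words k) L \<rho> (cj \<rho> gs) ts)) = M"
          using normal_hull_relators[of M k L M' \<rho> gs "cj \<rho> gs", folded F_def,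
              OF M(1) L(2) M'(2) Lc \<rho>M' gsc _ gs(3)] unfolding cj_def by blast
        have "ts \<in> Ts w L \<rho> gs" using ts(1,2) gs(2) unfolding Ts_def by simp
        then have "relators F (letter_words k) L \<rho> (cj \<rho> gs) ts \<in> st w L \<rho> gs" unfolding st_def using ts(3) by blast
        moreover have "gs \<in> Gs w" unfolding Gs_def using gs by simp
        ultimately have "relators F (letter_words k) L \<rho> (cj \<rho> gs) ts \<in> \<C>"
          unfolding \<C>_def using w L(1) \<rho>(1) by blast
        then show ?thesis using ts(4) by blast
      qed
      ultimately have "good n \<C>" unfolding good_def using fin\<C> by blast
      then show ?thesis by blast
    qed
  qed
  then obtain CC where CC: "\<And>n. good n (CC n)" by metis
  show ?thesis
  proof (intro exI[of _ C] allI)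
    fix n
    from CC[of n] have "finite (CC n) \<and> card (CC n) \<le> 2 ^ E n \<and>
      (\<forall>M. M \<lhd> F \<longrightarrow> M \<subseteq> K \<longrightarrow> finite ((\<lambda>x. M #>\<^bsub>F\<^esub> x) ` carrier F) \<longrightarrow> ridx F K M = 2 ^ n \<longrightarrow>
      (\<exists>L\<in>CC n. normal_hull F (set L) = M))"
      unfolding good_def by (elim conjE) (intro conjI; assumption)
    then show "\<exists>\<C>. finite \<C> \<and> card \<C> \<le> 2 ^ ((2 * k + 1) * n\<^sup>2 + C * n) \<and>
      (\<forall>M. M \<lhd> F \<longrightarrow> M \<subseteq> K \<longrightarrow> finite ((\<lambda>x. M #>\<^bsub>F\<^esub> x) ` carrier F) \<longrightarrow> ridx F K M = 2 ^ n \<longrightarrow>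
      (\<exists>L\<in>\<C>. normal_hull F (set L) = M))"
      unfolding E_def by (rule exI)
  qed
qed

text \<open>The Sylow preimage \<open>H\<close> has index \<open>b \<le> B\<close>, so only finitely
  many \<open>H\<close> occur. Each \<open>M\<close> lies in the normal core of its \<open>H\<close>
  with 2-power index, where \<open>relator_codes\<close> applies; the constant is uniform over the
  finitely many cores.\<close>

theorem few_normal_subgroups:
  fixes k B :: nat
  assumes "1 \<le> k"
  defines "S \<equiv> \<lambda>n. {M. M \<lhd> free_group k \<and> finite ((\<lambda>x. M #>\<^bsub>free_group k\<^esub> x) ` carrier (free_group k)) \<and>
    (\<exists>e b. e \<le> n \<and> b \<le> B \<and> ridx (free_group k) (carrier (free_group k)) M = 2 ^ e * b)}"
  obtains C where "\<And>n. finite (S n)" "\<And>n. card (S n) \<le> 2 ^ ((2 * k + 1) * n\<^sup>2 + C * n + C)"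
proof -
  define F where "F = free_group k"
  interpret F: group F unfolding F_def by (rule group_free_group)
  define HH where "HH = {H. subgroup H F \<and> finite ((\<lambda>x. H #>\<^bsub>F\<^esub> x) ` carrier F) \<and> ridx F (carrier F) H \<le> B}"
  have finHH: "finite HH" unfolding HH_def F_def by (rule finite_subgroups_index_le)
  define P where "P = (\<lambda>H C. \<forall>n. \<exists>\<C>. finite \<C> \<and> card \<C> \<le> 2 ^ ((2 * k + 1) * n\<^sup>2 + C * n) \<and>
    (\<forall>M. M \<lhd> F \<longrightarrow> M \<subseteq> normal_core F H \<longrightarrow> finite ((\<lambda>x. M #>\<^bsub>F\<^esub> x) ` carrier F) \<longrightarrow> ridx F (normal_core F H) M = 2 ^ n \<longrightarrow>
      (\<exists>L\<in>\<C>. normal_hull F (set L) = M)))"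
  have "\<exists>C. P H C" if "H \<in> HH" for H
  proof -
    have H: "subgroup H F" "finite ((\<lambda>x. H #>\<^bsub>F\<^esub> x) ` carrier F)" using that unfolding HH_def by auto
    show ?thesis unfolding P_def
      by (rule relator_codes[of k "normal_core F H", folded F_def, OF assms(1)]) (use F.normal_core_normal[OF H(1)] F.finite_cosets_normal_core[OF H] in auto)
  qed
  then obtain Cf where Cf: "\<And>H. H \<in> HH \<Longrightarrow> P H (Cf H)" by metis
  define C0 where "C0 = (\<Sum>H\<in>HH. Cf H)"
  have C0: "Cf H \<le> C0" if "H \<in> HH" for H unfolding C0_def using finHH that by (simp add: member_le_sum)
  have "\<forall>p\<in>HH \<times> UNIV. \<exists>\<C>. finite \<C> \<and> card \<C> \<le> 2 ^ ((2 * k + 1) * (snd p)\<^sup>2 + Cf (fst p) * snd p) \<and>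
    (\<forall>M. M \<lhd> F \<longrightarrow> M \<subseteq> normal_core F (fst p) \<longrightarrow> finite ((\<lambda>x. M #>\<^bsub>F\<^esub> x) ` carrier F) \<longrightarrow>
      ridx F (normal_core F (fst p)) M = 2 ^ snd p \<longrightarrow> (\<exists>L\<in>\<C>. normal_hull F (set L) = M))"
    using Cf unfolding P_def by auto
  then obtain CC where CC0: "\<forall>p\<in>HH \<times> UNIV. finite (CC p) \<and> card (CC p) \<le> 2 ^ ((2 * k + 1) * (snd p)\<^sup>2 + Cf (fst p) * snd p) \<and>
    (\<forall>M. M \<lhd> F \<longrightarrow> M \<subseteq> normal_core F (fst p) \<longrightarrow> finite ((\<lambda>x. M #>\<^bsub>F\<^esub> x) ` carrier F) \<longrightarrow>
      ridx F (normal_core F (fst p)) M = 2 ^ snd p \<longrightarrow> (\<exists>L\<in>CC p. normal_hull F (set L) = M))"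
    by (rule bchoice[THEN exE])
  have CC: "finite (CC (H, n)) \<and> card (CC (H, n)) \<le> 2 ^ ((2 * k + 1) * n\<^sup>2 + Cf H * n) \<and>
    (\<forall>M. M \<lhd> F \<longrightarrow> M \<subseteq> normal_core F H \<longrightarrow> finite ((\<lambda>x. M #>\<^bsub>F\<^esub> x) ` carrier F) \<longrightarrow>
      ridx F (normal_core F H) M = 2 ^ n \<longrightarrow> (\<exists>L\<in>CC (H, n). normal_hull F (set L) = M))" if "H \<in> HH" for H n
    by (rule bspec[OF CC0, of "(H, n)", unfolded fst_conv snd_conv]) (simp add: that)
  define U where "U = (\<lambda>n. \<Union>H\<in>HH. \<Union>e\<in>{..n}. (\<lambda>L. normal_hull F (set L)) ` CC (H, e))"
  have SU: "S n \<subseteq> U n" for n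
  proof
    fix M assume "M \<in> S n"
    then obtain e b where M: "M \<lhd> F" "finite ((\<lambda>x. M #>\<^bsub>F\<^esub> x) ` carrier F)" "e \<le> n" "b \<le> B" "ridx F (carrier F) M = 2 ^ e * b"
      unfolding S_def F_def by blast
    obtain H where H: "subgroup H F" "M \<subseteq> H" "ridx F (carrier F) H = b" "ridx F H M = 2 ^ e" "finite ((\<lambda>x. H #>\<^bsub>F\<^esub> x) ` carrier F)"
      using F.exists_sylow_preimage[OF M(1,2,5)] .
    have HH: "H \<in> HH" unfolding HH_def using H M(4) by simp
    let ?K = "normal_core F H"
    note Kn = F.normal_core_normal[OF H(1)]
    have MK: "M \<subseteq> ?K" using F.normal_core_greatest[OF M(1) H(2)] .
    have "ridx F H M = ridx F H ?K * ridx F ?K M"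
      by (rule F.ridx_tower[OF H(1) normal_imp_subgroup[OF Kn] normal_imp_subgroup[OF M(1)] MK F.normal_core_subset
            F.finite_cosets_subset[OF M(2) subgroup.subset[OF H(1)]]])
    then have "ridx F ?K M dvd 2 ^ e" using H(4) by simp
    then obtain i where i: "i \<le> e" "ridx F ?K M = 2 ^ i" using divides_primepow_nat[OF two_is_prime_nat] by blast
    then obtain L where "L \<in> CC (H, i)" "normal_hull F (set L) = M" using CC[OF HH, of i] M(1,2) MK by blast
    then show "M \<in> U n" unfolding U_def using HH i(1) M(3) by force
  qed
  have finU: "finite (U n)" for n unfolding U_def using finHH CC by (intro finite_UN_I finite_imageI) auto
  have cardU: "card (U n) \<le> 2 ^ ((2 * k + 1) * n\<^sup>2 + (C0 + 1) * n + card HH)" for n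
  proof -
    have "card (\<Union>e\<in>{..n}. (\<lambda>L. normal_hull F (set L)) ` CC (H, e)) \<le> card {..n} * 2 ^ ((2 * k + 1) * n\<^sup>2 + C0 * n)"
      if H: "H \<in> HH" for H
    proof (rule card_UN_le_mult)
      fix e assume e: "e \<in> {..n}"
      have "card ((\<lambda>L. normal_hull F (set L)) ` CC (H, e)) \<le> card (CC (H, e))" using CC[OF H] by (intro card_image_le) blast
      also have "\<dots> \<le> 2 ^ ((2 * k + 1) * e\<^sup>2 + Cf H * e)" using CC[OF H] by blast
      also have "\<dots> \<le> 2 ^ ((2 * k + 1) * n\<^sup>2 + C0 * n)"
        using e C0[OF H] by (intro power_increasing add_mono mult_mono power_mono) auto
      finally show "card ((\<lambda>L. normal_hull F (set L)) ` CC (H, e)) \<le> 2 ^ ((2 * k + 1) * n\<^sup>2 + C0 * n)" .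
    qed simp
    then have "card (U n) \<le> card HH * (card {..n} * 2 ^ ((2 * k + 1) * n\<^sup>2 + C0 * n))"
      unfolding U_def by (rule card_UN_le_mult[OF finHH])
    also have "\<dots> \<le> 2 ^ card HH * (2 ^ n * 2 ^ ((2 * k + 1) * n\<^sup>2 + C0 * n))"
      using less_exp[of "card HH"] less_exp[of n] by (intro mult_mono) (auto simp: Suc_le_eq)
    also have "\<dots> = 2 ^ ((2 * k + 1) * n\<^sup>2 + (C0 + 1) * n + card HH)" by (simp add: power_add algebra_simps)
    finally show ?thesis .
  qed
  show ?thesis
  proof (rule that[of "C0 + 1 + card HH"])
    show "finite (S n)" for n using finite_subset[OF SU finU] .
    have "card (S n) \<le> card (U n)" for n using card_mono[OF finU SU] .
    also have "card (U n) \<le> 2 ^ ((2 * k + 1) * n\<^sup>2 + (C0 + 1 + card HH) * n + (C0 + 1 + card HH))" for n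
      by (rule order_trans[OF cardU], rule power_increasing) (auto simp: algebra_simps)
    finally show "card (S n) \<le> 2 ^ ((2 * k + 1) * n\<^sup>2 + (C0 + 1 + card HH) * n + (C0 + 1 + card HH))" for n .
  qed
qed

section \<open>Word metrics on quotients\<close>

lemma word_value_append:
  assumes "group G" "S \<subseteq> carrier G" "us \<in> words G S" "vs \<in> words G S"
  shows "us @ vs \<in> words G S" "word_value G (us @ vs) = word_value G us \<otimes>\<^bsub>G\<^esub> word_value G vs"
proof -
  interpret group G by fact
  have letter: "a \<in> carrier G" if "a \<in> S \<union> m_inv G ` S" for a using that assms(2) by auto
  have val: "word_value G ws \<in> carrier G" if "ws \<in> words G S" for ws
    using word_value_in_generate[OF that] generate_incl[OF assms(2)] by blast
  show "us @ vs \<in> words G S" using assms(3,4) by (simp add: words_def)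
  show "word_value G (us @ vs) = word_value G us \<otimes>\<^bsub>G\<^esub> word_value G vs"
    using assms(3)
  proof (induction us)
    case Nil
    then show ?case using val[OF assms(4)] by (simp add: word_value_def)
  next
    case (Cons a us)
    then have a: "a \<in> carrier G" and us: "us \<in> words G S" using letter by (auto simp: words_def)
    then show ?case using Cons.IH[OF us] val[OF us] val[OF assms(4)] by (simp add: word_value_def m_assoc)
  qed
qed

lemma ex_word:
  fixes G (structure)
  assumes "group G" "S \<subseteq> carrier G" "x \<in> generate G S"
  shows "\<exists>ws\<in>words G S. word_value G ws = x"
proof -
  interpret group G by fact
  have single: "[a] \<in> words G S \<and> word_value G [a] = a" if "a \<in> S \<union> m_inv G ` S" for a
    using that assms(2) by (auto simp: words_def word_value_def)
  show ?thesis
    using assms(3)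
  proof (induction rule: generate.induct)
    case one
    show ?case by (rule bexI[of _ "[]"]) (auto simp: words_def word_value_def)
  next
    case (incl a)
    then show ?case using single[of a] by blast
  next
    case (inv a)
    then show ?case using single[of "inv a"] by blast
  next
    case (eng a b)
    then obtain us vs where "us \<in> words G S" "word_value G us = a" "vs \<in> words G S" "word_value G vs = b" by blast
    then show ?case using word_value_append[OF assms(1,2)] by blast
  qed
qed

definition word_ball :: "('a, 'b) monoid_scheme \<Rightarrow> 'a set \<Rightarrow> nat \<Rightarrow> 'a set" where
  "word_ball G S s = word_value G ` {ws \<in> words G S. length ws \<le> s}"

lemma word_length_le_iff:
  assumes "group G" "S \<subseteq> carrier G" "x \<in> generate G S"
  shows "word_length G S x \<le> s \<longleftrightarrow> x \<in> word_ball G S s"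
proof
  have "\<exists>n. \<exists>ws\<in>words G S. length ws = n \<and> word_value G ws = x" using ex_word[OF assms] by blast
  from LeastI_ex[OF this] show "word_length G S x \<le> s \<Longrightarrow> x \<in> word_ball G S s"
    unfolding word_length_def word_ball_def by force
next
  assume "x \<in> word_ball G S s"
  then obtain ws where ws: "ws \<in> words G S" "length ws \<le> s" "word_value G ws = x" unfolding word_ball_def by auto
  have "word_length G S x \<le> length ws"
    unfolding word_length_def by (rule Least_le) (use ws in blast)
  then show "word_length G S x \<le> s" using ws(2) by simp
qed

lemma finite_word_ball: "finite S \<Longrightarrow> finite (word_ball G S s)"
proof -
  assume "finite S"
  then have "finite {ws. set ws \<subseteq> S \<union> m_inv G ` S \<and> length ws \<le> s}" by (intro finite_lists_length_le) simp
  moreover have "{ws \<in> words G S. length ws \<le> s} = {ws. set ws \<subseteq> S \<union> m_inv G ` S \<and> length ws \<le> s}"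
    unfolding words_def by auto
  ultimately show ?thesis unfolding word_ball_def by simp
qed

lemma word_ball_subset:
  assumes "group G" "S \<subseteq> carrier G"
  shows "word_ball G S s \<subseteq> carrier G"
  using word_value_in_generate group.generate_incl[OF assms] unfolding word_ball_def by blast

lemma word_ball_Mod:
  fixes G (structure)
  assumes "group G" "S \<subseteq> carrier G" "N \<lhd> G"
  shows "word_ball (G Mod N) (quot_gens G S N) s = (\<lambda>x. N #>\<^bsub>G\<^esub> x) ` word_ball G S s"
proof -
  interpret group G by fact
  interpret N: normal N G by fact
  interpret Q: group "G Mod N" by (rule N.factorgroup_is_group)
  define q where "q = (\<lambda>x. N #> x)"
  interpret q: group_hom G "G Mod N" q
    using N.r_coset_hom_Mod is_group Q.is_group unfolding q_def by (simp add: group_hom_def group_hom_axioms_def)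
  have letters: "quot_gens G S N \<union> m_inv (G Mod N) ` quot_gens G S N = q ` (S \<union> m_inv G ` S)"
    using assms(2) unfolding quot_gens_def q_def[symmetric] by (auto simp: image_Un image_image subset_iff intro!: image_eqI)
  have val: "word_value (G Mod N) (map q ws) = q (word_value G ws)" if "ws \<in> words G S" for ws
    using that
  proof (induction ws)
    case Nil
    then show ?case by (simp add: word_value_def q_def N.subset)
  next
    case (Cons a ws)
    then have ws: "ws \<in> words G S" and a: "a \<in> carrier G" using assms(2) by (auto simp: words_def)
    have "word_value G ws \<in> carrier G" using word_value_in_generate[OF ws] generate_incl[OF assms(2)] by blast
    then show ?case using Cons.IH[OF ws] a by (simp add: word_value_def)
  qed
  have "{ws \<in> words (G Mod N) (quot_gens G S N). length ws \<le> s} = map q ` {ws \<in> words G S. length ws \<le> s}"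
    unfolding words_def letters by (auto simp: lists_image)
  then have "word_ball (G Mod N) (quot_gens G S N) s = (\<lambda>ws. word_value (G Mod N) (map q ws)) ` {ws \<in> words G S. length ws \<le> s}"
    unfolding word_ball_def by (simp add: image_image)
  also have "\<dots> = (\<lambda>ws. q (word_value G ws)) ` {ws \<in> words G S. length ws \<le> s}"
    by (rule image_cong) (use val in auto)
  finally show ?thesis unfolding word_ball_def q_def by (simp add: image_image)
qed

locale generated_group = group G for G (structure) +
  fixes S
  assumes finite_gens: "finite S" and gens_carrier: "S \<subseteq> carrier G" and gens_generate: "generate G S = carrier G"
begin

lemma quotient_generated:
  assumes "N \<lhd> G"
  shows "group (G Mod N)" "quot_gens G S N \<subseteq> carrier (G Mod N)"
    "generate (G Mod N) (quot_gens G S N) = carrier (G Mod N)"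
proof -
  interpret normal N G by fact
  have "group_hom G (G Mod N) (\<lambda>a. N #> a)"
    using r_coset_hom_Mod factorgroup_is_group is_group by (simp add: group_hom_def group_hom_axioms_def)
  then show "generate (G Mod N) (quot_gens G S N) = carrier (G Mod N)"
    using group_hom.generate_img[of G "G Mod N" "\<lambda>a. N #> a" S] gens_carrier gens_generate
    by (auto simp: quot_gens_def carrier_FactGroup)
  show "quot_gens G S N \<subseteq> carrier (G Mod N)"
    using gens_carrier by (auto simp: quot_gens_def carrier_FactGroup)
  show "group (G Mod N)" by (rule factorgroup_is_group)
qed

text \<open>Distance at most \<open>s\<close> in a quotient means right multiplication by an element
  of a ball that does not depend on \<open>N\<close>. This makes all later constants uniform over
  the components.\<close>

lemma word_dist_Mod_le_iff:
  assumes N: "N \<lhd> G" and x: "x \<in> carrier G" and y: "y \<in> carrier G"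
  shows "word_dist (G Mod N) (quot_gens G S N) (N #> x) (N #> y) \<le> real s
    \<longleftrightarrow> (\<exists>u\<in>word_ball G S s. N #> (x \<otimes> u) = N #> y)"
proof -
  interpret N: normal N G by fact
  interpret Q: group "G Mod N" by (rule N.factorgroup_is_group)
  interpret q: group_hom G "G Mod N" "\<lambda>x. N #> x"
    using N.r_coset_hom_Mod is_group Q.is_group by (simp add: group_hom_def group_hom_axioms_def)
  define z where "z = inv\<^bsub>G Mod N\<^esub> (N #> x) \<otimes>\<^bsub>G Mod N\<^esub> (N #> y)"
  have c: "N #> x \<in> carrier (G Mod N)" "N #> y \<in> carrier (G Mod N)" using x y q.hom_closed by blast+
  then have z: "z \<in> carrier (G Mod N)" unfolding z_def by (intro Q.m_closed Q.inv_closed)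
  have "word_dist (G Mod N) (quot_gens G S N) (N #> x) (N #> y) \<le> real s \<longleftrightarrow> word_length (G Mod N) (quot_gens G S N) z \<le> s"
    unfolding word_dist_def z_def by simp
  also have "\<dots> \<longleftrightarrow> z \<in> word_ball (G Mod N) (quot_gens G S N) s"
    using word_length_le_iff[OF quotient_generated(1,2)[OF N]] quotient_generated(3)[OF N] z by simp
  also have "\<dots> \<longleftrightarrow> (\<exists>u\<in>word_ball G S s. z = N #> u)"
    unfolding word_ball_Mod[OF is_group gens_carrier N] by blast
  also have "\<dots> \<longleftrightarrow> (\<exists>u\<in>word_ball G S s. N #> (x \<otimes> u) = N #> y)"
  proof (rule bex_cong[OF refl])
    fix u assume "u \<in> word_ball G S s"
    then have u: "u \<in> carrier G" using word_ball_subset[OF is_group gens_carrier] by blast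
    have uc: "N #> u \<in> carrier (G Mod N)" using u q.hom_closed by blast
    have "z = N #> u \<longleftrightarrow> (N #> x) \<otimes>\<^bsub>G Mod N\<^esub> z = (N #> x) \<otimes>\<^bsub>G Mod N\<^esub> (N #> u)"
      using c z uc by (metis Q.inv_mult_cancel(1))
    also have "(N #> x) \<otimes>\<^bsub>G Mod N\<^esub> z = N #> y"
      unfolding z_def using Q.inv_mult_cancel(2)[OF c] .
    also have "(N #> x) \<otimes>\<^bsub>G Mod N\<^esub> (N #> u) = N #> (x \<otimes> u)" using q.hom_mult[OF x u] by (rule sym)
    finally show "z = N #> u \<longleftrightarrow> N #> (x \<otimes> u) = N #> y" by auto
  qed
  finally show ?thesis .
qed

lemma word_dist_nonneg: "0 \<le> word_dist H U x y"
  by (simp add: word_dist_def)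

lemma word_dist_le_diam:
  assumes "N \<in> finite_index_normal G" "X \<in> carrier (G Mod N)" "Y \<in> carrier (G Mod N)"
  shows "word_dist (G Mod N) (quot_gens G S N) X Y \<le> word_diam (G Mod N) (quot_gens G S N)"
  unfolding word_diam_def
  by (rule cSUP_upper2[where x = "(X, Y)"]) (use assms in \<open>auto simp: finite_index_normal_def\<close>)

lemma finite_index_normalD:
  assumes "N \<in> finite_index_normal G"
  shows "N \<lhd> G" "subgroup N G" "finite ((\<lambda>x. N #> x) ` carrier G)" "finite (carrier (G Mod N))"
  using assms normal_imp_subgroup unfolding finite_index_normal_def by (auto simp: carrier_FactGroup)

lemma coset_in_Mod: "x \<in> carrier G \<Longrightarrow> N #> x \<in> carrier (G Mod N)"
  by (simp add: carrier_FactGroup)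

lemma diam_nonneg:
  assumes "N \<in> finite_index_normal G"
  shows "0 \<le> word_diam (G Mod N) (quot_gens G S N)"
  using word_dist_le_diam[OF assms coset_in_Mod coset_in_Mod, OF one_closed one_closed] word_dist_nonneg by (rule order_trans[rotated])

text \<open>A ball whose radius is the diameter already represents all cosets.\<close>

lemma ridx_le_diam:
  assumes N: "N \<in> finite_index_normal G" and le: "word_diam (G Mod N) (quot_gens G S N) \<le> real s"
  shows "ridx G (carrier G) N \<le> card (word_ball G S s)"
proof -
  note N' = finite_index_normalD[OF N]
  have "(\<lambda>x. N #> x) ` carrier G \<subseteq> (\<lambda>u. N #> u) ` word_ball G S s"
  proof (rule image_subsetI)
    fix x assume x: "x \<in> carrier G"
    have "word_dist (G Mod N) (quot_gens G S N) (N #> \<one>) (N #> x) \<le> real s"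
      using word_dist_le_diam[OF N coset_in_Mod[OF one_closed] coset_in_Mod[OF x]] le by (rule order_trans)
    then obtain u where u: "u \<in> word_ball G S s" "N #> (\<one> \<otimes> u) = N #> x"
      using word_dist_Mod_le_iff[OF N'(1) one_closed x] by blast
    then have "u \<in> carrier G" using word_ball_subset[OF is_group gens_carrier] by blast
    then show "N #> x \<in> (\<lambda>u. N #> u) ` word_ball G S s" using u by auto
  qed
  then have "ridx G (carrier G) N \<le> card ((\<lambda>u. N #> u) ` word_ball G S s)"
    unfolding ridx_def by (rule card_mono[OF finite_imageI[OF finite_word_ball[OF finite_gens]]])
  also have "\<dots> \<le> card (word_ball G S s)" using finite_word_ball[OF finite_gens] by (rule card_image_le)
  finally show ?thesis .
qed

abbreviation "bd \<equiv> box_dist G S"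

lemma bd_same: "bd (N, X) (N, Y) = word_dist (G Mod N) (quot_gens G S N) X Y"
  by (simp add: box_dist_def)

lemma bd_diff: "N \<noteq> M \<Longrightarrow> bd (N, X) (M, Y) = word_diam (G Mod N) (quot_gens G S N) + word_diam (G Mod M) (quot_gens G S M)"
  by (simp add: box_dist_def)

lemma bd_commute: "p \<in> box_space G \<Longrightarrow> q \<in> box_space G \<Longrightarrow> bd p q = bd q p"
  using Metric_space.commute[OF Metric_space_box_dist[OF is_group gens_carrier gens_generate], of p q] by simp

lemma bd_triangle:
  "p \<in> box_space G \<Longrightarrow> q \<in> box_space G \<Longrightarrow> r \<in> box_space G \<Longrightarrow> bd p r \<le> bd p q + bd q r"
  using Metric_space.triangle[OF Metric_space_box_dist[OF is_group gens_carrier gens_generate], of p q r] by simp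

lemma bd_refl: "p \<in> box_space G \<Longrightarrow> bd p p = 0"
  using Metric_space.mdist_zero[OF Metric_space_box_dist[OF is_group gens_carrier gens_generate], of p] by simp

lemma diam_le_bd:
  assumes "(N, X) \<in> box_space G" "(M, Y) \<in> box_space G" "N \<noteq> M"
  shows "word_diam (G Mod N) (quot_gens G S N) \<le> bd (N, X) (M, Y)"
    "word_diam (G Mod M) (quot_gens G S M) \<le> bd (N, X) (M, Y)"
  using bd_diff[OF assms(3), of X Y] diam_nonneg assms unfolding box_space_def by auto

lemma in_box_space: "N \<in> finite_index_normal G \<Longrightarrow> x \<in> carrier G \<Longrightarrow> (N, N #> x) \<in> box_space G"
  unfolding box_space_def using coset_in_Mod by simp

lemma box_spaceE:
  assumes "p \<in> box_space G"
  obtains N x where "p = (N, N #> x)" "N \<in> finite_index_normal G" "x \<in> carrier G"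
  using assms unfolding box_space_def by (auto simp: carrier_FactGroup)

end

locale generated_free_group = generated_group "free_group n" S for n S
begin

lemma finite_small_diam: "finite {N \<in> finite_index_normal (free_group n). word_diam (free_group n Mod N) (quot_gens (free_group n) S N) \<le> real s}"
proof (rule finite_subset[OF _ finite_subgroups_index_le[of n "card (word_ball (free_group n) S s)"]], rule subsetI)
  fix N assume "N \<in> {N \<in> finite_index_normal (free_group n). word_diam (free_group n Mod N) (quot_gens (free_group n) S N) \<le> real s}"
  then have N: "N \<in> finite_index_normal (free_group n)" "word_diam (free_group n Mod N) (quot_gens (free_group n) S N) \<le> real s" by auto
  show "N \<in> {H. subgroup H (free_group n) \<and> finite ((\<lambda>x. H #>\<^bsub>free_group n\<^esub> x) ` carrier (free_group n)) \<and>
     ridx (free_group n) (carrier (free_group n)) H \<le> card (word_ball (free_group n) S s)}"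
    using finite_index_normalD[OF N(1)] ridx_le_diam[OF N] by simp
qed

text \<open>Besides its own component a ball meets only components of small diameter, of which there
  are finitely many.\<close>

lemma finite_box_ball:
  assumes p: "p \<in> box_space (free_group n)"
  shows "finite {q \<in> box_space (free_group n). bd p q \<le> real s}"
proof -
  obtain N X where N: "p = (N, X)" by (cases p)
  let ?A = "insert N {M \<in> finite_index_normal (free_group n). word_diam (free_group n Mod M) (quot_gens (free_group n) S M) \<le> real s}"
  have "N \<in> finite_index_normal (free_group n)" using p N unfolding box_space_def by simp
  then have fin: "finite (SIGMA M:?A. carrier (free_group n Mod M))"
    using finite_small_diam[of s] finite_index_normalD(4) by (intro finite_SigmaI) auto
  have "{q \<in> box_space (free_group n). bd p q \<le> real s} \<subseteq> (SIGMA M:?A. carrier (free_group n Mod M))"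
  proof
    fix q assume "q \<in> {q \<in> box_space (free_group n). bd p q \<le> real s}"
    then have q: "q \<in> box_space (free_group n)" "bd p q \<le> real s" by auto
    obtain M Y where M: "q = (M, Y)" by (cases q)
    have "M \<in> ?A"
    proof (cases "N = M")
      case False
      then have "word_diam (free_group n Mod M) (quot_gens (free_group n) S M) \<le> real s"
        using diam_le_bd(2)[of N X M Y] p q N M by simp
      then show ?thesis using q(1) M unfolding box_space_def by simp
    qed simp
    then show "q \<in> (SIGMA M:?A. carrier (free_group n Mod M))" using q(1) M unfolding box_space_def by simp
  qed
  then show ?thesis using fin by (rule finite_subset)
qed

text \<open>Together with \<open>free_ball_word_bound\<close> this compares the length over
  \<open>S\<close> with the length over the free basis; both kinds of balls are finite.\<close>

lemma word_ball_length_bound: "\<exists>l. \<forall>u\<in>word_ball (free_group n) S s. u \<in> free_ball n l"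
proof -
  have "length u \<le> Max (length ` word_ball (free_group n) S s)" if "u \<in> word_ball (free_group n) S s" for u
    using that finite_word_ball[OF finite_gens] by (intro Max_ge) auto
  then show ?thesis using word_ball_subset[OF is_group gens_carrier] unfolding free_ball_def by blast
qed

lemma free_ball_word_bound: "\<exists>s. free_ball n l \<subseteq> word_ball (free_group n) S s"
proof -
  have mono: "word_ball (free_group n) S s \<subseteq> word_ball (free_group n) S t" if "s \<le> t" for s t
    using that unfolding word_ball_def by auto
  have "\<exists>s. u \<in> word_ball (free_group n) S s" if "u \<in> free_ball n l" for u
  proof -
    have "u \<in> generate (free_group n) S" using that gens_generate unfolding free_ball_def by simp
    from ex_word[OF is_group gens_carrier this] show ?thesis unfolding word_ball_def by blast
  qed
  then obtain f where f: "\<And>u. u \<in> free_ball n l \<Longrightarrow> u \<in> word_ball (free_group n) S (f u)" by metis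
  have "u \<in> word_ball (free_group n) S (Max (f ` free_ball n l))" if "u \<in> free_ball n l" for u
    using f[OF that] mono[OF Max_ge[of "f ` free_ball n l" "f u"]] finite_free_ball that by blast
  then show ?thesis by blast
qed

lemma bd_short:
  obtains l where "\<And>N x y. N \<in> finite_index_normal (free_group n) \<Longrightarrow> x \<in> carrier (free_group n) \<Longrightarrow> y \<in> carrier (free_group n) \<Longrightarrow>
    bd (N, N #>\<^bsub>free_group n\<^esub> x) (N, N #>\<^bsub>free_group n\<^esub> y) \<le> real s \<Longrightarrow>
    \<exists>u\<in>free_ball n l. N #>\<^bsub>free_group n\<^esub> y = N #>\<^bsub>free_group n\<^esub> (x \<otimes>\<^bsub>free_group n\<^esub> u)"
proof -
  obtain l where l: "\<And>u. u \<in> word_ball (free_group n) S s \<Longrightarrow> u \<in> free_ball n l" using word_ball_length_bound by blast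
  show ?thesis
  proof (rule that[of l])
    fix N x y assume N: "N \<in> finite_index_normal (free_group n)" and x: "x \<in> carrier (free_group n)" and y: "y \<in> carrier (free_group n)"
      and "bd (N, N #>\<^bsub>free_group n\<^esub> x) (N, N #>\<^bsub>free_group n\<^esub> y) \<le> real s"
    then obtain u where "u \<in> word_ball (free_group n) S s" "N #>\<^bsub>free_group n\<^esub> (x \<otimes>\<^bsub>free_group n\<^esub> u) = N #>\<^bsub>free_group n\<^esub> y"
      using word_dist_Mod_le_iff[OF finite_index_normalD(1)[OF N] x y] by (auto simp: bd_same)
    then show "\<exists>u\<in>free_ball n l. N #>\<^bsub>free_group n\<^esub> y = N #>\<^bsub>free_group n\<^esub> (x \<otimes>\<^bsub>free_group n\<^esub> u)" using l by metis
  qed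
qed

lemma bd_letter:
  obtains s where "\<And>N x a. N \<in> finite_index_normal (free_group n) \<Longrightarrow> x \<in> carrier (free_group n) \<Longrightarrow> snd a < n \<Longrightarrow>
    bd (N, N #>\<^bsub>free_group n\<^esub> x) (N, N #>\<^bsub>free_group n\<^esub> (x \<otimes>\<^bsub>free_group n\<^esub> [a])) \<le> real s"
proof -
  obtain s where s: "free_ball n 1 \<subseteq> word_ball (free_group n) S s" using free_ball_word_bound by blast
  show ?thesis
  proof (rule that[of s])
    fix N x and a :: letter assume N: "N \<in> finite_index_normal (free_group n)" and x: "x \<in> carrier (free_group n)" and a: "snd a < n"
    have ac: "[a] \<in> carrier (free_group n)" using a by simp
    have "[a] \<in> word_ball (free_group n) S s" using s ac by (auto simp: free_ball_def)
    then show "bd (N, N #>\<^bsub>free_group n\<^esub> x) (N, N #>\<^bsub>free_group n\<^esub> (x \<otimes>\<^bsub>free_group n\<^esub> [a])) \<le> real s"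
      unfolding bd_same using word_dist_Mod_le_iff[OF finite_index_normalD(1)[OF N] x m_closed[OF x ac]] by blast
  qed
qed

end

section \<open>Coarse equivalences\<close>

text \<open>Without a bound, counterexamples for all \<open>t\<close> would form two sequences whose
  distances stay at most \<open>s\<close> on one side and exceed \<open>t\<close> on the
  other.\<close>

lemma coarse_equivalence_bounds:
  assumes "coarse_equivalence X dX Y dY f"
  shows "\<exists>t::nat. \<forall>p\<in>X. \<forall>q\<in>X. dX p q \<le> real s \<longrightarrow> dY (f p) (f q) \<le> real t"
    and "\<exists>t::nat. \<forall>p\<in>X. \<forall>q\<in>X. dY (f p) (f q) \<le> real s \<longrightarrow> dX p q \<le> real t"
    and "\<exists>t::nat. \<forall>y\<in>Y. \<exists>x\<in>X. dY (f x) y \<le> real t"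
proof -
  have eq: "filterlim (\<lambda>n. dX (u n) (v n)) at_top sequentially \<longleftrightarrow> filterlim (\<lambda>n. dY (f (u n)) (f (v n))) at_top sequentially"
    if "range u \<subseteq> X" "range v \<subseteq> X" for u v :: "nat \<Rightarrow> _"
    using assms that unfolding coarse_equivalence_def by blast
  have lim: "filterlim g at_top sequentially" if "\<And>n. real n < g n" for g :: "nat \<Rightarrow> real"
    by (rule filterlim_at_top_mono[OF filterlim_real_sequentially]) (intro always_eventually allI less_imp_le that)
  have nlim: "\<not> filterlim g at_top sequentially" if "\<And>n. g n \<le> c" for g :: "nat \<Rightarrow> real" and c
  proof
    assume "filterlim g at_top sequentially"
    then have "eventually (\<lambda>n. c + 1 \<le> g n) sequentially" unfolding filterlim_at_top by blast
    then obtain n where "c + 1 \<le> g n" using eventually_happens'[OF sequentially_bot] by blast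
    then show False using that[of n] by simp
  qed
  show "\<exists>t::nat. \<forall>p\<in>X. \<forall>q\<in>X. dX p q \<le> real s \<longrightarrow> dY (f p) (f q) \<le> real t"
  proof (rule ccontr)
    assume "\<not> ?thesis"
    then have "\<forall>t::nat. \<exists>p q. p \<in> X \<and> q \<in> X \<and> dX p q \<le> real s \<and> real t < dY (f p) (f q)" by (meson not_le)
    then obtain u v where uv: "\<And>t. u t \<in> X \<and> v t \<in> X \<and> dX (u t) (v t) \<le> real s \<and> real t < dY (f (u t)) (f (v t))" by metis
    have "filterlim (\<lambda>n. dY (f (u n)) (f (v n))) at_top sequentially" by (rule lim) (use uv in blast)
    then have "filterlim (\<lambda>n. dX (u n) (v n)) at_top sequentially" using eq[of u v] uv by blast
    then show False using nlim[of "\<lambda>n. dX (u n) (v n)" "real s"] uv by blast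
  qed
  show "\<exists>t::nat. \<forall>p\<in>X. \<forall>q\<in>X. dY (f p) (f q) \<le> real s \<longrightarrow> dX p q \<le> real t"
  proof (rule ccontr)
    assume "\<not> ?thesis"
    then have "\<forall>t::nat. \<exists>p q. p \<in> X \<and> q \<in> X \<and> dY (f p) (f q) \<le> real s \<and> real t < dX p q" by (meson not_le)
    then obtain u v where uv: "\<And>t. u t \<in> X \<and> v t \<in> X \<and> dY (f (u t)) (f (v t)) \<le> real s \<and> real t < dX (u t) (v t)" by metis
    have "filterlim (\<lambda>n. dX (u n) (v n)) at_top sequentially" by (rule lim) (use uv in blast)
    then have "filterlim (\<lambda>n. dY (f (u n)) (f (v n))) at_top sequentially" using eq[of u v] uv by blast
    then show False using nlim[of "\<lambda>n. dY (f (u n)) (f (v n))" "real s"] uv by blast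
  qed
  obtain C where C: "\<forall>y\<in>Y. \<exists>x\<in>X. dY (f x) y \<le> C" using assms unfolding coarse_equivalence_def by blast
  obtain t :: nat where "C \<le> real t" using real_arch_simple by blast
  then show "\<exists>t::nat. \<forall>y\<in>Y. \<exists>x\<in>X. dY (f x) y \<le> real t" using C by (meson order_trans)
qed

section \<open>Components under a coarse equivalence\<close>

text \<open>Points of a component are joined by steps of bounded length, and so are their images up
  to another bound, whereas moving to a different component costs at least the diameter. Since few
  components have small diameter and fibres are finite, almost every component is mapped into a
  single one, and density shows that it nearly fills it.\<close>

lemma coarse_equivalence_components:
  fixes f :: "letter list set \<times> letter list set \<Rightarrow> letter list set \<times> letter list set"
  assumes "generated_free_group d S" and "generated_free_group k T"
    and f: "coarse_equivalence (box_space (free_group d)) (box_dist (free_group d) S)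
      (box_space (free_group k)) (box_dist (free_group k) T) f"
  obtains E r R \<Psi> where "finite E" "inj_on \<Psi> (finite_index_normal (free_group d) - E)"
    "\<And>N. N \<in> finite_index_normal (free_group d) - E \<Longrightarrow> \<Psi> N \<in> finite_index_normal (free_group k)"
    "\<And>N. N \<in> finite_index_normal (free_group d) - E \<Longrightarrow> N \<inter> free_ball d R \<subseteq> {[]} \<Longrightarrow>
      \<exists>\<beta>. surj_on_subgroup (free_group k) (free_group d) (\<Psi> N) N
        (normal_hull (free_group k) (\<Psi> N \<inter> free_ball k r)) \<beta>"
proof -
  interpret D: generated_free_group d S by fact
  interpret K: generated_free_group k T by fact
  have D1: "\<one>\<^bsub>free_group d\<^esub> = []" "[] \<in> carrier (free_group d)"
    and K1: "\<one>\<^bsub>free_group k\<^esub> = []" "[] \<in> carrier (free_group k)" by (simp_all add: free_group_simps)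
  let ?X = "box_space (free_group d)" and ?Y = "box_space (free_group k)"
  let ?ND = "finite_index_normal (free_group d)" and ?NK = "finite_index_normal (free_group k)"
  have fX: "f p \<in> ?Y" if "p \<in> ?X" for p using f that unfolding coarse_equivalence_def by blast
  have up: "\<exists>t::nat. \<forall>p\<in>?X. \<forall>q\<in>?X. D.bd p q \<le> real s \<longrightarrow> K.bd (f p) (f q) \<le> real t" for s
    using coarse_equivalence_bounds(1)[OF f] .
  have down: "\<exists>t::nat. \<forall>p\<in>?X. \<forall>q\<in>?X. K.bd (f p) (f q) \<le> real s \<longrightarrow> D.bd p q \<le> real t" for s
    using coarse_equivalence_bounds(2)[OF f] .
  obtain C :: nat where C: "\<And>y. y \<in> ?Y \<Longrightarrow> \<exists>x\<in>?X. K.bd (f x) y \<le> real C"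
    using coarse_equivalence_bounds(3)[OF f] by blast
  obtain s1 where s1: "\<And>N x a. N \<in> ?ND \<Longrightarrow> x \<in> carrier (free_group d) \<Longrightarrow> snd a < d \<Longrightarrow>
    D.bd (N, N #>\<^bsub>free_group d\<^esub> x) (N, N #>\<^bsub>free_group d\<^esub> (x \<otimes>\<^bsub>free_group d\<^esub> [a])) \<le> real s1"
    using D.bd_letter by blast
  obtain t1 where t1: "\<And>N x a. N \<in> ?NK \<Longrightarrow> x \<in> carrier (free_group k) \<Longrightarrow> snd a < k \<Longrightarrow>
    K.bd (N, N #>\<^bsub>free_group k\<^esub> x) (N, N #>\<^bsub>free_group k\<^esub> (x \<otimes>\<^bsub>free_group k\<^esub> [a])) \<le> real t1"
    using K.bd_letter by blast
  obtain A0 where A0: "\<And>p q. p \<in> ?X \<Longrightarrow> q \<in> ?X \<Longrightarrow> D.bd p q \<le> real s1 \<Longrightarrow> K.bd (f p) (f q) \<le> real A0"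
    using up[of s1] by blast
  \<comment> \<open>\<open>2 * C + t1\<close> bounds the distance of two image points that
    approximate neighbouring points of the target.\<close>
  obtain e where e: "\<And>p q. p \<in> ?X \<Longrightarrow> q \<in> ?X \<Longrightarrow> K.bd (f p) (f q) \<le> real (2 * C + t1) \<Longrightarrow> D.bd p q \<le> real e"
    using down[of "2 * C + t1"] by blast
  obtain e0 where e0: "\<And>p q. p \<in> ?X \<Longrightarrow> q \<in> ?X \<Longrightarrow> K.bd (f p) (f q) \<le> real 0 \<Longrightarrow> D.bd p q \<le> real e0"
    using down[of 0] by blast
  have eC: "D.bd p q \<le> real e" if "p \<in> ?X" "q \<in> ?X" "K.bd (f p) (f q) \<le> real C" for p q
    by (rule e[OF that(1,2)]) (use that(3) in simp)

  \<comment> \<open>The finite set of exceptional components\<close>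
  define Ysm where "Ysm = (SIGMA M:{M \<in> ?NK. word_diam (free_group k Mod M) (quot_gens (free_group k) T M) \<le> real A0}. carrier (free_group k Mod M))"
  have finY: "finite Ysm"
    unfolding Ysm_def using K.finite_small_diam K.finite_index_normalD(4) by (intro finite_SigmaI) auto
  have fib: "finite {p \<in> ?X. f p = y}" for y
  proof (cases "\<exists>p\<in>?X. f p = y")
    case True
    then obtain p where p: "p \<in> ?X" "f p = y" by blast
    have "{p \<in> ?X. f p = y} \<subseteq> {q \<in> ?X. D.bd p q \<le> real e0}"
    proof
      fix q assume q: "q \<in> {p \<in> ?X. f p = y}"
      then have "K.bd (f p) (f q) \<le> real 0" using p K.bd_refl[OF fX[OF p(1)]] by simp
      then show "q \<in> {q \<in> ?X. D.bd p q \<le> real e0}" using q e0[OF p(1)] by simp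
    qed
    then show ?thesis using D.finite_box_ball[OF p(1)] by (rule finite_subset)
  next
    case False
    then have "{p \<in> ?X. f p = y} = {}" by blast
    then show ?thesis by (simp only: finite.emptyI)
  qed
  \<comment> \<open>\<open>E1\<close> collects the components with a point mapped to a small target
    component, \<open>E2\<close> the small source components, which a jump of length
    \<open>e\<close> could leave.\<close>
  define E1 where "E1 = fst ` (\<Union>y\<in>Ysm. {p \<in> ?X. f p = y})"
  define E2 where "E2 = {N \<in> ?ND. word_diam (free_group d Mod N) (quot_gens (free_group d) S N) \<le> real e}"
  define E where "E = E1 \<union> E2"
  have finE: "finite E" unfolding E_def E1_def E2_def using finY fib D.finite_small_diam by simp
  have E1: "f p \<notin> Ysm" if "p \<in> ?X" "fst p \<notin> E" for p
    using that unfolding E_def E1_def by force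
  have E2: "M = N" if "(N, X) \<in> ?X" "(M, Y) \<in> ?X" "N \<notin> E" "D.bd (N, X) (M, Y) \<le> real e" for N M X Y
  proof (rule ccontr)
    assume "M \<noteq> N"
    then have "word_diam (free_group d Mod N) (quot_gens (free_group d) S N) \<le> real e"
      using D.diam_le_bd(1)[OF that(1,2)] that(4) by simp
    then have "N \<in> E2" unfolding E2_def using that(1) unfolding box_space_def by simp
    then show False using that(3) unfolding E_def by simp
  qed

  \<comment> \<open>The map between components\<close>
  define \<Psi> where "\<Psi> = (\<lambda>N. fst (f (N, N #>\<^bsub>free_group d\<^esub> [])))"
  have comp: "fst (f (N, N #>\<^bsub>free_group d\<^esub> x)) = \<Psi> N" if N: "N \<in> ?ND - E" and "x \<in> carrier (free_group d)" for N x
    using that(2)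
  proof (induction x rule: free_group_induct_snoc)
    case (snoc x a)
    have xa: "x \<otimes>\<^bsub>free_group d\<^esub> [a] \<in> carrier (free_group d)" using snoc by simp
    let ?p = "(N, N #>\<^bsub>free_group d\<^esub> x)" and ?q = "(N, N #>\<^bsub>free_group d\<^esub> (x \<otimes>\<^bsub>free_group d\<^esub> [a]))"
    have pq: "?p \<in> ?X" "?q \<in> ?X" using D.in_box_space N snoc(1) xa by auto
    have le: "K.bd (f ?p) (f ?q) \<le> real A0" using A0[OF pq] s1[of N x a] N snoc by simp
    obtain M X M' X' where M: "f ?p = (M, X)" "f ?q = (M', X')" by (meson surj_pair)
    \<comment> \<open>A jump of length at most \<open>A0\<close> can leave a component only if its
      diameter is at most \<open>A0\<close>, which \<open>E1\<close> excludes.\<close>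
    have "M' = M"
    proof (rule ccontr)
      assume ne: "M' \<noteq> M"
      have MX: "(M, X) \<in> ?Y" "(M', X') \<in> ?Y" using fX[OF pq(1)] fX[OF pq(2)] M by simp_all
      have "word_diam (free_group k Mod M) (quot_gens (free_group k) T M) \<le> real A0"
        using K.diam_le_bd(1)[OF MX] ne le M by simp
      then have "f ?p \<in> Ysm" unfolding Ysm_def using MX(1) M(1) unfolding box_space_def by simp
      then show False using E1[OF pq(1)] N by simp
    qed
    then show ?case using snoc.IH M by simp
  qed (simp add: \<Psi>_def)
  have \<Psi>_NK: "\<Psi> N \<in> ?NK" if "N \<in> ?ND - E" for N
    using fX[OF D.in_box_space[OF _ D1(2)]] that unfolding \<Psi>_def box_space_def by (force simp: mem_Times_iff)
  have lift: "\<exists>y\<in>carrier (free_group k). f (N, N #>\<^bsub>free_group d\<^esub> x) = (\<Psi> N, \<Psi> N #>\<^bsub>free_group k\<^esub> y)"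
    if N: "N \<in> ?ND - E" and x: "x \<in> carrier (free_group d)" for N x
  proof -
    have "f (N, N #>\<^bsub>free_group d\<^esub> x) \<in> ?Y" using fX D.in_box_space N x by simp
    then obtain M y where "f (N, N #>\<^bsub>free_group d\<^esub> x) = (M, M #>\<^bsub>free_group k\<^esub> y)" "y \<in> carrier (free_group k)"
      using K.box_spaceE by blast
    then show ?thesis using comp[OF N x] by auto
  qed
  have dense: "\<exists>x\<in>carrier (free_group d). K.bd (f (N, N #>\<^bsub>free_group d\<^esub> x)) (\<Psi> N, \<Psi> N #>\<^bsub>free_group k\<^esub> y) \<le> real C"
    if N: "N \<in> ?ND - E" and y: "y \<in> carrier (free_group k)" for N y
  proof -
    obtain y0 where y0: "y0 \<in> carrier (free_group k)" "f (N, N #>\<^bsub>free_group d\<^esub> []) = (\<Psi> N, \<Psi> N #>\<^bsub>free_group k\<^esub> y0)"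
      using lift[OF N D1(2)] by blast
    \<comment> \<open>A walk from one image point through the target component: a point
      approximating the next stop is within \<open>e\<close> of the previous one, so by
      \<open>E2\<close> it still belongs to \<open>N\<close>.\<close>
    have main: "\<exists>x\<in>carrier (free_group d). K.bd (f (N, N #>\<^bsub>free_group d\<^esub> x)) (\<Psi> N, \<Psi> N #>\<^bsub>free_group k\<^esub> (y0 \<otimes>\<^bsub>free_group k\<^esub> w)) \<le> real C"
      if "w \<in> carrier (free_group k)" for w
      using that
    proof (induction w rule: free_group_induct_snoc)
      case one
      have "y0 \<otimes>\<^bsub>free_group k\<^esub> [] = y0" using K.r_one[OF y0(1)] K1(1) by simp
      then have "K.bd (f (N, N #>\<^bsub>free_group d\<^esub> [])) (\<Psi> N, \<Psi> N #>\<^bsub>free_group k\<^esub> (y0 \<otimes>\<^bsub>free_group k\<^esub> [])) = 0"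
        using y0 K.bd_refl[OF fX[OF D.in_box_space[OF _ D1(2)]]] N by (metis DiffD1)
      then show ?case using D1(2) by (metis of_nat_0_le_iff)
    next
      case (snoc w a)
      obtain x where x: "x \<in> carrier (free_group d)"
        "K.bd (f (N, N #>\<^bsub>free_group d\<^esub> x)) (\<Psi> N, \<Psi> N #>\<^bsub>free_group k\<^esub> (y0 \<otimes>\<^bsub>free_group k\<^esub> w)) \<le> real C"
        using snoc.IH by blast
      define z where "z = y0 \<otimes>\<^bsub>free_group k\<^esub> w"
      have zc: "z \<in> carrier (free_group k)" "[a] \<in> carrier (free_group k)" unfolding z_def using y0 snoc by simp_all
      have z': "y0 \<otimes>\<^bsub>free_group k\<^esub> (w \<otimes>\<^bsub>free_group k\<^esub> [a]) = z \<otimes>\<^bsub>free_group k\<^esub> [a]"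
        unfolding z_def using y0 snoc zc(2) by (simp add: K.m_assoc)
      let ?p = "f (N, N #>\<^bsub>free_group d\<^esub> x)" and ?z = "(\<Psi> N, \<Psi> N #>\<^bsub>free_group k\<^esub> z)"
        and ?z' = "(\<Psi> N, \<Psi> N #>\<^bsub>free_group k\<^esub> (z \<otimes>\<^bsub>free_group k\<^esub> [a]))"
      have inY: "?z \<in> ?Y" "?z' \<in> ?Y" using K.in_box_space \<Psi>_NK[OF N] zc by auto
      have xX: "(N, N #>\<^bsub>free_group d\<^esub> x) \<in> ?X" using D.in_box_space N x by simp
      obtain q where q: "q \<in> ?X" "K.bd (f q) ?z' \<le> real C" using C[OF inY(2)] by blast
      have "K.bd ?p (f q) \<le> K.bd ?p ?z + K.bd ?z (f q)" using K.bd_triangle fX xX inY q by blast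
      also have "K.bd ?z (f q) \<le> K.bd ?z ?z' + K.bd ?z' (f q)" using K.bd_triangle fX xX inY q by blast
      also have "K.bd ?z' (f q) = K.bd (f q) ?z'" using K.bd_commute fX inY q by blast
      finally have "K.bd ?p (f q) \<le> real (2 * C + t1)"
        using x(2) q(2) t1[OF \<Psi>_NK[OF N] zc(1) snoc(2)] unfolding z_def by simp
      then have le: "D.bd (N, N #>\<^bsub>free_group d\<^esub> x) q \<le> real e" using e xX q by blast
      obtain M x' where M: "q = (M, M #>\<^bsub>free_group d\<^esub> x')" "x' \<in> carrier (free_group d)"
        using D.box_spaceE[OF q(1)] by blast
      have "M = N" using E2[of N "N #>\<^bsub>free_group d\<^esub> x" M] xX q(1) M(1) le N by blast
      then show ?case using q(2) M unfolding z' by blast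
    qed
    have "inv\<^bsub>free_group k\<^esub> y0 \<otimes>\<^bsub>free_group k\<^esub> y \<in> carrier (free_group k)" using y0 y by simp
    from main[OF this] show ?thesis using y0(1) y by simp
  qed
  have inj: "inj_on \<Psi> (?ND - E)"
  proof (rule inj_onI)
    fix N N' assume N: "N \<in> ?ND - E" "N' \<in> ?ND - E" "\<Psi> N = \<Psi> N'"
    obtain y where y: "y \<in> carrier (free_group k)" "f (N', N' #>\<^bsub>free_group d\<^esub> []) = (\<Psi> N, \<Psi> N #>\<^bsub>free_group k\<^esub> y)"
      using lift[OF N(2) D1(2)] N(3) by auto
    obtain x where x: "x \<in> carrier (free_group d)" "K.bd (f (N, N #>\<^bsub>free_group d\<^esub> x)) (\<Psi> N, \<Psi> N #>\<^bsub>free_group k\<^esub> y) \<le> real C"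
      using dense[OF N(1) y(1)] by blast
    have X: "(N, N #>\<^bsub>free_group d\<^esub> x) \<in> ?X" "(N', N' #>\<^bsub>free_group d\<^esub> []) \<in> ?X"
      using D.in_box_space N x(1) D1(2) by auto
    then have "D.bd (N, N #>\<^bsub>free_group d\<^esub> x) (N', N' #>\<^bsub>free_group d\<^esub> []) \<le> real e"
      using eC x(2) y(2) by simp
    then show "N = N'" using E2[OF X] N(1) by simp
  qed

  \<comment> \<open>Deck groups of matched components\<close>
  obtain l where l: "\<And>N x y. N \<in> ?NK \<Longrightarrow> x \<in> carrier (free_group k) \<Longrightarrow> y \<in> carrier (free_group k) \<Longrightarrow>
    K.bd (N, N #>\<^bsub>free_group k\<^esub> x) (N, N #>\<^bsub>free_group k\<^esub> y) \<le> real (max A0 C) \<Longrightarrow>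
    \<exists>u\<in>free_ball k l. N #>\<^bsub>free_group k\<^esub> y = N #>\<^bsub>free_group k\<^esub> (x \<otimes>\<^bsub>free_group k\<^esub> u)"
    using K.bd_short by blast
  obtain l' where l': "\<And>N x y. N \<in> ?ND \<Longrightarrow> x \<in> carrier (free_group d) \<Longrightarrow> y \<in> carrier (free_group d) \<Longrightarrow>
    D.bd (N, N #>\<^bsub>free_group d\<^esub> x) (N, N #>\<^bsub>free_group d\<^esub> y) \<le> real e \<Longrightarrow>
    \<exists>u\<in>free_ball d l'. N #>\<^bsub>free_group d\<^esub> y = N #>\<^bsub>free_group d\<^esub> (x \<otimes>\<^bsub>free_group d\<^esub> u)"
    using D.bd_short by blast
  define A where "A = max l l'"
  have l2: "\<exists>u\<in>free_ball k A. N #>\<^bsub>free_group k\<^esub> y = N #>\<^bsub>free_group k\<^esub> (x \<otimes>\<^bsub>free_group k\<^esub> u)"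
    if "N \<in> ?NK" "x \<in> carrier (free_group k)" "y \<in> carrier (free_group k)"
      "K.bd (N, N #>\<^bsub>free_group k\<^esub> x) (N, N #>\<^bsub>free_group k\<^esub> y) \<le> real (max A0 C)" for N x y
    using l[OF that] unfolding A_def free_ball_def by fastforce
  have l2': "\<exists>u\<in>free_ball d A. N #>\<^bsub>free_group d\<^esub> y = N #>\<^bsub>free_group d\<^esub> (x \<otimes>\<^bsub>free_group d\<^esub> u)"
    if "N \<in> ?ND" "x \<in> carrier (free_group d)" "y \<in> carrier (free_group d)"
      "D.bd (N, N #>\<^bsub>free_group d\<^esub> x) (N, N #>\<^bsub>free_group d\<^esub> y) \<le> real e" for N x y
    using l'[OF that] unfolding A_def free_ball_def by fastforce
  \<comment> \<open>The constants of \<open>coarse_deck_group\<close> for \<open>D = A\<close>, as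
    \<open>A\<close> bounds both steps and errors.\<close>
  define r where "r = A * A + 1 + 2 * A"
  define R where "R = A * r + r + 2 * A"
  have deck: "\<exists>\<beta>. surj_on_subgroup (free_group k) (free_group d) (\<Psi> N) N
      (normal_hull (free_group k) (\<Psi> N \<inter> free_ball k r)) \<beta>"
    if N: "N \<in> ?ND - E" and short: "N \<inter> free_ball d R \<subseteq> {[]}" for N
  proof -
    define M where "M = \<Psi> N"
    have MK: "M \<in> ?NK" unfolding M_def using \<Psi>_NK[OF N] .
    have ND: "N \<in> ?ND" using N by simp
    note Nn = D.finite_index_normalD[OF ND] and Mn = K.finite_index_normalD[OF MK]
    \<comment> \<open>The choice sees \<open>x\<close> only through its coset, so \<open>F\<close>
      respects congruence modulo \<open>N\<close> automatically; likewise \<open>G\<close> modulo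
      \<open>M\<close>.\<close>
    define F where "F = (\<lambda>x. SOME y. y \<in> carrier (free_group k) \<and> f (N, N #>\<^bsub>free_group d\<^esub> x) = (M, M #>\<^bsub>free_group k\<^esub> y))"
    define G where "G = (\<lambda>y. SOME x. x \<in> carrier (free_group d) \<and> K.bd (f (N, N #>\<^bsub>free_group d\<^esub> x)) (M, M #>\<^bsub>free_group k\<^esub> y) \<le> real C)"
    have F: "F x \<in> carrier (free_group k)" "f (N, N #>\<^bsub>free_group d\<^esub> x) = (M, M #>\<^bsub>free_group k\<^esub> F x)"
      if "x \<in> carrier (free_group d)" for x
      using someI_ex[of "\<lambda>y. y \<in> carrier (free_group k) \<and> f (N, N #>\<^bsub>free_group d\<^esub> x) = (M, M #>\<^bsub>free_group k\<^esub> y)"]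
        lift[OF N that] unfolding F_def M_def by blast+
    have G: "G y \<in> carrier (free_group d)" "K.bd (f (N, N #>\<^bsub>free_group d\<^esub> G y)) (M, M #>\<^bsub>free_group k\<^esub> y) \<le> real C"
      if "y \<in> carrier (free_group k)" for y
      using someI_ex[of "\<lambda>x. x \<in> carrier (free_group d) \<and> K.bd (f (N, N #>\<^bsub>free_group d\<^esub> x)) (M, M #>\<^bsub>free_group k\<^esub> y) \<le> real C"]
        dense[OF N that] unfolding G_def M_def by blast+
    have X: "(N, N #>\<^bsub>free_group d\<^esub> x) \<in> ?X" if "x \<in> carrier (free_group d)" for x using D.in_box_space[OF ND that] .
    have Y: "(M, M #>\<^bsub>free_group k\<^esub> y) \<in> ?Y" if "y \<in> carrier (free_group k)" for y using K.in_box_space[OF MK that] .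
    have F_step: "\<exists>c\<in>free_ball k A. M #>\<^bsub>free_group k\<^esub> F (x \<otimes>\<^bsub>free_group d\<^esub> [a]) = M #>\<^bsub>free_group k\<^esub> (F x \<otimes>\<^bsub>free_group k\<^esub> c)"
      if x: "x \<in> carrier (free_group d)" "snd a < d" for x a
    proof -
      have xa: "x \<otimes>\<^bsub>free_group d\<^esub> [a] \<in> carrier (free_group d)" using x by simp
      have "K.bd (M, M #>\<^bsub>free_group k\<^esub> F x) (M, M #>\<^bsub>free_group k\<^esub> F (x \<otimes>\<^bsub>free_group d\<^esub> [a])) \<le> real A0"
        using A0[OF X[OF x(1)] X[OF xa] s1[OF ND x]] unfolding F(2)[OF x(1)] F(2)[OF xa] .
      then show ?thesis by (intro l2[OF MK F(1)[OF x(1)] F(1)[OF xa]]) simp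
    qed
    have G_step: "\<exists>c\<in>free_ball d A. N #>\<^bsub>free_group d\<^esub> G (y \<otimes>\<^bsub>free_group k\<^esub> [a]) = N #>\<^bsub>free_group d\<^esub> (G y \<otimes>\<^bsub>free_group d\<^esub> c)"
      if y: "y \<in> carrier (free_group k)" "snd a < k" for y a
    proof -
      have ya: "y \<otimes>\<^bsub>free_group k\<^esub> [a] \<in> carrier (free_group k)" using y by simp
      let ?p = "f (N, N #>\<^bsub>free_group d\<^esub> G y)" and ?q = "f (N, N #>\<^bsub>free_group d\<^esub> G (y \<otimes>\<^bsub>free_group k\<^esub> [a]))"
      let ?y = "(M, M #>\<^bsub>free_group k\<^esub> y)" and ?ya = "(M, M #>\<^bsub>free_group k\<^esub> (y \<otimes>\<^bsub>free_group k\<^esub> [a]))"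
      note in_Y = fX[OF X[OF G(1)[OF y(1)]]] fX[OF X[OF G(1)[OF ya]]] Y[OF y(1)] Y[OF ya]
      have "K.bd ?p ?q \<le> K.bd ?p ?y + K.bd ?y ?q" using K.bd_triangle[OF in_Y(1,3,2)] .
      also have "K.bd ?y ?q \<le> K.bd ?y ?ya + K.bd ?ya ?q" using K.bd_triangle[OF in_Y(3,4,2)] .
      also have "K.bd ?ya ?q = K.bd ?q ?ya" using K.bd_commute[OF in_Y(4,2)] .
      finally have "K.bd ?p ?q \<le> real (2 * C + t1)"
        using G(2)[OF y(1)] G(2)[OF ya] t1[OF MK y] by simp
      then show ?thesis by (intro l2'[OF ND G(1)[OF y(1)] G(1)[OF ya]] e[OF X[OF G(1)[OF y(1)]] X[OF G(1)[OF ya]]])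
    qed
    have FG: "\<exists>h\<in>free_ball k A. M #>\<^bsub>free_group k\<^esub> F (G y) = M #>\<^bsub>free_group k\<^esub> (y \<otimes>\<^bsub>free_group k\<^esub> h)"
      if y: "y \<in> carrier (free_group k)" for y
    proof -
      have c: "F (G y) \<in> carrier (free_group k)" using F(1)[OF G(1)[OF y]] .
      have "K.bd (M, M #>\<^bsub>free_group k\<^esub> y) (M, M #>\<^bsub>free_group k\<^esub> F (G y)) \<le> real C"
        using G(2)[OF y] K.bd_commute[OF Y[OF y] Y[OF c]] unfolding F(2)[OF G(1)[OF y]] by simp
      then show ?thesis by (intro l2[OF MK y c]) simp
    qed
    have GF: "\<exists>h\<in>free_ball d A. N #>\<^bsub>free_group d\<^esub> G (F x) = N #>\<^bsub>free_group d\<^esub> (x \<otimes>\<^bsub>free_group d\<^esub> h)"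
      if x: "x \<in> carrier (free_group d)" for x
    proof -
      have c: "G (F x) \<in> carrier (free_group d)" using G(1)[OF F(1)[OF x]] .
      have "D.bd (N, N #>\<^bsub>free_group d\<^esub> G (F x)) (N, N #>\<^bsub>free_group d\<^esub> x) \<le> real e"
        by (rule eC[OF X[OF c] X[OF x]]) (use G(2)[OF F(1)[OF x]] in \<open>simp add: F(2)[OF x]\<close>)
      then have "D.bd (N, N #>\<^bsub>free_group d\<^esub> x) (N, N #>\<^bsub>free_group d\<^esub> G (F x)) \<le> real e"
        using D.bd_commute[OF X[OF c] X[OF x]] by simp
      then show ?thesis by (rule l2'[OF ND x c])
    qed
    have F_cong: "M #>\<^bsub>free_group k\<^esub> F x = M #>\<^bsub>free_group k\<^esub> F y" if "N #>\<^bsub>free_group d\<^esub> x = N #>\<^bsub>free_group d\<^esub> y" for x y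
      unfolding F_def that ..
    have G_cong: "N #>\<^bsub>free_group d\<^esub> G x = N #>\<^bsub>free_group d\<^esub> G y" if "M #>\<^bsub>free_group k\<^esub> x = M #>\<^bsub>free_group k\<^esub> y" for x y
      unfolding G_def that ..
    have short': "N \<inter> free_ball d (A * (A * A + 1 + 2 * A) + (A * A + 1 + 2 * A) + 2 * A) \<subseteq> {\<one>\<^bsub>free_group d\<^esub>}"
      using short unfolding R_def r_def D1 .
    show ?thesis
    proof (rule coarse_deck_group[OF Nn(1) Mn(1) F(1) G(1) F_step G_step F_cong G_cong FG GF short'])
      fix \<beta>
      assume \<beta>: "\<beta> ` M = N"
        "\<And>x y. x \<in> M \<Longrightarrow> y \<in> M \<Longrightarrow> \<beta> (x \<otimes>\<^bsub>free_group k\<^esub> y) = \<beta> x \<otimes>\<^bsub>free_group d\<^esub> \<beta> y"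
        "{x \<in> M. \<beta> x = \<one>\<^bsub>free_group d\<^esub>} = normal_hull (free_group k) (M \<inter> free_ball k (A * A + 1 + 2 * A))"
      have "surj_on_subgroup (free_group k) (free_group d) M N (normal_hull (free_group k) (M \<inter> free_ball k r)) \<beta>"
        using \<beta> Nn(2) Mn(2) K.is_group D.is_group
        unfolding surj_on_subgroup_def surj_on_subgroup_axioms_def r_def by blast
      then show ?thesis unfolding M_def by blast
    qed
  qed
  show ?thesis by (rule that[OF finE inj \<Psi>_NK deck])
qed

section \<open>Comparing the numbers of components\<close>

lemma odd_part:
  fixes m :: nat
  assumes "0 < m"
  shows "\<exists>e b. m = 2 ^ e * b \<and> odd b"
  using assms
proof (induction m rule: less_induct)
  case (less m)
  show ?case
  proof (cases "odd m")
    case True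
    then show ?thesis by (intro exI[of _ 0] exI[of _ m]) simp
  next
    case False
    then obtain j where j: "m = 2 * j" by blast
    have "j < m" "0 < j" using j less.prems by simp_all
    from less.IH[OF this] obtain e b where "j = 2 ^ e * b \<and> odd b" by blast
    then show ?thesis using j by (intro exI[of _ "Suc e"] exI[of _ b]) simp
  qed
qed

text \<open>The odd part of \<open>m\<close> divides \<open>m0\<close>, hence is at most
  \<open>B\<close>. The 2-part is at most \<open>m\<close>, thus at most \<open>m0 * 2 ^ n\<close>,
  and \<open>m0 \<le> 2 ^ B\<close>.\<close>

lemma two_power_ratio:
  fixes m m0 n n0 B :: nat
  assumes "m * 2 ^ n0 = m0 * 2 ^ n" "0 < m0" "m0 \<le> B"
  shows "\<exists>e b. e \<le> n + B \<and> b \<le> B \<and> m = 2 ^ e * b"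
proof -
  have "0 < m * 2 ^ n0" unfolding assms(1) using assms(2) by simp
  then have "0 < m" by (rule contrapos_pp) simp
  then obtain e b where e: "m = 2 ^ e * b" "odd b" using odd_part by blast
  have "b dvd m" unfolding e(1) by (rule dvd_triv_right)
  then have "b dvd m0 * 2 ^ n" unfolding assms(1)[symmetric] by (rule dvd_mult2)
  moreover have "coprime b (2 ^ n)" using e(2) by simp
  ultimately have "b dvd m0" by (simp only: coprime_dvd_mult_left_iff)
  then have "b \<le> m0" using assms(2) by (rule dvd_imp_le)
  then have "b \<le> B" using assms(3) by (rule le_trans)
  moreover have "2 ^ e \<le> (2::nat) ^ (n + B)"
  proof -
    have "2 ^ e \<le> m" using e \<open>0 < m\<close> by simp
    also have "m \<le> m * 2 ^ n0" by simp
    also have "\<dots> = m0 * 2 ^ n" by (rule assms(1))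
    also have "\<dots> \<le> 2 ^ B * 2 ^ n" using le_trans[OF assms(3) less_imp_le[OF less_exp[of B]]] by (intro mult_right_mono) simp_all
    finally show ?thesis by (simp add: power_add mult.commute)
  qed
  then have "e \<le> n + B" by simp
  ultimately show ?thesis using e(1) by blast
qed

text \<open>Bounding the square of \<open>d - 1\<close> by that of \<open>d\<close> turns the
  hypothesis into \<open>8 * (k + 1) * d < d\<^sup>2\<close>.\<close>

lemma rank_gap:
  fixes k d :: nat
  assumes "2 * (real k + 1) < (real d - 1)\<^sup>2 / (4 * real d)"
  shows "8 * k + 8 < d"
proof (rule ccontr)
  assume "\<not> 8 * k + 8 < d"
  then have d: "real d \<le> 8 * real k + 8" by simp
  have d0: "0 < real d" using assms by (cases "d = 0") auto
  have "2 * (real k + 1) * (4 * real d) < (real d - 1)\<^sup>2"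
    using assms d0 by (simp add: less_divide_eq)
  also have "\<dots> \<le> (real d)\<^sup>2" using d0 by (intro power_mono) auto
  also have "\<dots> \<le> real d * (8 * real k + 8)" unfolding power2_eq_square using d d0 by (intro mult_left_mono) auto
  finally show False by (simp add: algebra_simps)
qed

theorem theorem1p3:
  fixes k d :: nat and S T :: "letter list set"
  assumes "2 \<le> k" and "k \<le> d"
    and "2 * (real k + 1) < (real d - 1)\<^sup>2 / (4 * real d)"
    and "finite S" and "S \<subseteq> carrier (free_group d)"
    and "generate (free_group d) S = carrier (free_group d)"
    and "finite T" and "T \<subseteq> carrier (free_group k)"
    and "generate (free_group k) T = carrier (free_group k)"
  shows "\<not> coarsely_equivalent
           (box_space (free_group d)) (box_dist (free_group d) S)
           (box_space (free_group k)) (box_dist (free_group k) T)"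
proof
  assume "coarsely_equivalent (box_space (free_group d)) (box_dist (free_group d) S)
           (box_space (free_group k)) (box_dist (free_group k) T)"
  then obtain f where f: "coarse_equivalence (box_space (free_group d)) (box_dist (free_group d) S)
      (box_space (free_group k)) (box_dist (free_group k) T) f"
    unfolding coarsely_equivalent_def by blast
  interpret D: generated_free_group d S
    by (intro generated_free_group.intro generated_group.intro group_free_group generated_group_axioms.intro assms)
  interpret K: generated_free_group k T
    by (intro generated_free_group.intro generated_group.intro group_free_group generated_group_axioms.intro assms)
  have gap: "(8 * k + 6) + 2 < d" using rank_gap[OF assms(3)] by simp
  obtain E r R0 \<Psi> where finE: "finite E" and inj: "inj_on \<Psi> (finite_index_normal (free_group d) - E)"
    and \<Psi>: "\<And>N. N \<in> finite_index_normal (free_group d) - E \<Longrightarrow> \<Psi> N \<in> finite_index_normal (free_group k)"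
    and deck: "\<And>N. N \<in> finite_index_normal (free_group d) - E \<Longrightarrow> N \<inter> free_ball d R0 \<subseteq> {[]} \<Longrightarrow>
      \<exists>\<beta>. surj_on_subgroup (free_group k) (free_group d) (\<Psi> N) N
        (normal_hull (free_group k) (\<Psi> N \<inter> free_ball k r)) \<beta>"
    by (rule coarse_equivalence_components[OF D.generated_free_group_axioms K.generated_free_group_axioms f]) blast
  define id where "id = (\<lambda>N. ridx (free_group d) (carrier (free_group d)) N)"
  define ik where "ik = (\<lambda>M. ridx (free_group k) (carrier (free_group k)) M)"
  define ker where "ker = (\<lambda>N. normal_hull (free_group k) (\<Psi> N \<inter> free_ball k r))"
  define good where "good = (\<lambda>N. N \<in> finite_index_normal (free_group d) - E \<and> N \<inter> free_ball d R0 \<subseteq> {[]} \<and> (\<exists>n. id N = 2 ^ n))"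
  define KK where "KK = ker ` {N. good N}"
  have "KK \<subseteq> normal_hull (free_group k) ` Pow (free_ball k r)" unfolding KK_def ker_def by blast
  then have finKK: "finite KK" by (rule finite_subset) (simp add: finite_free_ball)
  \<comment> \<open>One reference subgroup for each \<open>K\<close>; every other index is compared
    with that of its reference.\<close>
  define ref where "ref = (\<lambda>L. SOME N. good N \<and> ker N = L)"
  have ref: "good (ref L) \<and> ker (ref L) = L" if "L \<in> KK" for L
    unfolding ref_def by (rule someI_ex) (use that in \<open>auto simp: KK_def\<close>)
  \<comment> \<open>A sum in place of a maximum, so that an empty \<open>KK\<close> needs no
    separate treatment.\<close>
  define B where "B = (\<Sum>L\<in>KK. ik (\<Psi> (ref L)))"
  have ratio: "\<exists>e b. e \<le> n + B \<and> b \<le> B \<and> ik (\<Psi> N) = 2 ^ e * b" if N: "good N" "id N = 2 ^ n" for N n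
  proof -
    define N0 where "N0 = ref (ker N)"
    have kN: "ker N \<in> KK" unfolding KK_def using N(1) by blast
    have N0: "good N0" "ker N0 = ker N" unfolding N0_def using ref[OF kN] by auto
    obtain n0 where n0: "id N0 = 2 ^ n0" using N0(1) unfolding good_def by blast
    have nd: "N \<in> finite_index_normal (free_group d) - E" "N0 \<in> finite_index_normal (free_group d) - E"
      using N(1) N0(1) unfolding good_def by auto
    obtain \<beta> \<beta>0 where b: "surj_on_subgroup (free_group k) (free_group d) (\<Psi> N) N (ker N) \<beta>"
      "surj_on_subgroup (free_group k) (free_group d) (\<Psi> N0) N0 (ker N) \<beta>0"
      using deck[of N] deck[of N0] N(1) N0 unfolding good_def ker_def by metis
    have "ik (\<Psi> N) * id N0 = ik (\<Psi> N0) * id N"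
      unfolding ik_def id_def
      by (rule index_ratio_deck_group[OF b K.finite_index_normalD(3)[OF \<Psi>[OF nd(1)]] K.finite_index_normalD(3)[OF \<Psi>[OF nd(2)]]
            D.finite_index_normalD(3) D.finite_index_normalD(3)])
        (use nd gap in auto)
    then have "ik (\<Psi> N) * 2 ^ n0 = ik (\<Psi> N0) * 2 ^ n" using n0 N(2) by simp
    moreover have "0 < ik (\<Psi> N0)"
      unfolding ik_def by (rule K.ridx_pos[OF K.subgroup_self K.finite_index_normalD(3)[OF \<Psi>[OF nd(2)]]])
    moreover have "ik (\<Psi> N0) \<le> B"
      unfolding B_def N0_def using finKK kN by (intro member_le_sum) auto
    ultimately show ?thesis by (rule two_power_ratio)
  qed
  define Sn where "Sn = (\<lambda>n. {M. M \<lhd> free_group k \<and> finite ((\<lambda>x. M #>\<^bsub>free_group k\<^esub> x) ` carrier (free_group k)) \<and>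
    (\<exists>e b. e \<le> n \<and> b \<le> B \<and> ridx (free_group k) (carrier (free_group k)) M = 2 ^ e * b)})"
  obtain C where C: "\<And>n. finite (Sn n)" "\<And>n. card (Sn n) \<le> 2 ^ ((2 * k + 1) * n\<^sup>2 + C * n + C)"
    using few_normal_subgroups[of k B] assms(1) unfolding Sn_def by auto
  \<comment> \<open>The coefficient of \<open>R\<close> and the constant term in the expansion of
    the upper exponent at \<open>n = 2 * R + B\<close>; as \<open>1 \<le> R\<close>, together they
    contribute at most \<open>R * Q\<close>.\<close>
  define Q where "Q = 4 * ((2 * k + 1) * B) + 2 * C + ((2 * k + 1) * B\<^sup>2 + C * B + C)"
  \<comment> \<open>\<open>R0\<close> removes the short elements, the sum of the indices keeps
    subgroups of index \<open>2 ^ (2 * R)\<close> out of \<open>E\<close>, and \<open>Q + 1\<close>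
    makes \<open>R\<close> exceed \<open>Q\<close> in the final comparison.\<close>
  define s where "s = R0 + (\<Sum>N\<in>E. id N) + Q + 1"
  obtain R \<N> where R: "s \<le> R" "2 ^ ((8 * k + 6 - 1) * R * R) \<le> card \<N>" "finite \<N>"
    and \<N>: "\<And>N. N \<in> \<N> \<Longrightarrow> N \<lhd> free_group d"
    "\<And>N. N \<in> \<N> \<Longrightarrow> finite ((\<lambda>x. N #>\<^bsub>free_group d\<^esub> x) ` carrier (free_group d))"
    "\<And>N. N \<in> \<N> \<Longrightarrow> id N = 2 ^ (2 * R)"
    "\<And>N w. N \<in> \<N> \<Longrightarrow> w \<in> N \<Longrightarrow> length w \<le> s \<Longrightarrow> w = []"
    using many_normal_subgroups[OF gap, of s] unfolding id_def by auto
  have goodN: "good N" if N: "N \<in> \<N>" for N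
  proof -
    have "N \<in> finite_index_normal (free_group d)"
      unfolding finite_index_normal_def using \<N>(1,2)[OF N] by (simp add: carrier_FactGroup)
    moreover have "N \<notin> E"
    proof
      assume "N \<in> E"
      then have "id N \<le> (\<Sum>N\<in>E. id N)" using finE by (intro member_le_sum) auto
      also have "\<dots> \<le> R" using R(1) unfolding s_def by simp
      also have "R < 2 ^ (2 * R)" using less_exp[of "2 * R"] by linarith
      finally show False using \<N>(3)[OF N] by simp
    qed
    moreover have "N \<inter> free_ball d R0 \<subseteq> {[]}"
      using \<N>(4)[OF N] unfolding free_ball_def s_def by auto
    ultimately show ?thesis unfolding good_def using \<N>(3)[OF N] by blast
  qed
  have "\<Psi> ` \<N> \<subseteq> Sn (2 * R + B)"
  proof (rule image_subsetI)
    fix N assume N: "N \<in> \<N>"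
    have "\<Psi> N \<in> finite_index_normal (free_group k)" using \<Psi>[of N] goodN[OF N] unfolding good_def by blast
    from K.finite_index_normalD[OF this] show "\<Psi> N \<in> Sn (2 * R + B)"
      unfolding Sn_def using ratio[OF goodN[OF N] \<N>(3)[OF N]] unfolding ik_def by simp
  qed
  then have "card (\<Psi> ` \<N>) \<le> card (Sn (2 * R + B))" using C(1) by (rule card_mono[rotated])
  moreover have "\<N> \<subseteq> finite_index_normal (free_group d) - E" using goodN unfolding good_def by blast
  then have "card (\<Psi> ` \<N>) = card \<N>" by (intro card_image inj_on_subset[OF inj])
  ultimately have "(2::nat) ^ ((8 * k + 6 - 1) * R * R) \<le> 2 ^ ((2 * k + 1) * (2 * R + B)\<^sup>2 + C * (2 * R + B) + C)"
    using R(2) C(2)[of "2 * R + B"] by linarith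
  then have "(8 * k + 5) * R * R \<le> (2 * k + 1) * (2 * R + B)\<^sup>2 + C * (2 * R + B) + C" by (simp add: add.commute)
  also have "\<dots> = (8 * k + 4) * R * R + R * (4 * ((2 * k + 1) * B) + 2 * C) + ((2 * k + 1) * B\<^sup>2 + C * B + C)"
    by (simp add: power2_eq_square algebra_simps)
  also have "\<dots> \<le> (8 * k + 4) * R * R + R * Q"
  proof -
    have "1 \<le> R" using R(1) unfolding s_def by simp
    then have "(2 * k + 1) * B\<^sup>2 + C * B + C \<le> R * ((2 * k + 1) * B\<^sup>2 + C * B + C)" by simp
    then show ?thesis unfolding Q_def by (simp only: distrib_left add.assoc)
  qed
  finally have "R * R \<le> R * Q" by (simp add: algebra_simps)
  moreover have "Q < R" using R(1) unfolding s_def by simp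
  ultimately show False by simp
qed

end
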